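(* Let $\gamma:\mathbb{R}^d\to[0,\infty)$ be bounded and uniformly continuous. The following are equivalent: (i) there exist $L>0$ and $c>0$ such that $\int_\ell \gamma\,dm_1\ge c$ for every line segment $\ell\subset\mathbb{R}^d$ of length $L$ (integration with respect to one-dimensional Lebesgue (arc-length) measure on $\ell$); (ii) for every $s>0$ there exist $C,\omega>0$ such that for all initial data and all $t>0$, the energy $E(t)$ of the solution of the damped fractional wave equation with parameter $s$ and damping $\gamma$ satisfies $$E(t)\le C(1+t)^{-\frac{s}{4-2s}}\,\|(w(0),w_t(0))\|_{H^s\times H^{s/2}}\quad\text{if }0<s<2\ \ (\text{for }(w(0),w_t(0))\in H^s\times H^{s/2}),$$ $$E(t)\le Ce^{-\omega t}E(0)\quad\text{if }s\ge 2.$$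
   Context: For $r\in\mathbb{R}$, $H^r=H^r(\mathbb{R}^d)$ is the Sobolev space with norm $\|u\|_{H^r}^2=\int_{\mathbb{R}^d}(1+|\xi|^2)^r|\widehat u(\xi)|^2d\xi$, and $(I-\Delta)^r$ is the Fourier multiplier with symbol $(1+|\xi|^2)^r$ (Fourier convention such that $-\Delta$ has symbol $|\xi|^2$). For $s>0$ let $\mathcal{H}=H^{s/2}\times L^2$ and let $\mathcal{A}_\gamma$ be the operator on $\mathcal{H}$ with domain $H^s\times H^{s/2}$ given by $\mathcal{A}_\gamma(u_1,u_2)=(u_2,\,-(I-\Delta)^{s/2}u_1-\gamma u_2)$; it generates a strongly continuous contraction semigroup $e^{t\mathcal{A}_\gamma}$ on $\mathcal{H}$. The damped fractional wave equation is $w_{tt}+\gamma w_t+(I-\Delta)^{s/2}w=0$ on $\mathbb{R}^d\times[0,\infty)$, whose solution is $(w(t),w_t(t))=e^{t\mathcal{A}_\gamma}(w(0),w_t(0))$, and its energy is $E(t)=\|(w(t),w_t(t))\|_{\mathcal{H}}=\big(\int_{\mathbb{R}^d}|(I-\Delta)^{s/4}w(x,t)|^2+|w_t(x,t)|^2dx\big)^{1/2}$. *)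

theory Defs
  imports "HOL-Analysis.Analysis"
begin

text \<open>Functions on R^d are modelled on an arbitrary euclidean space 'a, d = DIM('a).
  Elements of L^2 etc. are represented by complex-valued functions; all notions below
  are invariant under a.e. modification.\<close>

definition square_integrable :: "('a::euclidean_space \<Rightarrow> complex) \<Rightarrow> bool" where
  "square_integrable u \<longleftrightarrow> u \<in> borel_measurable lborel \<and>
     integrable lborel (\<lambda>x. (cmod (u x))\<^sup>2)"

definition l2norm :: "('a::euclidean_space \<Rightarrow> complex) \<Rightarrow> real" where
  "l2norm u = sqrt (integral\<^sup>L lborel (\<lambda>x. (cmod (u x))\<^sup>2))"

text \<open>Unitary Fourier transform of an integrable (test) function:
  hat phi(xi) = (2 pi)^(-d/2) int exp(-i x.xi) phi(x) dx, so that -Delta has symbol |xi|^2.\<close>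
definition ft :: "('a::euclidean_space \<Rightarrow> complex) \<Rightarrow> 'a \<Rightarrow> complex" where
  "ft \<phi> \<xi> = complex_of_real ((2 * pi) powr (- real DIM('a) / 2)) *
      integral\<^sup>L lborel (\<lambda>x. exp (- \<i> * complex_of_real (x \<bullet> \<xi>)) * \<phi> x)"

text \<open>v is the (L^2 / distributional) Fourier transform of u \<in> L^2:
  <v, phi> = <u, hat phi> for all continuous compactly supported test functions phi.\<close>
definition fourier_of :: "('a::euclidean_space \<Rightarrow> complex) \<Rightarrow> ('a \<Rightarrow> complex) \<Rightarrow> bool" where
  "fourier_of u v \<longleftrightarrow> square_integrable u \<and> square_integrable v \<and>
     (\<forall>\<phi>. continuous_on UNIV \<phi> \<and> bounded {x. \<phi> x \<noteq> 0} \<longrightarrow>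
        integral\<^sup>L lborel (\<lambda>\<xi>. v \<xi> * \<phi> \<xi>) = integral\<^sup>L lborel (\<lambda>x. u x * ft \<phi> x))"

text \<open>Sobolev space H^r (for r \<ge> 0, the only case used) and its norm.\<close>
definition sobolev :: "real \<Rightarrow> ('a::euclidean_space \<Rightarrow> complex) set" where
  "sobolev r = {u. square_integrable u \<and> (\<exists>v. fourier_of u v \<and>
      integrable lborel (\<lambda>\<xi>. (1 + (norm \<xi>)\<^sup>2) powr r * (cmod (v \<xi>))\<^sup>2))}"

definition sob_norm :: "real \<Rightarrow> ('a::euclidean_space \<Rightarrow> complex) \<Rightarrow> real" where
  "sob_norm r u = sqrt (integral\<^sup>L lborel
      (\<lambda>\<xi>. (1 + (norm \<xi>)\<^sup>2) powr r * (cmod ((SOME v. fourier_of u v) \<xi>))\<^sup>2))"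

definition frac_power :: "real \<Rightarrow> ('a::euclidean_space \<Rightarrow> complex) \<Rightarrow> 'a \<Rightarrow> complex" where
  "frac_power r u = (SOME f. \<exists>v. fourier_of u v \<and>
      fourier_of f (\<lambda>\<xi>. complex_of_real ((1 + (norm \<xi>)\<^sup>2) powr r) * v \<xi>))"

type_synonym 'a st = "('a \<Rightarrow> complex) \<times> ('a \<Rightarrow> complex)"

definition st_add :: "'a st \<Rightarrow> 'a st \<Rightarrow> 'a st" where
  "st_add x y = (\<lambda>z. fst x z + fst y z, \<lambda>z. snd x z + snd y z)"
definition st_diff :: "'a st \<Rightarrow> 'a st \<Rightarrow> 'a st" where
  "st_diff x y = (\<lambda>z. fst x z - fst y z, \<lambda>z. snd x z - snd y z)"
definition st_scale :: "complex \<Rightarrow> 'a st \<Rightarrow> 'a st" where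
  "st_scale c x = (\<lambda>z. c * fst x z, \<lambda>z. c * snd x z)"

definition Hsp :: "real \<Rightarrow> ('a::euclidean_space) st set" where
  "Hsp s = sobolev (s/2) \<times> {u. square_integrable u}"

definition Hnorm :: "real \<Rightarrow> ('a::euclidean_space) st \<Rightarrow> real" where
  "Hnorm s x = sqrt ((sob_norm (s/2) (fst x))\<^sup>2 + (l2norm (snd x))\<^sup>2)"

definition Dom :: "real \<Rightarrow> ('a::euclidean_space) st set" where
  "Dom s = sobolev s \<times> sobolev (s/2)"

definition Dnorm :: "real \<Rightarrow> ('a::euclidean_space) st \<Rightarrow> real" where
  "Dnorm s x = sqrt ((sob_norm s (fst x))\<^sup>2 + (sob_norm (s/2) (snd x))\<^sup>2)"

definition Agen :: "real \<Rightarrow> ('a::euclidean_space \<Rightarrow> real) \<Rightarrow> 'a st \<Rightarrow> 'a st" where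
  "Agen s \<gamma> x = (snd x, \<lambda>z. - frac_power (s/2) (fst x) z - complex_of_real (\<gamma> z) * snd x z)"

text \<open>T is a strongly continuous semigroup of bounded linear operators on H (up to
  a.e. equality of representatives) whose generator is A_gamma with domain Dom s.\<close>
definition semigroup_generated_by ::
    "real \<Rightarrow> ('a::euclidean_space \<Rightarrow> real) \<Rightarrow> (real \<Rightarrow> 'a st \<Rightarrow> 'a st) \<Rightarrow> bool" where
  "semigroup_generated_by s \<gamma> T \<longleftrightarrow>
     (\<forall>t\<ge>0. \<forall>x\<in>Hsp s. T t x \<in> Hsp s) \<and>
     (\<forall>t\<ge>0. \<forall>x\<in>Hsp s. \<forall>y\<in>Hsp s. \<forall>c.
        Hnorm s (st_diff (T t (st_add (st_scale c x) y)) (st_add (st_scale c (T t x)) (T t y))) = 0) \<and>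
     (\<forall>t\<ge>0. \<exists>K. \<forall>x\<in>Hsp s. Hnorm s (T t x) \<le> K * Hnorm s x) \<and>
     (\<forall>x\<in>Hsp s. Hnorm s (st_diff (T 0 x) x) = 0) \<and>
     (\<forall>t\<ge>0. \<forall>r\<ge>0. \<forall>x\<in>Hsp s. Hnorm s (st_diff (T (t + r) x) (T t (T r x))) = 0) \<and>
     (\<forall>x\<in>Hsp s. ((\<lambda>t. Hnorm s (st_diff (T t x) x)) \<longlongrightarrow> 0) (at_right 0)) \<and>
     (\<forall>x\<in>Hsp s. x \<in> Dom s \<longleftrightarrow> (\<exists>y\<in>Hsp s.
        ((\<lambda>h. Hnorm s (st_diff (st_scale (complex_of_real (1/h)) (st_diff (T h x) x)) y))
           \<longlongrightarrow> 0) (at_right 0))) \<and>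
     (\<forall>x\<in>Dom s.
        ((\<lambda>h. Hnorm s (st_diff (st_scale (complex_of_real (1/h)) (st_diff (T h x) x)) (Agen s \<gamma> x)))
           \<longlongrightarrow> 0) (at_right 0))"

definition energy :: "real \<Rightarrow> (real \<Rightarrow> 'a st \<Rightarrow> 'a st) \<Rightarrow> 'a::euclidean_space st \<Rightarrow> real \<Rightarrow> real" where
  "energy s T x t = Hnorm s (T t x)"

end

theory Submission
  imports Defs "HOL-Probability.Probability"
begin

text \<open>
  \<^bold>\<open>Sufficiency.\<close> Diagonalising the undamped equation on the Fourier side turns it into
  \<open>f \<mapsto> exp (i t \<lambda>) f\<close>, \<open>g \<mapsto> exp (- i t \<lambda>) g\<close> with \<open>\<lambda>(\<xi>) = (1 + |\<xi>|\<^sup>2)\<^bsup>s/4\<^esup>\<close>. The geometric control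
  condition gives an uncertainty principle: functions with spectrum in a shell \<open>R \<le> |\<xi>| \<le> R + \<delta>\<close> satisfy
  \<open>\<integral> \<gamma> |u|\<^sup>2 \<ge> \<kappa> \<integral> |u|\<^sup>2\<close> uniformly in \<open>R\<close>. Parseval's identity in time transfers it to the flow over a
  time of order \<open>\<tau>\<close>, provided the windows of width about \<open>1/\<tau>\<close> of the values of \<open>\<lambda>\<close> are thin shells. For
  \<open>s \<ge> 2\<close> this holds for a fixed \<open>\<tau>\<close> and the energy drops by a fixed factor; for \<open>s < 2\<close> it holds only
  below a threshold \<open>\<lambda> \<le> \<rho>(\<tau>)\<close>, the rest being controlled by the norm of the domain, and optimising
  \<open>\<tau>\<close> along the evolution gives the algebraic rate.

  \<^bold>\<open>Necessity.\<close> For \<open>s = 2\<close> high-frequency wave packets travel along straight lines with unit speed without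
  dispersing. If some long segment carries almost no damping, a packet moving along it loses almost no energy,
  contradicting exponential decay.\<close>

text \<open>Why shells: seen at a bounded scale, a thin shell of large radius is nearly flat. A
  function with spectrum in it, localised in space, has almost constant modulus along the normal
  direction over the length L, so \<gamma> acts through its line integrals. Where the rate comes
  from: for s < 2 the slope of \<lambda> decays like \<lambda>^(-(2 - s)/s), so windows of width
  1/\<tau> are thin only up to \<rho> of order \<tau>^\<alpha>, \<alpha> = s/(2 - s). The part above
  \<rho> has norm at most W/\<rho>, with W a multiple of the domain norm. In time 2 \<tau> the
  squared norm thus loses a fraction of order 1/\<tau> while it exceeds a multiple of \<tau>^(-2
  \<alpha>) W^2. Taking \<tau> at this threshold gives t^(-\<alpha>) for the squared norm, that is,
  the exponent \<alpha>/2 = s/(4 - 2 s) for the energy. What shapes the rest: the decay statement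
  speaks of every semigroup with the given generator, with constants chosen before it. Sufficiency
  may therefore use the generator only, and necessity has to construct a semigroup, without which
  the hypothesis would be empty.\<close>

abbreviation "cpx \<equiv> complex_of_real"
abbreviation "msq z \<equiv> (cmod z)\<^sup>2"
abbreviation "bfun \<equiv> borel_measurable borel"
abbreviation "L2 \<equiv> square_integrable"
abbreviation LEB_int :: "('a::euclidean_space \<Rightarrow> 'b::{banach, second_countable_topology}) \<Rightarrow> 'b" (binder "LEB " [60] 60)
  where "LEB_int f \<equiv> integral\<^sup>L lborel f"
abbreviation NNI_int :: "('a::euclidean_space \<Rightarrow> ennreal) \<Rightarrow> ennreal" (binder "NNI " [60] 60)
  where "NNI_int f \<equiv> integral\<^sup>N lborel f"

section \<open>The Hilbert space of square integrable functions\<close>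

lemma L2_iff:
  "L2 u \<longleftrightarrow> u \<in> bfun \<and> integrable lborel (\<lambda>x. msq (u x))" by (simp add: square_integrable_def)

lemma L2_measurable [measurable_dest]:
  "L2 u \<Longrightarrow> u \<in> bfun" by (simp add: L2_iff)

lemma L2_normD:
  "L2 u \<Longrightarrow> integrable lborel (\<lambda>x. msq (u x))" by (simp add: L2_iff)

lemma L2_bound:
  assumes "L2 v" "u \<in> bfun" "AE x in lborel. cmod (u x) \<le> C * cmod (v x)" shows "L2 u" unfolding L2_iff
proof
  show "integrable lborel (\<lambda>x. msq (u x))"
  proof (rule Bochner_Integration.integrable_bound)
    show "integrable lborel (\<lambda>x. C\<^sup>2 * msq (v x))" using assms(1) by (simp add: L2_iff)
    show "(\<lambda>x. msq (u x)) \<in> borel_measurable lborel" using assms(2) by measurable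
    show "AE x in lborel. norm (msq (u x)) \<le> norm (C\<^sup>2 * msq (v x))"
      using assms(3) by eventually_elim (auto simp flip: power_mult_distrib intro: power_mono)
  qed
qed (use assms in auto)

lemma L2_zero [simp]: "L2 (\<lambda>x. 0)" by (simp add: L2_iff)

lemma L2_mult_bounded:
  assumes "L2 v" "m \<in> bfun" "\<And>x. cmod (m x) \<le> C" shows "L2 (\<lambda>x. m x * v x)" by (rule L2_bound[OF assms(1), of _ C])
     (use assms in \<open>auto simp: norm_mult intro!: mult_right_mono\<close>)

lemma L2_cmult [intro]: "L2 v \<Longrightarrow> L2 (\<lambda>x. c * v x)" by (rule L2_mult_bounded) auto

lemma L2_add [intro]:
  assumes [measurable]: "L2 u" "L2 v" shows "L2 (\<lambda>x. u x + v x)" unfolding L2_iff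
proof
  show "integrable lborel (\<lambda>x. msq (u x + v x))"
  proof (rule Bochner_Integration.integrable_bound)
    show "integrable lborel (\<lambda>x. 2 * msq (u x) + 2 * msq (v x))" using assms by (simp add: L2_iff)
    have "msq (u x + v x) \<le> 2 * msq (u x) + 2 * msq (v x)" for x
    proof -
      have "msq (u x + v x) \<le> (cmod (u x) + cmod (v x))\<^sup>2" by (intro power_mono norm_triangle_ineq) auto
      also have "\<dots> \<le> 2 * msq (u x) + 2 * msq (v x)" using sum_squares_bound[of "cmod (u x)" "cmod (v x)"] by (simp add: power2_sum)
      finally show ?thesis .
    qed
    then show "AE x in lborel. norm (msq (u x + v x)) \<le> norm (2 * msq (u x) + 2 * msq (v x))" by (auto simp: abs_of_nonneg)
  qed measurable
qed measurable

lemma L2_uminus [intro]: "L2 u \<Longrightarrow> L2 (\<lambda>x. - u x)" by (simp add: L2_iff)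

lemma L2_diff [intro]:
  "L2 u \<Longrightarrow> L2 v \<Longrightarrow> L2 (\<lambda>x. u x - v x)" using L2_add[of u "\<lambda>x. - v x"] by auto

lemma measurable_cnj [measurable]: "u \<in> borel_measurable M \<Longrightarrow> (\<lambda>x. cnj (u x)) \<in> borel_measurable M"
  by (rule borel_measurable_continuous_on[where f = cnj]) (intro continuous_intros)

lemma L2_cnj: "L2 u \<Longrightarrow> L2 (\<lambda>x. cnj (u x))" by (simp add: L2_iff measurable_cnj)

lemma L2_cong_AE:
  assumes "L2 u" "v \<in> bfun" "AE x in lborel. u x = v x" shows "L2 v" by (rule L2_bound[OF assms(1), of _ 1]) (use assms in auto)

lemma integrable_mult_L2:
  assumes [measurable]: "L2 u" "L2 v" shows "integrable lborel (\<lambda>x. u x * v x)"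
proof (rule Bochner_Integration.integrable_bound)
  show "integrable lborel (\<lambda>x. msq (u x) + msq (v x))" using assms by (simp add: L2_iff)
  have "cmod (u x) * cmod (v x) \<le> msq (u x) + msq (v x)" for x
    using sum_squares_bound[of "cmod (u x)" "cmod (v x)"] mult_nonneg_nonneg[of "cmod (u x)" "cmod (v x)"] norm_ge_zero[of "u x"] norm_ge_zero[of "v x"]
    by linarith
  then show "AE x in lborel. norm (u x * v x) \<le> norm (msq (u x) + msq (v x))" by (auto simp: norm_mult)
qed measurable

lemma integrable_inner_L2:
  assumes "L2 u" "L2 v" shows "integrable lborel (\<lambda>x. u x \<bullet> v x)"
proof -
  have "integrable lborel (\<lambda>x. Re (u x * cnj (v x)))" by (intro integrable_Re integrable_mult_L2 L2_cnj assms)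
  then show ?thesis by (simp add: inner_complex_def)
qed

\<comment> \<open>The relation is partial: it is reflexive exactly on square integrable functions,
  so every class has an L2 representative, while \<open>cls u\<close> says nothing about
  \<open>u\<close> without \<open>L2 u\<close>.\<close>
quotient_type (overloaded) 'a l2 = "'a::euclidean_space \<Rightarrow> complex" / partial:
  "\<lambda>u v. L2 u \<and> L2 v \<and> (AE x in lborel. u x = v x)"
proof (rule part_equivpI)
  show "\<exists>u::'a \<Rightarrow> complex. L2 u \<and> L2 u \<and> (AE x in lborel. u x = u x)" by (rule exI[of _ "\<lambda>x. 0"]) auto
qed (auto simp: symp_def transp_def)

instantiation l2 :: (euclidean_space) real_inner
begin

lift_definition zero_l2 :: "'a l2" is "\<lambda>x. 0" by simp
lift_definition plus_l2 :: "'a l2 \<Rightarrow> 'a l2 \<Rightarrow> 'a l2" is "\<lambda>u v x. u x + v x" by auto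
lift_definition uminus_l2 :: "'a l2 \<Rightarrow> 'a l2" is "\<lambda>u x. - u x" by auto
lift_definition minus_l2 :: "'a l2 \<Rightarrow> 'a l2 \<Rightarrow> 'a l2" is "\<lambda>u v x. u x - v x" by auto
lift_definition scaleR_l2 :: "real \<Rightarrow> 'a l2 \<Rightarrow> 'a l2" is "\<lambda>c u x. cpx c * u x" by auto
text \<open>On complex numbers \<open>\<bullet>\<close> is the real part of the Hermitian product,
  so the classes form a real Hilbert space; complex scalars come back later as multiplication by a
  constant, \<open>mulop (\<lambda>_. c)\<close>.\<close>

lift_definition inner_l2 :: "'a l2 \<Rightarrow> 'a l2 \<Rightarrow> real" is "\<lambda>u v. integral\<^sup>L lborel (\<lambda>x. u x \<bullet> v x)"
  by (intro Bochner_Integration.integral_cong_AE) (auto, measurable)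

definition norm_l2 :: "'a l2 \<Rightarrow> real" where "norm_l2 x = sqrt (x \<bullet> x)"
definition dist_l2 :: "'a l2 \<Rightarrow> 'a l2 \<Rightarrow> real" where "dist_l2 x y = norm (x - y)"
definition sgn_l2 :: "'a l2 \<Rightarrow> 'a l2" where "sgn_l2 x = inverse (norm x) *\<^sub>R x"
definition uniformity_l2 :: "('a l2 \<times> 'a l2) filter" where "uniformity_l2 = (INF e\<in>{0 <..}. principal {(x, y). dist x y < e})"
definition open_l2 :: "'a l2 set \<Rightarrow> bool"
  where "open_l2 S = (\<forall>x\<in>S. \<forall>\<^sub>F (x', y) in uniformity. x' = x \<longrightarrow> y \<in> S)"

instance
proof
  fix x y z :: "'a l2" and a b :: real
  show "x + y + z = x + (y + z)" by transfer (auto simp: ac_simps)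
  show "x + y = y + x" by transfer (auto simp: ac_simps)
  show "0 + x = x" by transfer auto
  show "- x + x = 0" by transfer auto
  show "x - y = x + - y" by transfer auto
  show "a *\<^sub>R (x + y) = a *\<^sub>R x + a *\<^sub>R y" by transfer (auto simp: distrib_left)
  show "(a + b) *\<^sub>R x = a *\<^sub>R x + b *\<^sub>R x" by transfer (auto simp: distrib_right)
  show "a *\<^sub>R b *\<^sub>R x = (a * b) *\<^sub>R x" by transfer (auto simp: mult.assoc L2_cmult)
  show "1 *\<^sub>R x = x" by transfer auto
  show "dist x y = norm (x - y)" by (rule dist_l2_def)
  show "sgn x = inverse (norm x) *\<^sub>R x" by (rule sgn_l2_def)
  show "uniformity = (INF e\<in>{0 <..}. principal {(x, y :: 'a l2). dist x y < e})" by (rule uniformity_l2_def)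
  show "open U = (\<forall>x\<in>U. \<forall>\<^sub>F (x', y) in uniformity. x' = x \<longrightarrow> y \<in> U)" for U :: "'a l2 set"
    by (rule open_l2_def)
  show "x \<bullet> y = y \<bullet> x" by transfer (simp add: inner_commute)
  show "(x + y) \<bullet> z = x \<bullet> z + y \<bullet> z" by transfer (simp add: inner_add_left integrable_inner_L2)
  show "(a *\<^sub>R x) \<bullet> y = a * (x \<bullet> y)" by transfer (simp add: scaleR_conv_of_real[symmetric])
  show "0 \<le> x \<bullet> x" by transfer simp
  show "x \<bullet> x = 0 \<longleftrightarrow> x = 0"
  proof transfer
    fix u :: "'a \<Rightarrow> complex" assume u: "L2 u \<and> L2 u \<and> (AE x in lborel. u x = u x)"
    have "(LEB x. u x \<bullet> u x) = 0 \<longleftrightarrow> (AE x in lborel. u x \<bullet> u x = 0)"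
      using u by (intro integral_nonneg_eq_0_iff_AE integrable_inner_L2) auto
    then show "((LEB x. u x \<bullet> u x) = 0) = (L2 u \<and> L2 (\<lambda>x. 0) \<and> (AE x in lborel. u x = 0))" using u by auto
  qed
  show "norm x = sqrt (x \<bullet> x)" by (rule norm_l2_def)
qed

end

definition cls :: "('a::euclidean_space \<Rightarrow> complex) \<Rightarrow> 'a l2" where "cls = abs_l2"
definition rep :: "'a::euclidean_space l2 \<Rightarrow> 'a \<Rightarrow> complex" where "rep = rep_l2"

lemma L2_rep [simp, intro]: "L2 (rep f)" unfolding rep_def using Quotient_rep_reflp[OF Quotient_l2, of f] by simp

lemma measurable_rep [measurable]: "rep f \<in> bfun" by (rule L2_measurable) simp

lemma cls_rep [simp]: "cls (rep f) = f" unfolding cls_def rep_def by (rule Quotient_abs_rep[OF Quotient_l2])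

lemma cls_eq_iff: "L2 u \<Longrightarrow> L2 v \<Longrightarrow> cls u = cls v \<longleftrightarrow> (AE x in lborel. u x = v x)"
  unfolding cls_def using Quotient_rel[OF Quotient_l2, of u v] by auto

lemma rep_cls: "L2 u \<Longrightarrow> AE x in lborel. rep (cls u) x = u x" using cls_eq_iff[of "rep (cls u)" u] by simp

lemma cls_eqI: "L2 u \<Longrightarrow> AE x in lborel. rep f x = u x \<Longrightarrow> cls u = f" using cls_eq_iff[of "rep f" u] by simp

lemma cls_add: "L2 u \<Longrightarrow> L2 v \<Longrightarrow> cls (\<lambda>x. u x + v x) = cls u + cls v"
  unfolding cls_def by (simp add: plus_l2.abs_eq)

lemma cls_diff: "L2 u \<Longrightarrow> L2 v \<Longrightarrow> cls (\<lambda>x. u x - v x) = cls u - cls v"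
  unfolding cls_def by (simp add: minus_l2.abs_eq)

lemma cls_uminus: "L2 u \<Longrightarrow> cls (\<lambda>x. - u x) = - cls u" unfolding cls_def by (simp add: uminus_l2.abs_eq)

lemma cls_scaleR: "L2 u \<Longrightarrow> cls (\<lambda>x. cpx c * u x) = c *\<^sub>R cls u" unfolding cls_def by (simp add: scaleR_l2.abs_eq)

lemma cls_zero: "cls (\<lambda>x. 0) = 0" unfolding cls_def zero_l2_def by simp

lemma cls_sum:
  "(\<And>i. i \<in> I \<Longrightarrow> L2 (u i)) \<Longrightarrow> L2 (\<lambda>x. \<Sum>i\<in>I. u i x) \<and> cls (\<lambda>x. \<Sum>i\<in>I. u i x) = (\<Sum>i\<in>I. cls (u i))"
proof (induction I rule: infinite_finite_induct)
  case (insert i I)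
  then show ?case using L2_add[of "u i" "\<lambda>x. \<Sum>i\<in>I. u i x"] by (simp add: cls_add)
qed (auto simp: cls_zero)

lemma inner_cls: "L2 u \<Longrightarrow> L2 v \<Longrightarrow> cls u \<bullet> cls v = (LEB x. u x \<bullet> v x)"
  unfolding cls_def by (simp add: inner_l2.abs_eq)

lemma norm_cls: "L2 u \<Longrightarrow> norm (cls u) = l2norm u" unfolding norm_eq_sqrt_inner l2norm_def by (simp add: inner_cls power2_norm_eq_inner)

lemma norm_cls_sq: "L2 u \<Longrightarrow> (norm (cls u))\<^sup>2 = (LEB x. msq (u x))" by (simp add: norm_cls l2norm_def)

lemma norm_l2_sq: "(norm f)\<^sup>2 = (LEB x. msq (rep f x))" using norm_cls_sq[of "rep f"] by simp

lemma norm_cls_mono: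
  assumes "L2 u" "L2 v" "AE x in lborel. cmod (u x) \<le> cmod (v x)" shows "norm (cls u) \<le> norm (cls v)"
  unfolding norm_cls[OF assms(1)] norm_cls[OF assms(2)] l2norm_def
  using assms by (intro real_sqrt_le_mono integral_mono_AE) (auto simp: L2_iff elim!: eventually_mono)

lemma dist_cls: "L2 u \<Longrightarrow> L2 v \<Longrightarrow> dist (cls u) (cls v) = l2norm (\<lambda>x. u x - v x)"
  by (simp add: dist_norm norm_cls L2_diff flip: cls_diff)

lemma L2_dominated:
  assumes "integrable lborel g" "u \<in> bfun" "AE x in lborel. msq (u x) \<le> g x" shows "L2 u" unfolding L2_iff
proof
  show "integrable lborel (\<lambda>x. msq (u x))"
    by (rule Bochner_Integration.integrable_bound[OF assms(1)]) (use assms in \<open>auto elim!: eventually_mono\<close>)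
qed (use assms in auto)

text \<open>The bound on the squared moduli passes to the limit \<open>v\<close>, so
  \<open>4 * g\<close> dominates the squared distance by (a + b)^2 <= 2 a^2 + 2 b^2.\<close>

lemma tendsto_cls_dominated:
  fixes u :: "nat \<Rightarrow> 'a::euclidean_space \<Rightarrow> complex"
  assumes m: "\<And>n. u n \<in> bfun" "v \<in> bfun" and g: "integrable lborel g"
    and lim: "AE x in lborel. (\<lambda>n. u n x) \<longlonglongrightarrow> v x" and bd: "\<And>n. AE x in lborel. msq (u n x) \<le> g x"
  shows "\<And>n. L2 (u n)" "L2 v" "(\<lambda>n. cls (u n)) \<longlonglongrightarrow> cls v"
proof -
  show 1: "L2 (u n)" for n by (rule L2_dominated[OF g m(1) bd])
  have "AE x in lborel. \<forall>n. msq (u n x) \<le> g x" using bd by (simp add: AE_all_countable)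
  with lim have bv: "AE x in lborel. msq (v x) \<le> g x"
  proof eventually_elim
    case (elim x)
    have "(\<lambda>n. msq (u n x)) \<longlonglongrightarrow> msq (v x)" using elim by (intro tendsto_intros)
    then show ?case by (rule LIMSEQ_le_const2) (use elim in auto)
  qed
  show 2: "L2 v" by (rule L2_dominated[OF g m(2) bv])
  have "(\<lambda>n. LEB x. msq (u n x - v x)) \<longlonglongrightarrow> integral\<^sup>L lborel (\<lambda>x::'a. 0::real)"
  proof (rule integral_dominated_convergence[where w = "\<lambda>x. 4 * g x"])
    show "(\<lambda>x. 0) \<in> borel_measurable lborel" by simp
    show "(\<lambda>x. msq (u n x - v x)) \<in> borel_measurable lborel" for n using m by measurable
    show "integrable lborel (\<lambda>x. 4 * g x)" using g by simp
    show "AE x in lborel. (\<lambda>n. msq (u n x - v x)) \<longlonglongrightarrow> 0" using lim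
    proof eventually_elim
      case (elim x)
      have "(\<lambda>n. msq (u n x - v x)) \<longlonglongrightarrow> msq (v x - v x)" using elim by (intro tendsto_intros)
      then show ?case by simp
    qed
    show "AE x in lborel. norm (msq (u n x - v x)) \<le> 4 * g x" for n using bv bd[of n]
    proof eventually_elim
      case (elim x)
      have "msq (u n x - v x) \<le> (cmod (u n x) + cmod (v x))\<^sup>2" by (intro power_mono norm_triangle_ineq4) auto
      also have "\<dots> \<le> 2 * msq (u n x) + 2 * msq (v x)" using sum_squares_bound[of "cmod (u n x)" "cmod (v x)"] by (simp add: power2_sum)
      finally show ?case using elim by simp
    qed
  qed
  then have "(\<lambda>n. sqrt (LEB x. msq (u n x - v x))) \<longlonglongrightarrow> sqrt 0" by (intro tendsto_intros) simp
  then have "(\<lambda>n. dist (cls (u n)) (cls v)) \<longlonglongrightarrow> 0" using 1 2 by (simp add: dist_cls l2norm_def)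
  then show "(\<lambda>n. cls (u n)) \<longlonglongrightarrow> cls v" by (subst tendsto_dist_iff)
qed

text \<open>Square integrability of the limit is a conclusion here, not an assumption. This serves
  completeness, the removal of Gaussian damping from Fourier integrals, and the proof that an
  element with bounded difference quotients lies in the domain of a generator.\<close>

lemma l2norm_Fatou:
  assumes m: "\<And>n. L2 (u n)" "v \<in> bfun" and lim: "AE x in lborel. (\<lambda>n. u n x) \<longlonglongrightarrow> v x"
    and bd: "\<And>n. norm (cls (u n)) \<le> C" shows "L2 v" "norm (cls v) \<le> C"
proof -
  have meas[measurable]: "u n \<in> bfun" "v \<in> bfun" for n using m by auto
  have C: "0 \<le> C" using norm_ge_zero[of "cls (u 0)"] bd[of 0] by linarith
  have "(NNI x. ennreal (msq (v x))) = (NNI x. liminf (\<lambda>n. ennreal (msq (u n x))))" using lim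
  proof (intro nn_integral_cong_AE, eventually_elim)
    case (elim x)
    have "(\<lambda>n. ennreal (msq (u n x))) \<longlonglongrightarrow> ennreal (msq (v x))" using elim by (intro tendsto_intros)
    then show ?case by (rule lim_imp_Liminf[OF trivial_limit_sequentially, symmetric])
  qed
  also have "\<dots> \<le> liminf (\<lambda>n. \<integral>\<^sup>+x. ennreal (msq (u n x)) \<partial>lborel)" by (rule nn_integral_liminf) measurable
  also have "\<dots> \<le> liminf (\<lambda>n. ennreal (C\<^sup>2))"
  proof (rule Liminf_mono, rule always_eventually, rule allI)
    fix n
    have "(NNI x. ennreal (msq (u n x))) = ennreal ((norm (cls (u n)))\<^sup>2)"
      using m(1)[of n] by (subst nn_integral_eq_integral) (auto simp: norm_cls_sq L2_iff)
    also have "\<dots> \<le> ennreal (C\<^sup>2)" using bd[of n] by (intro ennreal_leI power_mono) auto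
    finally show "(NNI x. ennreal (msq (u n x))) \<le> ennreal (C\<^sup>2)" .
  qed
  also have "\<dots> = ennreal (C\<^sup>2)" by (simp add: Liminf_const)
  finally have *: "(NNI x. ennreal (msq (v x))) \<le> ennreal (C\<^sup>2)" .
  then have int: "integrable lborel (\<lambda>x. msq (v x))" by (intro integrableI_bounded) (auto simp: less_top[symmetric] top_unique)
  then show sv: "L2 v" by (simp add: L2_iff)
  have "ennreal ((norm (cls v))\<^sup>2) \<le> ennreal (C\<^sup>2)" using * int by (subst (asm) nn_integral_eq_integral) (auto simp: norm_cls_sq sv)
  then have "(norm (cls v))\<^sup>2 \<le> C\<^sup>2" by (simp add: ennreal_le_iff)
  then show "norm (cls v) \<le> C" using C by (rule power2_le_imp_le)
qed

text \<open>Riesz-Fischer through L1: multiplication by a positive weight \<open>w\<close> in L2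
  turns an L2-Cauchy sequence into an L1-Cauchy one by Cauchy-Schwarz, which has an almost
  everywhere Cauchy subsequence. Division by \<open>w\<close> recovers a pointwise limit, and
  Fatou's lemma makes it the L2 limit of the whole sequence.\<close>

instance l2 :: (euclidean_space) complete_space
proof
  fix X :: "nat \<Rightarrow> 'a l2" assume X: "Cauchy X"
  obtain w :: "'a \<Rightarrow> real" where w: "w \<in> borel_measurable lborel" "\<And>x. w x > 0" "\<And>x. w x \<le> 1" "integrable lborel w"
    by (rule sigma_finite_measure.obtain_positive_integrable_function[OF sigma_finite_lborel]) blast
  have sw: "L2 (\<lambda>x. cpx (w x))"
  proof (rule L2_dominated[OF w(4)])
    show "AE x in lborel. msq (cpx (w x)) \<le> w x" using w by (auto simp: power2_eq_square less_imp_le mult_left_le_one_le)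
  qed (use w in measurable)
  define s where "s n x = rep (X n) x * cpx (w x)" for n x
  have int: "integrable lborel (s n)" for n unfolding s_def by (intro integrable_mult_L2 sw) auto
  have L1: "(LEB x. norm (s i x - s j x)) \<le> norm (X i - X j) * norm (cls (\<lambda>x. cpx (w x)))" for i j
  proof -
    have sq: "L2 (\<lambda>x. cpx (cmod (rep (X i) x - rep (X j) x)))" by (rule L2_bound[of "\<lambda>x. rep (X i) x - rep (X j) x" _ 1])
         (auto intro!: L2_diff)
    have "(LEB x. norm (s i x - s j x)) = (LEB x. cpx (cmod (rep (X i) x - rep (X j) x)) \<bullet> cpx (w x))"
      using w by (intro Bochner_Integration.integral_cong) (auto simp: s_def inner_complex_def norm_mult less_imp_le simp flip: left_diff_distrib)
    also have "\<dots> = cls (\<lambda>x. cpx (cmod (rep (X i) x - rep (X j) x))) \<bullet> cls (\<lambda>x. cpx (w x))"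
      by (rule inner_cls[OF sq sw, symmetric])
    also have "\<dots> \<le> norm (cls (\<lambda>x. cpx (cmod (rep (X i) x - rep (X j) x)))) * norm (cls (\<lambda>x. cpx (w x)))"
      by (rule norm_cauchy_schwarz)
    also have "norm (cls (\<lambda>x. cpx (cmod (rep (X i) x - rep (X j) x)))) = norm (cls (\<lambda>x. rep (X i) x - rep (X j) x))"
      by (simp add: norm_cls sq L2_diff l2norm_def)
    also have "\<dots> = norm (X i - X j)" by (simp add: cls_diff)
    finally show ?thesis .
  qed
  have "\<exists>r. strict_mono r \<and> (AE x in lborel. Cauchy (\<lambda>i. s (r i) x))"
  proof -
    have "\<exists>N. \<forall>i\<ge>N. \<forall>j\<ge>N. (LEB x. norm (s i x - s j x)) < e" if e: "e > 0" for e
    proof -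
      define K where "K = norm (cls (\<lambda>x::'a. cpx (w x))) + 1"
      have K: "K > 0" by (simp add: K_def add_nonneg_pos)
      obtain N where N: "\<forall>i\<ge>N. \<forall>j\<ge>N. norm (X i - X j) < e / K" using CauchyD[OF X, of "e / K"] e K by auto
      show ?thesis
      proof (intro exI[of _ N] allI impI)
        fix i j assume ij: "i \<ge> N" "j \<ge> N"
        have "(LEB x. norm (s i x - s j x)) \<le> norm (X i - X j) * norm (cls (\<lambda>x. cpx (w x)))" by (rule L1)
        also have "\<dots> \<le> norm (X i - X j) * K" by (intro mult_left_mono) (auto simp: K_def)
        also have "\<dots> < e" using N ij K by (auto simp: pos_less_divide_eq)
        finally show "(LEB x. norm (s i x - s j x)) < e" .
      qed
    qed
    then show ?thesis using cauchy_L1_AE_cauchy_subseq[of lborel s] int by metis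
  qed
  then obtain r where r: "strict_mono r" and ae: "AE x in lborel. Cauchy (\<lambda>i. s (r i) x)" by blast
  define v where "v x = lim (\<lambda>i. rep (X (r i)) x)" for x
  have [measurable]: "v \<in> bfun" unfolding v_def by measurable
  have lim: "AE x in lborel. (\<lambda>i. rep (X (r i)) x) \<longlonglongrightarrow> v x" using ae
  proof eventually_elim
    case (elim x)
    then obtain l where "(\<lambda>i. s (r i) x) \<longlonglongrightarrow> l" by (metis Cauchy_convergent convergent_def)
    then have "(\<lambda>i. s (r i) x / cpx (w x)) \<longlonglongrightarrow> l / cpx (w x)"
      using w(2)[of x] by (intro tendsto_divide tendsto_const) auto
    then have "convergent (\<lambda>i. rep (X (r i)) x)" using w(2)[of x] unfolding convergent_def s_def by auto
    then show ?case by (simp add: v_def convergent_LIMSEQ_iff)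
  qed
  have "Bseq X" using X by (rule Cauchy_Bseq)
  then obtain C where C: "\<And>n. norm (X n) \<le> C" by (auto simp: Bseq_def)
  have sv: "L2 v" by (rule l2norm_Fatou[OF _ _ lim, of C]) (use C in auto)
  have "X \<longlonglongrightarrow> cls v"
  proof (rule LIMSEQ_I)
    fix e :: real assume e: "e > 0"
    obtain N where N: "\<forall>i\<ge>N. \<forall>j\<ge>N. norm (X i - X j) < e/2" using CauchyD[OF X, of "e / 2"] e by auto
    show "\<exists>N. \<forall>n\<ge>N. norm (X n - cls v) < e"
    proof (intro exI[of _ N] allI impI)
      fix n assume n: "n \<ge> N"
      \<comment> \<open>The shift to \<open>i + N\<close> keeps all subsequence indices beyond
        \<open>N\<close>, so the Cauchy bound holds for every member and survives the limit.\<close>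
      have "norm (cls (\<lambda>x. rep (X n) x - v x)) \<le> e/2"
      proof (rule l2norm_Fatou(2))
        show "L2 (\<lambda>x. rep (X n) x - rep (X (r (i + N))) x)" for i by (intro L2_diff) auto
        show "AE x in lborel. (\<lambda>i. rep (X n) x - rep (X (r (i + N))) x) \<longlonglongrightarrow> rep (X n) x - v x"
          using lim by eventually_elim (auto intro!: tendsto_intros LIMSEQ_ignore_initial_segment)
        show "norm (cls (\<lambda>x. rep (X n) x - rep (X (r (i + N))) x)) \<le> e/2" for i
        proof -
          have "r (i + N) \<ge> N" using seq_suble[OF r, of "i + N"] by simp
          then show ?thesis using N n by (simp add: cls_diff less_imp_le)
        qed
      qed measurable
      then show "norm (X n - cls v) < e" using e sv by (simp add: cls_diff)
    qed
  qed
  then show "convergent X" by (auto simp: convergent_def)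
qed

section \<open>Plancherel's theorem for integrable square integrable functions\<close>

lemma lborel_product_Basis:
  fixes f :: "'a::euclidean_space \<Rightarrow> real \<Rightarrow> complex"
  assumes int: "\<And>b. b \<in> Basis \<Longrightarrow> integrable lborel (f b)"
  shows "integrable lborel (\<lambda>x::'a. \<Prod>b\<in>Basis. f b (x \<bullet> b))"
    and "(LEB x. (\<Prod>b\<in>Basis. f b (x \<bullet> b))) = (\<Prod>b\<in>Basis. (LEB t. f b t))"
proof -
  interpret product_sigma_finite "\<lambda>_::'a. lborel::real measure" by standard
  have [measurable]: "f b \<in> bfun" if "b \<in> Basis" for b using borel_measurable_integrable[OF int[OF that]] by simp
  have T: "(\<lambda>g. \<Sum>b\<in>Basis. g b *\<^sub>R b) \<in> measurable (\<Pi>\<^sub>M b\<in>Basis. lborel::real measure) (borel::'a measure)"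
    by measurable
  have F: "(\<lambda>x::'a. \<Prod>b\<in>Basis. f b (x \<bullet> b)) \<in> bfun" by measurable
  have eq: "(\<Prod>b\<in>Basis. f b ((\<Sum>c\<in>Basis. g c *\<^sub>R c) \<bullet> b)) = (\<Prod>b\<in>Basis. f b (g b))" for g :: "'a \<Rightarrow> real"
    by (intro prod.cong) auto
  show "integrable lborel (\<lambda>x::'a. \<Prod>b\<in>Basis. f b (x \<bullet> b))"
    by (subst lborel_eq) (use T F int in \<open>simp add: integrable_distr_eq eq product_integrable_prod\<close>)
  show "(LEB x. (\<Prod>b\<in>Basis. f b (x \<bullet> b))) = (\<Prod>b\<in>Basis. (LEB t. f b t))"
    by (subst lborel_eq) (use T F int in \<open>simp add: integral_distr eq product_integral_prod\<close>)
qed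

text \<open>Up to the factor sqrt(2 pi) the integrand is the standard normal density times
  \<open>iexp\<close>, so the integral is the characteristic function of the standard normal
  distribution at \<open>- t\<close>.\<close>

lemma gaussian_real: shows "integrable lborel (\<lambda>x::real. exp (- \<i> * cpx (x * t)) * cpx (exp (- (x\<^sup>2 / 2))))"
    and "(LEB x. exp (- \<i> * cpx (x * t)) * cpx (exp (- (x\<^sup>2 / 2))))
      = cpx (sqrt (2 * pi) * exp (- (t\<^sup>2 / 2)))"
proof -
  have eq: "exp (- \<i> * cpx (x * t)) * cpx (exp (- (x\<^sup>2 / 2)))
     = sqrt (2 * pi) *\<^sub>R (std_normal_density x *\<^sub>R iexp ((- t) * x))" for x
    by (simp add: std_normal_density_def scaleR_conv_of_real ac_simps)
  have int: "integrable lborel (\<lambda>x. std_normal_density x *\<^sub>R iexp ((- t) * x))"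
  proof (rule Bochner_Integration.integrable_bound)
    show "integrable lborel std_normal_density" by (rule integrable_normal_density) simp
  qed (auto intro!: AE_I2 simp: norm_mult)
  then show "integrable lborel (\<lambda>x::real. exp (- \<i> * cpx (x * t)) * cpx (exp (- (x\<^sup>2 / 2))))"
    unfolding eq by (rule integrable_scaleR_right)
  have "(LEB x. std_normal_density x *\<^sub>R iexp ((- t) * x)) = char std_normal_distribution (- t)"
    unfolding char_def by (subst integral_density) auto
  also have "\<dots> = cpx (exp (- (t\<^sup>2 / 2)))" by (simp add: char_std_normal_distribution)
  finally show "(LEB x. exp (- \<i> * cpx (x * t)) * cpx (exp (- (x\<^sup>2 / 2))))
      = cpx (sqrt (2 * pi) * exp (- (t\<^sup>2 / 2)))" unfolding eq by (simp add: scaleR_conv_of_real)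
qed

abbreviation ft_const :: "'a::euclidean_space itself \<Rightarrow> real" where
  "ft_const _ \<equiv> (2 * pi) powr (- real DIM('a) / 2)"

text \<open>Both the Gaussian and the exponential factor over the coordinates, so the integral is a
  product of one-dimensional ones; the resulting power of sqrt(2 pi) cancels the constant in
  \<open>ft\<close>.\<close>

lemma gaussian_euclidean:
  fixes \<xi> :: "'a::euclidean_space"
  shows "integrable lborel (\<lambda>x. exp (- \<i> * cpx (x \<bullet> \<xi>)) * cpx (exp (- ((norm x)\<^sup>2 / 2))))"
    and "ft (\<lambda>x. cpx (exp (- ((norm x)\<^sup>2 / 2)))) \<xi> = cpx (exp (- ((norm \<xi>)\<^sup>2 / 2)))"
proof -
  let ?f = "\<lambda>(b::'a) t. exp (- \<i> * cpx (t * (\<xi> \<bullet> b))) * cpx (exp (- (t\<^sup>2 / 2)))"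
  have norm_eq: "(norm (x::'a))\<^sup>2 = (\<Sum>b\<in>Basis. (x \<bullet> b)\<^sup>2)" for x
    by (subst power2_norm_eq_inner, subst euclidean_inner) (simp add: power2_eq_square)
  have expn: "exp (- ((norm (x::'a))\<^sup>2 / 2)) = (\<Prod>b\<in>Basis. exp (- ((x \<bullet> b)\<^sup>2 / 2)))" for x
    unfolding norm_eq by (simp add: exp_sum[symmetric] sum_negf sum_divide_distrib)
  have eq: "exp (- \<i> * cpx (x \<bullet> \<xi>)) * cpx (exp (- ((norm x)\<^sup>2 / 2)))
     = (\<Prod>b\<in>Basis. ?f b (x \<bullet> b))" for x
  proof -
    have "exp (- \<i> * cpx (x \<bullet> \<xi>)) = (\<Prod>b\<in>Basis. exp (- \<i> * cpx ((x \<bullet> b) * (\<xi> \<bullet> b))))"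
      by (subst euclidean_inner) (simp add: exp_sum[symmetric] sum_negf sum_distrib_left of_real_sum)
    then show ?thesis unfolding expn by (simp add: prod.distrib)
  qed
  have int: "integrable lborel (?f b)" for b by (rule gaussian_real)
  show "integrable lborel (\<lambda>x. exp (- \<i> * cpx (x \<bullet> \<xi>)) * cpx (exp (- ((norm x)\<^sup>2 / 2))))"
    unfolding eq by (rule lborel_product_Basis[of ?f]) (rule int)
  have "(LEB x. exp (- \<i> * cpx (x \<bullet> \<xi>)) * cpx (exp (- ((norm x)\<^sup>2 / 2))))
    = (\<Prod>b\<in>(Basis::'a set). cpx (sqrt (2 * pi) * exp (- ((\<xi> \<bullet> b)\<^sup>2 / 2))))"
    unfolding eq using lborel_product_Basis(2)[of ?f, OF int] by (simp only: gaussian_real)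
  also have "\<dots> = cpx (sqrt (2 * pi) ^ DIM('a) * exp (- ((norm \<xi>)\<^sup>2 / 2)))" unfolding expn by (simp add: prod.distrib)
  also have "sqrt (2 * pi) ^ DIM('a) = (2 * pi) powr (real DIM('a) / 2)" by (simp add: powr_half_sqrt[symmetric] powr_powr flip: powr_realpow)
  finally show "ft (\<lambda>x. cpx (exp (- ((norm x)\<^sup>2 / 2)))) \<xi> = cpx (exp (- ((norm \<xi>)\<^sup>2 / 2)))"
    unfolding ft_def by (simp flip: of_real_mult mult.assoc powr_add)
qed

section \<open>Affine substitutions and elementary properties of the Fourier integral\<close>

lemma lborel_integrable_affine:
  fixes f :: "'a::euclidean_space \<Rightarrow> 'b::{banach, second_countable_topology}"
  assumes "integrable lborel f" "c \<noteq> 0" shows "integrable lborel (\<lambda>x. f (t + c *\<^sub>R x))"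
proof -
  have [measurable]: "f \<in> bfun" using assms by auto
  have "integrable (density (distr lborel borel (\<lambda>x. t + c *\<^sub>R x)) (\<lambda>_. ennreal (\<bar>c\<bar> ^ DIM('a)))) f"
    using lborel_affine[OF assms(2), of t] assms(1) by simp
  then have "integrable lborel (\<lambda>x. \<bar>c\<bar> ^ DIM('a) *\<^sub>R f (t + c *\<^sub>R x))"
    by (simp add: integrable_density integrable_distr_eq)
  then have "integrable lborel (\<lambda>x. inverse (\<bar>c\<bar> ^ DIM('a)) *\<^sub>R (\<bar>c\<bar> ^ DIM('a) *\<^sub>R f (t + c *\<^sub>R x)))"
    by (rule integrable_scaleR_right)
  then show ?thesis using assms(2) by simp
qed

lemma lborel_integral_affine:
  fixes f :: "'a::euclidean_space \<Rightarrow> 'b::{banach, second_countable_topology}"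
  assumes [measurable]: "f \<in> bfun" and "c \<noteq> 0" shows "(LEB x. f x) = \<bar>c\<bar> ^ DIM('a) *\<^sub>R (LEB x. f (t + c *\<^sub>R x))"
proof -
  have "(LEB x. f x) = integral\<^sup>L (density (distr lborel borel (\<lambda>x. t + c *\<^sub>R x)) (\<lambda>_. ennreal (\<bar>c\<bar> ^ DIM('a)))) f"
    using lborel_affine[OF assms(2), of t] by simp
  also have "\<dots> = \<bar>c\<bar> ^ DIM('a) *\<^sub>R (LEB x. f (t + c *\<^sub>R x))" by (simp add: integral_density integral_distr)
  finally show ?thesis .
qed

lemma lborel_integral_shift:
  fixes f :: "'a::euclidean_space \<Rightarrow> 'b::{banach, second_countable_topology}"
  assumes "f \<in> bfun" shows "(LEB x. f (t + x)) = (LEB x. f x)" using lborel_integral_affine[OF assms, of 1 t] by simp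

lemma lborel_integrable_shift:
  fixes f :: "'a::euclidean_space \<Rightarrow> 'b::{banach, second_countable_topology}"
  shows "integrable lborel f \<Longrightarrow> integrable lborel (\<lambda>x. f (t + x))" using lborel_integrable_affine[of f 1 t] by simp

lemma ft_measurable [measurable]:
  fixes u :: "'a::euclidean_space \<Rightarrow> complex"
  assumes [measurable]: "u \<in> bfun" shows "ft u \<in> bfun"
proof -
  have "(\<lambda>\<xi>. LEB x. exp (- \<i> * cpx (x \<bullet> \<xi>)) * u x) \<in> bfun"
    by (rule lborel.borel_measurable_lebesgue_integral) measurable
  then show ?thesis unfolding ft_def[abs_def] by measurable
qed

lemma integrable_ft_integrand:
  assumes "integrable lborel u" shows "integrable lborel (\<lambda>x. exp (- \<i> * cpx (x \<bullet> \<xi>)) * u x)"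
proof -
  have [measurable]: "u \<in> bfun" using assms by auto
  show ?thesis by (rule Bochner_Integration.integrable_bound[OF assms]) (auto simp: norm_mult)
qed

lemma norm_ft_le:
  fixes u :: "'a::euclidean_space \<Rightarrow> complex" shows "cmod (ft u \<xi>) \<le> ft_const TYPE('a) * (LEB x. cmod (u x))"
proof -
  have "cmod (LEB x. exp (- \<i> * cpx (x \<bullet> \<xi>)) * u x) \<le> (LEB x. cmod (exp (- \<i> * cpx (x \<bullet> \<xi>)) * u x))"
    by (rule integral_norm_bound)
  also have "\<dots> = (LEB x. cmod (u x))" by (simp add: norm_mult)
  finally show ?thesis unfolding ft_def by (simp add: norm_mult mult_left_mono)
qed

lemma ft_add: "integrable lborel u \<Longrightarrow> integrable lborel v \<Longrightarrow> ft (\<lambda>x. u x + v x) \<xi> = ft u \<xi> + ft v \<xi>"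
  unfolding ft_def using integrable_ft_integrand[of u \<xi>] integrable_ft_integrand[of v \<xi>] by (simp add: distrib_left)

lemma ft_cmult: "ft (\<lambda>x. c * u x) \<xi> = c * ft u \<xi>"
  unfolding ft_def by (subst mult.left_commute, subst integral_mult_right_zero) (simp add: ac_simps)

lemma ft_diff: "integrable lborel u \<Longrightarrow> integrable lborel v \<Longrightarrow> ft (\<lambda>x. u x - v x) \<xi> = ft u \<xi> - ft v \<xi>"
  using ft_add[of u "\<lambda>x. - v x" \<xi>] ft_cmult[of "-1" v \<xi>] by simp

lemma integrable_bounded_mult:
  fixes f g :: "'a::euclidean_space \<Rightarrow> complex"
  assumes "integrable lborel f" "g \<in> bfun" "\<And>x. cmod (g x) \<le> C"
  shows "integrable lborel (\<lambda>x. f x * g x)" "integrable lborel (\<lambda>x. g x * f x)"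
proof -
  have [measurable]: "f \<in> bfun" "g \<in> bfun" using assms by auto
  have "integrable lborel (\<lambda>x. cpx C * f x)" using assms(1) by simp
  then show "integrable lborel (\<lambda>x. f x * g x)" by (rule Bochner_Integration.integrable_bound)
       (use assms(3) norm_ge_zero[THEN order_trans, OF assms(3)] in \<open>auto simp: norm_mult mult.commute[of C] intro!: mult_left_mono AE_I2\<close>)
  then show "integrable lborel (\<lambda>x. g x * f x)" by (simp add: mult.commute)
qed

text \<open>Fubini's theorem; the kernel exp(-i x.\<xi>) is symmetric in its two variables.\<close>

lemma ft_mult_formula:
  fixes f g :: "'a::euclidean_space \<Rightarrow> complex"
  assumes f: "integrable lborel f" and g: "integrable lborel g" shows "(LEB \<xi>. ft f \<xi> * g \<xi>) = (LEB x. f x * ft g x)"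
proof -
  have [measurable]: "f \<in> bfun" "g \<in> bfun" using f g by auto
  let ?k = "\<lambda>x \<xi>. exp (- \<i> * cpx (x \<bullet> \<xi>)) * f x * g \<xi>"
  have int: "integrable (lborel \<Otimes>\<^sub>M lborel) (case_prod ?k)"
  proof (rule lborel_pair.Fubini_integrable)
    show "case_prod ?k \<in> borel_measurable (lborel \<Otimes>\<^sub>M lborel)" by measurable
    have "(\<lambda>x. LEB \<xi>. cmod (case_prod ?k (x, \<xi>))) = (\<lambda>x. cmod (f x) * (LEB \<xi>. cmod (g \<xi>)))" by (simp add: norm_mult)
    then show "integrable lborel (\<lambda>x. LEB \<xi>. cmod (case_prod ?k (x, \<xi>)))" using f by simp
    show "AE x in lborel. integrable lborel (\<lambda>\<xi>. case_prod ?k (x, \<xi>))"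
    proof (rule AE_I2)
      fix x
      have "integrable lborel (\<lambda>\<xi>. f x * (exp (- \<i> * cpx (\<xi> \<bullet> x)) * g \<xi>))"
        by (intro integrable_mult_right integrable_ft_integrand g)
      then show "integrable lborel (\<lambda>\<xi>. case_prod ?k (x, \<xi>))" by (simp add: ac_simps inner_commute)
    qed
  qed
  have "(LEB \<xi>. LEB x. ?k x \<xi>) = (LEB x. LEB \<xi>. ?k x \<xi>)" by (rule lborel_pair.Fubini_integral[OF int])
  moreover have "(LEB x. ?k x \<xi>) = (LEB x. exp (- \<i> * cpx (x \<bullet> \<xi>)) * f x) * g \<xi>" for \<xi> by (rule integral_mult_left_zero)
  moreover have "(LEB \<xi>. ?k x \<xi>) = f x * (LEB \<xi>. exp (- \<i> * cpx (\<xi> \<bullet> x)) * g \<xi>)" for x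
    by (subst integral_mult_right_zero[symmetric]) (simp only: ac_simps inner_commute)
  ultimately have eq: "(LEB \<xi>. (LEB x. exp (- \<i> * cpx (x \<bullet> \<xi>)) * f x) * g \<xi>)
     = (LEB x. f x * (LEB \<xi>. exp (- \<i> * cpx (\<xi> \<bullet> x)) * g \<xi>))" by (simp only:)
  have "(LEB \<xi>. ft f \<xi> * g \<xi>) = cpx (ft_const TYPE('a)) *
      (LEB \<xi>. (LEB x. exp (- \<i> * cpx (x \<bullet> \<xi>)) * f x) * g \<xi>)"
    unfolding ft_def by (subst integral_mult_right_zero[symmetric]) (simp only: ac_simps)
  also have "\<dots> = (LEB x. f x * ft g x)" unfolding eq ft_def by (subst integral_mult_right_zero[symmetric]) (simp only: ac_simps)
  finally show ?thesis .
qed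

text \<open>Rescaling by \<open>e\<close> and shifting by \<open>x\<close>: a wide modulated
  Gaussian has as transform an approximate identity at \<open>x\<close>, up to the normalising
  factor that \<open>gauss\<close> contains.\<close>

lemma ft_gaussian_scaled:
  fixes x y :: "'a::euclidean_space"
  assumes e: "e > 0" shows "integrable lborel (\<lambda>\<xi>. cpx (exp (- (e\<^sup>2 * (norm (\<xi>::'a))\<^sup>2 / 2))))"
    and "ft (\<lambda>\<xi>. exp (\<i> * cpx (x \<bullet> \<xi>)) * cpx (exp (- (e\<^sup>2 * (norm \<xi>)\<^sup>2 / 2)))) y
      = cpx ((1 / e) ^ DIM('a) * exp (- ((norm ((y - x) /\<^sub>R e))\<^sup>2 / 2)))"
proof -
  let ?G = "\<lambda>z \<xi>::'a. exp (- \<i> * cpx (\<xi> \<bullet> z)) * cpx (exp (- ((norm \<xi>)\<^sup>2 / 2)))"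
  have m: "?G z \<in> bfun" for z by measurable
  have "integrable lborel (\<lambda>\<xi>. ?G 0 (0 + e *\<^sub>R \<xi>))" by (rule lborel_integrable_affine[OF gaussian_euclidean(1)]) (use e in auto)
  then show "integrable lborel (\<lambda>\<xi>. cpx (exp (- (e\<^sup>2 * (norm (\<xi>::'a))\<^sup>2 / 2))))" using e by (simp add: power_mult_distrib)
  let ?z = "(y - x) /\<^sub>R e"
  have "(LEB \<xi>. ?G ?z \<xi>) = e ^ DIM('a) *\<^sub>R (LEB \<xi>. ?G ?z (0 + e *\<^sub>R \<xi>))"
    using lborel_integral_affine[OF m, of e ?z 0] e by simp
  also have "(\<lambda>\<xi>. ?G ?z (0 + e *\<^sub>R \<xi>)) = (\<lambda>\<xi>. exp (- \<i> * cpx (\<xi> \<bullet> y)) *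
     (exp (\<i> * cpx (x \<bullet> \<xi>)) * cpx (exp (- (e\<^sup>2 * (norm \<xi>)\<^sup>2 / 2)))))"
  proof
    fix \<xi> :: 'a
    have "(e *\<^sub>R \<xi>) \<bullet> ?z = \<xi> \<bullet> y - x \<bullet> \<xi>" using e by (simp add: inner_diff_right inner_commute)
    then have "exp (- \<i> * cpx ((e *\<^sub>R \<xi>) \<bullet> ?z)) = exp (- \<i> * cpx (\<xi> \<bullet> y)) * exp (\<i> * cpx (x \<bullet> \<xi>))"
      by (simp only:) (simp add: algebra_simps flip: exp_add)
    then show "?G ?z (0 + e *\<^sub>R \<xi>) = exp (- \<i> * cpx (\<xi> \<bullet> y)) *
     (exp (\<i> * cpx (x \<bullet> \<xi>)) * cpx (exp (- (e\<^sup>2 * (norm \<xi>)\<^sup>2 / 2))))"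
      using e by (simp only: add_0_left mult.assoc) (simp add: power_mult_distrib)
  qed
  finally have "ft (\<lambda>\<xi>. cpx (exp (- ((norm \<xi>)\<^sup>2 / 2)))) ?z = cpx (e ^ DIM('a)) *
    ft (\<lambda>\<xi>. exp (\<i> * cpx (x \<bullet> \<xi>)) * cpx (exp (- (e\<^sup>2 * (norm \<xi>)\<^sup>2 / 2)))) y"
    unfolding ft_def by (simp add: scaleR_conv_of_real)
  then show "ft (\<lambda>\<xi>. exp (\<i> * cpx (x \<bullet> \<xi>)) * cpx (exp (- (e\<^sup>2 * (norm \<xi>)\<^sup>2 / 2)))) y
      = cpx ((1 / e) ^ DIM('a) * exp (- ((norm ((y - x) /\<^sub>R e))\<^sup>2 / 2)))"
    unfolding gaussian_euclidean using e by (simp add: field_simps power_divide)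
qed

definition gauss :: "'a::euclidean_space \<Rightarrow> real" where
  "gauss z = ft_const TYPE('a) * exp (- ((norm z)\<^sup>2 / 2))"

lemma gauss: "gauss z > 0" "integrable lborel (gauss :: 'a::euclidean_space \<Rightarrow> real)"
   "(LEB z. gauss (z::'a)) = 1" "(gauss :: 'a \<Rightarrow> real) \<in> bfun"
proof -
  show "gauss z > 0" unfolding gauss_def by simp
  have int: "integrable lborel (\<lambda>x::'a. cpx (exp (- ((norm x)\<^sup>2 / 2))))" using gaussian_euclidean(1)[of "0::'a"] by simp
  have "integrable lborel (\<lambda>x::'a. Re (cpx (exp (- ((norm x)\<^sup>2 / 2)))))" by (rule integrable_Re[OF int])
  then show i: "integrable lborel (gauss :: 'a \<Rightarrow> real)" unfolding gauss_def[abs_def] by simp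
  have "cpx (LEB z. gauss (z::'a)) = ft (\<lambda>x. cpx (exp (- ((norm x)\<^sup>2 / 2)))) (0::'a)"
    unfolding ft_def gauss_def[abs_def] by (simp flip: integral_complex_of_real)
  also have "\<dots> = 1" by (simp only: gaussian_euclidean) simp
  finally show "(LEB z. gauss (z::'a)) = 1" using of_real_eq_1_iff by blast
  show "(gauss :: 'a \<Rightarrow> real) \<in> bfun" using i by auto
qed

text \<open>Damping the Fourier integral by a Gaussian turns the energy of \<open>ft u\<close> into a Gaussian
  average of the autocorrelation of \<open>u\<close>.\<close>

lemma ft_gaussian_energy:
  fixes u :: "'a::euclidean_space \<Rightarrow> complex"
  assumes u: "integrable lborel u" "L2 u" and e: "e > 0"
  defines "A \<equiv> \<lambda>w. LEB x. u x * cnj (u (x + w))"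
  shows "integrable lborel (\<lambda>\<xi>. msq (ft u \<xi>) * exp (- (e\<^sup>2 * (norm \<xi>)\<^sup>2 / 2)))" (is ?I) and "A \<in> bfun" (is ?M)
    and "\<And>w. cmod (A w) \<le> (LEB x. msq (u x))" and "cpx (LEB \<xi>. msq (ft u \<xi>) * exp (- (e\<^sup>2 * (norm \<xi>)\<^sup>2 / 2)))
      = (LEB z. A (e *\<^sub>R z) * cpx (gauss z))" (is ?E)
proof -
  have [measurable]: "u \<in> bfun" "(gauss :: 'a \<Rightarrow> real) \<in> bfun" using u gauss(4) by auto
  note [measurable] = ft_measurable[of u]
  define h where "h \<xi> = cpx (exp (- (e\<^sup>2 * (norm \<xi>)\<^sup>2 / 2)))" for \<xi> :: 'a
  have h: "integrable lborel h" unfolding h_def[abs_def] by (rule ft_gaussian_scaled(1)[OF e])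
  have [measurable]: "h \<in> bfun" using h by auto
  \<comment> \<open>With this \<open>g\<close> the damped energy is the integral of
    \<open>ft u * g\<close>, hence of \<open>u * ft g\<close> by the multiplication formula, and
    \<open>ft g\<close> is computable: it is a Gaussian average of conjugated translates of
    \<open>u\<close>.\<close>
  define g where "g \<xi> = h \<xi> * cnj (ft u \<xi>)" for \<xi>
  have g: "integrable lborel g" unfolding g_def by (rule integrable_bounded_mult[OF h, where C = "ft_const TYPE('a) * (LEB x. cmod (u x))"])
      (measurable, simp only: complex_mod_cnj norm_ft_le)
  have eg: "cpx (msq (ft u \<xi>) * exp (- (e\<^sup>2 * (norm \<xi>)\<^sup>2 / 2))) = ft u \<xi> * g \<xi>" for \<xi>
    by (simp only: g_def h_def of_real_mult complex_norm_square mult_ac)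
  have "integrable lborel (\<lambda>\<xi>. ft u \<xi> * g \<xi>)"
    by (rule integrable_bounded_mult[OF g, where C = "ft_const TYPE('a) * (LEB x. cmod (u x))"])
      (measurable, simp only: norm_ft_le)
  then have "integrable lborel (\<lambda>\<xi>. Re (ft u \<xi> * g \<xi>))" by (rule integrable_Re)
  then show ?I unfolding eg[symmetric] by simp
  have Ib: "integrable lborel (\<lambda>x. u x * cnj (u (x + w)))" and Ab: "(LEB x. cmod (u x * cnj (u (x + w)))) \<le> (LEB x. msq (u x))" for w
  proof -
    have sw: "integrable lborel (\<lambda>x. msq (u (x + w)))" "(LEB x. msq (u (x + w))) = (LEB x. msq (u x))"
      using lborel_integrable_shift[OF L2_normD[OF u(2)], of w]
        lborel_integral_shift[of "\<lambda>x. msq (u x)" w] by (simp_all add: add.commute)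
    have si: "integrable lborel (\<lambda>x. (msq (u x) + msq (u (x + w))) / 2)" using sw L2_normD[OF u(2)] by simp
    have b: "cmod (u x * cnj (u (x + w))) \<le> (msq (u x) + msq (u (x + w))) / 2" for x
      using sum_squares_bound[of "cmod (u x)" "cmod (u (x + w))"] by (simp add: norm_mult)
    show I: "integrable lborel (\<lambda>x. u x * cnj (u (x + w)))"
      by (rule Bochner_Integration.integrable_bound[OF si]) (use b in \<open>auto intro!: AE_I2 order_trans[OF b]\<close>)
    have "(LEB x. cmod (u x * cnj (u (x + w)))) \<le> (LEB x. (msq (u x) + msq (u (x + w))) / 2)" using I si b by (intro integral_mono) auto
    also have "\<dots> = (LEB x. msq (u x))" using sw L2_normD[OF u(2)] by simp
    finally show "(LEB x. cmod (u x * cnj (u (x + w)))) \<le> (LEB x. msq (u x))" .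
  qed
  show ?M unfolding A_def by (rule lborel.borel_measurable_lebesgue_integral) measurable
  show "cmod (A w) \<le> (LEB x. msq (u x))" for w unfolding A_def by (rule order_trans[OF integral_norm_bound Ab])
  have ftg: "ft g x = cpx (ft_const TYPE('a)) * (LEB z. cnj (u (x + e *\<^sub>R z)) * cpx (exp (- ((norm z)\<^sup>2 / 2))))" for x
  proof -
    let ?k = "\<lambda>\<xi>. exp (\<i> * cpx (x \<bullet> \<xi>)) * h \<xi>"
    have k: "integrable lborel ?k" by (rule integrable_bounded_mult(2)[OF h, where C = 1]) auto
    have "(LEB \<xi>. exp (- \<i> * cpx (\<xi> \<bullet> x)) * g \<xi>) = (LEB \<xi>. cnj (ft u \<xi> * ?k \<xi>))"
      by (intro Bochner_Integration.integral_cong) (simp_all add: g_def h_def exp_cnj inner_commute)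
    also have "\<dots> = cnj (LEB \<xi>. ft u \<xi> * ?k \<xi>)" by (rule Bochner_Integration.integral_cnj)
    also have "(LEB \<xi>. ft u \<xi> * ?k \<xi>) = (LEB y. u y * ft ?k y)" by (rule ft_mult_formula[OF u(1) k])
    also have "\<dots> = (LEB y. u y * cpx ((1 / e) ^ DIM('a) * exp (- ((norm ((y - x) /\<^sub>R e))\<^sup>2 / 2))))"
      unfolding h_def by (simp only: ft_gaussian_scaled(2)[OF e])
    also have "\<dots> = e ^ DIM('a) *\<^sub>R (LEB z. u (x + e *\<^sub>R z) * cpx ((1 / e) ^ DIM('a) * exp (- ((norm (((x + e *\<^sub>R z) - x) /\<^sub>R e))\<^sup>2 / 2))))"
      using e by (subst lborel_integral_affine[where c = e and t = x]) auto
    also have "\<dots> = (LEB z. u (x + e *\<^sub>R z) * cpx (exp (- ((norm z)\<^sup>2 / 2))))"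
      using e by (simp add: scaleR_conv_of_real power_divide mult.left_commute[of _ "1 / _"])
    finally show ?thesis unfolding ft_def by (simp only: Bochner_Integration.integral_cnj[symmetric]) simp
  qed
  have int2: "integrable (lborel \<Otimes>\<^sub>M lborel) (\<lambda>(z, x). u x * cnj (u (x + e *\<^sub>R z)) * cpx (gauss z))"
  proof (rule lborel_pair.Fubini_integrable)
    have "integrable lborel (\<lambda>z. (LEB x. cmod (u x * cnj (u (x + e *\<^sub>R z)))) * gauss z)"
    proof (rule Bochner_Integration.integrable_bound)
      show "integrable lborel (\<lambda>z. (LEB x. msq (u x)) * gauss (z::'a))" using gauss(2) by (rule integrable_mult_right)
      show "(\<lambda>z. (LEB x. cmod (u x * cnj (u (x + e *\<^sub>R z)))) * gauss z) \<in> borel_measurable lborel" by measurable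
      show "AE z in lborel. norm ((LEB x. cmod (u x * cnj (u (x + e *\<^sub>R z)))) * gauss z) \<le> norm ((LEB x. msq (u x)) * gauss (z::'a))"
        using Ab gauss(1) by (auto intro!: AE_I2 mult_right_mono simp: abs_mult less_imp_le)
    qed
    then show "integrable lborel (\<lambda>z. LEB x. cmod (case (z, x) of (z, x) \<Rightarrow> u x * cnj (u (x + e *\<^sub>R z)) * cpx (gauss z)))"
      by (simp add: norm_mult abs_of_pos[OF gauss(1)])
    show "AE z in lborel. integrable lborel (\<lambda>x. case (z, x) of (z, x) \<Rightarrow> u x * cnj (u (x + e *\<^sub>R z)) * cpx (gauss z))"
      using Ib by auto
  qed measurable
  have "cpx (LEB \<xi>. msq (ft u \<xi>) * exp (- (e\<^sup>2 * (norm \<xi>)\<^sup>2 / 2))) = (LEB \<xi>. ft u \<xi> * g \<xi>)"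
    by (simp only: eg[symmetric] integral_complex_of_real)
  also have "\<dots> = (LEB x. u x * ft g x)" by (rule ft_mult_formula[OF u(1) g])
  also have "\<dots> = (LEB x. LEB z. u x * cnj (u (x + e *\<^sub>R z)) * cpx (gauss z))"
    unfolding ftg by (intro Bochner_Integration.integral_cong refl)
      (simp add: gauss_def ac_simps flip: integral_mult_right_zero)
  also have "\<dots> = (LEB z. LEB x. u x * cnj (u (x + e *\<^sub>R z)) * cpx (gauss z))" by (rule lborel_pair.Fubini_integral[OF int2])
  also have "\<dots> = (LEB z. A (e *\<^sub>R z) * cpx (gauss z))" unfolding A_def by simp
  finally show ?E .
qed

lemma exp_gauss_tendsto:
  "(\<lambda>n. exp (- ((1 / real (Suc n))\<^sup>2 * a))) \<longlonglongrightarrow> 1"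
proof -
  have "(\<lambda>n. exp (- ((1 / real (Suc n))\<^sup>2 * a))) \<longlonglongrightarrow> exp (- (0\<^sup>2 * a))"
    by (intro tendsto_intros LIMSEQ_inverse_real_of_nat[unfolded inverse_eq_divide])
  then show ?thesis by simp
qed

text \<open>Only an inequality at this stage: the autocorrelation is bounded by its value at 0, so
  its Gaussian average is at most the squared norm, and Fatou's lemma removes the damping. Equality
  by this route asks for continuity of the autocorrelation at 0.\<close>

lemma ft_contraction:
  fixes u :: "'a::euclidean_space \<Rightarrow> complex"
  assumes u: "integrable lborel u" "L2 u" shows "L2 (ft u)" "norm (cls (ft u)) \<le> norm (cls u)"
proof -
  have [measurable]: "u \<in> bfun" using u by auto
  \<comment> \<open>The exponent has 1/4 where the energy identity has 1/2 because
    \<open>f n\<close> gets squared.\<close>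
  define f where "f n \<xi> = ft u \<xi> * cpx (exp (- ((1 / real (Suc n))\<^sup>2 * ((norm \<xi>)\<^sup>2 / 4))))" for n \<xi>
  define A where "A w = (LEB x. u x * cnj (u (x + w)))" for w
  have fsq: "msq (f n \<xi>) = msq (ft u \<xi>) * exp (- ((1 / real (Suc n))\<^sup>2 * (norm \<xi>)\<^sup>2 / 2))" for n \<xi>
    unfolding f_def norm_mult power_mult_distrib norm_of_real abs_exp_cancel exp_double[symmetric] by (simp add: field_simps flip: exp_double)
  have pos: "1 / real (Suc n) > 0" for n by simp
  have [measurable]: "f n \<in> bfun" for n unfolding f_def by measurable
  have sf: "L2 (f n)" for n unfolding L2_iff using ft_gaussian_energy(1)[OF u pos[of n]] by (simp only: fsq) simp
  have nf: "norm (cls (f n)) \<le> norm (cls u)" for n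
  proof (rule power2_le_imp_le)
    have "cpx ((norm (cls (f n)))\<^sup>2) = (LEB z. A ((1 / real (Suc n)) *\<^sub>R z) * cpx (gauss z))"
      unfolding norm_cls_sq[OF sf] fsq A_def by (rule ft_gaussian_energy(4)[OF u pos[of n]])
    then have "(norm (cls (f n)))\<^sup>2 = cmod (LEB z. A ((1 / real (Suc n)) *\<^sub>R z) * cpx (gauss z))"
      by (metis norm_of_real abs_power2 abs_norm_cancel power2_abs)
    also have "\<dots> \<le> (LEB z. cmod (A ((1 / real (Suc n)) *\<^sub>R z) * cpx (gauss z)))" by (rule integral_norm_bound)
    also have "\<dots> \<le> (LEB z. (norm (cls u))\<^sup>2 * gauss (z::'a))"
    proof (rule integral_mono')
      show "integrable lborel (\<lambda>z. (norm (cls u))\<^sup>2 * gauss (z::'a))" using gauss(2) by (rule integrable_mult_right)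
      show "cmod (A ((1 / real (Suc n)) *\<^sub>R z) * cpx (gauss z)) \<le> (norm (cls u))\<^sup>2 * gauss z" for z
        using ft_gaussian_energy(3)[OF u pos[of n], of "(1 / real (Suc n)) *\<^sub>R z"] gauss(1)[of z]
        unfolding A_def norm_cls_sq[OF u(2)] norm_mult by (simp add: mult_right_mono)
      show "0 \<le> (norm (cls u))\<^sup>2 * gauss z" for z using gauss(1)[of z] by simp
    qed
    also have "\<dots> = (norm (cls u))\<^sup>2" using gauss(3)[where 'a = 'a] by simp
    finally show "(norm (cls (f n)))\<^sup>2 \<le> (norm (cls u))\<^sup>2" .
  qed simp
  have lim: "AE \<xi> in lborel. (\<lambda>n. f n \<xi>) \<longlonglongrightarrow> ft u \<xi>"
  proof (rule AE_I2)
    fix \<xi> :: 'a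
    have "(\<lambda>n. f n \<xi>) \<longlonglongrightarrow> ft u \<xi> * cpx 1" unfolding f_def by (intro tendsto_intros exp_gauss_tendsto)
    then show "(\<lambda>n. f n \<xi>) \<longlonglongrightarrow> ft u \<xi>" by simp
  qed
  show "L2 (ft u)" "norm (cls (ft u)) \<le> norm (cls u)" using l2norm_Fatou[OF sf _ lim nf] by auto
qed

definition Cc :: "('a::euclidean_space \<Rightarrow> complex) \<Rightarrow> bool" where
  "Cc \<phi> \<longleftrightarrow> continuous_on UNIV \<phi> \<and> bounded {x. \<phi> x \<noteq> 0}"

lemma Cc_measurable: "Cc \<phi> \<Longrightarrow> \<phi> \<in> bfun" by (auto simp: Cc_def intro: borel_measurable_continuous_onI)

lemma bounded_support_integrable:
  fixes u :: "'a::euclidean_space \<Rightarrow> complex"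
  assumes "u \<in> bfun" "\<And>x. cmod (u x) \<le> M" "\<And>x. R < norm x \<Longrightarrow> u x = 0" shows "integrable lborel u" "L2 u"
proof -
  have M: "0 \<le> M" using norm_ge_zero order_trans assms(2) by blast
  have ib: "integrable lborel (indicat_real (cball (0::'a) R))" using emeasure_lborel_cball_finite[of "0::'a" R] by (simp add: top.not_eq_extremum)
  show "integrable lborel u"
  proof (rule Bochner_Integration.integrable_bound)
    show "integrable lborel (\<lambda>x. M * indicat_real (cball (0::'a) R) x)" using ib by (rule integrable_mult_right)
    show "AE x in lborel. norm (u x) \<le> norm (M * indicat_real (cball (0::'a) R) x)" using assms(2,3) M by (auto simp: indicator_def not_le)
  qed (use assms in auto)
  show "L2 u"
  proof (rule L2_dominated)
    show "integrable lborel (\<lambda>x. M\<^sup>2 * indicat_real (cball (0::'a) R) x)" using ib by (rule integrable_mult_right)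
    show "AE x in lborel. msq (u x) \<le> M\<^sup>2 * indicat_real (cball (0::'a) R) x"
      using assms(2,3) M by (auto simp: indicator_def not_le intro!: power_mono)
  qed (use assms in auto)
qed

lemma Cc_bounds:
  assumes "Cc \<phi>"
  obtains M R where "\<And>x. cmod (\<phi> x) \<le> M" "\<And>x. R < norm x \<Longrightarrow> \<phi> x = 0"
proof -
  have "\<exists>R. \<forall>x. \<phi> x \<noteq> 0 \<longrightarrow> norm x \<le> R" using assms unfolding Cc_def bounded_iff by simp
  then obtain R where R: "\<And>x. \<phi> x \<noteq> 0 \<Longrightarrow> norm x \<le> R" by blast
  have "compact (\<phi> ` cball 0 R)" using assms continuous_on_subset[of UNIV \<phi> "cball 0 R"]
    by (intro compact_continuous_image) (simp_all add: Cc_def)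
  then have "bounded (\<phi> ` cball 0 R)" by (rule compact_imp_bounded)
  then obtain M where M: "\<And>x. x \<in> cball 0 R \<Longrightarrow> cmod (\<phi> x) \<le> M" unfolding bounded_iff by blast
  have "cmod (\<phi> x) \<le> max M 0" for x using R[of x] M[of x] by (cases "\<phi> x = 0") auto
  moreover have "R < norm x \<Longrightarrow> \<phi> x = 0" for x using R[of x] by force
  ultimately show thesis by (rule that)
qed

lemma Cc_integrable: "Cc \<phi> \<Longrightarrow> integrable lborel \<phi>" and Cc_L2: "Cc \<phi> \<Longrightarrow> L2 \<phi>"
proof -
  assume cc: "Cc \<phi>"
  obtain M R where *: "\<And>x. cmod (\<phi> x) \<le> M" "\<And>x. R < norm x \<Longrightarrow> \<phi> x = 0" by (rule Cc_bounds[OF cc]) blast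
  show "integrable lborel \<phi>" "L2 \<phi>" by (rule bounded_support_integrable[OF Cc_measurable[OF cc] *], assumption)+
qed

text \<open>A truncation \<open>v n\<close> is bounded with bounded support, and a measurable
  function is an almost everywhere limit of continuous ones. Clipping their real and imaginary parts
  and multiplying by the cutoff \<open>ct\<close> yields members of \<open>Cc\<close> with a common
  dominating function, and does not disturb the limit \<open>v n\<close>.\<close>

lemma Cc_dense:
  fixes u :: "'a::euclidean_space \<Rightarrow> complex"
  assumes u: "L2 u" and e: "e > 0"
  obtains \<phi> where "Cc \<phi>" "norm (cls u - cls \<phi>) < e"
proof -
  have [measurable]: "u \<in> bfun" using u by auto
  define v where "v n x = (if cmod (u x) \<le> real n \<and> norm x \<le> real n then u x else 0)" for n x
  have [measurable]: "v n \<in> bfun" for n unfolding v_def by measurable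
  have "(\<lambda>n. cls (v n)) \<longlonglongrightarrow> cls u"
  proof (rule tendsto_cls_dominated(3)[OF _ _ L2_normD[OF u]])
    show "AE x in lborel. (\<lambda>n. v n x) \<longlonglongrightarrow> u x"
    proof (rule AE_I2)
      fix x :: 'a
      obtain N where N: "max (cmod (u x)) (norm x) \<le> real N" using real_arch_simple by blast
      then have "v n x = u x" if "n \<ge> N" for n using that by (auto simp: v_def)
      then show "(\<lambda>n. v n x) \<longlonglongrightarrow> u x" by (intro tendsto_eventually) (auto simp: eventually_sequentially)
    qed
  qed (auto simp: v_def)
  then obtain n where n: "norm (cls u - cls (v n)) < e/2" using e by (metis LIMSEQ_D half_gt_zero order_refl norm_minus_commute)
  have vs: "L2 (v n)" by (rule bounded_support_integrable[of _ "real n" "real n"]) (auto simp: v_def)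
  have "v n \<in> borel_measurable lebesgue" by (simp add: measurable_completion)
  then have "v n measurable_on UNIV" by (rule lebesgue_measurable_imp_measurable_on) simp
  then obtain N g where g: "negligible N" "\<And>k. continuous_on UNIV (g k)" "\<And>x. x \<notin> N \<Longrightarrow> (\<lambda>k. g k x) \<longlonglongrightarrow> v n x"
    unfolding measurable_on_def by auto
  \<comment> \<open>One constant for two purposes: a clipping level above all values of
    \<open>v n\<close>, and the radius of a ball containing the support of
    \<open>ct\<close>.\<close>
  define M where "M = real n + 1"
  define cl where "cl t = max (- M) (min M t)" for t :: real
  define ct where "ct x = max 0 (min 1 (real n + 1 - norm x))" for x :: 'a
  define \<phi> where "\<phi> k x = cpx (ct x) * Complex (cl (Re (g k x))) (cl (Im (g k x)))" for k x
  have cc: "Cc (\<phi> k)" for k unfolding Cc_def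
  proof
    show "continuous_on UNIV (\<phi> k)" unfolding \<phi>_def ct_def cl_def Complex_eq by (intro continuous_intros g)
    have "{x. \<phi> k x \<noteq> 0} \<subseteq> cball 0 (real n + 1)" unfolding \<phi>_def ct_def by auto
    then show "bounded {x. \<phi> k x \<noteq> 0}" using bounded_cball bounded_subset by blast
  qed
  have ib: "integrable lborel (indicat_real (cball (0::'a) M))" using emeasure_lborel_cball_finite[of "0::'a" M] by (simp add: top.not_eq_extremum)
  have "(\<lambda>k. cls (\<phi> k)) \<longlonglongrightarrow> cls (v n)"
  proof (rule tendsto_cls_dominated(3)[where g = "\<lambda>x. (2 * M\<^sup>2) * indicat_real (cball (0::'a) M) x"])
    show "\<phi> k \<in> bfun" for k by (rule Cc_measurable[OF cc])
    show "integrable lborel (\<lambda>x. (2 * M\<^sup>2) * indicat_real (cball (0::'a) M) x)" using ib by (rule integrable_mult_right)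
    have "AE x in lebesgue. x \<notin> N" using g(1) unfolding negligible_iff_null_sets by (rule AE_not_in)
    then have "AE x in lborel. x \<notin> N" by (simp only: AE_completion_iff)
    then show "AE x in lborel. (\<lambda>k. \<phi> k x) \<longlonglongrightarrow> v n x"
    proof eventually_elim
      case (elim x)
      have c: "\<bar>Re (v n x)\<bar> \<le> M" "\<bar>Im (v n x)\<bar> \<le> M"
        using abs_Re_le_cmod[of "u x"] abs_Im_le_cmod[of "u x"] by (auto simp: v_def M_def)
      have "(\<lambda>k. \<phi> k x) \<longlonglongrightarrow> cpx (ct x) * Complex (cl (Re (v n x))) (cl (Im (v n x)))"
        unfolding \<phi>_def cl_def using elim g(3)[of x] by (intro tendsto_intros) auto
      also have "cpx (ct x) * Complex (cl (Re (v n x))) (cl (Im (v n x))) = v n x"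
      proof (cases "v n x = 0")
        case True then show ?thesis by (simp add: cl_def M_def max_def min_def zero_complex.code[symmetric])
      next
        case False
        then have "ct x = 1" by (auto simp: v_def ct_def split: if_splits)
        then show ?thesis using c by (simp add: cl_def max_def min_def abs_le_iff complex_eq_iff)
      qed
      finally show ?case .
    qed
    show "AE x in lborel. msq (\<phi> k x) \<le> (2 * M\<^sup>2) * indicat_real (cball (0::'a) M) x" for k
    proof (rule AE_I2)
      fix x :: 'a
      have cb: "(cl t)\<^sup>2 \<le> M\<^sup>2" for t unfolding cl_def M_def by (intro abs_le_square_iff[THEN iffD1]) auto
      have "msq (\<phi> k x) = (ct x)\<^sup>2 * ((cl (Re (g k x)))\<^sup>2 + (cl (Im (g k x)))\<^sup>2)"
        unfolding \<phi>_def norm_mult power_mult_distrib by (simp add: cmod_power2)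
      also have "\<dots> \<le> (ct x)\<^sup>2 * (2 * M\<^sup>2)" using cb[of "Re (g k x)"] cb[of "Im (g k x)"] by (intro mult_left_mono) auto
      also have "(ct x)\<^sup>2 \<le> indicat_real (cball (0::'a) M) x" by (auto simp: ct_def M_def indicator_def power_le_one max_def min_def)
      then have "(ct x)\<^sup>2 * (2 * M\<^sup>2) \<le> (2 * M\<^sup>2) * indicat_real (cball (0::'a) M) x"
        by (subst mult.commute) (intro mult_left_mono, auto)
      finally show "msq (\<phi> k x) \<le> (2 * M\<^sup>2) * indicat_real (cball (0::'a) M) x" .
    qed
  qed auto
  then obtain k where k: "norm (cls (v n) - cls (\<phi> k)) < e/2" using e by (metis LIMSEQ_D half_gt_zero order_refl norm_minus_commute)
  have "norm (cls u - cls (\<phi> k)) < e" using norm_triangle_ineq[of "cls u - cls (v n)" "cls (v n) - cls (\<phi> k)"] n k by simp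
  then show thesis using cc that by blast
qed

text \<open>For continuous compactly supported \<phi> the autocorrelation is continuous at 0, so the
  Gaussian average in the energy identity tends to the full squared norm. The other side converges
  by domination, \<open>ft \<phi>\<close> being already known to lie in L2.\<close>

lemma ft_isometry_Cc:
  fixes \<phi> :: "'a::euclidean_space \<Rightarrow> complex"
  assumes cc: "Cc \<phi>" shows "norm (cls (ft \<phi>)) = norm (cls \<phi>)"
proof -
  note u = Cc_integrable[OF cc] Cc_L2[OF cc]
  obtain M R where M: "\<And>x. cmod (\<phi> x) \<le> M" using Cc_bounds[OF cc] by metis
  have [measurable]: "\<phi> \<in> bfun" by (rule Cc_measurable[OF cc])
  define A where "A w = (LEB x. \<phi> x * cnj (\<phi> (x + w)))" for w
  define e where "e n = 1 / real (Suc n)" for n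
  have e: "e n > 0" for n by (simp add: e_def)
  have e0: "e \<longlonglongrightarrow> 0" unfolding e_def using LIMSEQ_inverse_real_of_nat by (simp add: inverse_eq_divide)
  have A: "(\<lambda>n. A (e n *\<^sub>R z)) \<longlonglongrightarrow> cpx ((norm (cls \<phi>))\<^sup>2)" for z
  proof -
    have "(\<lambda>n. A (e n *\<^sub>R z)) \<longlonglongrightarrow> (LEB x. \<phi> x * cnj (\<phi> x))" unfolding A_def
    proof (rule integral_dominated_convergence[where w = "\<lambda>x. cmod (\<phi> x) * M"])
      show "AE x in lborel. (\<lambda>n. \<phi> x * cnj (\<phi> (x + e n *\<^sub>R z))) \<longlonglongrightarrow> \<phi> x * cnj (\<phi> x)"
      proof (rule AE_I2)
        fix x
        have "(\<lambda>n. x + e n *\<^sub>R z) \<longlonglongrightarrow> x + 0 *\<^sub>R z" by (intro tendsto_intros e0)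
        moreover have "isCont \<phi> (x + 0 *\<^sub>R z)" using cc by (simp add: Cc_def continuous_on_eq_continuous_at)
        ultimately have "(\<lambda>n. \<phi> (x + e n *\<^sub>R z)) \<longlonglongrightarrow> \<phi> (x + 0 *\<^sub>R z)"
          by (rule isCont_tendsto_compose[rotated])
        then show "(\<lambda>n. \<phi> x * cnj (\<phi> (x + e n *\<^sub>R z))) \<longlonglongrightarrow> \<phi> x * cnj (\<phi> x)"
          by (intro tendsto_intros) simp
      qed
      show "integrable lborel (\<lambda>x. cmod (\<phi> x) * M)" using u(1) by simp
      show "AE x in lborel. norm (\<phi> x * cnj (\<phi> (x + e n *\<^sub>R z))) \<le> cmod (\<phi> x) * M" for n
        using M by (auto simp: norm_mult intro!: mult_left_mono)
    qed measurable
    also have "(LEB x. \<phi> x * cnj (\<phi> x)) = cpx ((norm (cls \<phi>))\<^sup>2)"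
      unfolding norm_cls_sq[OF u(2)] by (simp only: complex_norm_square[symmetric] integral_complex_of_real)
    finally show ?thesis .
  qed
  note en = ft_gaussian_energy[OF u e]
  have [measurable]: "A \<in> bfun" unfolding A_def by (rule en(2))
  have "(\<lambda>n. LEB z. A (e n *\<^sub>R z) * cpx (gauss z)) \<longlonglongrightarrow> (LEB z. cpx ((norm (cls \<phi>))\<^sup>2) * cpx (gauss (z::'a)))"
  proof (rule integral_dominated_convergence[where w = "\<lambda>z. (norm (cls \<phi>))\<^sup>2 * gauss (z::'a)"])
    show "integrable lborel (\<lambda>z. (norm (cls \<phi>))\<^sup>2 * gauss (z::'a))" using gauss(2) by (rule integrable_mult_right)
    show "AE z in lborel. norm (A (e n *\<^sub>R z) * cpx (gauss z)) \<le> (norm (cls \<phi>))\<^sup>2 * gauss z" for n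
    proof (rule AE_I2)
      fix z
      show "norm (A (e n *\<^sub>R z) * cpx (gauss z)) \<le> (norm (cls \<phi>))\<^sup>2 * gauss z"
        using en(3)[of "e n *\<^sub>R z"] gauss(1)[of z] unfolding A_def norm_cls_sq[OF u(2)] norm_mult by (simp add: mult_right_mono)
    qed
    show "AE z in lborel. (\<lambda>n. A (e n *\<^sub>R z) * cpx (gauss z)) \<longlonglongrightarrow> cpx ((norm (cls \<phi>))\<^sup>2) * cpx (gauss z)"
      by (intro AE_I2 tendsto_intros A)
    note gauss(4)[measurable]
    show "(\<lambda>z. A (e n *\<^sub>R z) * cpx (gauss z)) \<in> borel_measurable lborel"
      "(\<lambda>z. cpx ((norm (cls \<phi>))\<^sup>2) * cpx (gauss (z::'a))) \<in> borel_measurable lborel" for n by measurable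
  qed
  also have "(LEB z. cpx ((norm (cls \<phi>))\<^sup>2) * cpx (gauss (z::'a))) = cpx ((norm (cls \<phi>))\<^sup>2)"
    using gauss(3)[where 'a = 'a] by (simp only: integral_mult_right_zero integral_complex_of_real) simp
  finally have lim1: "(\<lambda>n. cpx (LEB \<xi>. msq (ft \<phi> \<xi>) * exp (- ((e n)\<^sup>2 * (norm \<xi>)\<^sup>2 / 2)))) \<longlonglongrightarrow> cpx ((norm (cls \<phi>))\<^sup>2)"
    unfolding en(4) A_def .
  have lim2: "(\<lambda>n. LEB \<xi>. msq (ft \<phi> \<xi>) * exp (- ((e n)\<^sup>2 * (norm \<xi>)\<^sup>2 / 2))) \<longlonglongrightarrow> (LEB \<xi>. msq (ft \<phi> \<xi>))"
  proof (rule integral_dominated_convergence)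
    show "integrable lborel (\<lambda>\<xi>. msq (ft \<phi> \<xi>))" by (rule L2_normD[OF ft_contraction(1)[OF u]])
    show "AE \<xi> in lborel. (\<lambda>n. msq (ft \<phi> \<xi>) * exp (- ((e n)\<^sup>2 * (norm \<xi>)\<^sup>2 / 2))) \<longlonglongrightarrow> msq (ft \<phi> \<xi>)"
    proof (rule AE_I2)
      fix \<xi> :: 'a
      have "(\<lambda>n. msq (ft \<phi> \<xi>) * exp (- ((e n)\<^sup>2 * (norm \<xi>)\<^sup>2 / 2))) \<longlonglongrightarrow> msq (ft \<phi> \<xi>) * exp (- (0\<^sup>2 * (norm \<xi>)\<^sup>2 / 2))"
        by (intro tendsto_intros e0) simp
      then show "(\<lambda>n. msq (ft \<phi> \<xi>) * exp (- ((e n)\<^sup>2 * (norm \<xi>)\<^sup>2 / 2))) \<longlonglongrightarrow> msq (ft \<phi> \<xi>)" by simp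
    qed
    show "AE \<xi> in lborel. norm (msq (ft \<phi> \<xi>) * exp (- ((e n)\<^sup>2 * (norm \<xi>)\<^sup>2 / 2))) \<le> msq (ft \<phi> \<xi>)" for n
      by (auto intro!: mult_left_le)
  qed measurable
  have "(norm (cls (ft \<phi>)))\<^sup>2 = (norm (cls \<phi>))\<^sup>2"
    using LIMSEQ_unique[OF lim1 tendsto_of_real[OF lim2]] unfolding norm_cls_sq[OF ft_contraction(1)[OF u]] by (metis of_real_eq_iff)
  then show ?thesis by (simp add: power2_eq_iff_nonneg)
qed

text \<open>The isometry on \<open>Cc\<close> extends by density, the contraction property
  controlling the transform of \<open>u - \<phi>\<close>.\<close>

theorem plancherel:
  fixes u :: "'a::euclidean_space \<Rightarrow> complex"
  assumes u: "integrable lborel u" "L2 u" shows "norm (cls (ft u)) = norm (cls u)"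
proof (rule antisym[OF ft_contraction(2)[OF u]])
  show "norm (cls u) \<le> norm (cls (ft u))"
  proof (rule field_le_epsilon)
    fix e :: real assume e: "e > 0"
    obtain \<phi> where p: "Cc \<phi>" "norm (cls u - cls \<phi>) < e/2" using Cc_dense[OF u(2), of "e/2"] e by auto
    note pi = Cc_integrable[OF p(1)] Cc_L2[OF p(1)]
    have d: "integrable lborel (\<lambda>x. u x - \<phi> x)" "L2 (\<lambda>x. u x - \<phi> x)" using u pi by (auto intro!: L2_diff)
    have "ft (\<lambda>x. u x - \<phi> x) = (\<lambda>\<xi>. ft u \<xi> - ft \<phi> \<xi>)" using u pi by (auto simp: ft_diff)
    then have "norm (cls (ft u) - cls (ft \<phi>)) \<le> norm (cls u - cls \<phi>)"
      using ft_contraction(2)[OF d] u pi by (simp add: cls_diff ft_contraction)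
    then show "norm (cls u) \<le> norm (cls (ft u)) + e"
      using norm_triangle_ineq2[of "cls u" "cls \<phi>"] norm_triangle_ineq3[of "cls (ft u)" "cls (ft \<phi>)"] ft_isometry_Cc[OF p(1)] p(2)
      by linarith
  qed
qed

lemma plancherel_inner:
  fixes a b :: "'a::euclidean_space \<Rightarrow> complex"
  assumes a: "integrable lborel a" "L2 a" and b: "integrable lborel b" "L2 b" shows "cls (ft a) \<bullet> cls (ft b) = cls a \<bullet> cls b"
proof -
  have s: "integrable lborel (\<lambda>x. a x + b x)" "L2 (\<lambda>x. a x + b x)" using a b by auto
  have "ft (\<lambda>x. a x + b x) = (\<lambda>\<xi>. ft a \<xi> + ft b \<xi>)" using a b by (auto simp: ft_add)
  then have "norm (cls (ft a) + cls (ft b)) = norm (cls a + cls b)" using plancherel[OF s] a b by (simp add: cls_add ft_contraction)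
  then show ?thesis by (simp only: dot_norm plancherel[OF a] plancherel[OF b])
qed

text \<open>The real inner product yields the real part only; replacing \<open>b\<close> by
  \<open>\<i> * b\<close> yields the imaginary part.\<close>

lemma parseval:
  fixes a b :: "'a::euclidean_space \<Rightarrow> complex"
  assumes a: "integrable lborel a" "L2 a" and b: "integrable lborel b" "L2 b"
  shows "(LEB \<xi>. ft a \<xi> * cnj (ft b \<xi>)) = (LEB x. a x * cnj (b x))"
proof -
  have inner_Re: "cls u \<bullet> cls v = Re (LEB x. u x * cnj (v x))" if "L2 u" "L2 v" for u v :: "'a \<Rightarrow> complex"
  proof -
    have "integrable lborel (\<lambda>x. u x * cnj (v x))" using that by (intro integrable_mult_L2 L2_cnj)
    from integral_Re[OF this] show ?thesis using that by (simp add: inner_cls inner_complex_def)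
  qed
  have b': "integrable lborel (\<lambda>x. \<i> * b x)" "L2 (\<lambda>x. \<i> * b x)" using b by (auto intro: L2_cmult)
  have Im_eq: "Im (LEB x. u x * cnj (v x)) = Re (LEB x. u x * cnj (\<i> * v x))" for u v :: "'a \<Rightarrow> complex"
  proof -
    have "(LEB x. u x * cnj (\<i> * v x)) = (LEB x. - \<i> * (u x * cnj (v x)))" by (intro Bochner_Integration.integral_cong) auto
    also have "\<dots> = - \<i> * (LEB x. u x * cnj (v x))" by (rule integral_mult_right_zero)
    finally show ?thesis by simp
  qed
  have fi: "ft (\<lambda>x. \<i> * b x) = (\<lambda>\<xi>. \<i> * ft b \<xi>)" by (auto simp: ft_cmult)
  show ?thesis
  proof (rule complex_eqI)
    show "Re (LEB \<xi>. ft a \<xi> * cnj (ft b \<xi>)) = Re (LEB x. a x * cnj (b x))"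
      using plancherel_inner[OF a b] a b by (simp add: inner_Re ft_contraction)
    show "Im (LEB \<xi>. ft a \<xi> * cnj (ft b \<xi>)) = Im (LEB x. a x * cnj (b x))"
      unfolding Im_eq using plancherel_inner[OF a b'] a b b' ft_contraction(1)[OF b'] by (simp add: inner_Re ft_contraction fi del: complex_cnj_mult)
  qed
qed

section \<open>The Fourier transform as a unitary operator\<close>

definition ift :: "('a::euclidean_space \<Rightarrow> complex) \<Rightarrow> 'a \<Rightarrow> complex" where
  "ift v x = ft v (- x)"

lemma ift_measurable [measurable]:
  fixes u :: "'a::euclidean_space \<Rightarrow> complex"
  assumes "u \<in> bfun" shows "ift u \<in> bfun"
proof -
  have "(uminus :: 'a \<Rightarrow> 'a) \<in> bfun" by (intro borel_measurable_continuous_onI continuous_intros)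
  from measurable_compose[OF this ft_measurable[OF assms]] show ?thesis unfolding ift_def[abs_def] .
qed

lemma ift_cnj: "ift v x = cnj (ft (\<lambda>y. cnj (v y)) x)" unfolding ift_def ft_def
  by (simp add: exp_cnj Bochner_Integration.integral_cnj[symmetric] del: Bochner_Integration.integral_cnj)

lemma L2_ift:
  assumes v: "integrable lborel v" "L2 v" shows "L2 (ift v)" unfolding ift_cnj[abs_def] by (intro L2_cnj ft_contraction integrable_cnj v)

lemma norm_cls_cnj: "L2 u \<Longrightarrow> norm (cls (\<lambda>x. cnj (u x))) = norm (cls u)" by (simp add: norm_cls L2_cnj l2norm_def)

lemma norm_ift:
  assumes v: "integrable lborel v" "L2 v" shows "norm (cls (ift v)) = norm (cls v)"
proof -
  have c: "integrable lborel (\<lambda>x. cnj (v x))" "L2 (\<lambda>x. cnj (v x))" using v by (auto intro: L2_cnj)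
  show ?thesis unfolding ift_cnj[abs_def] using plancherel[OF c] ft_contraction(1)[OF c] v by (simp add: norm_cls_cnj)
qed

lemma fourier_of_iff:
  "fourier_of u v \<longleftrightarrow> L2 u \<and> L2 v \<and>
     (\<forall>\<phi>. Cc \<phi> \<longrightarrow> (LEB \<xi>. v \<xi> * \<phi> \<xi>) = (LEB x. u x * ft \<phi> x))"
  unfolding fourier_of_def Cc_def ..

lemma L2_ft_Cc: "Cc \<phi> \<Longrightarrow> L2 (ft \<phi>)" by (intro ft_contraction(1) Cc_integrable Cc_L2)

lemma fourier_of_ft:
  assumes u: "integrable lborel u" "L2 u" shows "fourier_of u (ft u)"
  unfolding fourier_of_iff using u ft_contraction(1)[OF u] ft_mult_formula[OF u(1) Cc_integrable] by blast

text \<open>Fourier inversion in weak form: pairing with a test function is Parseval's formula for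
  that function and \<open>cnj v\<close>, so no pointwise inversion formula enters.\<close>

lemma fourier_of_ift:
  assumes v: "integrable lborel v" "L2 v" shows "fourier_of (ift v) v" unfolding fourier_of_iff
proof (intro conjI allI impI)
  fix \<phi> :: "'a \<Rightarrow> complex" assume p: "Cc \<phi>"
  have c: "integrable lborel (\<lambda>x. cnj (v x))" "L2 (\<lambda>x. cnj (v x))" using v by (auto intro: L2_cnj)
  show "(LEB \<xi>. v \<xi> * \<phi> \<xi>) = (LEB x. ift v x * ft \<phi> x)" using parseval[OF Cc_integrable[OF p] Cc_L2[OF p] c] unfolding ift_cnj
    by (simp add: mult.commute)
qed (use v L2_ift in auto)

lemma fourier_of_add:
  assumes "fourier_of u v" "fourier_of u' v'" shows "fourier_of (\<lambda>x. u x + u' x) (\<lambda>x. v x + v' x)"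
  using assms unfolding fourier_of_iff by (auto simp: distrib_right integrable_mult_L2 L2_ft_Cc Cc_L2)

lemma fourier_of_cmult:
  assumes "fourier_of u v" shows "fourier_of (\<lambda>x. c * u x) (\<lambda>x. c * v x)"
  using assms unfolding fourier_of_iff by (auto simp: mult.assoc intro!: L2_cmult)

lemma fourier_of_diff:
  assumes "fourier_of u v" "fourier_of u' v'" shows "fourier_of (\<lambda>x. u x - u' x) (\<lambda>x. v x - v' x)"
  using fourier_of_add[OF assms(1) fourier_of_cmult[OF assms(2), of "-1"]] by simp

text \<open>Writes the complex bilinear pairing through two real inner products, which makes its
  continuity in \<open>cls u\<close> immediate.\<close>

lemma pairing_cls:
  assumes "L2 u" "L2 \<phi>"
  shows "(LEB x. u x * \<phi> x) = cpx (cls u \<bullet> cls (\<lambda>x. cnj (\<phi> x))) + \<i> * cpx (cls u \<bullet> cls (\<lambda>x. \<i> * cnj (\<phi> x)))"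
proof -
  have i: "integrable lborel (\<lambda>x. u x * \<phi> x)" using assms by (rule integrable_mult_L2)
  have s: "L2 (\<lambda>x. cnj (\<phi> x))" "L2 (\<lambda>x. \<i> * cnj (\<phi> x))" using assms by (auto intro: L2_cnj L2_cmult)
  have "cls u \<bullet> cls (\<lambda>x. cnj (\<phi> x)) = Re (LEB x. u x * \<phi> x)"
    using integral_Re[OF i] assms s by (simp add: inner_cls inner_complex_def)
  moreover have "cls u \<bullet> cls (\<lambda>x. \<i> * cnj (\<phi> x)) = Im (LEB x. u x * \<phi> x)"
    using integral_Im[OF i] assms s by (simp add: inner_cls inner_complex_def algebra_simps)
  ultimately show ?thesis by (simp add: complex_eq)
qed

lemma tendsto_pairing:
  assumes "\<And>n. L2 (u n)" "L2 v" "L2 \<phi>" "(\<lambda>n. cls (u n)) \<longlonglongrightarrow> cls v"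
  shows "(\<lambda>n. LEB x. u n x * \<phi> x) \<longlonglongrightarrow> (LEB x. v x * \<phi> x)"
  unfolding pairing_cls[OF assms(1,3)] pairing_cls[OF assms(2,3)] by (intro tendsto_intros assms(4))

lemma fourier_of_limit:
  assumes "\<And>n. fourier_of (u n) (v n)" "L2 u'" "L2 v'"
    and "(\<lambda>n. cls (u n)) \<longlonglongrightarrow> cls u'" "(\<lambda>n. cls (v n)) \<longlonglongrightarrow> cls v'" shows "fourier_of u' v'"
  unfolding fourier_of_iff
proof (intro conjI allI impI assms(2,3))
  fix \<phi> :: "'a \<Rightarrow> complex" assume p: "Cc \<phi>"
  have s: "L2 (u n)" "L2 (v n)" for n using assms(1) by (auto simp: fourier_of_iff)
  have "(\<lambda>n. LEB \<xi>. v n \<xi> * \<phi> \<xi>) \<longlonglongrightarrow> (LEB \<xi>. v' \<xi> * \<phi> \<xi>)"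
    by (rule tendsto_pairing[OF s(2) assms(3) Cc_L2[OF p] assms(5)])
  moreover have "(\<lambda>n. LEB \<xi>. u n \<xi> * ft \<phi> \<xi>) \<longlonglongrightarrow> (LEB \<xi>. u' \<xi> * ft \<phi> \<xi>)"
    by (rule tendsto_pairing[OF s(1) assms(2) L2_ft_Cc[OF p] assms(4)])
  moreover have "(LEB \<xi>. v n \<xi> * \<phi> \<xi>) = (LEB \<xi>. u n \<xi> * ft \<phi> \<xi>)" for n
    using assms(1)[of n] p by (auto simp: fourier_of_iff)
  ultimately show "(LEB \<xi>. v' \<xi> * \<phi> \<xi>) = (LEB x. u' x * ft \<phi> x)" using LIMSEQ_unique by simp
qed

text \<open>The functions \<open>\<xi> \<mapsto> exp (- i x \<xi>) \<chi> \<xi>\<close> with a cutoff \<open>\<chi>\<close> are admissible test functions,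
  so Plancherel's theorem applies to \<open>d\<chi>\<close>.\<close>

lemma Cc_null:
  fixes d :: "'a::euclidean_space \<Rightarrow> complex"
  assumes d: "L2 d" and 0: "\<And>\<phi>. Cc \<phi> \<Longrightarrow> (LEB \<xi>. d \<xi> * \<phi> \<xi>) = 0" shows "AE x in lborel. d x = 0"
proof -
  have [measurable]: "d \<in> bfun" using d by auto
  define ct where "ct n x = cpx (max 0 (min 1 (real n + 1 - norm x)))" for n and x :: 'a
  have ctc: "continuous_on UNIV (ct n)" for n unfolding ct_def by (intro continuous_intros)
  have ctb: "bounded {x. ct n x \<noteq> 0}" for n
  proof -
    have "{x. ct n x \<noteq> 0} \<subseteq> cball 0 (real n + 1)" unfolding ct_def by auto
    then show ?thesis using bounded_cball bounded_subset by blast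
  qed
  have cc: "Cc (ct n)" for n using ctc ctb by (simp add: Cc_def)
  have cn: "cmod (ct n x) \<le> 1" for n x by (simp add: ct_def)
  have "AE x in lborel. ct n x * d x = 0" for n
  proof -
    have i: "integrable lborel (\<lambda>x. ct n x * d x)" by (rule integrable_mult_L2[OF Cc_L2[OF cc] d])
    have s: "L2 (\<lambda>x. ct n x * d x)" by (rule L2_mult_bounded[OF d _ cn]) (rule Cc_measurable[OF cc])
    have "ft (\<lambda>x. ct n x * d x) \<xi> = 0" for \<xi>
    proof -
      have "Cc (\<lambda>x. exp (- \<i> * cpx (x \<bullet> \<xi>)) * ct n x)"
        unfolding Cc_def using bounded_subset[OF ctb[of n]] ctc[of n] by (auto intro!: continuous_intros)
      from 0[OF this] show ?thesis unfolding ft_def by (simp add: ac_simps)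
    qed
    then have "ft (\<lambda>x. ct n x * d x) = (\<lambda>x. 0)" by auto
    then have "cls (\<lambda>x. ct n x * d x) = cls (\<lambda>x. 0)" using plancherel[OF i s] by (simp add: cls_zero)
    then show ?thesis using s by (simp add: cls_eq_iff)
  qed
  then have "AE x in lborel. \<forall>n. ct n x * d x = 0" by (subst AE_all_countable) auto
  then show ?thesis
  proof eventually_elim
    case (elim x)
    obtain n where "norm x \<le> real n" using real_arch_simple by blast
    then have "ct n x = 1" by (simp add: ct_def)
    then show ?case using elim by (metis mult_1)
  qed
qed

lemma fourier_of_zero: "fourier_of (\<lambda>x. 0) v \<Longrightarrow> AE x in lborel. v x = 0" unfolding fourier_of_iff by (rule Cc_null) auto

text \<open>Approximation by \<open>Cc\<close>: the transforms of the approximants have the same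
  mutual distances, so they converge, and the graph of the transform is closed. The inner fact on
  limits uses only the isometry and serves \<open>ft\<close> and \<open>ift\<close> alike.\<close>

lemma fourier_exists:
  assumes u: "L2 u" shows "\<exists>v. fourier_of u v \<and> norm (cls v) = norm (cls u)"
    and "\<exists>v. fourier_of v u \<and> norm (cls v) = norm (cls u)"
proof -
  have "\<exists>\<phi>. Cc \<phi> \<and> norm (cls u - cls \<phi>) < 1 / real (Suc n)" for n
    using Cc_dense[OF u, of "1 / real (Suc n)"] by (metis of_nat_0_less_iff zero_less_Suc zero_less_divide_1_iff)
  then obtain \<phi> where p: "\<And>n. Cc (\<phi> n)" "\<And>n. norm (cls u - cls (\<phi> n)) < 1 / real (Suc n)" by metis
  note pi = Cc_integrable[OF p(1)] Cc_L2[OF p(1)]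
  have lim: "(\<lambda>n. cls (\<phi> n)) \<longlonglongrightarrow> cls u"
  proof (rule Lim_transform_bound[THEN Lim_null[THEN iffD2]])
    show "(\<lambda>n. 1 / real (Suc n)) \<longlonglongrightarrow> 0" using LIMSEQ_inverse_real_of_nat by (simp add: inverse_eq_divide)
    show "\<forall>\<^sub>F n in sequentially. norm (cls (\<phi> n) - cls u) \<le> norm (1 / real (Suc n))"
      using p(2) by (intro always_eventually allI) (simp add: norm_minus_commute less_imp_le)
  qed
  have *: "\<exists>w. L2 w \<and> (\<lambda>n. cls (f n)) \<longlonglongrightarrow> cls w \<and> norm (cls w) = norm (cls u)"
    if f: "\<And>m n. norm (cls (f m) - cls (f n)) = norm (cls (\<phi> m) - cls (\<phi> n))" "\<And>n. norm (cls (f n)) = norm (cls (\<phi> n))" for f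
  proof -
    have "Cauchy (\<lambda>n. cls (\<phi> n))" using lim by (rule LIMSEQ_imp_Cauchy)
    then have "Cauchy (\<lambda>n. cls (f n))" by (simp add: Cauchy_def dist_norm f(1))
    then obtain w where w: "(\<lambda>n. cls (f n)) \<longlonglongrightarrow> w" by (metis Cauchy_convergent convergent_def)
    have "(\<lambda>n. norm (cls (f n))) \<longlonglongrightarrow> norm w" using w by (rule tendsto_norm)
    moreover have "(\<lambda>n. norm (cls (f n))) \<longlonglongrightarrow> norm (cls u)" unfolding f(2) using lim by (rule tendsto_norm)
    ultimately have "norm w = norm (cls u)" by (rule LIMSEQ_unique)
    then show ?thesis using w by (intro exI[of _ "rep w"]) auto
  qed
  have d: "integrable lborel (\<lambda>x. \<phi> m x - \<phi> n x)" "L2 (\<lambda>x. \<phi> m x - \<phi> n x)" for m n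
    using pi by (auto intro!: L2_diff)
  have "norm (cls (ft (\<phi> m)) - cls (ft (\<phi> n))) = norm (cls (\<phi> m) - cls (\<phi> n))" for m n
  proof -
    have "ft (\<lambda>x. \<phi> m x - \<phi> n x) = (\<lambda>x. ft (\<phi> m) x - ft (\<phi> n) x)" using pi by (auto simp: ft_diff)
    with plancherel[OF d, of m n] show ?thesis by (simp add: cls_diff ft_contraction pi)
  qed
  from *[OF this plancherel[OF pi]] obtain w where w: "L2 w" "(\<lambda>n. cls (ft (\<phi> n))) \<longlonglongrightarrow> cls w" "norm (cls w) = norm (cls u)" by auto
  then show "\<exists>v. fourier_of u v \<and> norm (cls v) = norm (cls u)" using fourier_of_limit[OF fourier_of_ft[OF pi] u w(1) lim w(2)] by blast
  have "norm (cls (ift (\<phi> m)) - cls (ift (\<phi> n))) = norm (cls (\<phi> m) - cls (\<phi> n))" for m n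
  proof -
    have "ift (\<lambda>x. \<phi> m x - \<phi> n x) = (\<lambda>x. ift (\<phi> m) x - ift (\<phi> n) x)" using pi by (auto simp: ift_def ft_diff)
    with norm_ift[OF d, of m n] show ?thesis by (simp add: cls_diff L2_ift pi)
  qed
  from *[OF this norm_ift[OF pi]] obtain w where w: "L2 w" "(\<lambda>n. cls (ift (\<phi> n))) \<longlonglongrightarrow> cls w" "norm (cls w) = norm (cls u)" by auto
  then show "\<exists>v. fourier_of v u \<and> norm (cls v) = norm (cls u)" using fourier_of_limit[OF fourier_of_ift[OF pi] w(1) u w(2) lim] by blast
qed

lemma fourier_of_norm:
  assumes uv: "fourier_of u v" shows "norm (cls v) = norm (cls u)"
proof -
  have s: "L2 u" "L2 v" using uv by (auto simp: fourier_of_iff)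
  obtain w where w: "fourier_of u w" "norm (cls w) = norm (cls u)" using fourier_exists(1)[OF s(1)] by auto
  have sw: "L2 w" using w by (auto simp: fourier_of_iff)
  have "AE x in lborel. v x - w x = 0" using fourier_of_diff[OF uv w(1)] by (intro fourier_of_zero) simp
  then have "AE x in lborel. v x = w x" by eventually_elim simp
  then have "cls v = cls w" using s sw by (simp add: cls_eq_iff)
  then show ?thesis using w by simp
qed

text \<open>The choice is immaterial: \<open>fourier_of\<close> determines each side by the other up
  to almost everywhere equality, so \<open>Fo\<close> and \<open>Fi\<close> are mutually inverse
  isometries of the classes.\<close>

definition Fo :: "'a::euclidean_space l2 \<Rightarrow> 'a l2" where
  "Fo f = cls (SOME v. fourier_of (rep f) v)"
definition Fi :: "'a::euclidean_space l2 \<Rightarrow> 'a l2" where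
  "Fi f = cls (SOME u. fourier_of u (rep f))"

lemma fourier_of_unique:
  assumes "fourier_of u v" "fourier_of u' v'" shows "cls u = cls u' \<longleftrightarrow> cls v = cls v'"
proof -
  have s: "L2 u" "L2 v" "L2 u'" "L2 v'" using assms by (auto simp: fourier_of_iff)
  have "norm (cls v - cls v') = norm (cls u - cls u')" using fourier_of_norm[OF fourier_of_diff[OF assms]] s by (simp add: cls_diff)
  then show ?thesis by auto
qed

lemma fourier_of_cong:
  assumes "fourier_of u v" "L2 u'" "L2 v'" "cls u = cls u'" "cls v = cls v'" shows "fourier_of u' v'"
  by (rule fourier_of_limit[of "\<lambda>_. u" "\<lambda>_. v"]) (use assms in auto)

lemma fourier_of_Fo: "fourier_of (rep f) (rep (Fo f))"
proof -
  have *: "fourier_of (rep f) (SOME v. fourier_of (rep f) v)"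
    by (rule someI_ex[of "fourier_of (rep f)"]) (use fourier_exists(1)[OF L2_rep, of f] in blast)
  then show ?thesis by (rule fourier_of_cong) (use * in \<open>auto simp: Fo_def fourier_of_iff\<close>)
qed

lemma fourier_of_Fi: "fourier_of (rep (Fi f)) (rep f)"
proof -
  have *: "fourier_of (SOME u. fourier_of u (rep f)) (rep f)"
    by (rule someI_ex[of "\<lambda>u. fourier_of u (rep f)"]) (use fourier_exists(2)[OF L2_rep, of f] in blast)
  then show ?thesis by (rule fourier_of_cong) (use * in \<open>auto simp: Fi_def fourier_of_iff\<close>)
qed

lemma fourier_of_iff_Fo:
  "fourier_of u v \<longleftrightarrow> L2 u \<and> L2 v \<and> Fo (cls u) = cls v"
proof
  assume uv: "fourier_of u v"
  then have s: "L2 u" "L2 v" by (auto simp: fourier_of_iff)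
  then show "L2 u \<and> L2 v \<and> Fo (cls u) = cls v" using fourier_of_unique[OF uv fourier_of_Fo[of "cls u"]] by auto
next
  assume a: "L2 u \<and> L2 v \<and> Fo (cls u) = cls v"
  show "fourier_of u v" by (rule fourier_of_cong[OF fourier_of_Fo[of "cls u"]]) (use a in auto)
qed

lemma Fo_eq: "fourier_of u v \<Longrightarrow> Fo (cls u) = cls v" by (simp add: fourier_of_iff_Fo)

lemma Fo_Fi [simp]: "Fo (Fi f) = f" using fourier_of_Fi[of f] by (simp add: fourier_of_iff_Fo)

lemma Fi_Fo [simp]: "Fi (Fo f) = f" using fourier_of_unique[OF fourier_of_Fi[of "Fo f"] fourier_of_Fo[of f]] by simp

lemma Fi_eq: "fourier_of u v \<Longrightarrow> Fi (cls v) = cls u" using Fo_eq[of u v] by (metis Fi_Fo)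

lemma Fo_add: "Fo (f + g) = Fo f + Fo g" using Fo_eq[OF fourier_of_add[OF fourier_of_Fo[of f] fourier_of_Fo[of g]]] by (simp add: cls_add)

lemma Fo_scaleR: "Fo (c *\<^sub>R f) = c *\<^sub>R Fo f"
  using Fo_eq[OF fourier_of_cmult[OF fourier_of_Fo[of f]], of "cpx c"] by (simp add: cls_scaleR)

lemma norm_Fo [simp]: "norm (Fo f) = norm f" using fourier_of_norm[OF fourier_of_Fo[of f]] by simp

lemma norm_Fi [simp]: "norm (Fi f) = norm f" using norm_Fo[of "Fi f"] by simp

lemma bounded_linear_Fo: "bounded_linear Fo" by (rule bounded_linear_intro[where K = 1]) (auto simp: Fo_add Fo_scaleR)

lemma Fi_add: "Fi (f + g) = Fi f + Fi g" using Fo_add[of "Fi f" "Fi g"] by (metis Fo_Fi Fi_Fo)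

lemma Fi_scaleR: "Fi (c *\<^sub>R f) = c *\<^sub>R Fi f" using Fo_scaleR[of c "Fi f"] by (metis Fo_Fi Fi_Fo)

lemma bounded_linear_Fi: "bounded_linear Fi" by (rule bounded_linear_intro[where K = 1]) (auto simp: Fi_add Fi_scaleR)

lemma inner_Fo: "Fo f \<bullet> Fo g = f \<bullet> g" by (simp only: dot_norm norm_Fo flip: Fo_add)

lemma inner_Fo_left: "Fo f \<bullet> g = f \<bullet> Fi g" using inner_Fo[of f "Fi g"] by simp

lemma Fo_cls: "integrable lborel u \<Longrightarrow> L2 u \<Longrightarrow> Fo (cls u) = cls (ft u)" by (intro Fo_eq fourier_of_ft)

lemma Fi_cls: "integrable lborel v \<Longrightarrow> L2 v \<Longrightarrow> Fi (cls v) = cls (ift v)" by (intro Fi_eq fourier_of_ift)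

section \<open>Multiplication operators\<close>

definition bmf :: "('a::euclidean_space \<Rightarrow> complex) \<Rightarrow> bool" where
  "bmf m \<longleftrightarrow> m \<in> bfun \<and> (\<exists>C. \<forall>x. cmod (m x) \<le> C)"

lemma bmfI: "m \<in> bfun \<Longrightarrow> (\<And>x. cmod (m x) \<le> C) \<Longrightarrow> bmf m" unfolding bmf_def by auto

lemma bmf_measurable [measurable_dest]: "bmf m \<Longrightarrow> m \<in> bfun" by (simp add: bmf_def)

lemma bmf_const [simp]: "bmf (\<lambda>x. c)" by (auto simp: bmf_def)

lemma bmf_mult: "bmf m \<Longrightarrow> bmf n \<Longrightarrow> bmf (\<lambda>x. m x * n x)"
proof -
  assume m: "bmf m" and n: "bmf n"
  then obtain C D where CD: "\<And>x. cmod (m x) \<le> C" "\<And>x. cmod (n x) \<le> D" by (auto simp: bmf_def)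
  have "cmod (m x * n x) \<le> C * D" for x unfolding norm_mult by (intro mult_mono CD norm_ge_zero order_trans[OF norm_ge_zero CD(1)])
  then show "bmf (\<lambda>x. m x * n x)" using m n by (auto simp: bmf_def)
qed

lemma L2_bmf: "bmf m \<Longrightarrow> L2 u \<Longrightarrow> L2 (\<lambda>x. m x * u x)" unfolding bmf_def by (auto intro: L2_mult_bounded)

definition mulop :: "('a::euclidean_space \<Rightarrow> complex) \<Rightarrow> 'a l2 \<Rightarrow> 'a l2" where
  "mulop m f = cls (\<lambda>x. m x * rep f x)"

text \<open>For unbounded \<open>m\<close> this is the domain of multiplication by \<open>m\<close>; outside of it \<open>mulop m f\<close> is
  an unspecified value.\<close>

definition muldom :: "('a::euclidean_space \<Rightarrow> complex) \<Rightarrow> 'a l2 set" where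
  "muldom m = {f. L2 (\<lambda>x. m x * rep f x)}"

lemma muldom_bmf [simp]: "bmf m \<Longrightarrow> f \<in> muldom m" by (simp add: muldom_def L2_bmf)

lemma muldom_cls:
  assumes [measurable]: "L2 u" "m \<in> bfun" shows "cls u \<in> muldom m \<longleftrightarrow> L2 (\<lambda>x. m x * u x)"
proof -
  have *: "AE x in lborel. m x * rep (cls u) x = m x * u x" using rep_cls[OF assms(1)] by eventually_elim simp
  then have **: "AE x in lborel. m x * u x = m x * rep (cls u) x" by eventually_elim (rule sym)
  show ?thesis unfolding muldom_def using L2_cong_AE[OF _ _ *] L2_cong_AE[OF _ _ **] by auto
qed

lemma mulop_cls:
  assumes [measurable]: "L2 u" "m \<in> bfun" and s: "L2 (\<lambda>x. m x * u x)" shows "mulop m (cls u) = cls (\<lambda>x. m x * u x)"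
proof -
  have *: "AE x in lborel. m x * u x = m x * rep (cls u) x" using rep_cls[OF assms(1)] by eventually_elim simp
  then have s': "L2 (\<lambda>x. m x * rep (cls u) x)" by (intro L2_cong_AE[OF s _ *]) measurable
  show ?thesis unfolding mulop_def using cls_eq_iff[OF s s'] * by simp
qed

lemma mulop_cls_bmf: "bmf m \<Longrightarrow> L2 u \<Longrightarrow> mulop m (cls u) = cls (\<lambda>x. m x * u x)" by (intro mulop_cls L2_bmf) auto

lemma rep_mulop: "f \<in> muldom m \<Longrightarrow> AE x in lborel. rep (mulop m f) x = m x * rep f x"
  unfolding mulop_def muldom_def by (intro rep_cls) simp

lemma muldom_add:
  assumes m[measurable]: "m \<in> bfun" and f: "f \<in> muldom m" and g: "g \<in> muldom m"
  shows "f + g \<in> muldom m" "mulop m (f + g) = mulop m f + mulop m g"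
proof -
  have s: "L2 (\<lambda>x. m x * (rep f x + rep g x))" using f g by (auto simp: muldom_def distrib_left)
  have e: "f + g = cls (\<lambda>x. rep f x + rep g x)" by (simp add: cls_add)
  show "f + g \<in> muldom m" unfolding e by (subst muldom_cls) (auto intro!: L2_add s)
  show "mulop m (f + g) = mulop m f + mulop m g"
    unfolding e by (subst mulop_cls) (use f g s in \<open>auto simp: mulop_def muldom_def distrib_left cls_add\<close>)
qed

lemma muldom_cmult:
  assumes m[measurable]: "m \<in> bfun" and f: "f \<in> muldom m"
  shows "mulop (\<lambda>x. c) f \<in> muldom m" "mulop m (mulop (\<lambda>x. c) f) = mulop (\<lambda>x. c) (mulop m f)"
proof -
  have s: "L2 (\<lambda>x. c * (m x * rep f x))" using f by (auto simp: muldom_def)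
  then have s': "L2 (\<lambda>x. m x * (c * rep f x))" by (simp add: ac_simps)
  have e: "mulop (\<lambda>x. c) f = cls (\<lambda>x. c * rep f x)" by (simp add: mulop_def)
  show "mulop (\<lambda>x. c) f \<in> muldom m" unfolding e by (subst muldom_cls) (auto intro!: s')
  show "mulop m (mulop (\<lambda>x. c) f) = mulop (\<lambda>x. c) (mulop m f)"
    unfolding e by (subst mulop_cls) (use f s' in \<open>auto simp: mulop_def[of m] muldom_def mulop_cls_bmf ac_simps\<close>)
qed

lemma mulop_const_of_real: "mulop (\<lambda>x. cpx c) f = c *\<^sub>R f" unfolding mulop_def using cls_scaleR[of "rep f" c] by simp

lemma muldom_scaleR:
  assumes "m \<in> bfun" "f \<in> muldom m" shows "c *\<^sub>R f \<in> muldom m" "mulop m (c *\<^sub>R f) = c *\<^sub>R mulop m f"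
  using muldom_cmult[OF assms, of "cpx c"] by (simp_all add: mulop_const_of_real)

lemma bounded_linear_mulop:
  assumes m: "bmf m" shows "bounded_linear (mulop m)"
proof -
  obtain C where C: "\<And>x. cmod (m x) \<le> C" using m by (auto simp: bmf_def)
  have C0: "0 \<le> C" using norm_ge_zero order_trans C by blast
  have n: "norm (mulop m f) \<le> norm f * C" for f
  proof -
    have "norm (mulop m f) \<le> norm (cls (\<lambda>x. cpx C * rep f x))" unfolding mulop_def using m C C0
      by (intro norm_cls_mono) (auto simp: norm_mult intro!: L2_bmf L2_cmult mult_right_mono)
    also have "\<dots> = norm f * C" using C0 by (simp add: cls_scaleR)
    finally show ?thesis .
  qed
  show ?thesis by (rule bounded_linear_intro[where K = C]) (use m in \<open>auto simp: muldom_add muldom_scaleR bmf_measurable n\<close>)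
qed

lemma norm_mulop_le:
  assumes m: "m \<in> bfun" and C: "\<And>x. cmod (m x) \<le> C" shows "norm (mulop m f) \<le> C * norm f"
proof -
  have C0: "0 \<le> C" using norm_ge_zero order_trans C by blast
  have "norm (mulop m f) \<le> norm (cls (\<lambda>x. cpx C * rep f x))" unfolding mulop_def using m C C0
    by (intro norm_cls_mono) (auto simp: norm_mult intro!: L2_mult_bounded L2_cmult mult_right_mono)
  also have "\<dots> = C * norm f" using C0 by (simp add: cls_scaleR)
  finally show ?thesis .
qed

lemma mulop_mulop:
  assumes m[measurable]: "m \<in> bfun" and n[measurable]: "n \<in> bfun" and f: "f \<in> muldom n" "mulop n f \<in> muldom m"
  shows "mulop m (mulop n f) = mulop (\<lambda>x. m x * n x) f" "f \<in> muldom (\<lambda>x. m x * n x)"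
proof -
  have s: "L2 (\<lambda>x. n x * rep f x)" using f by (simp add: muldom_def)
  have s2: "L2 (\<lambda>x. m x * (n x * rep f x))" using f(2) s by (simp add: mulop_def muldom_cls)
  show "mulop m (mulop n f) = mulop (\<lambda>x. m x * n x) f"
    unfolding mulop_def[of n] mulop_def[of "\<lambda>x. m x * n x"] by (subst mulop_cls) (use s s2 in \<open>auto simp: mult.assoc\<close>)
  show "f \<in> muldom (\<lambda>x. m x * n x)" using s2 by (simp add: muldom_def mult.assoc)
qed

lemma mulop_mulop_bmf: "bmf m \<Longrightarrow> bmf n \<Longrightarrow> mulop m (mulop n f) = mulop (\<lambda>x. m x * n x) f"
  by (rule mulop_mulop) auto

lemma mulop_one [simp]: "mulop (\<lambda>x. 1) f = f" by (simp add: mulop_def)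

lemma mulop_zero [simp]: "mulop (\<lambda>x. 0) f = 0" by (simp add: mulop_def cls_zero)

lemma norm_mulop_sq: "f \<in> muldom m \<Longrightarrow> (norm (mulop m f))\<^sup>2 = (LEB x. msq (m x) * msq (rep f x))"
  unfolding mulop_def muldom_def by (simp add: norm_cls_sq norm_mult power_mult_distrib)

lemma norm_mulop_unimodular:
  assumes "m \<in> bfun" "\<And>x. cmod (m x) = 1" shows "norm (mulop m f) = norm f"
proof -
  have "bmf m" using assms by (intro bmfI[of _ 1]) auto
  then have "(norm (mulop m f))\<^sup>2 = (norm f)\<^sup>2" by (simp add: norm_mulop_sq[OF muldom_bmf] assms flip: norm_l2_sq)
  then show ?thesis by (simp add: power2_eq_iff_nonneg)
qed

lemma inner_mulop:
  assumes "f \<in> muldom m" "g \<in> muldom (\<lambda>x. cnj (m x))" shows "mulop m f \<bullet> g = f \<bullet> mulop (\<lambda>x. cnj (m x)) g"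
proof -
  have "mulop m f \<bullet> cls (rep g) = (LEB x. (m x * rep f x) \<bullet> rep g x)"
    unfolding mulop_def using assms by (intro inner_cls) (auto simp: muldom_def)
  also have "\<dots> = (LEB x. rep f x \<bullet> (cnj (m x) * rep g x))"
    by (intro Bochner_Integration.integral_cong) (auto simp: inner_complex_def algebra_simps)
  also have "\<dots> = cls (rep f) \<bullet> mulop (\<lambda>x. cnj (m x)) g"
    unfolding mulop_def using assms by (intro inner_cls[symmetric]) (auto simp: muldom_def)
  finally show ?thesis by simp
qed

text \<open>The dominating symbol \<open>b\<close> may be unbounded as long as \<open>f\<close> lies
  in its domain; this is what allows unitary groups to be differentiated on the domains of their
  generators.\<close>

lemma tendsto_mulop_dominated:
  assumes m: "\<And>n. m n \<in> bfun" "m' \<in> bfun" "b \<in> bfun"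
    and lim: "\<And>x. (\<lambda>n. m n x) \<longlonglongrightarrow> m' x" and bd: "\<And>n x. cmod (m n x) \<le> cmod (b x)" and f: "f \<in> muldom b"
  shows "(\<lambda>n. mulop (m n) f) \<longlonglongrightarrow> mulop m' f" unfolding mulop_def
proof (rule tendsto_cls_dominated(3))
  show "integrable lborel (\<lambda>x. msq (b x * rep f x))" using f by (auto simp: muldom_def intro: L2_normD)
  show "AE x in lborel. (\<lambda>n. m n x * rep f x) \<longlonglongrightarrow> m' x * rep f x" by (intro AE_I2 tendsto_intros lim)
  show "AE x in lborel. msq (m n x * rep f x) \<le> msq (b x * rep f x)" for n
    using bd[of n] by (auto simp: norm_mult intro!: power_mono mult_right_mono)
qed (use m in measurable)

lemma muldom_mono:
  assumes m: "m \<in> bfun" and bd: "\<And>x. cmod (m x) \<le> C * cmod (b x)" and f: "f \<in> muldom b" shows "f \<in> muldom m"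
  unfolding muldom_def mem_Collect_eq by (rule L2_bound[of "\<lambda>x. b x * rep f x" _ C])
     (use f m bd in \<open>auto simp: muldom_def norm_mult mult.assoc[symmetric] intro!: mult_right_mono\<close>)

lemma Fo_cmul: "Fo (mulop (\<lambda>x. c) f) = mulop (\<lambda>x. c) (Fo f)"
  using Fo_eq[OF fourier_of_cmult[OF fourier_of_Fo[of f], of c]] by (simp add: mulop_def)

lemma Fi_cmul: "Fi (mulop (\<lambda>x. c) f) = mulop (\<lambda>x. c) (Fi f)" using Fo_cmul[of c "Fi f"] by (metis Fo_Fi Fi_Fo)

section \<open>Uncertainty principle at low frequencies\<close>

lemma ift_integrand: "ift v x = cpx (ft_const TYPE('a)) * (LEB \<xi>. exp (\<i> * cpx (x \<bullet> \<xi>)) * v \<xi>)" for x :: "'a::euclidean_space"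
  unfolding ift_def ft_def by (simp add: inner_commute)

lemma ift_add: "integrable lborel u \<Longrightarrow> integrable lborel v \<Longrightarrow> ift (\<lambda>x. u x + v x) x = ift u x + ift v x"
  by (simp add: ift_def ft_add)

lemma ift_diff: "integrable lborel u \<Longrightarrow> integrable lborel v \<Longrightarrow> ift (\<lambda>x. u x - v x) x = ift u x - ift v x"
  by (simp add: ift_def ft_diff)

lemma ift_cmult: "ift (\<lambda>x. c * u x) x = c * ift u x" by (simp add: ift_def ft_cmult)

lemma ift_sum:
  "(\<And>i. i \<in> I \<Longrightarrow> integrable lborel (u i)) \<Longrightarrow> ift (\<lambda>x. \<Sum>i\<in>I. u i x) x = (\<Sum>i\<in>I. ift (u i) x)"
proof (induction I rule: infinite_finite_induct)
  case (insert i I)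
  then show ?case by (simp add: ift_add Bochner_Integration.integrable_sum)
qed (auto simp: ift_def ft_def)

lemma ift_shift:
  fixes x y :: "'a::euclidean_space" shows "ift v (x + y) = ift (\<lambda>\<xi>. exp (\<i> * cpx (y \<bullet> \<xi>)) * v \<xi>) x"
  unfolding ift_integrand by (simp add: inner_add_left distrib_left exp_add mult.assoc)

lemma integrable_bounded_support:
  fixes v :: "'a::euclidean_space \<Rightarrow> complex"
  assumes v: "L2 v" and R: "\<And>\<xi>. R < norm \<xi> \<Longrightarrow> v \<xi> = 0" shows "integrable lborel v"
proof -
  have "L2 (\<lambda>\<xi>::'a. cpx (indicat_real (cball 0 R) \<xi>))" by (rule bounded_support_integrable[of _ 1 R]) (auto simp: indicator_def)
  from integrable_mult_L2[OF this v]
  have "integrable lborel (\<lambda>\<xi>. cpx (indicat_real (cball 0 R) \<xi>) * v \<xi>)" .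
  also have "(\<lambda>\<xi>. cpx (indicat_real (cball 0 R) \<xi>) * v \<xi>) = v" using R by (auto simp: indicator_def not_le fun_eq_iff)
  finally show ?thesis .
qed

section \<open>Damping coefficients and the control condition along segments\<close>

locale damping =
  fixes \<gamma> :: "'a::euclidean_space \<Rightarrow> real" and M :: real
  assumes nonneg: "0 \<le> \<gamma> x" and le_M: "\<gamma> x \<le> M" and uc: "uniformly_continuous_on UNIV \<gamma>"
begin

lemma M_nonneg: "0 \<le> M" using nonneg le_M order_trans by blast

lemma cont: "continuous_on UNIV \<gamma>" using uc by (rule uniformly_continuous_imp_continuous)

lemma meas [measurable]: "\<gamma> \<in> bfun" using cont by (rule borel_measurable_continuous_onI)

lemma uc_dist:
  assumes "e > 0"
  obtains d where "d > 0" "\<And>x y. dist x y < d \<Longrightarrow> \<bar>\<gamma> x - \<gamma> y\<bar> < e"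
  using uc assms unfolding uniformly_continuous_on_def by (metis UNIV_I dist_real_def)

lemma integrable_weight:
  assumes "L2 u" shows "integrable lborel (\<lambda>x. \<gamma> x * msq (u x))"
proof (rule Bochner_Integration.integrable_bound)
  show "integrable lborel (\<lambda>x. M * msq (u x))" using assms by (simp add: L2_iff)
  show "(\<lambda>x. \<gamma> x * msq (u x)) \<in> borel_measurable lborel" using assms by measurable
  show "AE x in lborel. norm (\<gamma> x * msq (u x)) \<le> norm (M * msq (u x))"
    using nonneg le_M M_nonneg by (auto simp: abs_mult intro!: mult_right_mono)
qed

end

locale gcc_damping = damping +
  fixes L c :: real
  assumes L: "L > 0" and c: "c > 0"
    and gcc: "norm e = 1 \<Longrightarrow> c \<le> integral {0..L} (\<lambda>\<tau>. \<gamma> (a + \<tau> *\<^sub>R e))"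
begin

text \<open>If \<gamma> stayed below c / (2 L) along the segment, its integral would be at most c /
  2.\<close>

lemma gcc_point:
  assumes "norm e = 1" shows "\<exists>\<tau>. 0 \<le> \<tau> \<and> \<tau> \<le> L \<and> c / (2 * L) \<le> \<gamma> (a + \<tau> *\<^sub>R e)"
proof (rule ccontr)
  assume n: "\<not> ?thesis"
  have *: "\<gamma> (a + \<tau> *\<^sub>R e) \<le> c / (2 * L)" if "\<tau> \<in> {0..L}" for \<tau> using n that by (metis atLeastAtMost_iff linear)
  have "continuous_on {0..L} (\<lambda>\<tau>. \<gamma> (a + \<tau> *\<^sub>R e))"
    by (rule continuous_on_compose2[OF cont]) (auto intro!: continuous_intros)
  then have "(\<lambda>\<tau>. \<gamma> (a + \<tau> *\<^sub>R e)) integrable_on {0..L}" by (rule integrable_continuous_interval)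
  then have "integral {0..L} (\<lambda>\<tau>. \<gamma> (a + \<tau> *\<^sub>R e)) \<le> integral {0..L} (\<lambda>\<tau>. c / (2 * L))"
    using * by (intro integral_le) auto
  also have "\<dots> = c / 2" using L by simp
  finally show False using gcc[OF assms, of a] c by linarith
qed

end

text \<open>Split the binomial expansion of \<open>(S + (1 - S))\<^sup>N\<^sup>+\<^sup>n\<close> at the exponent \<open>N\<close> of \<open>S\<close>.\<close>

lemma extrapolation_identity:
  fixes N n :: nat
  obtains a :: "nat \<Rightarrow> complex" and q :: "complex \<Rightarrow> complex"
  where "\<And>S. 1 = (\<Sum>j\<le>n. a j * S ^ (N + j)) + (1 - S) ^ n * q S"
    and "\<And>S. cmod S = 1 \<Longrightarrow> cmod (q S) \<le> 3 ^ (N + n)" and "continuous_on UNIV q"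
proof -
  define p where "p = (\<Sum>k\<in>{N..N+n}. smult (of_nat (N + n choose k)) (monom 1 (k - N) * [:1, -1:] ^ (N + n - k)) :: complex poly)"
  \<comment> \<open>These are the terms with k < N, with the common factor (1 - S)^n removed; the
    others, collected in \<open>p\<close>, give S^N times a polynomial of degree at most n.\<close>
  define q where "q S = (\<Sum>k<N. of_nat (N + n choose k) * S ^ k * (1 - S) ^ (N - k))" for S :: complex
  have deg: "degree p \<le> n" unfolding p_def
  proof (rule degree_sum_le)
    fix k assume k: "k \<in> {N..N+n}"
    have "degree (monom 1 (k - N) * [:1, -1::complex:] ^ (N + n - k)) \<le> (k - N) + (N + n - k)"
      by (rule order_trans[OF degree_mult_le add_mono[OF degree_monom_le order_trans[OF degree_power_le]]]) auto
    then show "degree (smult (of_nat (N + n choose k)) (monom 1 (k - N) * [:1, -1::complex:] ^ (N + n - k))) \<le> n"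
      using k by (intro order_trans[OF degree_smult_le]) auto
  qed simp
  have polyp: "poly p S = (\<Sum>j\<le>n. coeff p j * S ^ j)" for S
    unfolding poly_altdef by (rule sum.mono_neutral_left) (use deg in \<open>auto simp: coeff_eq_0\<close>)
  have id: "1 = S ^ N * poly p S + (1 - S) ^ n * q S" for S
  proof -
    have "1 = (S + (1 - S)) ^ (N + n)" by simp
    also have "\<dots> = (\<Sum>k\<le>N + n. of_nat (N + n choose k) * S ^ k * (1 - S) ^ (N + n - k))" by (rule binomial_ring)
    also have "{..N + n} = {..<N} \<union> {N..N+n}" by auto
    also have "(\<Sum>k\<in>{..<N} \<union> {N..N+n}. of_nat (N + n choose k) * S ^ k * (1 - S) ^ (N + n - k))
      = (\<Sum>k<N. of_nat (N + n choose k) * S ^ k * (1 - S) ^ (N + n - k))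
        + (\<Sum>k\<in>{N..N+n}. of_nat (N + n choose k) * S ^ k * (1 - S) ^ (N + n - k))" by (rule sum.union_disjoint) auto
    also have "(\<Sum>k<N. of_nat (N + n choose k) * S ^ k * (1 - S) ^ (N + n - k)) = (1 - S) ^ n * q S" unfolding q_def sum_distrib_left
    proof (rule sum.cong[OF refl])
      fix k assume "k \<in> {..<N}"
      then have "N + n - k = n + (N - k)" by auto
      then show "of_nat (N + n choose k) * S ^ k * (1 - S) ^ (N + n - k) = (1 - S) ^ n * (of_nat (N + n choose k) * S ^ k * (1 - S) ^ (N - k))"
        by (simp add: power_add)
    qed
    also have "(\<Sum>k\<in>{N..N+n}. of_nat (N + n choose k) * S ^ k * (1 - S) ^ (N + n - k)) = S ^ N * poly p S"
      unfolding p_def poly_sum sum_distrib_left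
    proof (rule sum.cong[OF refl])
      fix k assume "k \<in> {N..N+n}"
      then have "S ^ k = S ^ N * S ^ (k - N)" by (simp flip: power_add)
      then show "of_nat (N + n choose k) * S ^ k * (1 - S) ^ (N + n - k) =
        S ^ N * poly (smult (of_nat (N + n choose k)) (monom 1 (k - N) * [:1, - 1:] ^ (N + n - k))) S" by (simp add: poly_monom)
    qed
    finally show ?thesis by (simp add: add.commute)
  qed
  show thesis
  proof (rule that[of "coeff p" q])
    show "1 = (\<Sum>j\<le>n. coeff p j * S ^ (N + j)) + (1 - S) ^ n * q S" for S
      by (subst id[of S]) (simp add: polyp sum_distrib_left power_add ac_simps)
    show "cmod (q S) \<le> 3 ^ (N + n)" if S: "cmod S = 1" for S
    proof -
      have S2: "cmod (1 - S) \<le> 2" using norm_triangle_ineq4[of 1 S] S by simp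
      have "cmod (q S) \<le> (\<Sum>k<N. real (N + n choose k) * 2 ^ (N + n - k))" unfolding q_def
      proof (rule order_trans[OF norm_sum], rule sum_mono)
        fix k
        have "cmod (1 - S) ^ (N - k) \<le> 2 ^ (N - k)" using S2 by (rule power_mono) auto
        also have "\<dots> \<le> (2::real) ^ (N + n - k)" by (rule power_increasing) auto
        finally show "cmod (of_nat (N + n choose k) * S ^ k * (1 - S) ^ (N - k)) \<le> real (N + n choose k) * 2 ^ (N + n - k)"
          by (simp add: norm_mult norm_power S mult_left_mono)
      qed
      also have "\<dots> \<le> (\<Sum>k\<le>N + n. real (N + n choose k) * 2 ^ (N + n - k))" by (rule sum_mono2) auto
      also have "\<dots> = (1 + 2) ^ (N + n)" by (subst binomial_ring) simp
      finally show ?thesis by simp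
    qed
    show "continuous_on UNIV q" unfolding q_def by (intro continuous_intros)
  qed
qed

lemma norm_exp_diff_le: "cmod (exp (\<i> * cpx a) - exp (\<i> * cpx b)) \<le> \<bar>a - b\<bar>"
proof -
  have "cmod (exp (\<i> * cpx a) - exp (\<i> * cpx b)) = cmod (exp (\<i> * cpx b) * (iexp (a - b) - 1))" by (simp add: algebra_simps flip: exp_add)
  also have "\<dots> = cmod (iexp (a - b) - 1)" by (simp add: norm_mult)
  also have "\<dots> \<le> \<bar>a - b\<bar>" using iexp_approx1[of "a - b" 0] by simp
  finally show ?thesis .
qed

lemma cmod_sum_sq_le:
  assumes "finite I" shows "msq ((\<Sum>i\<in>I. z i) + r) \<le> 2 * real (card I) * (\<Sum>i\<in>I. msq (z i)) + 2 * msq r"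
proof -
  have "msq ((\<Sum>i\<in>I. z i) + r) \<le> ((\<Sum>i\<in>I. cmod (z i)) + cmod r)\<^sup>2"
    by (intro power_mono order_trans[OF norm_triangle_ineq] add_right_mono norm_sum) auto
  also have "\<dots> \<le> 2 * (\<Sum>i\<in>I. cmod (z i))\<^sup>2 + 2 * msq r"
    using sum_squares_bound[of "\<Sum>i\<in>I. cmod (z i)" "cmod r"] by (simp add: power2_sum)
  also have "(\<Sum>i\<in>I. cmod (z i))\<^sup>2 \<le> real (card I) * (\<Sum>i\<in>I. msq (z i))"
    using sum_squared_le_sum_of_squares[of "\<lambda>i. cmod (z i)" I] by (simp add: sum_divide_distrib mult.commute)
  finally show ?thesis by simp
qed

context gcc_damping
begin

text \<open>A band-limited \<open>u\<close> can be extrapolated along a line: translation by a small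
  step h acts on the Fourier side as multiplication by \<open>S\<close>, and |1 - S| is at most h R
  on the support. Hence u(x) is a combination of n + 1 values at equally spaced points of one cell
  further along the line, plus a remainder with factor (1 - S)^n. For every x one of finitely many
  cells lies where \<gamma> is bounded below.\<close>

lemma low_frequency:
  assumes R: "R \<ge> 0"
  shows "\<exists>\<kappa>>0. \<forall>v. L2 v \<longrightarrow> (\<forall>\<xi>. R < norm \<xi> \<longrightarrow> v \<xi> = 0) \<longrightarrow>
     \<kappa> * (LEB \<xi>. msq (v \<xi>)) \<le> (LEB x. \<gamma> x * msq (ift v x))"
proof -
  obtain e :: 'a where e: "e \<in> Basis" using nonempty_Basis by blast
  then have ne: "norm e = 1" by simp
  \<comment> \<open>Half of the lower bound c / (2 L) from \<open>gcc_point\<close>; the other half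
    is spent on the oscillation of \<gamma> within a cell of length d.\<close>
  define c1 where "c1 = c / (4 * L)"
  have c1: "c1 > 0" using L c by (simp add: c1_def)
  obtain d0 where d0: "d0 > 0" "\<And>x y. dist x y < d0 \<Longrightarrow> \<bar>\<gamma> x - \<gamma> y\<bar> < c1" using uc_dist[OF c1] by blast
  define d where "d = d0 / 2"
  have d: "d > 0" using d0 by (simp add: d_def)
  define K where "K = nat \<lfloor>L / d\<rfloor>"
  have cell: "\<exists>k\<le>K. \<forall>t\<in>{real k * d..real (k + 1) * d}. c1 \<le> \<gamma> (x + t *\<^sub>R e)" for x
  proof -
    obtain \<tau> where \<tau>: "0 \<le> \<tau>" "\<tau> \<le> L" "c / (2 * L) \<le> \<gamma> (x + \<tau> *\<^sub>R e)" using gcc_point[OF ne] by blast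
    define k where "k = nat \<lfloor>\<tau> / d\<rfloor>"
    have k0: "0 \<le> \<lfloor>\<tau> / d\<rfloor>" using \<tau> d by simp
    have k1: "real k * d \<le> \<tau>" "\<tau> \<le> real (k + 1) * d"
      using k0 floor_divide_lower[OF d, of \<tau>] floor_divide_upper[OF d, of \<tau>] by (simp_all add: k_def add.commute)
    have "k \<le> K" unfolding k_def K_def using \<tau> d by (intro nat_mono floor_mono divide_right_mono) auto
    moreover have "c1 \<le> \<gamma> (x + t *\<^sub>R e)" if t: "t \<in> {real k * d..real (k + 1) * d}" for t
    proof -
      have "dist (x + t *\<^sub>R e) (x + \<tau> *\<^sub>R e) = \<bar>t - \<tau>\<bar>"
        using ne by (simp add: dist_norm flip: scaleR_left_diff_distrib)
      also have "\<dots> \<le> d" using t k1 by (auto simp: algebra_simps abs_le_iff)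
      also have "\<dots> < d0" using d0 by (simp add: d_def)
      finally have "\<bar>\<gamma> (x + t *\<^sub>R e) - \<gamma> (x + \<tau> *\<^sub>R e)\<bar> < c1" by (rule d0)
      moreover have "c / (2 * L) = 2 * c1" by (simp add: c1_def)
      ultimately show ?thesis using \<tau>(3) by linarith
    qed
    ultimately show ?thesis by blast
  qed
  \<comment> \<open>Small enough that the K + 1 remainders together contribute at most half of the
    total mass.\<close>
  define \<epsilon> where "\<epsilon> = 1 / (4 * (real K + 1))"
  obtain n where n: "n > 0" "d * R * 3 ^ (K + 1) / real n \<le> 1/2" "(1/2)^n \<le> \<epsilon>"
  proof -
    have e0: "\<epsilon> > 0" by (simp add: \<epsilon>_def)
    obtain n1 where n1: "(1/2)^n1 < \<epsilon>" using real_arch_pow_inv[OF e0, of "1/2"] by auto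
    obtain n2 :: nat where n2: "2 * (d * R * 3 ^ (K + 1)) \<le> real n2" using real_arch_simple by blast
    define n where "n = Suc (max n1 n2)"
    have "(1/2::real)^n \<le> (1/2)^n1" by (rule power_decreasing) (auto simp: n_def)
    moreover have "d * R * 3 ^ (K + 1) / real n \<le> 1/2"
    proof -
      have "2 * (d * R * 3 ^ (K + 1)) \<le> real n" using n2 by (simp add: n_def)
      then show ?thesis by (simp add: n_def field_simps)
    qed
    ultimately show thesis using n1 by (intro that[of n]) (auto simp: n_def)
  qed
  define h where "h = d / real n"
  have h: "h > 0" using d n by (simp add: h_def)
  define P where "P k a q \<longleftrightarrow> (\<forall>S. 1 = (\<Sum>j\<le>n. a j * S ^ (k * n + j)) + (1 - S) ^ n * q S) \<and>
      (\<forall>S. cmod S = 1 \<longrightarrow> cmod (q S) \<le> 3 ^ (k * n + n)) \<and> continuous_on UNIV q"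
    for k and a :: "nat \<Rightarrow> complex" and q :: "complex \<Rightarrow> complex"
  have "\<exists>a q. P k a q" for k unfolding P_def by (rule extrapolation_identity[of "k * n" n]) blast
  then obtain a q where P: "\<And>k. P k (a k) (q k)" by metis
  then have aq: "\<And>k S. 1 = (\<Sum>j\<le>n. a k j * S ^ (k * n + j)) + (1 - S) ^ n * q k S"
     "\<And>k S. cmod S = 1 \<Longrightarrow> cmod (q k S) \<le> 3 ^ (k * n + n)" "\<And>k. continuous_on UNIV (q k)" unfolding P_def by blast+
  define A where "A = (\<Sum>k\<le>K. 2 * (real n + 1) / c1 * (\<Sum>j\<le>n. msq (a k j))) + 1"
  have A: "A > 0" unfolding A_def using c1 by (intro add_nonneg_pos sum_nonneg mult_nonneg_nonneg divide_nonneg_pos) auto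
  define S where "S \<xi> = exp (\<i> * cpx (h * (e \<bullet> \<xi>)))" for \<xi>
  have S1: "cmod (S \<xi>) = 1" for \<xi> by (simp add: S_def)
  have [measurable]: "S \<in> bfun" unfolding S_def by measurable
  have Spow: "S \<xi> ^ m = exp (\<i> * cpx (((real m * h) *\<^sub>R e) \<bullet> \<xi>))" for m \<xi>
    unfolding S_def by (simp add: ac_simps flip: exp_of_nat_mult)
  define y where "y k j = (real (k * n + j) * h) *\<^sub>R e" for k j
  have main: "(1/2) / A * (LEB \<xi>. msq (v \<xi>)) \<le> (LEB x. \<gamma> x * msq (ift v x))"
    if sv: "L2 v" and supp: "\<And>\<xi>. R < norm \<xi> \<Longrightarrow> v \<xi> = 0" for v
  proof -
    have iv: "integrable lborel v" using sv supp by (rule integrable_bounded_support)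
    have [measurable]: "v \<in> bfun" using sv by auto
    define u where "u = ift v"
    have su: "L2 u" unfolding u_def using iv sv by (rule L2_ift)
    have [measurable]: "u \<in> bfun" using su by auto
    define V where "V = (LEB \<xi>. msq (v \<xi>))"
    have V: "V \<ge> 0" by (simp add: V_def)
    have uV: "(LEB x. msq (u x)) = V" using arg_cong[OF norm_ift[OF iv sv], of power2] su sv by (simp add: norm_cls_sq u_def V_def)
    define J where "J = (LEB x. \<gamma> x * msq (u x))"
    have [measurable]: "q k \<in> bfun" for k by (rule borel_measurable_continuous_onI[OF aq(3)])
    define w where "w k \<xi> = (1 - S \<xi>) ^ n * q k (S \<xi>) * v \<xi>" for k \<xi>
    have [measurable]: "w k \<in> bfun" for k unfolding w_def by measurable
    have wb: "cmod (w k \<xi>) \<le> \<epsilon> * cmod (v \<xi>)" if k: "k \<le> K" for k \<xi>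
    proof (cases "norm \<xi> \<le> R")
      case True
      have "cmod (1 - S \<xi>) \<le> \<bar>0 - h * (e \<bullet> \<xi>)\<bar>" unfolding S_def using norm_exp_diff_le[of 0 "h * (e \<bullet> \<xi>)"] by simp
      also have "\<dots> \<le> h * R" using h Cauchy_Schwarz_ineq2[of e \<xi>] ne True by (auto simp: abs_mult)
      finally have "cmod (1 - S \<xi>) ^ n \<le> (h * R) ^ n" by (intro power_mono) auto
      then have "cmod ((1 - S \<xi>) ^ n * q k (S \<xi>)) \<le> (h * R) ^ n * 3 ^ (k * n + n)"
        unfolding norm_mult norm_power using aq(2)[OF S1] h R by (intro mult_mono) auto
      also have "\<dots> \<le> (h * R) ^ n * 3 ^ ((K + 1) * n)" using k h R by (intro mult_left_mono power_increasing) (auto simp: algebra_simps)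
      \<comment> \<open>Since h = d / n, the exponential bound 3^((K + 1) n) on \<open>q\<close> is
        beaten by n^(-n): this is why refining the step at fixed cell length works.\<close>
      also have "\<dots> = (d * R * 3 ^ (K + 1) / real n) ^ n"
        by (simp add: h_def power_mult_distrib power_divide power_mult[symmetric] power_add field_simps)
      also have "\<dots> \<le> (1/2) ^ n" using n d R by (intro power_mono) auto
      also have "\<dots> \<le> \<epsilon>" by (rule n)
      finally show ?thesis unfolding w_def norm_mult by (simp add: mult_right_mono norm_mult)
    next
      case False
      then show ?thesis using supp[of \<xi>] by (simp add: w_def)
    qed
    have sw: "L2 (w k)" if "k \<le> K" for k by (rule L2_bound[OF sv, of _ \<epsilon>]) (use wb[OF that] in auto)
    have iw: "integrable lborel (w k)" if "k \<le> K" for k by (rule integrable_bounded_support[OF sw[OF that], of R]) (simp add: w_def supp)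
    define r where "r k = ift (w k)" for k
    have sr: "L2 (r k)" if "k \<le> K" for k unfolding r_def by (rule L2_ift[OF iw sw]) (use that in auto)
    have rV: "(LEB x. msq (r k x)) \<le> \<epsilon>\<^sup>2 * V" if k: "k \<le> K" for k
    proof -
      have "(LEB x. msq (r k x)) = (LEB \<xi>. msq (w k \<xi>))"
        using arg_cong[OF norm_ift[OF iw[OF k] sw[OF k]], of power2] sr[OF k] sw[OF k] by (simp add: norm_cls_sq r_def)
      also have "\<dots> \<le> (LEB \<xi>. \<epsilon>\<^sup>2 * msq (v \<xi>))"
      proof (rule integral_mono)
        show "integrable lborel (\<lambda>\<xi>. \<epsilon>\<^sup>2 * msq (v \<xi>))" by (intro integrable_mult_right L2_normD sv)
        show "msq (w k \<xi>) \<le> \<epsilon>\<^sup>2 * msq (v \<xi>)" for \<xi>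
          unfolding power_mult_distrib[symmetric] by (rule power_mono[OF wb[OF k]]) simp
      qed (rule L2_normD[OF sw[OF k]])
      also have "\<dots> = \<epsilon>\<^sup>2 * V" by (simp add: V_def)
      finally show ?thesis .
    qed
    have expand: "u x = (\<Sum>j\<le>n. a k j * u (x + y k j)) + r k x" if k: "k \<le> K" for k x
    proof -
      have i: "integrable lborel (\<lambda>\<xi>. a k j * (S \<xi> ^ (k * n + j) * v \<xi>))" for j
        by (intro integrable_mult_right integrable_bounded_mult(2)[OF iv, where C = 1]) (auto simp: norm_power S1)
      have "v = (\<lambda>\<xi>. (\<Sum>j\<le>n. a k j * (S \<xi> ^ (k * n + j) * v \<xi>)) + w k \<xi>)"
      proof
        fix \<xi>
        have "v \<xi> = 1 * v \<xi>" by simp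
        also have "\<dots> = ((\<Sum>j\<le>n. a k j * S \<xi> ^ (k * n + j)) + (1 - S \<xi>) ^ n * q k (S \<xi>)) * v \<xi>"
          by (subst aq(1)[of k "S \<xi>"]) simp
        also have "\<dots> = (\<Sum>j\<le>n. a k j * (S \<xi> ^ (k * n + j) * v \<xi>)) + w k \<xi>"
          by (simp add: w_def distrib_right sum_distrib_right mult.assoc)
        finally show "v \<xi> = (\<Sum>j\<le>n. a k j * (S \<xi> ^ (k * n + j) * v \<xi>)) + w k \<xi>" .
      qed
      then have "u x = ift (\<lambda>\<xi>. (\<Sum>j\<le>n. a k j * (S \<xi> ^ (k * n + j) * v \<xi>)) + w k \<xi>) x" unfolding u_def by (rule arg_cong2[of _ _ _ _ ift, OF _ refl])
      also have "\<dots> = (\<Sum>j\<le>n. a k j * ift (\<lambda>\<xi>. S \<xi> ^ (k * n + j) * v \<xi>) x) + r k x"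
        unfolding r_def using i by (subst ift_add[OF Bochner_Integration.integrable_sum iw[OF k]]) (simp_all only: ift_sum ift_cmult)
      also have "(\<Sum>j\<le>n. a k j * ift (\<lambda>\<xi>. S \<xi> ^ (k * n + j) * v \<xi>) x) = (\<Sum>j\<le>n. a k j * u (x + y k j))"
        unfolding u_def ift_shift Spow y_def ..
      finally show ?thesis .
    qed
    define G where "G k x = 2 * (real n + 1) / c1 * (\<Sum>j\<le>n. msq (a k j) * (\<gamma> (x + y k j) * msq (u (x + y k j)))) + 2 * msq (r k x)" for k x
    have G0: "G k x \<ge> 0" for k x unfolding G_def using c1 nonneg by (intro add_nonneg_nonneg mult_nonneg_nonneg sum_nonneg divide_nonneg_pos) auto
    \<comment> \<open>The good cell depends on x. Adding the bounds of all cells removes this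
      dependence, so that integration in x involves only translates of \<gamma> |u|^2 and the
      remainders.\<close>
    have pt: "msq (u x) \<le> (\<Sum>k\<le>K. G k x)" for x
    proof -
      obtain k where k: "k \<le> K" "\<forall>t\<in>{real k * d..real (k + 1) * d}. c1 \<le> \<gamma> (x + t *\<^sub>R e)" using cell by blast
      have "c1 \<le> \<gamma> (x + y k j)" if j: "j \<le> n" for j
      proof -
        have "real (k * n + j) * h = real k * d + real j * d / real n" using n by (simp add: h_def field_simps)
        moreover have "0 \<le> real j * d / real n" "real j * d / real n \<le> d" using j n d by (auto simp: field_simps)
        ultimately have "real (k * n + j) * h \<in> {real k * d..real (k + 1) * d}" by (auto simp: algebra_simps)
        then show ?thesis using k(2) by (simp add: y_def)
      qed
      then have g: "msq (u (x + y k j)) \<le> \<gamma> (x + y k j) * msq (u (x + y k j)) / c1" if "j \<le> n" for j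
        using that c1 by (simp add: pos_le_divide_eq mult.commute mult_right_mono)
      have "msq (u x) \<le> 2 * real (card {..n}) * (\<Sum>j\<le>n. msq (a k j * u (x + y k j))) + 2 * msq (r k x)"
        by (subst expand[OF k(1)], rule cmod_sum_sq_le) simp
      also have "(\<Sum>j\<le>n. msq (a k j * u (x + y k j))) \<le> (\<Sum>j\<le>n. msq (a k j) * (\<gamma> (x + y k j) * msq (u (x + y k j)) / c1))"
        unfolding norm_mult power_mult_distrib by (intro sum_mono mult_left_mono g) auto
      also have "2 * real (card {..n}) * (\<Sum>j\<le>n. msq (a k j) * (\<gamma> (x + y k j) * msq (u (x + y k j)) / c1)) + 2 * msq (r k x) = G k x"
        unfolding G_def by (simp add: sum_distrib_left mult_ac add.commute)
      finally have "msq (u x) \<le> G k x" by simp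
      also have "\<dots> \<le> (\<Sum>k\<le>K. G k x)" using k(1) G0 by (intro member_le_sum) auto
      finally show ?thesis .
    qed
    have sh: "integrable lborel (\<lambda>x. \<gamma> (x + z) * msq (u (x + z)))" "(LEB x. \<gamma> (x + z) * msq (u (x + z))) = J" for z
      using lborel_integrable_shift[OF integrable_weight[OF su], of z]
        lborel_integral_shift[of "\<lambda>x. \<gamma> x * msq (u x)" z] by (simp_all add: add.commute J_def)
    have Gi: "integrable lborel (G k)" if "k \<le> K" for k
      unfolding G_def using sh sr[OF that] by (intro Bochner_Integration.integrable_add integrable_mult_right Bochner_Integration.integrable_sum) (auto simp: L2_iff)
    have GV: "(LEB x. G k x) \<le> 2 * (real n + 1) / c1 * (\<Sum>j\<le>n. msq (a k j)) * J + 2 * (\<epsilon>\<^sup>2 * V)" if k: "k \<le> K" for k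
    proof -
      have "(LEB x. G k x) = 2 * (real n + 1) / c1 * (\<Sum>j\<le>n. msq (a k j) * J) + 2 * (LEB x. msq (r k x))"
        unfolding G_def using sh sr[OF k] by (simp add: L2_iff Bochner_Integration.integral_sum Bochner_Integration.integrable_sum)
      then show ?thesis using rV[OF k] by (simp add: sum_distrib_right mult.assoc)
    qed
    have "V \<le> (LEB x. (\<Sum>k\<le>K. G k x))" unfolding uV[symmetric] using su Gi pt by (intro integral_mono) (auto simp: L2_iff)
    also have "\<dots> = (\<Sum>k\<le>K. LEB x. G k x)" using Gi by (intro Bochner_Integration.integral_sum) auto
    also have "\<dots> \<le> (\<Sum>k\<le>K. 2 * (real n + 1) / c1 * (\<Sum>j\<le>n. msq (a k j)) * J + 2 * (\<epsilon>\<^sup>2 * V))"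
      by (intro sum_mono GV) auto
    also have "\<dots> = (A - 1) * J + (real K + 1) * (2 * (\<epsilon>\<^sup>2 * V))"
      by (simp add: A_def sum.distrib sum_distrib_right add.commute[of 1])
    also have "(real K + 1) * (2 * (\<epsilon>\<^sup>2 * V)) \<le> V / 2"
    proof -
      have "(real K + 1) * \<epsilon> = 1 / 4" by (simp add: \<epsilon>_def field_simps)
      moreover have "(real K + 1) * (2 * \<epsilon>\<^sup>2) = 2 * ((real K + 1) * \<epsilon>) * \<epsilon>" by (simp add: power2_eq_square)
      ultimately have "(real K + 1) * (2 * \<epsilon>\<^sup>2) = \<epsilon> / 2" by simp
      also have "\<dots> \<le> 1 / 2" by (simp add: \<epsilon>_def field_simps)
      finally show ?thesis using V mult_right_mono[of "(real K + 1) * (2 * \<epsilon>\<^sup>2)" "1/2" V] by (simp add: mult.assoc)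
    qed
    finally have "V / 2 \<le> (A - 1) * J" by simp
    also have "\<dots> \<le> A * J" unfolding J_def using nonneg by (intro mult_right_mono integral_nonneg) auto
    finally show ?thesis using A unfolding V_def J_def u_def by (simp add: field_simps)
  qed
  show ?thesis using main A by (intro exI[of _ "(1/2) / A"]) auto
qed

end

section \<open>Uncertainty principle at high frequencies\<close>

lemma nn_integral_lborel_shift:
  fixes f :: "'a::euclidean_space \<Rightarrow> ennreal"
  assumes "f \<in> bfun" shows "(NNI x. f (t + x)) = (NNI x. f x)"
proof -
  have "(NNI x. f x) = (\<integral>\<^sup>+x. f x \<partial>(distr lborel borel ((+) t)))" by (simp add: lborel_distr_plus)
  also have "\<dots> = (NNI x. f (t + x))" by (subst nn_integral_distr) (use assms in auto)
  finally show ?thesis ..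
qed

lemma nn_integral_lborel_reflect:
  fixes f :: "'a::euclidean_space \<Rightarrow> ennreal"
  assumes [measurable]: "f \<in> bfun" shows "(NNI x. f (t - x)) = (NNI x. f x)"
proof -
  have "(NNI x. f x) = (\<integral>\<^sup>+x. f x \<partial>(density (distr lborel borel (\<lambda>x. t + (-1) *\<^sub>R x)) (\<lambda>_. ennreal (\<bar>-1\<bar> ^ DIM('a)))))"
    by (subst lborel_affine[of "-1" t]) auto
  also have "\<dots> = (NNI x. f (t - x))" by (simp add: nn_integral_density nn_integral_distr)
  finally show ?thesis ..
qed

lemma ift_mult_formula:
  fixes f v :: "'a::euclidean_space \<Rightarrow> complex"
  assumes f: "integrable lborel f" and v: "integrable lborel v" shows "(LEB y. f y * ift v y) = (LEB \<xi>. ift f \<xi> * v \<xi>)"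
proof -
  have [measurable]: "f \<in> bfun" "v \<in> bfun" using f v by auto
  have f': "integrable lborel (\<lambda>y. f (- y))" using lborel_integrable_affine[OF f, of "-1" 0] by simp
  have "(LEB y. f y * ift v y) = (LEB y. f (- y) * ft v y)" by (subst lborel_integral_affine[of _ "-1" 0]) (auto simp: ift_def)
  also have "\<dots> = (LEB \<xi>. ft (\<lambda>y. f (- y)) \<xi> * v \<xi>)" by (rule ft_mult_formula[OF f' v, symmetric])
  also have "ft (\<lambda>y. f (- y)) = ift f" unfolding ift_def ft_def by (rule ext, subst lborel_integral_affine[of _ "-1" 0]) auto
  finally show ?thesis .
qed

text \<open>A windowed Fourier transform read in two ways: for fixed x it is the transform of the
  piece of \<open>ift v\<close> in a ball, to which Plancherel applies; for fixed \<eta> it is a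
  function of x whose spectrum is \<open>v\<close> recentred at \<eta> and weighted by the transform
  of the ball.\<close>

lemma ft_localized:
  fixes v :: "'a::euclidean_space \<Rightarrow> complex"
  assumes v: "integrable lborel v" shows "ft (\<lambda>y. cpx (indicat_real (ball x r) y) * ift v y) \<eta>
    = ift (\<lambda>\<zeta>. ift (\<lambda>z. cpx (indicat_real (ball 0 r) z)) \<zeta> * v (\<zeta> + \<eta>)) x"
proof -
  have [measurable]: "v \<in> bfun" using v by auto
  let ?k = "ift (\<lambda>z::'a. cpx (indicat_real (ball 0 r) z))"
  let ?c = "cpx (ft_const TYPE('a))"
  define f where "f y = exp (- \<i> * cpx (y \<bullet> \<eta>)) * cpx (indicat_real (ball x r) y)" for y
  have [measurable]: "ball x r \<in> sets borel" by simp
  have f: "integrable lborel f"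
  proof (rule bounded_support_integrable(1)[of _ 1 "norm x + r"])
    show "f \<in> bfun" unfolding f_def by measurable
    show "cmod (f y) \<le> 1" for y by (auto simp: f_def norm_mult indicator_def)
    show "f y = 0" if "norm x + r < norm y" for y
      using that norm_triangle_ineq2[of y x] by (auto simp: f_def indicator_def dist_norm norm_minus_commute)
  qed
  have [measurable]: "f \<in> bfun" using f by auto
  have kf: "ift f \<xi> = exp (\<i> * cpx (x \<bullet> (\<xi> - \<eta>))) * ?k (\<xi> - \<eta>)" for \<xi>
  proof -
    have "(LEB y. exp (\<i> * cpx (\<xi> \<bullet> y)) * f y) = (LEB z. exp (\<i> * cpx (\<xi> \<bullet> (x + z))) * f (x + z))"
      by (rule lborel_integral_shift[symmetric]) measurable
    also have "\<dots> = (LEB z. exp (\<i> * cpx (x \<bullet> (\<xi> - \<eta>))) * (exp (\<i> * cpx ((\<xi> - \<eta>) \<bullet> z)) * cpx (indicat_real (ball 0 r) z)))"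
    proof (rule Bochner_Integration.integral_cong[OF refl])
      fix z
      have "exp (\<i> * cpx (\<xi> \<bullet> (x + z))) * exp (- \<i> * cpx ((x + z) \<bullet> \<eta>)) = exp (\<i> * cpx (x \<bullet> (\<xi> - \<eta>))) * exp (\<i> * cpx ((\<xi> - \<eta>) \<bullet> z))"
        unfolding exp_add[symmetric] by (rule arg_cong[of _ _ exp]) (simp add: inner_add_left inner_add_right inner_diff_left inner_diff_right inner_commute algebra_simps)
      then show "exp (\<i> * cpx (\<xi> \<bullet> (x + z))) * f (x + z) = exp (\<i> * cpx (x \<bullet> (\<xi> - \<eta>))) * (exp (\<i> * cpx ((\<xi> - \<eta>) \<bullet> z)) * cpx (indicat_real (ball 0 r) z))"
        unfolding f_def by (simp add: dist_norm mult.assoc[symmetric] indicator_def)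
    qed
    also have "\<dots> = exp (\<i> * cpx (x \<bullet> (\<xi> - \<eta>))) * (LEB z. exp (\<i> * cpx ((\<xi> - \<eta>) \<bullet> z)) * cpx (indicat_real (ball 0 r) z))"
      by (rule integral_mult_right_zero)
    finally show ?thesis unfolding ift_integrand by (simp only: mult.left_commute)
  qed
  have "ft (\<lambda>y. cpx (indicat_real (ball x r) y) * ift v y) \<eta> = ?c * (LEB y. f y * ift v y)"
    unfolding ft_def f_def by (simp add: mult.assoc)
  also have "(LEB y. f y * ift v y) = (LEB \<xi>. ift f \<xi> * v \<xi>)" by (rule ift_mult_formula[OF f v])
  also have "\<dots> = (LEB \<zeta>. ift f (\<eta> + \<zeta>) * v (\<eta> + \<zeta>))" by (rule lborel_integral_shift[symmetric]) measurable
  finally show ?thesis unfolding ift_integrand[of _ x] kf by (simp add: mult.assoc add.commute)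
qed

context damping
begin

lemma nn_integral_weight:
  "L2 u \<Longrightarrow> (NNI x. ennreal (\<gamma> x) * ennreal (msq (u x))) = ennreal (LEB x. \<gamma> x * msq (u x))"
  using integrable_weight[of u] nonneg by (subst nn_integral_eq_integral[symmetric]) (auto simp: ennreal_mult)

end

lemma nn_integral_L2:
  "L2 u \<Longrightarrow> (NNI x. ennreal (msq (u x))) = ennreal (LEB x. msq (u x))" by (intro nn_integral_eq_integral) (auto simp: L2_iff)

context gcc_damping
begin

text \<open>The control condition as a nonnegative integral, the form in which Tonelli's theorem can
  average it over base points.\<close>

lemma nn_integral_line:
  assumes e: "norm e = 1" shows "ennreal c \<le> (NNI \<tau>. ennreal (indicat_real {0..L} \<tau>) * ennreal (\<gamma> (a + \<tau> *\<^sub>R e)))"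
proof -
  have "continuous_on {0..L} (\<lambda>\<tau>. \<gamma> (a + \<tau> *\<^sub>R e))"
    by (rule continuous_on_compose2[OF cont]) (auto intro!: continuous_intros)
  then have s: "set_integrable lborel {0..L} (\<lambda>\<tau>. \<gamma> (a + \<tau> *\<^sub>R e))" by (rule borel_integrable_atLeastAtMost')
  have "ennreal c \<le> ennreal (integral {0..L} (\<lambda>\<tau>. \<gamma> (a + \<tau> *\<^sub>R e)))" using gcc[OF e] by (rule ennreal_leI)
  also have "integral {0..L} (\<lambda>\<tau>. \<gamma> (a + \<tau> *\<^sub>R e)) = (LEB \<tau>. indicat_real {0..L} \<tau> * \<gamma> (a + \<tau> *\<^sub>R e))"
    using set_borel_integral_eq_integral(2)[OF s] by (simp add: set_lebesgue_integral_def)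
  also have "ennreal \<dots> = (NNI \<tau>. ennreal (indicat_real {0..L} \<tau> * \<gamma> (a + \<tau> *\<^sub>R e)))"
    using s nonneg by (intro nn_integral_eq_integral[symmetric]) (auto simp: set_integrable_def)
  also have "\<dots> = (NNI \<tau>. ennreal (indicat_real {0..L} \<tau>) * ennreal (\<gamma> (a + \<tau> *\<^sub>R e)))"
    using nonneg by (simp add: ennreal_mult)
  finally show ?thesis .
qed

text \<open>If the spectrum of \<open>g = ift w\<close> concentrates near the hyperplane \<open>e \<bullet> \<zeta> = \<kappa>\<close>, then \<open>\<bar>g\<bar>\<close> is
  nearly constant along lines in direction \<open>e\<close> over distances at most \<open>L\<close>, so \<open>\<gamma>\<close> may be
  replaced by its averages along such segments.\<close>

lemma directional:
  assumes w: "integrable lborel w" "L2 w" and e: "norm e = 1"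
  shows "c / (2 * L) * (LEB \<zeta>. msq (w \<zeta>)) \<le> (LEB x. \<gamma> x * msq (ift w x))
    + M * (LEB \<zeta>. min 4 (L\<^sup>2 * (e \<bullet> \<zeta> - \<kappa>)\<^sup>2) * msq (w \<zeta>))"
proof -
  have [measurable]: "w \<in> bfun" using w by auto
  define g where "g = ift w"
  have sg: "L2 g" unfolding g_def using w by (rule L2_ift)
  have [measurable]: "g \<in> bfun" using sg by auto
  define W where "W = (LEB \<zeta>. msq (w \<zeta>))"
  have gW: "(LEB x. msq (g x)) = W" using arg_cong[OF norm_ift[OF w], where f = power2] sg w(2) by (simp add: norm_cls_sq g_def W_def)
  define J where "J = (LEB x. \<gamma> x * msq (g x))"
  \<comment> \<open>An upper bound, uniform for 0 <= \<tau> <= L, of the squared distance between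
    the phases exp(i \<tau> e.\<zeta>) and exp(i \<tau> \<kappa>); 4 is the trivial bound.\<close>
  define m where "m \<zeta> = min 4 (L\<^sup>2 * (e \<bullet> \<zeta> - \<kappa>)\<^sup>2)" for \<zeta>
  have [measurable]: "m \<in> bfun" unfolding m_def by measurable
  have m: "0 \<le> m \<zeta>" "m \<zeta> \<le> 4" for \<zeta> by (auto simp: m_def)
  define E where "E = (LEB \<zeta>. m \<zeta> * msq (w \<zeta>))"
  have mi: "integrable lborel (\<lambda>\<zeta>. m \<zeta> * msq (w \<zeta>))"
    by (rule Bochner_Integration.integrable_bound[of _ "\<lambda>\<zeta>. 4 * msq (w \<zeta>)"])
       (use w(2) m in \<open>auto simp: L2_iff abs_mult intro!: mult_right_mono\<close>)
  have E0: "0 \<le> E" unfolding E_def using m by (intro Bochner_Integration.integral_nonneg) auto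
  have J0: "0 \<le> J" unfolding J_def using nonneg by (intro Bochner_Integration.integral_nonneg) auto
  have step: "(LEB x. \<gamma> (x + \<tau> *\<^sub>R e) * msq (g x)) \<le> 2 * (J + M * E)"
     and stepi: "integrable lborel (\<lambda>x. \<gamma> (x + \<tau> *\<^sub>R e) * msq (g x))"
    if \<tau>: "0 \<le> \<tau>" "\<tau> \<le> L" for \<tau>
  proof -
    define d where "d \<zeta> = (exp (\<i> * cpx (\<tau> *\<^sub>R e \<bullet> \<zeta>)) - exp (\<i> * cpx (\<tau> * \<kappa>))) * w \<zeta>" for \<zeta>
    have db: "cmod (exp (\<i> * cpx (\<tau> *\<^sub>R e \<bullet> \<zeta>)) - exp (\<i> * cpx (\<tau> * \<kappa>))) \<le> 2" for \<zeta>
      by (rule order_trans[OF norm_triangle_ineq4]) simp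
    have id: "integrable lborel d" unfolding d_def by (rule integrable_bounded_mult(2)[OF w(1) _ db]) measurable
    have sd: "L2 d" unfolding d_def by (rule L2_mult_bounded[OF w(2) _ db]) measurable
    have dm: "msq (d \<zeta>) \<le> m \<zeta> * msq (w \<zeta>)" for \<zeta>
    proof -
      let ?z = "exp (\<i> * cpx (\<tau> *\<^sub>R e \<bullet> \<zeta>)) - exp (\<i> * cpx (\<tau> * \<kappa>))"
      have "cmod ?z \<le> \<bar>\<tau> * (e \<bullet> \<zeta> - \<kappa>)\<bar>"
        using norm_exp_diff_le[of "\<tau> *\<^sub>R e \<bullet> \<zeta>" "\<tau> * \<kappa>"] by (simp add: right_diff_distrib)
      then have "msq ?z \<le> (\<tau> * (e \<bullet> \<zeta> - \<kappa>))\<^sup>2" by (metis abs_le_square_iff abs_norm_cancel)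
      also have "\<dots> \<le> L\<^sup>2 * (e \<bullet> \<zeta> - \<kappa>)\<^sup>2" unfolding power_mult_distrib using \<tau> by (intro mult_right_mono power_mono) auto
      finally have "msq ?z \<le> L\<^sup>2 * (e \<bullet> \<zeta> - \<kappa>)\<^sup>2" .
      moreover have "msq ?z \<le> 2\<^sup>2" by (rule power_mono[OF db]) simp
      ultimately show ?thesis unfolding d_def norm_mult power_mult_distrib m_def by (intro mult_right_mono) auto
    qed
    define D where "D = ift d"
    have sD: "L2 D" unfolding D_def using id sd by (rule L2_ift)
    have "(LEB x. msq (D x)) = (LEB x. msq (d x))" using arg_cong[OF norm_ift[OF id sd], where f = power2] sD sd by (simp add: norm_cls_sq D_def)
    also have "\<dots> \<le> E" unfolding E_def using sd mi dm by (intro integral_mono) (auto simp: L2_iff)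
    finally have DE: "(LEB x. msq (D x)) \<le> E" .
    \<comment> \<open>The translate of g is compared with g times a unimodular constant, which is
      invisible to the modulus.\<close>
    have Dx: "D x = g (x + \<tau> *\<^sub>R e) - exp (\<i> * cpx (\<tau> * \<kappa>)) * g x" for x
    proof -
      have i1: "integrable lborel (\<lambda>\<zeta>. exp (\<i> * cpx (\<tau> *\<^sub>R e \<bullet> \<zeta>)) * w \<zeta>)"
        by (rule integrable_bounded_mult(2)[OF w(1), where C = 1]) auto
      have i2: "integrable lborel (\<lambda>\<zeta>. exp (\<i> * cpx (\<tau> * \<kappa>)) * w \<zeta>)" using w(1) by simp
      have "d = (\<lambda>\<zeta>. exp (\<i> * cpx (\<tau> *\<^sub>R e \<bullet> \<zeta>)) * w \<zeta> - exp (\<i> * cpx (\<tau> * \<kappa>)) * w \<zeta>)"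
        by (auto simp: d_def left_diff_distrib)
      then show ?thesis unfolding D_def using i1 i2 by (simp only: ift_diff ift_cmult g_def ift_shift)
    qed
    have pt: "\<gamma> (x + \<tau> *\<^sub>R e) * msq (g x) \<le> 2 * (\<gamma> (x + \<tau> *\<^sub>R e) * msq (g (x + \<tau> *\<^sub>R e))) + 2 * M * msq (D x)" for x
    proof -
      have "cmod (g x) = cmod (exp (\<i> * cpx (\<tau> * \<kappa>)) * g x)" by (simp add: norm_mult)
      also have "\<dots> = cmod (g (x + \<tau> *\<^sub>R e) - D x)" by (simp add: Dx)
      also have "\<dots> \<le> cmod (g (x + \<tau> *\<^sub>R e)) + cmod (D x)" by (rule norm_triangle_ineq4)
      finally have "msq (g x) \<le> (cmod (g (x + \<tau> *\<^sub>R e)) + cmod (D x))\<^sup>2" by (intro power_mono) auto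
      also have "\<dots> \<le> 2 * msq (g (x + \<tau> *\<^sub>R e)) + 2 * msq (D x)"
        using sum_squares_bound[of "cmod (g (x + \<tau> *\<^sub>R e))" "cmod (D x)"] by (simp add: power2_sum)
      finally have "\<gamma> (x + \<tau> *\<^sub>R e) * msq (g x) \<le> \<gamma> (x + \<tau> *\<^sub>R e) * (2 * msq (g (x + \<tau> *\<^sub>R e)) + 2 * msq (D x))"
        using nonneg by (rule mult_left_mono)
      also have "\<dots> = 2 * (\<gamma> (x + \<tau> *\<^sub>R e) * msq (g (x + \<tau> *\<^sub>R e))) + 2 * (\<gamma> (x + \<tau> *\<^sub>R e) * msq (D x))"
        by (simp add: algebra_simps)
      also have "\<gamma> (x + \<tau> *\<^sub>R e) * msq (D x) \<le> M * msq (D x)" using le_M by (rule mult_right_mono) simp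
      finally show ?thesis by simp
    qed
    have sh: "integrable lborel (\<lambda>x. \<gamma> (x + \<tau> *\<^sub>R e) * msq (g (x + \<tau> *\<^sub>R e)))" "(LEB x. \<gamma> (x + \<tau> *\<^sub>R e) * msq (g (x + \<tau> *\<^sub>R e))) = J"
      using lborel_integrable_shift[OF integrable_weight[OF sg], of "\<tau> *\<^sub>R e"]
        lborel_integral_shift[of "\<lambda>x. \<gamma> x * msq (g x)" "\<tau> *\<^sub>R e"] by (simp_all add: add.commute J_def)
    show i: "integrable lborel (\<lambda>x. \<gamma> (x + \<tau> *\<^sub>R e) * msq (g x))"
      by (rule Bochner_Integration.integrable_bound[of _ "\<lambda>x. M * msq (g x)"])
         (use sg nonneg le_M M_nonneg in \<open>auto simp: L2_iff abs_mult intro!: mult_right_mono\<close>)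
    have "(LEB x. \<gamma> (x + \<tau> *\<^sub>R e) * msq (g x)) \<le> (LEB x. 2 * (\<gamma> (x + \<tau> *\<^sub>R e) * msq (g (x + \<tau> *\<^sub>R e))) + 2 * M * msq (D x))"
      using i sh sD pt by (intro integral_mono) (auto simp: L2_iff)
    also have "\<dots> = 2 * J + 2 * M * (LEB x. msq (D x))" using sh sD by (simp add: L2_iff)
    also have "\<dots> \<le> 2 * J + 2 * M * E" using DE M_nonneg by (intro add_left_mono mult_left_mono) auto
    finally show "(LEB x. \<gamma> (x + \<tau> *\<^sub>R e) * msq (g x)) \<le> 2 * (J + M * E)" by (simp add: algebra_simps)
  qed
  have "ennreal c * ennreal W = (NNI x. ennreal c * ennreal (msq (g x)))" using nn_integral_L2[OF sg] gW by (simp add: nn_integral_cmult)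
  also have "\<dots> \<le> (NNI x. (NNI \<tau>. ennreal (indicat_real {0..L} \<tau>) * ennreal (\<gamma> (x + \<tau> *\<^sub>R e))) * ennreal (msq (g x)))"
    by (intro nn_integral_mono mult_right_mono nn_integral_line[OF e]) auto
  also have "\<dots> = (NNI x. (NNI \<tau>. ennreal (indicat_real {0..L} \<tau>) * (ennreal (\<gamma> (x + \<tau> *\<^sub>R e)) * ennreal (msq (g x)))))"
    by (simp add: nn_integral_multc[symmetric] mult.assoc)
  also have "\<dots> = (NNI \<tau>. (NNI x. ennreal (indicat_real {0..L} \<tau>) * (ennreal (\<gamma> (x + \<tau> *\<^sub>R e)) * ennreal (msq (g x)))))"
    by (rule lborel_pair.Fubini') measurable
  also have "\<dots> \<le> (NNI \<tau>. ennreal (2 * (J + M * E)) * indicator {0..L} \<tau>)"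
  proof (rule nn_integral_mono)
    fix \<tau> :: real
    show "(NNI x. ennreal (indicat_real {0..L} \<tau>) * (ennreal (\<gamma> (x + \<tau> *\<^sub>R e)) * ennreal (msq (g x))))
      \<le> ennreal (2 * (J + M * E)) * indicator {0..L} \<tau>"
    proof (cases "\<tau> \<in> {0..L}")
      case True
      then have t: "0 \<le> \<tau>" "\<tau> \<le> L" by auto
      have "(NNI x. ennreal (\<gamma> (x + \<tau> *\<^sub>R e)) * ennreal (msq (g x))) = ennreal (LEB x. \<gamma> (x + \<tau> *\<^sub>R e) * msq (g x))"
        using stepi[OF t] nonneg by (subst nn_integral_eq_integral[symmetric]) (auto simp: ennreal_mult)
      then show ?thesis using True step[OF t] by (simp add: ennreal_leI)
    qed simp
  qed
  also have "\<dots> = ennreal (2 * (J + M * E)) * ennreal L" using L by (simp add: nn_integral_cmult_indicator)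
  finally have "ennreal (c * W) \<le> ennreal (2 * (J + M * E) * L)" using c L J0 E0 M_nonneg by (simp add: ennreal_mult W_def)
  then have "c * W \<le> 2 * (J + M * E) * L" using J0 E0 M_nonneg L by (subst (asm) ennreal_le_iff) auto
  then show ?thesis using L unfolding W_def[symmetric] J_def E_def m_def g_def by (simp add: field_simps)
qed

end

context gcc_damping
begin

text \<open>Continuous windowing: x runs over centres of balls of radius r, on which \<gamma> varies
  by less than \<epsilon>, and \<eta> over frequencies. The windowed piece has its spectrum mostly
  within N of \<eta>; at that scale a thin shell of large radius is flat, so
  \<open>directional\<close> applies with normal \<eta>/|\<eta>|. Integration over x and \<eta>
  reassembles |u|^2 by Plancherel.\<close>

lemma high_frequency:
  shows "\<exists>R0>0. \<exists>\<delta>>0. \<exists>\<kappa>>0. \<forall>R\<ge>R0. \<forall>v. L2 v \<longrightarrow> (\<forall>\<xi>. v \<xi> \<noteq> 0 \<longrightarrow> R \<le> norm \<xi> \<and> norm \<xi> \<le> R + \<delta>) \<longrightarrow>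
     \<kappa> * (LEB \<xi>. msq (v \<xi>)) \<le> (LEB x. \<gamma> x * msq (ift v x))"
proof -
  define M' where "M' = M + 1"
  have M': "M' > 0" "M \<le> M'" using M_nonneg by (auto simp: M'_def)
  \<comment> \<open>Error budget: from c / (2 L) the windowing costs c / (8 L) and the near and far
    spectral errors c / (16 L) each, which leaves c / (4 L).\<close>
  define \<epsilon> where "\<epsilon> = c / (8 * L)"
  have \<epsilon>: "\<epsilon> > 0" using c L by (simp add: \<epsilon>_def)
  obtain r where r: "r > 0" "\<And>x y. dist x y < r \<Longrightarrow> \<bar>\<gamma> x - \<gamma> y\<bar> < \<epsilon>" using uc_dist[OF \<epsilon>] by blast
  define b where "b x = cpx (indicat_real (ball (0::'a) r) x)" for x
  have [measurable]: "ball x r \<in> sets borel" for x :: 'a by simp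
  have bm: "b \<in> bfun" unfolding b_def by measurable
  have "\<And>x. cmod (b x) \<le> 1" "\<And>x. r < norm x \<Longrightarrow> b x = 0" by (auto simp: b_def indicator_def)
  note b = bounded_support_integrable[OF bm this]
  define k where "k = ift b"
  have sk: "L2 k" unfolding k_def using b by (rule L2_ift)
  have [measurable]: "k \<in> bfun" using sk by auto
  define V where "V = measure lborel (ball (0::'a) r)"
  have Vpos: "V > 0" using r by (simp add: V_def content_ball_pos)
  have ballV: "emeasure lborel (ball (x::'a) r) = ennreal V" for x
  proof -
    have "emeasure lborel (ball x r) = ennreal (measure lborel (ball x r))"
      using emeasure_lborel_ball_finite[of x r] by (intro emeasure_eq_ennreal_measure) auto
    then show ?thesis using r content_ball[of r x] content_ball[of r "0::'a"] by (simp add: V_def)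
  qed
  have kV: "(LEB x. msq (k x)) = V"
  proof -
    have "(LEB x. msq (k x)) = (LEB x. msq (b x))" using arg_cong[OF norm_ift[OF b], where f = power2] sk b(2) by (simp add: norm_cls_sq k_def)
    also have "\<dots> = (LEB x. indicat_real (ball (0::'a) r) x)" by (intro Bochner_Integration.integral_cong) (auto simp: b_def indicator_def)
    also have "\<dots> = V" by (simp add: V_def)
    finally show ?thesis .
  qed
  \<comment> \<open>Admissible tail mass of the window's transform: 4 M' \<theta> equals V times c /
    (16 L).\<close>
  define \<theta> where "\<theta> = V * c / (64 * L * M')"
  have \<theta>: "\<theta> > 0" using Vpos c L M' by (simp add: \<theta>_def)
  obtain N :: nat where N: "N > 0" "(LEB \<zeta>. indicat_real {\<zeta>. real N < norm \<zeta>} \<zeta> * msq (k \<zeta>)) < \<theta>"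
  proof -
    have "(\<lambda>n. LEB \<zeta>. indicat_real {\<zeta>. real n < norm \<zeta>} \<zeta> * msq (k \<zeta>)) \<longlonglongrightarrow> (LINT \<zeta>|(lborel::'a measure). 0)"
    proof (rule integral_dominated_convergence[where w = "\<lambda>\<zeta>. msq (k \<zeta>)"])
      show "AE \<zeta> in lborel. (\<lambda>n. indicat_real {\<zeta>. real n < norm \<zeta>} \<zeta> * msq (k \<zeta>)) \<longlonglongrightarrow> 0"
      proof (rule AE_I2)
        fix \<zeta> :: 'a
        obtain n0 where "norm \<zeta> \<le> real n0" using real_arch_simple by blast
        then have "\<forall>n\<ge>n0. indicat_real {\<zeta>. real n < norm \<zeta>} \<zeta> * msq (k \<zeta>) = 0" by (auto simp: indicator_def)
        then show "(\<lambda>n. indicat_real {\<zeta>. real n < norm \<zeta>} \<zeta> * msq (k \<zeta>)) \<longlonglongrightarrow> 0"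
          by (intro tendsto_eventually) (auto simp: eventually_sequentially)
      qed
    qed (use sk in \<open>auto simp: L2_iff indicator_def\<close>)
    then have "\<exists>n0. \<forall>n\<ge>n0. (LEB \<zeta>. indicat_real {\<zeta>. real n < norm \<zeta>} \<zeta> * msq (k \<zeta>)) < \<theta>"
      using order_tendstoD(2)[of _ 0 sequentially \<theta>] \<theta> by (simp add: eventually_sequentially)
    then obtain n0 where n0: "\<forall>n\<ge>n0. (LEB \<zeta>. indicat_real {\<zeta>. real n < norm \<zeta>} \<zeta> * msq (k \<zeta>)) < \<theta>" by blast
    then have "(LEB \<zeta>. indicat_real {\<zeta>. real (Suc n0) < norm \<zeta>} \<zeta> * msq (k \<zeta>)) < \<theta>" by (elim allE[of _ "Suc n0"]) auto
    then show thesis by (intro that[of "Suc n0"]) auto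
  qed
  \<comment> \<open>Calibrated, using \<delta>^2 <= \<delta>, so that M' L^2 (2 \<delta>)^2 is at
    most c / (16 L).\<close>
  define \<delta> where "\<delta> = min 1 (c / (64 * L ^ 3 * M'))"
  have \<delta>: "\<delta> > 0" "\<delta> \<le> 1" using c L M' by (auto simp: \<delta>_def)
  have \<delta>2: "M' * (L\<^sup>2 * (2 * \<delta>)\<^sup>2) \<le> c / (16 * L)"
  proof -
    define q where "q = c / (64 * L ^ 3 * M')"
    have "\<delta>\<^sup>2 \<le> \<delta>" using \<delta> by (simp add: power2_eq_square mult_left_le)
    also have "\<delta> \<le> q" by (simp add: \<delta>_def q_def)
    finally have "(2 * \<delta>)\<^sup>2 \<le> 4 * q" by (simp add: power_mult_distrib)
    then have "M' * (L\<^sup>2 * (2 * \<delta>)\<^sup>2) \<le> M' * (L\<^sup>2 * (4 * q))" using M' by (intro mult_left_mono) simp_all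
    also have "\<dots> = c / (16 * L)" unfolding q_def using L M' by (simp add: field_simps power2_eq_square power3_eq_cube)
    finally show ?thesis .
  qed
  \<comment> \<open>R >= 2 N forces |\<eta>| >= R / 2 for every \<eta> within N of the shell, and R
    >= N^2 / \<delta> makes the curvature of the sphere cost at most \<delta> over a distance
    N.\<close>
  define R0 where "R0 = max (2 * real N) ((real N)\<^sup>2 / \<delta>)"
  have R0: "R0 > 0" using N by (simp add: R0_def less_max_iff_disj)
  obtain b0 :: 'a where b0: "b0 \<in> Basis" using nonempty_Basis by blast
  \<comment> \<open>The default at 0 keeps \<open>en\<close> a unit vector with
    \<open>en \<eta> \<bullet> \<eta> = norm \<eta>\<close> everywhere.\<close>
  define en where "en \<eta> = (if \<eta> = 0 then b0 else \<eta> /\<^sub>R norm \<eta>)" for \<eta> :: 'a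
  have en: "norm (en \<eta>) = 1" "en \<eta> \<bullet> \<eta> = norm \<eta>" for \<eta>
    using b0 by (auto simp: en_def dot_square_norm power2_eq_square)
  have [measurable]: "en \<in> bfun" unfolding en_def by measurable
  have main: "c / (4 * L) * (LEB \<xi>. msq (v \<xi>)) \<le> (LEB x. \<gamma> x * msq (ift v x))"
    if R: "R \<ge> R0" and sv: "L2 v" and supp: "\<And>\<xi>. v \<xi> \<noteq> 0 \<Longrightarrow> R \<le> norm \<xi> \<and> norm \<xi> \<le> R + \<delta>" for R v
  proof -
    have [measurable]: "v \<in> bfun" using sv by auto
    have iv: "integrable lborel v" by (rule integrable_bounded_support[OF sv, of "R + \<delta>"]) (use supp in force)
    define u where "u = ift v"
    have su: "L2 u" unfolding u_def using iv sv by (rule L2_ift)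
    have [measurable]: "u \<in> bfun" using su by auto
    define W where "W = (LEB \<xi>. msq (v \<xi>))"
    have W0: "W \<ge> 0" by (simp add: W_def)
    have uW: "(LEB x. msq (u x)) = W" using arg_cong[OF norm_ift[OF iv sv], where f = power2] su sv by (simp add: norm_cls_sq u_def W_def)
    define J where "J = (LEB x. \<gamma> x * msq (u x))"
    have J0: "J \<ge> 0" unfolding J_def using nonneg by (intro Bochner_Integration.integral_nonneg) auto
    define m where "m \<eta> \<xi> = min 4 (L\<^sup>2 * (en \<eta> \<bullet> \<xi> - R)\<^sup>2)" for \<eta> \<xi>
    have [measurable]: "(\<lambda>(\<eta>, \<xi>). m \<eta> \<xi>) \<in> borel_measurable (borel \<Otimes>\<^sub>M borel)" unfolding m_def by measurable
    have m0: "0 \<le> m \<eta> \<xi>" "m \<eta> \<xi> \<le> 4" for \<eta> \<xi> by (auto simp: m_def)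
    define w where "w \<eta> \<zeta> = k \<zeta> * v (\<zeta> + \<eta>)" for \<eta> \<zeta>
    have kb: "cmod (k \<zeta>) \<le> ft_const TYPE('a) * (LEB x. cmod (b x))" for \<zeta> unfolding k_def ift_def by (rule norm_ft_le)
    have svs: "L2 (\<lambda>\<zeta>. v (\<zeta> + \<eta>))" for \<eta> using lborel_integrable_shift[OF L2_normD[OF sv], of \<eta>]
      by (simp add: L2_iff add.commute)
    have sw: "L2 (w \<eta>)" for \<eta> unfolding w_def by (rule L2_mult_bounded[OF svs _ kb]) measurable
    have iw: "integrable lborel (w \<eta>)" for \<eta> unfolding w_def by (rule integrable_mult_L2[OF sk svs])
    define g where "g \<eta> x = ft (\<lambda>y. cpx (indicat_real (ball x r) y) * u y) \<eta>" for \<eta> x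
    have gw: "g \<eta> = ift (w \<eta>)" for \<eta> unfolding g_def w_def k_def b_def u_def by (rule ext) (rule ft_localized[OF iv])
    have [measurable]: "(\<lambda>(\<eta>, x). g \<eta> x) \<in> borel_measurable (borel \<Otimes>\<^sub>M borel)"
    proof -
      have "(\<lambda>p. LEB y. exp (- \<i> * cpx (y \<bullet> fst p)) * (cpx (if dist (snd p) y < r then 1 else 0) * u y)) \<in> borel_measurable (borel \<Otimes>\<^sub>M borel)"
        by (rule lborel.borel_measurable_lebesgue_integral) measurable
      then show ?thesis unfolding g_def ft_def by (simp add: case_prod_beta' indicator_def)
    qed
    let ?E = "\<lambda>\<eta>. NNI \<xi>. ennreal (m \<eta> \<xi>) * ennreal (msq (k (\<xi> - \<eta>))) * ennreal (msq (v \<xi>))" and ?D = "\<lambda>\<eta>. NNI x. ennreal (\<gamma> x) * ennreal (msq (g \<eta> x))" and ?W = "\<lambda>\<eta>. NNI \<zeta>. ennreal (msq (w \<eta> \<zeta>))"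
    have near: "m \<eta> \<xi> \<le> L\<^sup>2 * (2 * \<delta>)\<^sup>2" if v: "v \<xi> \<noteq> 0" and d: "norm (\<xi> - \<eta>) \<le> real N" for \<eta> \<xi>
    proof -
      have x: "R \<le> norm \<xi>" "norm \<xi> \<le> R + \<delta>" using supp[OF v] by auto
      have Rn: "2 * real N \<le> R" "(real N)\<^sup>2 / \<delta> \<le> R" using R by (auto simp: R0_def)
      have "norm \<eta> \<ge> norm \<xi> - norm (\<xi> - \<eta>)" using norm_triangle_ineq2[of \<xi> \<eta>] norm_triangle_ineq3[of \<xi> "\<xi> - \<eta>"] by (simp add: norm_minus_commute)
      then have \<eta>: "norm \<eta> \<ge> R / 2" using x d Rn by linarith
      have Rp: "R > 0" using R R0 by linarith
      have up: "en \<eta> \<bullet> \<xi> \<le> R + \<delta>" using Cauchy_Schwarz_ineq2[of "en \<eta>" \<xi>] en(1)[of \<eta>] x by simp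
      \<comment> \<open>The law of cosines bounds the defect between |\<xi>| and its component along
        \<eta> by |\<xi> - \<eta>|^2 / (2 |\<eta>|).\<close>
      have "2 * norm \<eta> * (norm \<xi> - en \<eta> \<bullet> \<xi>) = (norm (\<xi> - \<eta>))\<^sup>2 - (norm \<xi> - norm \<eta>)\<^sup>2"
      proof -
        have "\<eta> \<noteq> 0" using \<eta> Rp by auto
        then have "norm \<eta> * (en \<eta> \<bullet> \<xi>) = \<eta> \<bullet> \<xi>" by (simp add: en_def)
        moreover have "(norm (\<xi> - \<eta>))\<^sup>2 = (norm \<xi>)\<^sup>2 - 2 * (\<eta> \<bullet> \<xi>) + (norm \<eta>)\<^sup>2"
          by (simp add: power2_norm_eq_inner inner_diff_left inner_diff_right inner_commute)
        ultimately show ?thesis by (simp add: power2_diff algebra_simps)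
      qed
      also have "\<dots> \<le> (real N)\<^sup>2" using power_mono[OF d, of 2] by (simp add: add_increasing2 diff_le_eq)
      also have "\<dots> \<le> \<delta> * R" using Rn \<delta> by (simp add: pos_divide_le_eq mult.commute)
      finally have *: "2 * norm \<eta> * (norm \<xi> - en \<eta> \<bullet> \<xi>) \<le> \<delta> * R" .
      have p: "norm \<xi> - en \<eta> \<bullet> \<xi> \<ge> 0" using Cauchy_Schwarz_ineq2[of "en \<eta>" \<xi>] en(1)[of \<eta>] by simp
      have "R * (norm \<xi> - en \<eta> \<bullet> \<xi>) \<le> 2 * norm \<eta> * (norm \<xi> - en \<eta> \<bullet> \<xi>)" using \<eta> p by (intro mult_right_mono) auto
      then have "R * (norm \<xi> - en \<eta> \<bullet> \<xi>) \<le> R * \<delta>" using * by (simp add: mult.commute)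
      then have "norm \<xi> - en \<eta> \<bullet> \<xi> \<le> \<delta>" using Rp by simp
      then have "\<bar>en \<eta> \<bullet> \<xi> - R\<bar> \<le> 2 * \<delta>" using up x \<delta> by (auto simp: abs_le_iff)
      then have "(en \<eta> \<bullet> \<xi> - R)\<^sup>2 \<le> (2 * \<delta>)\<^sup>2" using abs_le_square_iff[of "en \<eta> \<bullet> \<xi> - R" "2 * \<delta>"] \<delta> by simp
      then have "L\<^sup>2 * (en \<eta> \<bullet> \<xi> - R)\<^sup>2 \<le> L\<^sup>2 * (2 * \<delta>)\<^sup>2" by (rule mult_left_mono) simp
      then show ?thesis by (simp add: m_def min.coboundedI2)
    qed
    \<comment> \<open>The spectrum of the windowed piece is recentred at \<eta>, hence the
      hyperplane constant R - |\<eta>| in place of R.\<close>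
    have one: "ennreal (c / (2 * L)) * ?W \<eta>
        \<le> ?D \<eta>
         + ennreal M' * ?E \<eta>" for \<eta>
    proof -
      let ?m = "\<lambda>\<zeta>. min 4 (L\<^sup>2 * (en \<eta> \<bullet> \<zeta> - (R - norm \<eta>))\<^sup>2)"
      have mm: "?m \<zeta> = m \<eta> (\<eta> + \<zeta>)" for \<zeta> by (simp add: m_def inner_add_right en algebra_simps)
      have mi: "integrable lborel (\<lambda>\<zeta>. ?m \<zeta> * msq (w \<eta> \<zeta>))"
        by (rule Bochner_Integration.integrable_bound[of _ "\<lambda>\<zeta>. 4 * msq (w \<eta> \<zeta>)"])
           (use sw[of \<eta>] in \<open>auto simp: L2_iff abs_mult intro!: mult_right_mono\<close>)
      have "c / (2 * L) * (LEB \<zeta>. msq (w \<eta> \<zeta>)) \<le> (LEB x. \<gamma> x * msq (g \<eta> x)) + M * (LEB \<zeta>. ?m \<zeta> * msq (w \<eta> \<zeta>))"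
        unfolding gw by (rule directional[OF iw sw en(1)])
      also have "\<dots> \<le> (LEB x. \<gamma> x * msq (g \<eta> x)) + M' * (LEB \<zeta>. ?m \<zeta> * msq (w \<eta> \<zeta>))"
        using M' by (intro add_left_mono mult_right_mono Bochner_Integration.integral_nonneg) auto
      finally have "ennreal (c / (2 * L) * (LEB \<zeta>. msq (w \<eta> \<zeta>))) \<le> ennreal ((LEB x. \<gamma> x * msq (g \<eta> x)) + M' * (LEB \<zeta>. ?m \<zeta> * msq (w \<eta> \<zeta>)))"
        by (rule ennreal_leI)
      also have "\<dots> = ennreal (LEB x. \<gamma> x * msq (g \<eta> x)) + ennreal M' * ennreal (LEB \<zeta>. ?m \<zeta> * msq (w \<eta> \<zeta>))"
        using M' nonneg by (subst ennreal_plus) (auto intro!: Bochner_Integration.integral_nonneg simp: ennreal_mult)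
      also have "ennreal (LEB x. \<gamma> x * msq (g \<eta> x)) = ?D \<eta>"
        unfolding gw by (rule nn_integral_weight[OF L2_ift[OF iw sw], symmetric])
      also have "ennreal (LEB \<zeta>. ?m \<zeta> * msq (w \<eta> \<zeta>)) = (NNI \<zeta>. ennreal (?m \<zeta> * msq (w \<eta> \<zeta>)))"
        using mi by (intro nn_integral_eq_integral[symmetric]) auto
      also have "\<dots> = (NNI \<zeta>. ennreal (m \<eta> (\<eta> + \<zeta>)) * ennreal (msq (k ((\<eta> + \<zeta>) - \<eta>))) * ennreal (msq (v (\<eta> + \<zeta>))))"
        unfolding mm w_def using m0 by (intro nn_integral_cong) (simp add: norm_mult power_mult_distrib ennreal_mult add.commute mult.assoc)
      also have "\<dots> = ?E \<eta>"
        by (rule nn_integral_lborel_shift) measurable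
      finally show ?thesis using c L by (subst nn_integral_L2[OF sw], subst ennreal_mult[symmetric]) simp_all
    qed
    have lhs: "(NNI \<eta>. ?W \<eta>) = ennreal V * ennreal W"
    proof -
      have "(NNI \<eta>. ?W \<eta>)
        = (NNI \<zeta>. (NNI \<eta>. ennreal (msq (w \<eta> \<zeta>))))" unfolding w_def by (rule lborel_pair.Fubini') measurable
      also have "\<dots> = (NNI \<zeta>. ennreal (msq (k \<zeta>)) * (NNI \<eta>. ennreal (msq (v (\<zeta> + \<eta>)))))"
        by (simp add: w_def norm_mult power_mult_distrib ennreal_mult nn_integral_cmult)
      also have "\<dots> = (NNI \<zeta>. ennreal (msq (k \<zeta>)) * ennreal W)"
        using nn_integral_lborel_shift[of "\<lambda>\<eta>. ennreal (msq (v \<eta>))"] nn_integral_L2[OF sv] by (simp add: W_def)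
      also have "\<dots> = ennreal V * ennreal W" using nn_integral_L2[OF sk] kV by (simp add: nn_integral_multc)
      finally show ?thesis .
    qed
    \<comment> \<open>Plancherel in \<eta> for each fixed x, then exchange of x and y: on the ball
      around y the value \<gamma> x is at most \<gamma> y + \<epsilon>.\<close>
    have mid: "(NNI \<eta>. ?D \<eta>) \<le> ennreal V * ennreal (J + \<epsilon> * W)"
    proof -
      have "(NNI \<eta>. ?D \<eta>)
         = (NNI x. (NNI \<eta>. ennreal (\<gamma> x) * ennreal (msq (g \<eta> x))))" by (rule lborel_pair.Fubini') measurable
      also have "\<dots> = (NNI x. ennreal (\<gamma> x) * (NNI y. indicator (ball x r) y * ennreal (msq (u y))))"
      proof (rule nn_integral_cong)
        fix x :: 'a
        let ?f = "\<lambda>y. cpx (indicat_real (ball x r) y) * u y"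
        have sf: "L2 ?f" by (rule L2_mult_bounded[OF su, of _ 1]) (auto simp: indicator_def)
        have "L2 (\<lambda>y. cpx (indicat_real (ball x r) y))"
          by (rule bounded_support_integrable[of _ 1 "norm x + r"]) (auto simp: indicator_def dist_norm, smt (verit) norm_triangle_sub norm_minus_commute)
        from integrable_mult_L2[OF this su] have "integrable lborel ?f" .
        note pl = plancherel[OF this sf] ft_contraction(1)[OF this sf]
        have "(NNI \<eta>. ennreal (msq (g \<eta> x))) = ennreal (LEB y. msq (?f y))"
          using arg_cong[OF pl(1), where f = power2] nn_integral_L2[OF pl(2)] sf pl(2) by (simp add: g_def norm_cls_sq)
        also have "\<dots> = (NNI y. ennreal (msq (?f y)))" by (rule nn_integral_L2[OF sf, symmetric])
        also have "\<dots> = (NNI y. indicator (ball x r) y * ennreal (msq (u y)))" by (intro nn_integral_cong) (auto simp: indicator_def)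
        finally have gx: "(NNI \<eta>. ennreal (msq (g \<eta> x))) = (NNI y. indicator (ball x r) y * ennreal (msq (u y)))" .
        have gm: "(\<lambda>\<eta>. ennreal (msq (g \<eta> x))) \<in> borel_measurable lborel" by measurable
        show "(NNI \<eta>. ennreal (\<gamma> x) * ennreal (msq (g \<eta> x))) = ennreal (\<gamma> x) * (NNI y. indicator (ball x r) y * ennreal (msq (u y)))"
          unfolding nn_integral_cmult[OF gm] gx ..
      qed
      also have "\<dots> = (NNI x. (NNI y. ennreal (\<gamma> x) * (if dist x y < r then 1 else 0) * ennreal (msq (u y))))"
        by (intro nn_integral_cong, subst nn_integral_cmult[symmetric]) (auto simp: indicator_def mult.assoc intro!: nn_integral_cong)
      also have "\<dots> = (NNI y. (NNI x. ennreal (\<gamma> x) * (if dist x y < r then 1 else 0) * ennreal (msq (u y))))"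
        by (rule lborel_pair.Fubini') measurable
      also have "\<dots> \<le> (NNI y. ennreal V * ennreal ((\<gamma> y + \<epsilon>) * msq (u y)))"
      proof (rule nn_integral_mono)
        fix y :: 'a
        have "(NNI x. ennreal (\<gamma> x) * (if dist x y < r then 1 else 0) * ennreal (msq (u y)))
          \<le> (NNI x. ennreal ((\<gamma> y + \<epsilon>) * msq (u y)) * indicator (ball y r) x)"
        proof (rule nn_integral_mono)
          fix x :: 'a
          have "\<gamma> x * msq (u y) \<le> (\<gamma> y + \<epsilon>) * msq (u y)" if "dist x y < r"
            using r(2)[OF that] by (intro mult_right_mono) auto
          then show "ennreal (\<gamma> x) * (if dist x y < r then 1 else 0) * ennreal (msq (u y)) \<le> ennreal ((\<gamma> y + \<epsilon>) * msq (u y)) * indicator (ball y r) x"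
            using nonneg by (auto simp: dist_commute ennreal_mult[symmetric] intro: ennreal_leI)
        qed
        also have "\<dots> = ennreal V * ennreal ((\<gamma> y + \<epsilon>) * msq (u y))"
          by (subst nn_integral_cmult_indicator) (auto simp: ballV mult.commute)
        finally show "(NNI x. ennreal (\<gamma> x) * (if dist x y < r then 1 else 0) * ennreal (msq (u y))) \<le> ennreal V * ennreal ((\<gamma> y + \<epsilon>) * msq (u y))" .
      qed
      also have "\<dots> = ennreal V * (NNI y. ennreal ((\<gamma> y + \<epsilon>) * msq (u y)))" by (rule nn_integral_cmult) measurable
      also have "(NNI y. ennreal ((\<gamma> y + \<epsilon>) * msq (u y))) = ennreal (J + \<epsilon> * W)"
      proof (subst nn_integral_eq_integral)
        have i: "integrable lborel (\<lambda>y. \<gamma> y * msq (u y))" "integrable lborel (\<lambda>y. \<epsilon> * msq (u y))"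
          using integrable_weight[OF su] su by (auto simp: L2_iff)
        then show "integrable lborel (\<lambda>y. (\<gamma> y + \<epsilon>) * msq (u y))" by (simp add: distrib_right)
        show "AE y in lborel. 0 \<le> (\<gamma> y + \<epsilon>) * msq (u y)" using nonneg \<epsilon> by (intro AE_I2 mult_nonneg_nonneg) (auto simp: add_nonneg_nonneg less_imp_le)
        show "ennreal (LEB y. (\<gamma> y + \<epsilon>) * msq (u y)) = ennreal (J + \<epsilon> * W)"
          unfolding distrib_right using i uW by (simp add: J_def)
      qed
      finally show ?thesis .
    qed
    have err: "(NNI \<eta>. ?E \<eta>)
      \<le> ennreal (L\<^sup>2 * (2 * \<delta>)\<^sup>2 * V + 4 * \<theta>) * ennreal W"
    proof -
      \<comment> \<open>A majorant depending on \<xi> - \<eta> only: within N the flatness estimate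
        applies, beyond N the trivial bound 4 meets the small tail of \<open>k\<close>.\<close>
      define kk where "kk \<zeta> = (L\<^sup>2 * (2 * \<delta>)\<^sup>2) * msq (k \<zeta>) + 4 * (indicat_real {\<zeta>. real N < norm \<zeta>} \<zeta> * msq (k \<zeta>))" for \<zeta>
      have [measurable]: "kk \<in> bfun" unfolding kk_def by measurable
      have kki: "(NNI \<zeta>. ennreal (kk \<zeta>)) \<le> ennreal (L\<^sup>2 * (2 * \<delta>)\<^sup>2 * V + 4 * \<theta>)"
      proof -
        have i1: "integrable lborel (\<lambda>\<zeta>. msq (k \<zeta>))" using sk by (simp add: L2_iff)
        have i2: "integrable lborel (\<lambda>\<zeta>. indicat_real {\<zeta>. real N < norm \<zeta>} \<zeta> * msq (k \<zeta>))"
          by (rule Bochner_Integration.integrable_bound[OF i1]) (auto simp: indicator_def)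
        have "(NNI \<zeta>. ennreal (kk \<zeta>)) = ennreal (LEB \<zeta>. kk \<zeta>)"
          by (rule nn_integral_eq_integral) (use i1 i2 in \<open>auto simp: kk_def intro!: AE_I2 add_nonneg_nonneg mult_nonneg_nonneg\<close>)
        also have "(LEB \<zeta>. kk \<zeta>) = L\<^sup>2 * (2 * \<delta>)\<^sup>2 * V + 4 * (LEB \<zeta>. indicat_real {\<zeta>. real N < norm \<zeta>} \<zeta> * msq (k \<zeta>))"
          unfolding kk_def using i1 i2 kV by simp
        also have "ennreal \<dots> \<le> ennreal (L\<^sup>2 * (2 * \<delta>)\<^sup>2 * V + 4 * \<theta>)" using N(2) by (intro ennreal_leI) linarith
        finally show ?thesis .
      qed
      have "(NNI \<eta>. ?E \<eta>)
        = (NNI \<xi>. (NNI \<eta>. ennreal (m \<eta> \<xi>) * ennreal (msq (k (\<xi> - \<eta>))) * ennreal (msq (v \<xi>))))"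
        by (rule lborel_pair.Fubini') measurable
      also have "\<dots> \<le> (NNI \<xi>. (NNI \<eta>. ennreal (kk (\<xi> - \<eta>)) * ennreal (msq (v \<xi>))))"
      proof (intro nn_integral_mono)
        fix \<xi> \<eta> :: 'a
        have "m \<eta> \<xi> * msq (k (\<xi> - \<eta>)) \<le> kk (\<xi> - \<eta>)" if "v \<xi> \<noteq> 0"
        proof (cases "norm (\<xi> - \<eta>) \<le> real N")
          case True
          then show ?thesis using near[OF that True] by (simp add: kk_def mult_right_mono)
        next
          case False
          then show ?thesis using m0(2)[of \<eta> \<xi>] by (auto simp: kk_def not_le intro!: add_increasing mult_right_mono)
        qed
        note mk = this
        show "ennreal (m \<eta> \<xi>) * ennreal (msq (k (\<xi> - \<eta>))) * ennreal (msq (v \<xi>)) \<le> ennreal (kk (\<xi> - \<eta>)) * ennreal (msq (v \<xi>))"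
        proof (cases "v \<xi> = 0")
          case False
          have kk0: "0 \<le> kk (\<xi> - \<eta>)" by (auto simp: kk_def indicator_def)
          have "m \<eta> \<xi> * msq (k (\<xi> - \<eta>)) * msq (v \<xi>) \<le> kk (\<xi> - \<eta>) * msq (v \<xi>)"
            using mk[OF False] by (rule mult_right_mono) simp
          then show ?thesis using m0[of \<eta> \<xi>] kk0 by (simp add: ennreal_mult[symmetric] ennreal_leI)
        qed simp
      qed
      also have "\<dots> = (NNI \<xi>. (NNI \<zeta>. ennreal (kk \<zeta>)) * ennreal (msq (v \<xi>)))"
        using nn_integral_lborel_reflect[of "\<lambda>\<zeta>. ennreal (kk \<zeta>)"] by (simp add: nn_integral_multc)
      also have "\<dots> = (NNI \<zeta>. ennreal (kk \<zeta>)) * ennreal W" using nn_integral_L2[OF sv] by (simp add: nn_integral_cmult W_def)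
      also have "\<dots> \<le> ennreal (L\<^sup>2 * (2 * \<delta>)\<^sup>2 * V + 4 * \<theta>) * ennreal W" by (rule mult_right_mono[OF kki]) simp
      finally show ?thesis .
    qed
    have "ennreal (c / (2 * L)) * (ennreal V * ennreal W) = (NNI \<eta>. ennreal (c / (2 * L)) * ?W \<eta>)"
      unfolding lhs[symmetric] w_def by (rule nn_integral_cmult[symmetric]) measurable
    also have "\<dots> \<le> (NNI \<eta>. ?D \<eta>
         + ennreal M' * ?E \<eta>)"
      by (rule nn_integral_mono[OF one])
    also have "\<dots> = (NNI \<eta>. ?D \<eta>)
         + ennreal M' * (NNI \<eta>. ?E \<eta>)"
      by (subst nn_integral_add) (auto simp: nn_integral_cmult)
    also have "\<dots> \<le> ennreal V * ennreal (J + \<epsilon> * W) + ennreal M' * (ennreal (L\<^sup>2 * (2 * \<delta>)\<^sup>2 * V + 4 * \<theta>) * ennreal W)"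
      by (intro add_mono mult_left_mono mid err) auto
    finally have "ennreal (c / (2 * L) * (V * W)) \<le> ennreal (V * (J + \<epsilon> * W) + M' * ((L\<^sup>2 * (2 * \<delta>)\<^sup>2 * V + 4 * \<theta>) * W))"
      using c L Vpos W0 J0 \<epsilon> M' \<theta> by (simp add: ennreal_mult[symmetric] ennreal_plus[symmetric] del: ennreal_plus)
    then have "c / (2 * L) * (V * W) \<le> V * (J + \<epsilon> * W) + M' * ((L\<^sup>2 * (2 * \<delta>)\<^sup>2 * V + 4 * \<theta>) * W)"
      using c L Vpos W0 J0 \<epsilon> M' \<theta> by (subst (asm) ennreal_le_iff) (auto intro!: add_nonneg_nonneg mult_nonneg_nonneg)
    also have "M' * ((L\<^sup>2 * (2 * \<delta>)\<^sup>2 * V + 4 * \<theta>) * W) = (M' * (L\<^sup>2 * (2 * \<delta>)\<^sup>2)) * (V * W) + (4 * M' * \<theta>) * W"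
      by (simp add: algebra_simps)
    also have "4 * M' * \<theta> = c / (16 * L) * V" using M' L by (simp add: \<theta>_def field_simps)
    also have "(M' * (L\<^sup>2 * (2 * \<delta>)\<^sup>2)) * (V * W) \<le> c / (16 * L) * (V * W)"
      using \<delta>2 Vpos W0 by (intro mult_right_mono) auto
    finally have "V * (c / (2 * L) * W) \<le> V * (J + \<epsilon> * W + c / (16 * L) * W + c / (16 * L) * W)" by (simp add: algebra_simps)
    then have "c / (2 * L) * W \<le> J + \<epsilon> * W + c / (16 * L) * W + c / (16 * L) * W" by (rule mult_left_le_imp_le[OF _ Vpos])
    then have "c / (4 * L) * W \<le> J" using L by (simp add: \<epsilon>_def field_simps)
    then show ?thesis by (simp add: W_def J_def u_def)
  qed
  show ?thesis by (intro exI[of _ R0] exI[of _ \<delta>] exI[of _ "c / (4 * L)"] conjI allI impI main) (use R0 \<delta> c L in auto)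
qed

text \<open>Shells with R >= R0 are covered by the high-frequency estimate; every other one lies in
  the ball of radius R0 + \<delta>, where the low-frequency estimate holds with its own
  constant.\<close>

lemma uncertainty:
  "\<exists>\<delta>>0. \<exists>\<kappa>>0. \<forall>R\<ge>0. \<forall>g::'a l2. (AE \<xi> in lborel. rep g \<xi> \<noteq> 0 \<longrightarrow> R \<le> norm \<xi> \<and> norm \<xi> \<le> R + \<delta>) \<longrightarrow>
     \<kappa> * (norm g)\<^sup>2 \<le> (norm (mulop (\<lambda>x. cpx (sqrt (\<gamma> x))) (Fi g)))\<^sup>2"
proof -
  from high_frequency obtain R0 \<delta> \<kappa>1 where h: "R0 > 0" "\<delta> > 0" "\<kappa>1 > 0" and H: "\<forall>R\<ge>R0. \<forall>v. L2 v \<longrightarrow>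
      (\<forall>\<xi>. v \<xi> \<noteq> 0 \<longrightarrow> R \<le> norm \<xi> \<and> norm \<xi> \<le> R + \<delta>) \<longrightarrow>
     \<kappa>1 * (LEB \<xi>. msq (v \<xi>)) \<le> (LEB x. \<gamma> x * msq (ift v x))" by (elim exE conjE) (rule that; assumption)
  have "R0 + \<delta> \<ge> 0" using h by simp
  from low_frequency[OF this] obtain \<kappa>2 where l: "\<kappa>2 > 0" and LF: "\<forall>v. L2 v \<longrightarrow> (\<forall>\<xi>. R0 + \<delta> < norm \<xi> \<longrightarrow> v \<xi> = 0) \<longrightarrow>
     \<kappa>2 * (LEB \<xi>. msq (v \<xi>)) \<le> (LEB x. \<gamma> x * msq (ift v x))" by (elim exE conjE) (rule that; assumption)
  have "min \<kappa>1 \<kappa>2 * (norm g)\<^sup>2 \<le> (norm (mulop (\<lambda>x. cpx (sqrt (\<gamma> x))) (Fi g)))\<^sup>2"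
    if R: "R \<ge> 0" and supp: "AE \<xi> in lborel. rep g \<xi> \<noteq> 0 \<longrightarrow> R \<le> norm \<xi> \<and> norm \<xi> \<le> R + \<delta>" for R and g :: "'a l2"
  proof -
    define v where "v \<xi> = (if R \<le> norm \<xi> \<and> norm \<xi> \<le> R + \<delta> then rep g \<xi> else 0)" for \<xi>
    have [measurable]: "v \<in> bfun" unfolding v_def by measurable
    have sv: "L2 v" by (rule L2_bound[of "rep g" _ 1]) (auto simp: v_def)
    have vg: "cls v = g" by (rule cls_eqI[OF sv]) (use supp in \<open>eventually_elim, auto simp: v_def\<close>)
    have iv: "integrable lborel v" by (rule integrable_bounded_support[OF sv, of "R + \<delta>"]) (auto simp: v_def)
    have W: "(norm g)\<^sup>2 = (LEB \<xi>. msq (v \<xi>))" using norm_cls_sq[OF sv] vg by simp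
    have si: "L2 (ift v)" by (rule L2_ift[OF iv sv])
    have bm: "bmf (\<lambda>x. cpx (sqrt (\<gamma> x)))" by (rule bmfI[of _ "sqrt M"]) (use nonneg le_M in auto)
    have "mulop (\<lambda>x. cpx (sqrt (\<gamma> x))) (Fi g) = cls (\<lambda>x. cpx (sqrt (\<gamma> x)) * ift v x)"
      unfolding vg[symmetric] Fi_cls[OF iv sv] by (rule mulop_cls_bmf[OF bm si])
    then have J: "(norm (mulop (\<lambda>x. cpx (sqrt (\<gamma> x))) (Fi g)))\<^sup>2 = (LEB x. \<gamma> x * msq (ift v x))"
      using nonneg by (simp add: norm_cls_sq L2_bmf[OF bm si] norm_mult power_mult_distrib)
    have W0: "(norm g)\<^sup>2 \<ge> 0" by simp
    show ?thesis
    proof (cases "R \<ge> R0")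
      case True
      have "\<kappa>1 * (norm g)\<^sup>2 \<le> (LEB x. \<gamma> x * msq (ift v x))"
        unfolding W by (rule H[rule_format, OF True sv]) (auto simp: v_def split: if_splits)
      moreover have "min \<kappa>1 \<kappa>2 * (norm g)\<^sup>2 \<le> \<kappa>1 * (norm g)\<^sup>2" by (intro mult_right_mono) auto
      ultimately show ?thesis unfolding J by linarith
    next
      case False
      have "\<kappa>2 * (norm g)\<^sup>2 \<le> (LEB x. \<gamma> x * msq (ift v x))"
        unfolding W by (rule LF[rule_format, OF sv]) (use False in \<open>auto simp: v_def\<close>)
      moreover have "min \<kappa>1 \<kappa>2 * (norm g)\<^sup>2 \<le> \<kappa>2 * (norm g)\<^sup>2" by (intro mult_right_mono) auto
      ultimately show ?thesis unfolding J by linarith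
    qed
  qed
  then show ?thesis using h l by (intro exI[of _ \<delta>] exI[of _ "min \<kappa>1 \<kappa>2"] conjI allI impI) auto
qed

end

section \<open>Strongly continuous semigroups\<close>

text \<open>Gliding hump: if the operator norms were unbounded, one could choose
  \<open>x = \<Sum>k. \<plusminus>\<xi> k\<close> with \<open>\<parallel>\<xi> k\<parallel> = 3\<^sup>-\<^sup>k\<close> along which the operators are unbounded.\<close>

lemma uniform_boundedness:
  fixes F :: "nat \<Rightarrow> 'b::banach \<Rightarrow> 'c::real_normed_vector"
  assumes bl: "\<And>n. bounded_linear (F n)" and pw: "\<And>x. \<exists>K. \<forall>n. norm (F n x) \<le> K"
  shows "\<exists>K. \<forall>n. onorm (F n) \<le> K"
proof (rule ccontr)
  assume "\<not> ?thesis"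
  \<comment> \<open>Growth 4^k against hump sizes 3^(-k) leaves (4/3)^k, which is unbounded.\<close>
  then have "\<exists>n. (4::real) ^ k < onorm (F n)" for k by (metis not_le)
  then obtain N where N: "\<And>k. (4::real) ^ k < onorm (F (N k))" by metis
  define G where "G k = F (N k)" for k
  have G: "bounded_linear (G k)" "(4::real) ^ k < onorm (G k)" for k using bl N by (auto simp: G_def)
  have on: "onorm (G k) > 0" for k using G(2)[of k] zero_less_power[of "4::real" k] by linarith
  have "\<exists>\<xi>. norm \<xi> = (1/3) ^ k \<and> (2/3) * onorm (G k) * (1/3) ^ k \<le> norm (G k \<xi>)" for k
  proof -
    have "\<exists>u. (2/3) * onorm (G k) * norm u < norm (G k u)"
    proof (rule ccontr)
      assume "\<not> ?thesis"
      then have "onorm (G k) \<le> (2/3) * onorm (G k)" using on[of k] by (intro onorm_bound) (auto simp: not_less)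
      then show False using on[of k] by simp
    qed
    then obtain u where u: "(2/3) * onorm (G k) * norm u < norm (G k u)" by blast
    have u0: "norm u > 0" using u G(1)[of k] by (auto simp: linear_simps)
    define a where "a = (1/3) ^ k / norm u"
    have a: "a > 0" using u0 by (simp add: a_def)
    have "norm (a *\<^sub>R u) = (1/3) ^ k" using u0 by (simp add: a_def)
    moreover have "(2/3) * onorm (G k) * (1/3) ^ k \<le> norm (G k (a *\<^sub>R u))"
    proof -
      have "(2/3) * onorm (G k) * (1/3) ^ k = a * ((2/3) * onorm (G k) * norm u)" using u0 by (simp add: a_def)
      also have "\<dots> \<le> a * norm (G k u)" using u a by (intro mult_left_mono) auto
      also have "\<dots> = norm (G k (a *\<^sub>R u))" using a G(1)[of k] by (simp add: linear_simps)
      finally show ?thesis .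
    qed
    ultimately show ?thesis by blast
  qed
  then obtain \<xi> where \<xi>: "\<And>k. norm (\<xi> k) = (1/3) ^ k" "\<And>k. (2/3) * onorm (G k) * (1/3) ^ k \<le> norm (G k (\<xi> k))" by metis
  \<comment> \<open>The sign is chosen greedily: of G(x + \<xi>) and G(x - \<xi>), whose difference
    is 2 G \<xi>, the larger has norm at least that of G \<xi>.\<close>
  define x where "x = rec_nat 0 (\<lambda>k y. if norm (G k (y - \<xi> k)) \<le> norm (G k (y + \<xi> k)) then y + \<xi> k else y - \<xi> k)"
  have xs: "x (Suc k) = (if norm (G k (x k - \<xi> k)) \<le> norm (G k (x k + \<xi> k)) then x k + \<xi> k else x k - \<xi> k)" for k
    by (simp add: x_def)
  define d where "d k = x (Suc k) - x k" for k
  have nd: "norm (d k) = (1/3) ^ k" for k unfolding d_def xs using \<xi>(1)[of k] by auto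
  have xsum: "x n = (\<Sum>k<n. d k)" for n by (induction n) (auto simp: d_def x_def)
  have Gx: "(2/3) * onorm (G k) * (1/3) ^ k \<le> norm (G k (x (Suc k)))" for k
  proof -
    have "2 *\<^sub>R G k (\<xi> k) = G k (x k + \<xi> k) - G k (x k - \<xi> k)" using G(1)[of k] by (simp add: linear_simps scaleR_2)
    then have "2 * norm (G k (\<xi> k)) = norm (G k (x k + \<xi> k) - G k (x k - \<xi> k))" by (metis norm_scaleR abs_numeral)
    also have "\<dots> \<le> norm (G k (x k + \<xi> k)) + norm (G k (x k - \<xi> k))" by (rule norm_triangle_ineq4)
    finally have "norm (G k (\<xi> k)) \<le> norm (G k (x (Suc k)))" unfolding xs by auto
    then show ?thesis using \<xi>(2)[of k] by linarith
  qed
  have sm: "summable d" by (rule summable_norm_cancel) (simp add: nd summable_geometric)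
  define y where "y = suminf d"
  have tail: "norm (y - x (Suc k)) \<le> (1/2) * (1/3) ^ k" for k
  proof -
    have "y - x (Suc k) = (\<Sum>j. d (j + Suc k))" unfolding y_def xsum using suminf_minus_initial_segment[OF sm, of "Suc k"] by simp
    also have "norm \<dots> \<le> (\<Sum>j. norm (d (j + Suc k)))"
      by (rule summable_norm) (auto simp: nd power_add intro!: summable_mult2 summable_geometric)
    also have "\<dots> = (\<Sum>j. (1/3) ^ j) * ((1/3) ^ Suc k)"
      unfolding nd power_add by (rule suminf_mult2[symmetric]) (auto intro: summable_geometric)
    also have "(\<Sum>j. (1/3::real) ^ j) = 3/2" by (subst suminf_geometric) auto
    finally show ?thesis by simp
  qed
  \<comment> \<open>In units of the operator norm times 3^(-k), the hump contributes 2/3 and the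
    later ones take back at most 1/2, hence the factor 1/6.\<close>
  have low: "(1/6) * (4/3) ^ k \<le> norm (G k y)" for k
  proof -
    have "norm (G k (x (Suc k))) \<le> norm (G k y) + norm (G k (y - x (Suc k)))"
      using norm_triangle_ineq4[of "G k y" "G k (y - x (Suc k))"] G(1)[of k] by (simp add: linear_simps)
    also have "norm (G k (y - x (Suc k))) \<le> onorm (G k) * ((1/2) * (1/3) ^ k)"
      using onorm[OF G(1)[of k], of "y - x (Suc k)"] mult_left_mono[OF tail[of k], of "onorm (G k)"] on[of k] by linarith
    finally have "(1/6) * (onorm (G k) * (1/3) ^ k) \<le> norm (G k y)" using Gx[of k] by (simp add: algebra_simps)
    moreover have "4 ^ k * (1/3::real) ^ k \<le> onorm (G k) * (1/3) ^ k" using G(2)[of k] by (intro mult_right_mono) auto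
    moreover have "4 ^ k * (1/3::real) ^ k = (4/3) ^ k" by (simp add: power_mult_distrib[symmetric])
    ultimately show ?thesis by linarith
  qed
  obtain K where K: "\<And>n. norm (F n y) \<le> K" using pw[of y] by blast
  obtain k where "6 * K < (4/3::real) ^ k" using real_arch_pow[of "4/3::real" "6 * K"] by auto
  then show False using low[of k] K[of "N k"] by (simp add: G_def)
qed

text \<open>Counterpart of \<open>semigroup_generated_by\<close> on a normed space, where a
  vanishing seminorm of a difference becomes equality. Only real linearity is recorded.\<close>

definition generates :: "(real \<Rightarrow> 'h \<Rightarrow> 'h) \<Rightarrow> 'h::real_normed_vector set \<Rightarrow> ('h \<Rightarrow> 'h) \<Rightarrow> bool" where
  "generates T D A \<longleftrightarrow> (\<forall>t\<ge>0. bounded_linear (T t)) \<and> (\<forall>z. T 0 z = z) \<and>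
     (\<forall>t\<ge>0. \<forall>r\<ge>0. \<forall>z. T (t + r) z = T t (T r z)) \<and>
     (\<forall>z. ((\<lambda>t. T t z) \<longlongrightarrow> z) (at_right 0)) \<and>
     (\<forall>z. z \<in> D \<longleftrightarrow> (\<exists>y. ((\<lambda>h. (1/h) *\<^sub>R (T h z - z)) \<longlongrightarrow> y) (at_right 0))) \<and>
     (\<forall>z\<in>D. ((\<lambda>h. (1/h) *\<^sub>R (T h z - z)) \<longlongrightarrow> A z) (at_right 0))"

lemma at_right_0D:
  fixes f :: "real \<Rightarrow> 'b::real_normed_vector"
  assumes "(f \<longlongrightarrow> l) (at_right 0)" "e > 0"
  obtains d where "d > 0" "\<And>h. 0 < h \<Longrightarrow> h < d \<Longrightarrow> norm (f h - l) < e"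
  using tendstoD[OF assms] unfolding eventually_at_right_field dist_norm by auto

lemma has_vector_derivative_quotientI:
  fixes f :: "real \<Rightarrow> 'b::real_normed_vector"
  assumes "\<And>e. e > 0 \<Longrightarrow> \<exists>d>0. \<forall>r\<in>S. r \<noteq> t \<and> \<bar>r - t\<bar> < d \<longrightarrow> norm ((1 / (r - t)) *\<^sub>R (f r - f t) - D) \<le> e"
  shows "(f has_vector_derivative D) (at t within S)" unfolding has_vector_derivative_def has_derivative_within_alt
proof (intro conjI allI impI)
  show "bounded_linear (\<lambda>x. x *\<^sub>R D)" by (rule bounded_linear_scaleR_left)
  fix e :: real assume "e > 0"
  from assms[OF this] obtain d where d: "d > 0" "\<forall>r\<in>S. r \<noteq> t \<and> \<bar>r - t\<bar> < d \<longrightarrow> norm ((1 / (r - t)) *\<^sub>R (f r - f t) - D) \<le> e" by blast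
  show "\<exists>d>0. \<forall>y\<in>S. norm (y - t) < d \<longrightarrow> norm (f y - f t - (y - t) *\<^sub>R D) \<le> e * norm (y - t)"
  proof (intro exI[of _ d] conjI d ballI impI)
    fix y assume y: "y \<in> S" "norm (y - t) < d"
    show "norm (f y - f t - (y - t) *\<^sub>R D) \<le> e * norm (y - t)"
    proof (cases "y = t")
      case False
      have "f y - f t - (y - t) *\<^sub>R D = (y - t) *\<^sub>R ((1 / (y - t)) *\<^sub>R (f y - f t) - D)"
        using False by (simp add: scaleR_right_diff_distrib)
      then have "norm (f y - f t - (y - t) *\<^sub>R D) = \<bar>y - t\<bar> * norm ((1 / (y - t)) *\<^sub>R (f y - f t) - D)" by simp
      also have "\<dots> \<le> \<bar>y - t\<bar> * e" using d(2) y False by (intro mult_left_mono) auto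
      finally show ?thesis by (simp add: mult.commute)
    qed simp
  qed
qed

locale C0_semigroup =
  fixes T :: "real \<Rightarrow> 'h \<Rightarrow> 'h::{real_inner, banach}" and D A
  assumes gen: "generates T D A"
begin

lemma bl: "0 \<le> t \<Longrightarrow> bounded_linear (T t)" and T0: "T 0 z = z"
  and Tadd: "0 \<le> t \<Longrightarrow> 0 \<le> r \<Longrightarrow> T (t + r) z = T t (T r z)"
  and Tlim: "((\<lambda>t. T t z) \<longlongrightarrow> z) (at_right 0)"
  and Diff: "z \<in> D \<longleftrightarrow> (\<exists>y. ((\<lambda>h. (1/h) *\<^sub>R (T h z - z)) \<longlongrightarrow> y) (at_right 0))"
  and Dlim: "z \<in> D \<Longrightarrow> ((\<lambda>h. (1/h) *\<^sub>R (T h z - z)) \<longlongrightarrow> A z) (at_right 0)"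
  using gen unfolding generates_def by blast+

text \<open>A failure would give times h n tending to 0 with operator norms beyond n, against
  uniform boundedness: each orbit converges along these times by right continuity at 0.\<close>

lemma local_bound: "\<exists>\<delta>>0. \<exists>K. \<forall>h. 0 \<le> h \<and> h \<le> \<delta> \<longrightarrow> (\<forall>z. norm (T h z) \<le> K * norm z)"
proof (rule ccontr)
  assume "\<not> ?thesis"
  then have "\<exists>h. 0 \<le> h \<and> h \<le> 1 / real (Suc n) \<and> (\<exists>z. \<not> norm (T h z) \<le> real n * norm z)" for n
    by (metis of_nat_0_less_iff zero_less_Suc zero_less_divide_1_iff)
  then obtain h where h: "\<And>n. 0 \<le> h n" "\<And>n. h n \<le> 1 / real (Suc n)" "\<And>n. \<exists>z. \<not> norm (T (h n) z) \<le> real n * norm z" by metis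
  have h0: "h \<longlonglongrightarrow> 0"
    by (rule tendsto_sandwich[OF _ _ tendsto_const LIMSEQ_inverse_real_of_nat[unfolded inverse_eq_divide]]) (use h in auto)
  have "\<exists>K. \<forall>n. norm (T (h n) z) \<le> K" for z
  proof -
    have "(\<lambda>n. T (h n) z) \<longlonglongrightarrow> z"
    proof (rule LIMSEQ_I)
      fix e :: real assume e: "e > 0"
      obtain d where d: "d > 0" "\<And>h. 0 < h \<Longrightarrow> h < d \<Longrightarrow> norm (T h z - z) < e" using at_right_0D[OF Tlim e] by metis
      obtain N where N: "\<forall>n\<ge>N. norm (h n - 0) < d" using LIMSEQ_D[OF h0 d(1)] by blast
      have "norm (T (h n) z - z) < e" if "n \<ge> N" for n
      proof (cases "h n = 0")
        case False then show ?thesis using N that h(1)[of n] by (intro d(2)) auto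
      qed (use e in \<open>simp add: T0\<close>)
      then show "\<exists>no. \<forall>n\<ge>no. norm (T (h n) z - z) < e" by blast
    qed
    then have "Bseq (\<lambda>n. T (h n) z)" by (intro convergent_imp_Bseq) (auto simp: convergent_def)
    then show ?thesis by (auto simp: Bseq_def)
  qed
  from uniform_boundedness[of "\<lambda>n. T (h n)", OF bl[OF h(1)] this]
  obtain K where K: "\<And>n. onorm (T (h n)) \<le> K" by blast
  obtain n where n: "K \<le> real n" using real_arch_simple by blast
  have "norm (T (h n) z) \<le> real n * norm z" for z
  proof -
    have "norm (T (h n) z) \<le> onorm (T (h n)) * norm z" by (rule onorm[OF bl[OF h(1)]])
    also have "\<dots> \<le> real n * norm z" using K[of n] n by (intro mult_right_mono) auto
    finally show ?thesis .
  qed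
  then show False using h(3)[of n] by blast
qed

lemma bound_on: "\<exists>K\<ge>0. \<forall>t. 0 \<le> t \<and> t \<le> \<tau> \<longrightarrow> (\<forall>z. norm (T t z) \<le> K * norm z)"
proof -
  obtain \<delta> K where d: "\<delta> > 0" "\<And>h z. 0 \<le> h \<Longrightarrow> h \<le> \<delta> \<Longrightarrow> norm (T h z) \<le> K * norm z" using local_bound by blast
  define K' where "K' = max K 1"
  have K': "K' \<ge> 1" "\<And>h z. 0 \<le> h \<Longrightarrow> h \<le> \<delta> \<Longrightarrow> norm (T h z) \<le> K' * norm z"
    by (auto simp: K'_def intro!: order_trans[OF d(2)] mult_right_mono)
  have ind: "\<forall>t. 0 \<le> t \<and> t \<le> real n * \<delta> \<longrightarrow> (\<forall>z. norm (T t z) \<le> K' ^ n * norm z)" for n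
  proof (induction n)
    case (Suc n)
    show ?case
    proof (intro allI impI)
      fix t z assume t: "0 \<le> t \<and> t \<le> real (Suc n) * \<delta>"
      show "norm (T t z) \<le> K' ^ Suc n * norm z"
      proof (cases "t \<le> \<delta>")
        case True
        have "norm (T t z) \<le> K' * norm z" using K'(2) t True by blast
        also have "\<dots> \<le> K' ^ Suc n * norm z" using K'(1) power_increasing[of 1 "Suc n" K'] by (intro mult_right_mono) auto
        finally show ?thesis .
      next
        case False
        have t1: "0 \<le> t - \<delta>" "t - \<delta> \<le> real n * \<delta>" using False t by (auto simp: algebra_simps)
        have "T t z = T \<delta> (T (t - \<delta>) z)" using Tadd[of \<delta> "t - \<delta>" z] d(1) t1 by simp
        then have "norm (T t z) \<le> K' * norm (T (t - \<delta>) z)" using K'(2)[of \<delta>] d(1) by simp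
        also have "\<dots> \<le> K' * (K' ^ n * norm z)" using Suc.IH t1 K'(1) by (intro mult_left_mono) auto
        finally show ?thesis by simp
      qed
    qed
  next
    case 0
    show ?case
    proof (intro allI impI)
      fix t z assume "0 \<le> t \<and> t \<le> real 0 * \<delta>"
      then have "t = 0" by simp
      then show "norm (T t z) \<le> K' ^ 0 * norm z" by (simp add: T0)
    qed
  qed
  obtain n :: nat where n: "\<tau> / \<delta> \<le> real n" using real_arch_simple by blast
  have "\<tau> \<le> real n * \<delta>" using n d(1) by (simp add: pos_divide_le_eq)
  then show ?thesis using ind[of n] K'(1) by (intro exI[of _ "K' ^ n"]) auto
qed

text \<open>Right continuity at 0 gives two-sided continuity because increments are always factored
  through the earlier of the two times.\<close>

lemma cont: "continuous_on {0..} (\<lambda>t. T t z)" unfolding continuous_on_iff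
proof (intro ballI allI impI)
  fix t e :: real assume t: "t \<in> {0..}" and e: "e > 0"
  obtain K where K: "K \<ge> 0" "\<And>r z. 0 \<le> r \<Longrightarrow> r \<le> t + 1 \<Longrightarrow> norm (T r z) \<le> K * norm z" using bound_on[of "t + 1"] by blast
  have "e / (K + 1) > 0" using e K by simp
  then obtain d where d: "d > 0" "\<And>h. 0 < h \<Longrightarrow> h < d \<Longrightarrow> norm (T h z - z) < e / (K + 1)" using at_right_0D[OF Tlim] by metis
  have key: "norm (T b z - T a z) < e" if ab: "0 \<le> a" "a < b" "b - a < d" "a \<le> t + 1" for a b
  proof -
    have "T b z - T a z = T a (T (b - a) z - z)" using Tadd[of a "b - a" z] ab linear_simps(2)[OF bl[of a]] by simp
    then have "norm (T b z - T a z) \<le> K * norm (T (b - a) z - z)" using K(2) ab by simp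
    also have "\<dots> \<le> K * (e / (K + 1))" using K(1) d(2)[of "b - a"] ab by (intro mult_left_mono) auto
    also have "\<dots> < e" using K(1) e by (simp add: field_simps)
    finally show ?thesis .
  qed
  show "\<exists>d>0. \<forall>x'\<in>{0..}. dist x' t < d \<longrightarrow> dist (T x' z) (T t z) < e"
  proof (intro exI[of _ "min d 1"] conjI ballI impI)
    fix r assume r: "r \<in> {0..}" "dist r t < min d 1"
    show "dist (T r z) (T t z) < e"
    proof (cases r t rule: linorder_cases)
      case less then show ?thesis using key[of r t] r t by (auto simp: dist_norm norm_minus_commute)
    next
      case equal then show ?thesis using e by simp
    next
      case greater then show ?thesis using key[of t r] r t by (auto simp: dist_norm)
    qed
  qed (use d in auto)
qed

lemma D_invariant:
  assumes z: "z \<in> D" and t: "0 \<le> t" shows "T t z \<in> D" "A (T t z) = T t (A z)"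
proof -
  have "((\<lambda>h. T t ((1/h) *\<^sub>R (T h z - z))) \<longlongrightarrow> T t (A z)) (at_right 0)"
    by (rule bounded_linear.tendsto[OF bl[OF t] Dlim[OF z]])
  moreover have "\<forall>\<^sub>F h in at_right 0. T t ((1/h) *\<^sub>R (T h z - z)) = (1/h) *\<^sub>R (T h (T t z) - T t z)"
  proof -
    have "T t ((1/h) *\<^sub>R (T h z - z)) = (1/h) *\<^sub>R (T h (T t z) - T t z)" if "h > 0" for h
      using Tadd[of t h z] Tadd[of h t z] t that by (simp add: linear_simps[OF bl[OF t]] add.commute)
    then show ?thesis by (simp add: eventually_at_filter)
  qed
  ultimately have *: "((\<lambda>h. (1/h) *\<^sub>R (T h (T t z) - T t z)) \<longlongrightarrow> T t (A z)) (at_right 0)"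
    by (rule Lim_transform_eventually)
  then show "T t z \<in> D" unfolding Diff by blast
  then show "A (T t z) = T t (A z)" using tendsto_unique[OF _ Dlim *] by simp
qed

text \<open>The left difference quotient at t is the right quotient at an earlier time r, which is
  \<open>T r\<close> applied to a quotient at 0; local boundedness and the continuity of
  \<open>T r (A z)\<close> in r finish the argument.\<close>

lemma deriv:
  assumes z: "z \<in> D" and t: "0 \<le> t" shows "((\<lambda>t. T t z) has_vector_derivative T t (A z)) (at t within {0..})"
proof (rule has_vector_derivative_quotientI)
  fix e :: real assume e: "e > 0"
  obtain K where K: "K \<ge> 0" "\<And>r z. 0 \<le> r \<Longrightarrow> r \<le> t + 1 \<Longrightarrow> norm (T r z) \<le> K * norm z" using bound_on[of "t + 1"] by blast
  have e1: "e / (2 * (K + 1)) > 0" using e K by simp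
  obtain d1 where d1: "d1 > 0" "\<And>h. 0 < h \<Longrightarrow> h < d1 \<Longrightarrow> norm ((1/h) *\<^sub>R (T h z - z) - A z) < e / (2 * (K + 1))"
    using at_right_0D[OF Dlim[OF z] e1] by metis
  obtain d2 where d2: "d2 > 0" "\<And>r. 0 \<le> r \<Longrightarrow> dist r t < d2 \<Longrightarrow> dist (T r (A z)) (T t (A z)) < e / 2"
    using cont[of "A z", unfolded continuous_on_iff, rule_format, of t "e/2"] t e by auto
  have key: "norm ((1 / (b - a)) *\<^sub>R (T b z - T a z) - T a (A z)) \<le> e / 2" if ab: "0 \<le> a" "a < b" "b - a < d1" "a \<le> t + 1" for a b
  proof -
    have "(1 / (b - a)) *\<^sub>R (T b z - T a z) - T a (A z) = T a ((1 / (b - a)) *\<^sub>R (T (b - a) z - z) - A z)"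
      using Tadd[of a "b - a" z] ab by (simp add: linear_simps[OF bl[OF ab(1)]])
    then have "norm ((1 / (b - a)) *\<^sub>R (T b z - T a z) - T a (A z)) \<le> K * norm ((1 / (b - a)) *\<^sub>R (T (b - a) z - z) - A z)"
      using K(2) ab by simp
    also have "\<dots> \<le> K * (e / (2 * (K + 1)))" using d1(2)[of "b - a"] ab K(1) by (intro mult_left_mono) auto
    also have "\<dots> \<le> e / 2" using K(1) e by (simp add: field_simps)
    finally show ?thesis .
  qed
  show "\<exists>d>0. \<forall>r\<in>{0..}. r \<noteq> t \<and> \<bar>r - t\<bar> < d \<longrightarrow> norm ((1 / (r - t)) *\<^sub>R (T r z - T t z) - T t (A z)) \<le> e"
  proof (intro exI[of _ "min 1 (min d1 d2)"] conjI ballI impI)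
    fix r assume r: "r \<in> {0..}" "r \<noteq> t \<and> \<bar>r - t\<bar> < min 1 (min d1 d2)"
    show "norm ((1 / (r - t)) *\<^sub>R (T r z - T t z) - T t (A z)) \<le> e"
    proof (cases "t < r")
      case True
      then have "norm ((1 / (r - t)) *\<^sub>R (T r z - T t z) - T t (A z)) \<le> e / 2" using r t by (intro key) auto
      then show ?thesis using e by linarith
    next
      case False
      have eq: "(1 / (r - t)) *\<^sub>R (T r z - T t z) = (1 / (t - r)) *\<^sub>R (T t z - T r z)"
      proof -
        have "1 / (r - t) = - (1 / (t - r))" by (metis minus_diff_eq minus_divide_right)
        then show ?thesis by (simp add: scaleR_right_diff_distrib)
      qed
      have "norm ((1 / (r - t)) *\<^sub>R (T r z - T t z) - T t (A z)) \<le> norm ((1 / (t - r)) *\<^sub>R (T t z - T r z) - T r (A z)) + norm (T r (A z) - T t (A z))"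
        unfolding eq using norm_triangle_ineq[of "(1 / (t - r)) *\<^sub>R (T t z - T r z) - T r (A z)" "T r (A z) - T t (A z)"] by simp
      also have "norm ((1 / (t - r)) *\<^sub>R (T t z - T r z) - T r (A z)) \<le> e / 2" using r t False by (intro key) auto
      also have "norm (T r (A z) - T t (A z)) \<le> e / 2" using d2(2)[of r] r by (auto simp: dist_norm)
      finally show ?thesis by simp
    qed
  qed (use d1 d2 in auto)
qed

end

lemma has_vector_derivative_nonpos_antimono:
  fixes f :: "real \<Rightarrow> real"
  assumes d: "\<And>t. t \<in> {a..b} \<Longrightarrow> (f has_vector_derivative f' t) (at t within {a..b})"
    and n: "\<And>t. t \<in> {a..b} \<Longrightarrow> f' t \<le> 0" and ab: "a \<le> b" shows "f b \<le> f a"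
proof -
  have "(f' has_integral f b - f a) {a..b}" by (rule fundamental_theorem_of_calculus[OF ab d])
  then have "f b - f a \<le> 0" by (rule has_integral_le[OF _ has_integral_0]) (rule n)
  then show ?thesis by simp
qed

locale dissipative_semigroup = C0_semigroup +
  assumes dissip: "z \<in> D \<Longrightarrow> A z \<bullet> z \<le> 0" and dense: "closure D = UNIV"
begin

lemma energy_deriv:
  assumes z: "z \<in> D" and t: "0 \<le> t"
  shows "((\<lambda>t. (norm (T t z))\<^sup>2) has_vector_derivative 2 * (A (T t z) \<bullet> T t z)) (at t within {0..})"
  using bounded_bilinear.has_vector_derivative[OF bounded_bilinear_inner deriv[OF z t] deriv[OF z t]]
  unfolding power2_norm_eq_inner D_invariant(2)[OF z t] by (simp add: inner_commute)

lemma contraction: "0 \<le> t \<Longrightarrow> norm (T t z) \<le> norm z"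
proof -
  assume t: "0 \<le> t"
  have D: "norm (T t z) \<le> norm z" if z: "z \<in> D" for z
  proof -
    have "(norm (T t z))\<^sup>2 \<le> (norm (T 0 z))\<^sup>2"
    proof (rule has_vector_derivative_nonpos_antimono[OF _ _ t])
      show "((\<lambda>t. (norm (T t z))\<^sup>2) has_vector_derivative 2 * (A (T r z) \<bullet> T r z)) (at r within {0..t})" if "r \<in> {0..t}" for r
        by (rule has_vector_derivative_within_subset[OF energy_deriv[OF z]]) (use that in auto)
      show "2 * (A (T r z) \<bullet> T r z) \<le> 0" if "r \<in> {0..t}" for r using dissip[OF D_invariant(1)[OF z, of r]] that by simp
    qed
    then show ?thesis by (simp add: T0)
  qed
  have "closed {z. norm (T t z) \<le> norm z}" by (intro closed_Collect_le continuous_intros linear_continuous_on[OF bl[OF t]])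
  then have "closure D \<subseteq> {z. norm (T t z) \<le> norm z}" by (rule closure_minimal[rotated]) (use D in auto)
  then show ?thesis using dense by auto
qed

end

section \<open>Bounded perturbations of isometric groups\<close>

text \<open>Provides the existence of the damped semigroup. The group property allows Duhamel's
  integral to be written with \<open>S (- r)\<close> inside, so that the integrand does not depend
  on the upper limit.\<close>

locale perturbed_group =
  fixes S :: "real \<Rightarrow> 'h \<Rightarrow> 'h::{real_inner, banach}" and D and A0 B :: "'h \<Rightarrow> 'h"
  assumes S_bl: "bounded_linear (S t)" and S0: "S 0 z = z" and S_add: "S (t + r) z = S t (S r z)"
    and S_norm: "norm (S t z) = norm z" and S_cont: "continuous_on UNIV (\<lambda>t. S t z)"
    and S_diff: "z \<in> D \<longleftrightarrow> (\<exists>y. ((\<lambda>h. (1/h) *\<^sub>R (S h z - z)) \<longlongrightarrow> y) (at_right 0))"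
    and S_lim: "z \<in> D \<Longrightarrow> ((\<lambda>h. (1/h) *\<^sub>R (S h z - z)) \<longlongrightarrow> A0 z) (at_right 0)"
    and B_bl: "bounded_linear B"
begin

lemma S_tendsto:
  assumes t: "(t \<longlongrightarrow> t0) F" and f: "(f \<longlongrightarrow> f0) F"
  shows "((\<lambda>x. S (t x) (f x)) \<longlongrightarrow> S t0 f0) F"
proof (rule LIM_zero_cancel, rule Lim_null_comparison)
  have "((\<lambda>x. S (t x) f0) \<longlongrightarrow> S t0 f0) F"
    by (rule tendsto_compose[OF _ t]) (use S_cont in \<open>simp add: continuous_on_eq_continuous_at isCont_def\<close>)
  then show "((\<lambda>x. norm (f x - f0) + norm (S (t x) f0 - S t0 f0)) \<longlongrightarrow> 0) F"
    using f by (auto intro!: tendsto_add_zero tendsto_norm_zero simp: LIM_zero)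
  have "norm (S (t x) (f x) - S t0 f0) \<le> norm (f x - f0) + norm (S (t x) f0 - S t0 f0)" for x
  proof -
    have "S (t x) (f x) - S t0 f0 = S (t x) (f x - f0) + (S (t x) f0 - S t0 f0)" by (simp add: linear_simps[OF S_bl])
    then show ?thesis by (simp only:) (rule order_trans[OF norm_triangle_ineq], simp add: S_norm)
  qed
  then show "\<forall>\<^sub>F x in F. norm (S (t x) (f x) - S t0 f0) \<le> norm (f x - f0) + norm (S (t x) f0 - S t0 f0)" by simp
qed

lemma S_continuous_on:
  "continuous_on I t \<Longrightarrow> continuous_on I f \<Longrightarrow> continuous_on I (\<lambda>x. S (t x) (f x))"
  unfolding continuous_on_def by (auto intro: S_tendsto)

lemma B_continuous_on: "continuous_on I f \<Longrightarrow> continuous_on I (\<lambda>x. B (f x))" by (rule bounded_linear.continuous_on[OF B_bl])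

text \<open>Weight for the norm sup exp(-\<beta> t) |X t|, in which the Volterra operator contracts
  by 1/2. The summand 1 keeps \<beta> positive even for B = 0.\<close>

definition \<beta> where "\<beta> = 2 * onorm B + 1"

lemma \<beta>: "\<beta> > 0" "2 * onorm B \<le> \<beta>" using onorm_pos_le[OF B_bl] by (auto simp: \<beta>_def)

lemma volterra_bound:
  assumes g: "continuous_on {0..t} g" and C: "\<And>r. 0 \<le> r \<Longrightarrow> r \<le> t \<Longrightarrow> norm (g r) \<le> C * exp (\<beta> * r)" and t: "0 \<le> t"
  shows "norm (integral {0..t} (\<lambda>r. S (- r) (B (g r)))) \<le> C / 2 * exp (\<beta> * t)"
proof -
  have C0: "0 \<le> C" using C[of 0] t norm_ge_zero[of "g 0"] by (simp del: norm_ge_zero)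
  have I: "((\<lambda>r. onorm B * C * exp (\<beta> * r)) has_integral (onorm B * C * (exp (\<beta> * t) / \<beta>) - onorm B * C * (exp (\<beta> * 0) / \<beta>))) {0..t}"
    by (rule fundamental_theorem_of_calculus[OF t])
       (use \<beta> in \<open>auto intro!: derivative_eq_intros simp flip: has_real_derivative_iff_has_vector_derivative\<close>)
  have "norm (integral {0..t} (\<lambda>r. S (- r) (B (g r)))) \<le> integral {0..t} (\<lambda>r. onorm B * C * exp (\<beta> * r))"
  proof (rule integral_norm_bound_integral)
    show "(\<lambda>r. S (- r) (B (g r))) integrable_on {0..t}"
      by (intro integrable_continuous_interval S_continuous_on B_continuous_on g continuous_intros)
    show "(\<lambda>r. onorm B * C * exp (\<beta> * r)) integrable_on {0..t}" using I by blast
    show "norm (S (- r) (B (g r))) \<le> onorm B * C * exp (\<beta> * r)" if "r \<in> {0..t}" for r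
    proof -
      have "norm (B (g r)) \<le> onorm B * norm (g r)" by (rule onorm[OF B_bl])
      also have "\<dots> \<le> onorm B * (C * exp (\<beta> * r))" using C[of r] that onorm_pos_le[OF B_bl] by (intro mult_left_mono) auto
      finally show ?thesis by (simp add: S_norm)
    qed
  qed
  also have "\<dots> = onorm B * C * (exp (\<beta> * t) / \<beta>) - onorm B * C * (exp (\<beta> * 0) / \<beta>)" using I by (rule integral_unique)
  also have "\<dots> \<le> onorm B * C * (exp (\<beta> * t) / \<beta>)" using C0 \<beta> onorm_pos_le[OF B_bl] by simp
  also have "\<dots> = (onorm B / \<beta>) * (C * exp (\<beta> * t))" by simp
  also have "\<dots> \<le> (1/2) * (C * exp (\<beta> * t))" using \<beta> C0 by (intro mult_right_mono) (auto simp: divide_le_eq)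
  finally show ?thesis by simp
qed

text \<open>Variation of constants. The growth bound makes uniqueness follow from iterating the
  contraction.\<close>

definition sol :: "'h \<Rightarrow> (real \<Rightarrow> 'h) \<Rightarrow> bool" where
  "sol x X \<longleftrightarrow> continuous_on {0..} X \<and> (\<exists>C. \<forall>t\<ge>0. norm (X t) \<le> C * exp (\<beta> * t)) \<and>
     (\<forall>t\<ge>0. X t = S t (x + integral {0..t} (\<lambda>r. S (- r) (B (X r)))))"

lemma integrand_integrable:
  "continuous_on {a..b} X \<Longrightarrow> (\<lambda>r. S (- r) (B (X r))) integrable_on {a..b}"
  by (intro integrable_continuous_interval S_continuous_on B_continuous_on continuous_intros)

lemma sol_unique:
  assumes "sol x X" "sol x Y" and t: "0 \<le> t" shows "X t = Y t"
proof -
  obtain C1 C2 where C: "\<And>t. t \<ge> 0 \<Longrightarrow> norm (X t) \<le> C1 * exp (\<beta> * t)" "\<And>t. t \<ge> 0 \<Longrightarrow> norm (Y t) \<le> C2 * exp (\<beta> * t)"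
    using assms unfolding sol_def by blast
  have cX: "continuous_on {0..t} X" and cY: "continuous_on {0..t} Y" for t using assms unfolding sol_def by (auto intro: continuous_on_subset)
  have "norm (X t - Y t) \<le> (C1 + C2) * (1/2) ^ n * exp (\<beta> * t)" if "t \<ge> 0" for n t using that
  proof (induction n arbitrary: t)
    case 0
    show ?case using C[OF 0] norm_triangle_ineq4[of "X t" "Y t"] by (simp add: distrib_right)
  next
    case (Suc n)
    have "X t - Y t = S t (integral {0..t} (\<lambda>r. S (- r) (B (X r)))) - S t (integral {0..t} (\<lambda>r. S (- r) (B (Y r))))"
      using assms Suc.prems unfolding sol_def by (simp add: linear_simps[OF S_bl])
    also have "\<dots> = S t (integral {0..t} (\<lambda>r. S (- r) (B (X r)) - S (- r) (B (Y r))))"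
      by (simp add: linear_simps[OF S_bl] integral_diff integrand_integrable cX cY)
    also have "\<dots> = S t (integral {0..t} (\<lambda>r. S (- r) (B (X r - Y r))))" by (simp add: linear_simps[OF S_bl] linear_simps[OF B_bl])
    finally have "norm (X t - Y t) = norm (integral {0..t} (\<lambda>r. S (- r) (B (X r - Y r))))" by (simp add: S_norm)
    also have "\<dots> \<le> (C1 + C2) * (1/2) ^ n / 2 * exp (\<beta> * t)"
      by (rule volterra_bound) (use Suc in \<open>auto intro!: continuous_intros cX cY\<close>)
    finally show ?case by simp
  qed
  note b = this[OF t]
  have "(\<lambda>n. (C1 + C2) * (1/2) ^ n * exp (\<beta> * t)) \<longlonglongrightarrow> (C1 + C2) * 0 * exp (\<beta> * t)"
    by (intro tendsto_intros LIMSEQ_power_zero) auto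
  then have "norm (X t - Y t) \<le> (C1 + C2) * 0 * exp (\<beta> * t)" by (rule LIMSEQ_le_const) (use b in auto)
  then show ?thesis by simp
qed

lemma continuous_integral_max:
  fixes g :: "real \<Rightarrow> 'h"
  assumes g: "continuous_on UNIV g" shows "continuous_on UNIV (\<lambda>t. integral {0..max 0 t} g)"
  unfolding continuous_on_eq_continuous_at[OF open_UNIV]
proof
  fix t :: real
  have "continuous_on {0..\<bar>t\<bar>+1} (\<lambda>u. integral {0..u} g)"
    by (intro indefinite_integral_continuous_1 integrable_continuous_interval continuous_on_subset[OF g]) auto
  then have "continuous_on {..<\<bar>t\<bar>+1} (\<lambda>t. integral {0..max 0 t} g)"
    by (rule continuous_on_compose2[of _ _ _ "\<lambda>t. max 0 t"]) (auto intro!: continuous_intros)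
  then show "isCont (\<lambda>t. integral {0..max 0 t} g) t" by (auto simp: continuous_on_eq_continuous_at[OF open_lessThan])
qed

text \<open>Banach's fixed point theorem for Z t = exp(-\<beta> t) X t among bounded continuous
  functions. These live on the whole line, so the map is frozen for negative times by
  \<open>max 0 t\<close>.\<close>

lemma sol_exists: "\<exists>X. sol x X \<and> (\<forall>t\<ge>0. norm (X t) \<le> 2 * norm x * exp (\<beta> * t))"
proof -
  define g where "g Z r = exp (\<beta> * r) *\<^sub>R apply_bcontfun Z r" for Z :: "real \<Rightarrow>\<^sub>C 'h" and r
  have gc: "continuous_on I (g Z)" for Z I unfolding g_def by (intro continuous_intros continuous_on_apply_bcontfun)
  have gn: "norm (g Z r) \<le> norm Z * exp (\<beta> * r)" for Z r unfolding g_def using norm_bounded[of Z r] by simp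
  define F where "F Z t = exp (- \<beta> * max 0 t) *\<^sub>R S (max 0 t) (x + integral {0..max 0 t} (\<lambda>r. S (- r) (B (g Z r))))" for Z t
  have Fc: "continuous_on UNIV (F Z)" for Z unfolding F_def by (intro continuous_intros S_continuous_on continuous_integral_max B_continuous_on gc)
  have Fb: "norm (F Z t) \<le> norm x + norm Z / 2" for Z t
  proof -
    have "norm (F Z t) = exp (- \<beta> * max 0 t) * norm (x + integral {0..max 0 t} (\<lambda>r. S (- r) (B (g Z r))))" by (simp add: F_def S_norm)
    also have "\<dots> \<le> exp (- \<beta> * max 0 t) * (norm x + norm Z / 2 * exp (\<beta> * max 0 t))"
      by (intro mult_left_mono order_trans[OF norm_triangle_ineq] add_left_mono volterra_bound gc gn) auto
    also have "\<dots> = exp (- \<beta> * max 0 t) * norm x + norm Z / 2" by (simp add: distrib_left mult_exp_exp exp_minus)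
    also have "\<dots> \<le> norm x + norm Z / 2" using \<beta>(1) by (simp add: mult_left_le_one_le)
    finally show ?thesis .
  qed
  have Fbc: "F Z \<in> bcontfun" for Z using Fc Fb by (auto simp: bcontfun_def bounded_iff)
  define \<Phi> where "\<Phi> Z = Bcontfun (F Z)" for Z
  have app: "apply_bcontfun (\<Phi> Z) = F Z" for Z unfolding \<Phi>_def by (rule Bcontfun_inverse[OF Fbc])
  have "dist (\<Phi> Z) (\<Phi> Z') \<le> (1/2) * dist Z Z'" for Z Z'
  proof (rule dist_bound)
    fix t
    let ?I = "\<lambda>Z. integral {0..max 0 t} (\<lambda>r. S (- r) (B (g Z r)))"
    have "F Z t - F Z' t = exp (- \<beta> * max 0 t) *\<^sub>R S (max 0 t) (?I Z - ?I Z')"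
      by (simp add: F_def linear_simps[OF S_bl] scaleR_right_diff_distrib algebra_simps)
    also have "?I Z - ?I Z' = integral {0..max 0 t} (\<lambda>r. S (- r) (B (g Z r - g Z' r)))"
      by (simp add: integral_diff[symmetric] integrand_integrable gc linear_simps[OF S_bl] linear_simps[OF B_bl])
    finally have "norm (F Z t - F Z' t) = exp (- \<beta> * max 0 t) * norm (integral {0..max 0 t} (\<lambda>r. S (- r) (B (g Z r - g Z' r))))"
      by (simp add: S_norm)
    also have "\<dots> \<le> exp (- \<beta> * max 0 t) * (dist Z Z' / 2 * exp (\<beta> * max 0 t))"
    proof (intro mult_left_mono volterra_bound continuous_on_diff gc)
      fix r
      have "norm (g Z r - g Z' r) = exp (\<beta> * r) * dist (apply_bcontfun Z r) (apply_bcontfun Z' r)"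
        by (simp add: g_def dist_norm flip: scaleR_right_diff_distrib)
      also have "\<dots> \<le> exp (\<beta> * r) * dist Z Z'" by (intro mult_left_mono dist_bounded) auto
      finally show "norm (g Z r - g Z' r) \<le> dist Z Z' * exp (\<beta> * r)" by (simp add: mult.commute)
    qed auto
    also have "\<dots> = (1/2) * dist Z Z'" by (simp add: exp_minus)
    finally show "dist (apply_bcontfun (\<Phi> Z) t) (apply_bcontfun (\<Phi> Z') t) \<le> (1/2) * dist Z Z'" by (simp add: app dist_norm)
  qed
  then have "\<exists>!Z. \<Phi> Z = Z" by (intro banach_fix_type[of "1/2"]) auto
  then obtain Z where Z: "\<Phi> Z = Z" by blast
  have Zt: "apply_bcontfun Z t = F Z t" for t using app[of Z] Z by simp
  have nZ: "norm Z \<le> 2 * norm x"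
  proof -
    have "norm Z \<le> norm x + norm Z / 2" by (rule norm_bound) (simp only: Zt Fb)
    then show ?thesis by simp
  qed
  define X where "X = g Z"
  have Xb: "norm (X t) \<le> 2 * norm x * exp (\<beta> * t)" for t unfolding X_def by (rule order_trans[OF gn mult_right_mono[OF nZ]]) simp
  have "X t = S t (x + integral {0..t} (\<lambda>r. S (- r) (B (X r))))" if "t \<ge> 0" for t
  proof -
    have "X t = exp (\<beta> * t) *\<^sub>R F Z t" unfolding X_def g_def Zt ..
    also have "\<dots> = S t (x + integral {0..t} (\<lambda>r. S (- r) (B (X r))))" using that by (simp add: F_def X_def exp_minus)
    finally show ?thesis .
  qed
  moreover have "continuous_on {0..} X" unfolding X_def by (rule gc)
  ultimately have "sol x X" unfolding sol_def using Xb by blast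
  then show ?thesis using Xb by blast
qed

definition T :: "real \<Rightarrow> 'h \<Rightarrow> 'h" where
  "T t x = (SOME X. sol x X) t"

lemma sol_T: "sol x (\<lambda>t. T t x)" unfolding T_def using someI_ex[of "sol x"] sol_exists[of x] by auto

lemma T_eq: "sol x X \<Longrightarrow> 0 \<le> t \<Longrightarrow> T t x = X t" using sol_unique[OF sol_T] by blast

lemma T_bound: "0 \<le> t \<Longrightarrow> norm (T t x) \<le> 2 * norm x * exp (\<beta> * t)" using sol_exists[of x] T_eq by metis

lemma sol_cont: "sol x X \<Longrightarrow> 0 \<le> a \<Longrightarrow> continuous_on {a..b} X" unfolding sol_def by (auto intro: continuous_on_subset)

lemma sol_add:
  assumes "sol x X" "sol y Y" shows "sol (x + y) (\<lambda>t. X t + Y t)"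
proof -
  obtain C1 C2 where C: "\<And>t. t \<ge> 0 \<Longrightarrow> norm (X t) \<le> C1 * exp (\<beta> * t)" "\<And>t. t \<ge> 0 \<Longrightarrow> norm (Y t) \<le> C2 * exp (\<beta> * t)"
    using assms unfolding sol_def by blast
  have "norm (X t + Y t) \<le> (C1 + C2) * exp (\<beta> * t)" if "t \<ge> 0" for t
    using C[OF that] norm_triangle_ineq[of "X t" "Y t"] by (simp add: distrib_right)
  moreover have "X t + Y t = S t ((x + y) + integral {0..t} (\<lambda>r. S (- r) (B (X r + Y r))))" if "t \<ge> 0" for t
  proof -
    have "integral {0..t} (\<lambda>r. S (- r) (B (X r + Y r))) = integral {0..t} (\<lambda>r. S (- r) (B (X r))) + integral {0..t} (\<lambda>r. S (- r) (B (Y r)))"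
      using assms by (simp add: linear_simps[OF S_bl] linear_simps[OF B_bl] integral_add integrand_integrable sol_cont)
    moreover have "X t = S t (x + integral {0..t} (\<lambda>r. S (- r) (B (X r))))" "Y t = S t (y + integral {0..t} (\<lambda>r. S (- r) (B (Y r))))"
      using assms that unfolding sol_def by blast+
    ultimately show ?thesis by (simp add: linear_simps[OF S_bl])
  qed
  ultimately show ?thesis using assms unfolding sol_def by (auto intro: continuous_on_add)
qed

text \<open>By uniqueness, operators commuting with S and B then commute with T as well: real
  scalars give homogeneity, and complex ones will give the complex linearity that the real framework
  does not see.\<close>

lemma sol_map:
  assumes X: "sol x X" and C: "bounded_linear C" "\<And>t z. C (S t z) = S t (C z)" "\<And>z. C (B z) = B (C z)"
  shows "sol (C x) (\<lambda>t. C (X t))"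
proof -
  obtain C1 where C1: "\<And>t. t \<ge> 0 \<Longrightarrow> norm (X t) \<le> C1 * exp (\<beta> * t)" using X unfolding sol_def by blast
  have "norm (C (X t)) \<le> (onorm C * C1) * exp (\<beta> * t)" if "t \<ge> 0" for t
    using onorm[OF C(1), of "X t"] mult_left_mono[OF C1[OF that] onorm_pos_le[OF C(1)]] by simp
  moreover have "C (X t) = S t (C x + integral {0..t} (\<lambda>r. S (- r) (B (C (X r)))))" if "t \<ge> 0" for t
  proof -
    have "X t = S t (x + integral {0..t} (\<lambda>r. S (- r) (B (X r))))" using X that unfolding sol_def by blast
    then have "C (X t) = S t (C x + C (integral {0..t} (\<lambda>r. S (- r) (B (X r)))))" by (simp add: C(2) linear_simps[OF C(1)])
    also have "C (integral {0..t} (\<lambda>r. S (- r) (B (X r)))) = integral {0..t} (\<lambda>r. C (S (- r) (B (X r))))"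
      using integral_linear[OF integrand_integrable[OF sol_cont[OF X]] C(1), of 0 t] by (simp add: o_def)
    finally show ?thesis by (simp add: C)
  qed
  ultimately show ?thesis using X bounded_linear.continuous_on[OF C(1)] unfolding sol_def by blast
qed

lemma T_commute:
  assumes "bounded_linear C" "\<And>t z. C (S t z) = S t (C z)" "\<And>z. C (B z) = B (C z)" "0 \<le> t" shows "T t (C z) = C (T t z)"
  by (rule T_eq[OF sol_map[OF sol_T]]) (use assms in auto)

lemma T_bl: "0 \<le> t \<Longrightarrow> bounded_linear (T t)"
proof (rule bounded_linear_intro[where K = "2 * exp (\<beta> * t)"])
  assume t: "0 \<le> t"
  show "T t (x + y) = T t x + T t y" for x y by (rule T_eq[OF sol_add[OF sol_T sol_T] t])
  show "T t (c *\<^sub>R x) = c *\<^sub>R T t x" for c x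
    by (rule T_commute[OF bounded_linear_scaleR_right _ _ t]) (simp_all add: linear_simps[OF S_bl] linear_simps[OF B_bl])
  show "norm (T t x) \<le> norm x * (2 * exp (\<beta> * t))" for x using T_bound[OF t, of x] by (simp add: mult_ac)
qed

lemma T_eqn: "0 \<le> t \<Longrightarrow> T t x = S t (x + integral {0..t} (\<lambda>r. S (- r) (B (T r x))))"
  using sol_T[of x] unfolding sol_def by blast

lemma T_cont: "continuous_on {0..} (\<lambda>t. T t x)" using sol_T[of x] unfolding sol_def by blast

lemma T_semigroup:
  assumes r0: "0 \<le> r0" and t: "0 \<le> t" shows "T (t + r0) x = T t (T r0 x)"
proof (rule T_eq[OF _ t, symmetric])
  let ?h = "\<lambda>r. S (- r) (B (T r x))"
  obtain C where C: "\<And>t. t \<ge> 0 \<Longrightarrow> norm (T t x) \<le> C * exp (\<beta> * t)" using sol_T[of x] unfolding sol_def by blast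
  have "norm (T (t + r0) x) \<le> (C * exp (\<beta> * r0)) * exp (\<beta> * t)" if "t \<ge> 0" for t
    using C[of "t + r0"] that r0 by (simp add: distrib_left exp_add mult_ac)
  moreover have "continuous_on {0..} (\<lambda>t. T (t + r0) x)"
    by (rule continuous_on_compose2[OF T_cont]) (use r0 in \<open>auto intro!: continuous_intros\<close>)
  moreover have "T (t + r0) x = S t (T r0 x + integral {0..t} (\<lambda>r. S (- r) (B (T (r + r0) x))))" if t: "t \<ge> 0" for t
  proof -
    have hc: "continuous_on {a..b} ?h" if "0 \<le> a" for a b
      by (intro S_continuous_on B_continuous_on continuous_intros continuous_on_subset[OF T_cont]) (use that in auto)
    have "integral {0..t + r0} ?h = integral {0..r0} ?h + integral {r0..t + r0} ?h"
      by (rule Henstock_Kurzweil_Integration.integral_combine[symmetric]) (use r0 t in \<open>auto intro!: integrable_continuous_interval hc\<close>)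
    also have "integral {r0..t + r0} ?h = integral {0..t} (\<lambda>r. ?h (r + r0))"
      using integral_shift_Icc_real[of 0 t ?h r0] by (simp add: o_def add.commute)
    also have "\<dots> = integral {0..t} (\<lambda>r. S (- r0) (S (- r) (B (T (r + r0) x))))" by (simp add: S_add[symmetric] add.commute)
    also have "\<dots> = S (- r0) (integral {0..t} (\<lambda>r. S (- r) (B (T (r + r0) x))))"
    proof -
      have "(\<lambda>r. S (- r) (B (T (r + r0) x))) integrable_on {0..t}"
        by (intro integrand_integrable continuous_on_compose2[OF T_cont]) (use r0 in \<open>auto intro!: continuous_intros\<close>)
      from integral_linear[OF this S_bl[of "- r0"]] show ?thesis by (simp add: o_def)
    qed
    finally have I: "integral {0..t + r0} ?h = integral {0..r0} ?h + S (- r0) (integral {0..t} (\<lambda>r. S (- r) (B (T (r + r0) x))))" .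
    have "T (t + r0) x = S t (S r0 (x + integral {0..t + r0} ?h))" using T_eqn[of "t + r0" x] t r0 by (simp add: S_add[symmetric])
    also have "S r0 (x + integral {0..t + r0} ?h) = S r0 (x + integral {0..r0} ?h) + integral {0..t} (\<lambda>r. S (- r) (B (T (r + r0) x)))"
      unfolding I by (simp add: linear_simps[OF S_bl] S_add[symmetric] S0 add.assoc)
    also have "S r0 (x + integral {0..r0} ?h) = T r0 x" using T_eqn[OF r0, of x] by simp
    finally show ?thesis .
  qed
  ultimately show "sol (T r0 x) (\<lambda>t. T (t + r0) x)" unfolding sol_def by blast
qed

text \<open>The limit exists for every x, in the domain or not. Hence the quotients of T and of S
  converge for the same x, and the perturbed generator has exactly the domain of the unperturbed
  one.\<close>

lemma T_quotient:
  "((\<lambda>h. (1/h) *\<^sub>R (T h x - x) - (1/h) *\<^sub>R (S h x - x)) \<longlongrightarrow> B x) (at_right 0)"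
proof -
  let ?h = "\<lambda>r. S (- r) (B (T r x))"
  have T0: "T 0 x = x" using T_eqn[of 0 x] by (simp add: S0)
  have hc: "continuous_on {0..1} ?h" by (intro S_continuous_on B_continuous_on continuous_intros continuous_on_subset[OF T_cont]) auto
  have der: "((\<lambda>u. integral {0..u} ?h) has_vector_derivative ?h 0) (at 0 within {0..1})" by (rule integral_has_vector_derivative[OF hc]) auto
  have q: "((\<lambda>h. (1/h) *\<^sub>R integral {0..h} ?h) \<longlongrightarrow> B x) (at_right 0)"
  proof (rule tendstoI)
    fix e :: real assume e: "e > 0"
    then obtain d where d: "d > 0" "\<forall>y\<in>{0..1}. norm (y - 0) < d \<longrightarrow> norm (integral {0..y} ?h - integral {0..0} ?h - (y - 0) *\<^sub>R ?h 0) \<le> e / 2 * norm (y - 0)"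
      using der unfolding has_vector_derivative_def has_derivative_within_alt by (meson half_gt_zero)
    have "dist ((1/h) *\<^sub>R integral {0..h} ?h) (B x) < e" if h: "0 < h" "h < min 1 d" for h
    proof -
      have "norm (integral {0..h} ?h - h *\<^sub>R B x) \<le> e / 2 * h" using d(2)[rule_format, of h] h by (simp add: T0 S0)
      moreover have "integral {0..h} ?h - h *\<^sub>R B x = h *\<^sub>R ((1/h) *\<^sub>R integral {0..h} ?h - B x)" using h by (simp add: scaleR_right_diff_distrib)
      ultimately have "h * norm ((1/h) *\<^sub>R integral {0..h} ?h - B x) \<le> h * (e / 2)" using h by (simp add: mult.commute)
      then show ?thesis using h e by (simp add: dist_norm)
    qed
    then show "\<forall>\<^sub>F h in at_right 0. dist ((1/h) *\<^sub>R integral {0..h} ?h) (B x) < e"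
      unfolding eventually_at_right_field using d(1) by (intro exI[of _ "min 1 d"]) auto
  qed
  have "((\<lambda>h. S h ((1/h) *\<^sub>R integral {0..h} ?h)) \<longlongrightarrow> S 0 (B x)) (at_right 0)"
    by (rule S_tendsto[OF _ q]) (rule tendsto_ident_at)
  then show ?thesis
  proof (rule Lim_transform_eventually[OF tendsto_eq_rhs])
    have "S h ((1/h) *\<^sub>R integral {0..h} ?h) = (1/h) *\<^sub>R (T h x - x) - (1/h) *\<^sub>R (S h x - x)" if "h > 0" for h
      using T_eqn[of h x] that by (simp add: linear_simps[OF S_bl] flip: scaleR_right_diff_distrib)
    then show "\<forall>\<^sub>F h in at_right 0. S h ((1/h) *\<^sub>R integral {0..h} ?h) = (1/h) *\<^sub>R (T h x - x) - (1/h) *\<^sub>R (S h x - x)"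
      by (simp add: eventually_at_filter)
  qed (simp add: S0)
qed

theorem generates_T: "generates T D (\<lambda>z. A0 z + B z)"
  unfolding generates_def
proof (intro conjI allI impI ballI)
  show "bounded_linear (T t)" if "0 \<le> t" for t using that by (rule T_bl)
  show T0: "T 0 z = z" for z using T_eqn[of 0 z] by (simp add: S0)
  show "T (t + r) z = T t (T r z)" if "0 \<le> t" "0 \<le> r" for t r z using T_semigroup that by blast
  show "((\<lambda>t. T t z) \<longlongrightarrow> z) (at_right 0)" for z
  proof -
    have "((\<lambda>t. T t z) \<longlongrightarrow> T 0 z) (at 0 within {0..})" using T_cont[of z] unfolding continuous_on_def by auto
    then show ?thesis unfolding T0 by (rule tendsto_within_subset) auto
  qed
  show "((\<lambda>h. (1/h) *\<^sub>R (T h z - z)) \<longlongrightarrow> A0 z + B z) (at_right 0)" if "z \<in> D" for z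
    using tendsto_add[OF S_lim[OF that] T_quotient[of z]] by simp
  show "z \<in> D \<longleftrightarrow> (\<exists>y. ((\<lambda>h. (1/h) *\<^sub>R (T h z - z)) \<longlongrightarrow> y) (at_right 0))" for z
  proof
    assume "z \<in> D"
    then show "\<exists>y. ((\<lambda>h. (1/h) *\<^sub>R (T h z - z)) \<longlongrightarrow> y) (at_right 0)"
      using tendsto_add[OF S_lim[of z] T_quotient[of z]] by auto
  next
    assume "\<exists>y. ((\<lambda>h. (1/h) *\<^sub>R (T h z - z)) \<longlongrightarrow> y) (at_right 0)"
    then obtain y where "((\<lambda>h. (1/h) *\<^sub>R (T h z - z)) \<longlongrightarrow> y) (at_right 0)" by blast
    from tendsto_diff[OF this T_quotient[of z]] show "z \<in> D" unfolding S_diff by auto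
  qed
qed

end

section \<open>The damped wave operator in diagonal coordinates\<close>

instance l2 :: (euclidean_space) banach ..

definition U :: "('a::euclidean_space \<Rightarrow> real) \<Rightarrow> real \<Rightarrow> 'a l2 \<Rightarrow> 'a l2" where
  "U m t = mulop (\<lambda>\<xi>. iexp (t * m \<xi>))"

abbreviation cof :: "('a \<Rightarrow> real) \<Rightarrow> 'a \<Rightarrow> complex" where
  "cof m \<equiv> \<lambda>\<xi>. cpx (m \<xi>)"

abbreviation icof :: "('a \<Rightarrow> real) \<Rightarrow> 'a \<Rightarrow> complex" where
  "icof m \<equiv> \<lambda>\<xi>. \<i> * cpx (m \<xi>)"

lemma muldom_diff:
  assumes m: "m \<in> bfun" and f: "f \<in> muldom m" and g: "g \<in> muldom m" shows "f - g \<in> muldom m" "mulop m (f - g) = mulop m f - mulop m g"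
  using muldom_add[OF m f muldom_scaleR(1)[OF m g], of "-1"] muldom_scaleR(2)[OF m g, of "-1"] by simp_all

lemma muldom_icof: "m \<in> bfun \<Longrightarrow> muldom (icof m) = muldom (cof m)"
  by (auto intro!: muldom_mono[of "icof m" 1 "cof m"] muldom_mono[of "cof m" 1 "icof m"] simp: norm_mult)

lemma mulop_uminus_fun: "f \<in> muldom m \<Longrightarrow> mulop (\<lambda>\<xi>. - m \<xi>) f = - mulop m f"
  unfolding mulop_def muldom_def by (simp add: cls_uminus)

lemma bmf_iexp: "m \<in> bfun \<Longrightarrow> bmf (\<lambda>\<xi>. iexp (t * m \<xi>))" by (rule bmfI[of _ 1]) auto

lemma U_bl: "m \<in> bfun \<Longrightarrow> bounded_linear (U m t)" unfolding U_def by (intro bounded_linear_mulop bmf_iexp)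

lemma U_norm: "m \<in> bfun \<Longrightarrow> norm (U m t f) = norm f" unfolding U_def by (rule norm_mulop_unimodular) auto

lemma U_0 [simp]: "U m 0 f = f" by (simp add: U_def)

lemma U_add: "m \<in> bfun \<Longrightarrow> U m (t + r) f = U m t (U m r f)"
  unfolding U_def by (simp only: mulop_mulop_bmf[OF bmf_iexp bmf_iexp] distrib_right of_real_add distrib_left exp_add)

lemma U_cont:
  assumes m: "m \<in> bfun" shows "continuous_on UNIV (\<lambda>t. U m t f)" unfolding continuous_on_sequentially o_def
proof (intro allI ballI impI)
  fix X :: "nat \<Rightarrow> real" and t assume X: "(\<forall>n. X n \<in> UNIV) \<and> X \<longlonglongrightarrow> t"
  show "(\<lambda>n. U m (X n) f) \<longlonglongrightarrow> U m t f" unfolding U_def by (rule tendsto_mulop_dominated[where b = "\<lambda>_. 1"])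
       (use m X in \<open>auto intro!: tendsto_intros\<close>)
qed

lemma quotient_symbol_bound: "h \<noteq> 0 \<Longrightarrow> cmod ((iexp (h * a) - 1) / cpx h) \<le> \<bar>a\<bar>"
  using norm_exp_diff_le[of "h * a" 0] by (simp add: norm_divide abs_mult divide_le_eq mult.commute)

lemma quotient_symbol_limit:
  assumes X: "X \<longlonglongrightarrow> 0" "\<And>n. X n \<noteq> 0"
  shows "(\<lambda>n. (iexp (X n * a) - 1) / cpx (X n)) \<longlonglongrightarrow> \<i> * cpx a"
proof -
  have b: "norm ((iexp (X n * a) - 1) / cpx (X n) - \<i> * cpx a) \<le> \<bar>X n\<bar> * a\<^sup>2 / 2" for n
  proof -
    have "(iexp (X n * a) - 1) / cpx (X n) - \<i> * cpx a
      = (iexp (X n * a) - (\<Sum>k\<le>1. (\<i> * cpx (X n * a)) ^ k / fact k)) / cpx (X n)" using X(2)[of n] by (simp add: field_simps)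
    then have "norm ((iexp (X n * a) - 1) / cpx (X n) - \<i> * cpx a) \<le> (\<bar>X n * a\<bar> ^ Suc 1 / fact (Suc 1)) / \<bar>X n\<bar>"
      by (simp only: norm_divide norm_of_real) (intro divide_right_mono iexp_approx1, simp)
    also have "\<dots> = \<bar>X n\<bar> * a\<^sup>2 / 2" using X(2)[of n] by (simp add: power2_eq_square abs_mult field_simps)
    finally show ?thesis .
  qed
  have "(\<lambda>n. \<bar>X n\<bar> * a\<^sup>2 / 2) \<longlonglongrightarrow> \<bar>0\<bar> * a\<^sup>2 / 2" by (intro tendsto_intros X(1)) simp
  then have "(\<lambda>n. \<bar>X n\<bar> * a\<^sup>2 / 2) \<longlonglongrightarrow> 0" by simp
  from Lim_null_comparison[OF always_eventually[OF allI[OF b]] this] show ?thesis by (rule LIM_zero_cancel)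
qed

lemma U_quotient_mulop:
  assumes m: "m \<in> bfun" shows "(1 / h) *\<^sub>R (U m h f - f) = mulop (\<lambda>\<xi>. (iexp (h * m \<xi>) - 1) / cpx h) f"
    "L2 (\<lambda>\<xi>. (iexp (h * m \<xi>) - 1) / cpx h * rep f \<xi>)"
proof -
  have s: "L2 (\<lambda>\<xi>. iexp (h * m \<xi>) * rep f \<xi>)" by (intro L2_bmf bmf_iexp m) auto
  have e: "(\<lambda>\<xi>. (iexp (h * m \<xi>) - 1) / cpx h * rep f \<xi>) = (\<lambda>\<xi>. cpx (1 / h) * (iexp (h * m \<xi>) * rep f \<xi> - rep f \<xi>))"
    by (auto simp: divide_inverse algebra_simps)
  have s': "L2 (\<lambda>\<xi>. iexp (h * m \<xi>) * rep f \<xi> - rep f \<xi>)" using s by (intro L2_diff) auto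
  show "L2 (\<lambda>\<xi>. (iexp (h * m \<xi>) - 1) / cpx h * rep f \<xi>)" unfolding e by (intro L2_cmult s')
  show "(1 / h) *\<^sub>R (U m h f - f) = mulop (\<lambda>\<xi>. (iexp (h * m \<xi>) - 1) / cpx h) f"
    unfolding mulop_def e cls_scaleR[OF s'] U_def cls_diff[OF s L2_rep] cls_rep ..
qed

lemma U_quotient:
  assumes m[measurable]: "m \<in> bfun" and f: "f \<in> muldom (cof m)"
  shows "((\<lambda>h. (1 / h) *\<^sub>R (U m h f - f)) \<longlongrightarrow> mulop (icof m) f) (at 0)" unfolding tendsto_at_iff_sequentially o_def
proof (intro allI impI)
  fix X :: "nat \<Rightarrow> real" assume X0: "\<forall>i. X i \<in> UNIV - {0}" and X: "X \<longlonglongrightarrow> 0"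
  have X0': "X n \<noteq> 0" for n using X0 by auto
  show "(\<lambda>n. (1 / X n) *\<^sub>R (U m (X n) f - f)) \<longlonglongrightarrow> mulop (icof m) f" unfolding U_quotient_mulop[OF m]
    by (rule tendsto_mulop_dominated[where b = "cof m"]) (use f quotient_symbol_bound[OF X0'] quotient_symbol_limit[OF X X0'] in auto)
qed

text \<open>Convergent quotients have bounded norms along a sequence and converge pointwise to i m
  f, so Fatou's lemma puts i m f in L2.\<close>

lemma U_muldom_converse:
  assumes m[measurable]: "m \<in> bfun" and lim: "((\<lambda>h. (1 / h) *\<^sub>R (U m h f - f)) \<longlongrightarrow> y) (at_right 0)"
  shows "f \<in> muldom (cof m)"
proof -
  define X where "X n = 1 / real (Suc n)" for n
  have X0: "X n \<noteq> 0" "X n > 0" for n by (auto simp: X_def)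
  have X: "X \<longlonglongrightarrow> 0" unfolding X_def using LIMSEQ_inverse_real_of_nat by (simp add: inverse_eq_divide)
  have "(\<lambda>n. (1 / X n) *\<^sub>R (U m (X n) f - f)) \<longlonglongrightarrow> y"
    using lim X X0 unfolding tendsto_at_iff_sequentially o_def by auto
  then have "Bseq (\<lambda>n. (1 / X n) *\<^sub>R (U m (X n) f - f))" by (intro convergent_imp_Bseq) (auto simp: convergent_def)
  then obtain C where C: "\<And>n. norm ((1 / X n) *\<^sub>R (U m (X n) f - f)) \<le> C" by (auto simp: Bseq_def)
  have "L2 (\<lambda>\<xi>. icof m \<xi> * rep f \<xi>)"
  proof (rule l2norm_Fatou(1))
    show "L2 (\<lambda>\<xi>. (iexp (X n * m \<xi>) - 1) / cpx (X n) * rep f \<xi>)" for n by (rule U_quotient_mulop(2)[OF m])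
    show "norm (cls (\<lambda>\<xi>. (iexp (X n * m \<xi>) - 1) / cpx (X n) * rep f \<xi>)) \<le> C" for n
      using C[of n] unfolding U_quotient_mulop(1)[OF m] mulop_def .
    show "AE \<xi> in lborel. (\<lambda>n. (iexp (X n * m \<xi>) - 1) / cpx (X n) * rep f \<xi>) \<longlonglongrightarrow> icof m \<xi> * rep f \<xi>"
      by (intro AE_I2 tendsto_mult tendsto_const quotient_symbol_limit X X0)
  qed measurable
  then have "f \<in> muldom (icof m)" by (simp add: muldom_def)
  then show ?thesis by (simp add: muldom_icof)
qed

lemma truncation_dense:
  assumes m[measurable]: "m \<in> bfun" shows "\<exists>F. (\<forall>n. F n \<in> muldom (cof m)) \<and> F \<longlonglongrightarrow> f"
proof -
  define c where "c n \<xi> = (if \<bar>m \<xi>\<bar> \<le> real n then 1 else 0 :: complex)" for n :: nat and \<xi>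
  have [measurable]: "c n \<in> bfun" for n unfolding c_def by measurable
  have "(\<lambda>n. mulop (c n) f) \<longlonglongrightarrow> mulop (\<lambda>_. 1) f"
  proof (rule tendsto_mulop_dominated[where b = "\<lambda>_. 1"])
    fix \<xi>
    obtain N where N: "\<bar>m \<xi>\<bar> \<le> real N" using real_arch_simple by blast
    then have "c n \<xi> = 1" if "n \<ge> N" for n using that by (auto simp: c_def)
    then show "(\<lambda>n. c n \<xi>) \<longlonglongrightarrow> 1" by (intro tendsto_eventually) (auto simp: eventually_sequentially)
  qed (auto simp: c_def)
  moreover have "mulop (c n) f \<in> muldom (cof m)" for n
  proof -
    have s: "L2 (\<lambda>\<xi>. c n \<xi> * rep f \<xi>)" by (rule L2_mult_bounded[of _ _ 1]) (auto simp: c_def)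
    have "L2 (\<lambda>\<xi>. cof m \<xi> * (c n \<xi> * rep f \<xi>))"
      by (rule L2_bound[of "rep f" _ "real n"]) (auto simp: c_def norm_mult intro!: mult_right_mono)
    then show ?thesis unfolding mulop_def using s by (subst muldom_cls) auto
  qed
  ultimately show ?thesis by (intro exI[of _ "\<lambda>n. mulop (c n) f"]) auto
qed

section \<open>The diagonal group, its generator and its domain\<close>

type_synonym 'a state = "'a l2 \<times> 'a l2"

definition Sg :: "('a::euclidean_space \<Rightarrow> real) \<Rightarrow> real \<Rightarrow> 'a state \<Rightarrow> 'a state" where
  "Sg m t z = (U m t (fst z), U m (- t) (snd z))"

definition Dm :: "('a::euclidean_space \<Rightarrow> real) \<Rightarrow> 'a state set" where
  "Dm m = {z. fst z \<in> muldom (cof m) \<and> snd z \<in> muldom (cof m)}"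

definition A0 :: "('a::euclidean_space \<Rightarrow> real) \<Rightarrow> 'a state \<Rightarrow> 'a state" where
  "A0 m z = (mulop (icof m) (fst z), - mulop (icof m) (snd z))"

lemma Sg_bl: "m \<in> bfun \<Longrightarrow> bounded_linear (Sg m t)" unfolding Sg_def[abs_def]
  by (rule bounded_linear_Pair[OF bounded_linear_compose[OF U_bl bounded_linear_fst] bounded_linear_compose[OF U_bl bounded_linear_snd]])

lemma Sg_0: "Sg m 0 z = z" by (simp add: Sg_def)

lemma Sg_add: "m \<in> bfun \<Longrightarrow> Sg m (t + r) z = Sg m t (Sg m r z)" using U_add[of m t r] U_add[of m "-t" "-r"] by (simp add: Sg_def)

lemma Sg_norm: "m \<in> bfun \<Longrightarrow> norm (Sg m t z) = norm z" by (simp add: Sg_def norm_prod_def U_norm)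

lemma Sg_cont: "m \<in> bfun \<Longrightarrow> continuous_on UNIV (\<lambda>t. Sg m t z)" unfolding Sg_def
  by (rule continuous_on_Pair[OF U_cont continuous_on_compose2[OF U_cont _ subset_UNIV]]) (auto intro: continuous_intros)

lemma Sg_quotient:
  assumes m: "m \<in> bfun" and z: "z \<in> Dm m" shows "((\<lambda>h. (1 / h) *\<^sub>R (Sg m h z - z)) \<longlongrightarrow> A0 m z) (at 0)"
proof -
  have mm: "(\<lambda>\<xi>. - m \<xi>) \<in> bfun" using m by measurable
  have s: "snd z \<in> muldom (cof m)" using z by (simp add: Dm_def)
  then have s': "snd z \<in> muldom (cof (\<lambda>\<xi>. - m \<xi>))" by (rule muldom_mono[of _ 1, rotated 2]) (use m in auto)
  have "U m (- h) f = U (\<lambda>\<xi>. - m \<xi>) h f" for h f by (simp add: U_def)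
  moreover have "mulop (icof (\<lambda>\<xi>. - m \<xi>)) (snd z) = - mulop (icof m) (snd z)"
    using mulop_uminus_fun[of "snd z" "icof m"] s m by (simp add: muldom_icof)
  ultimately have "((\<lambda>h. (1 / h) *\<^sub>R (U m (- h) (snd z) - snd z)) \<longlongrightarrow> - mulop (icof m) (snd z)) (at 0)"
    using U_quotient[OF mm s'] by simp
  moreover have "((\<lambda>h. (1 / h) *\<^sub>R (U m h (fst z) - fst z)) \<longlongrightarrow> mulop (icof m) (fst z)) (at 0)"
    using U_quotient[OF m] z by (simp add: Dm_def)
  ultimately have "((\<lambda>h. ((1 / h) *\<^sub>R (U m h (fst z) - fst z), (1 / h) *\<^sub>R (U m (- h) (snd z) - snd z))) \<longlongrightarrow> A0 m z) (at 0)"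
    unfolding A0_def by (intro tendsto_Pair)
  then show ?thesis by (simp add: Sg_def scaleR_prod_def minus_prod_def)
qed

lemma Sg_Dm_converse:
  assumes m: "m \<in> bfun" and lim: "((\<lambda>h. (1 / h) *\<^sub>R (Sg m h z - z)) \<longlongrightarrow> y) (at_right 0)" shows "z \<in> Dm m"
proof -
  have mm: "(\<lambda>\<xi>. - m \<xi>) \<in> bfun" using m by measurable
  have "((\<lambda>h. (1 / h) *\<^sub>R (U m h (fst z) - fst z)) \<longlongrightarrow> fst y) (at_right 0)"
    using tendsto_fst[OF lim] by (simp add: Sg_def)
  then have 1: "fst z \<in> muldom (cof m)" by (rule U_muldom_converse[OF m])
  have "U m (- h) f = U (\<lambda>\<xi>. - m \<xi>) h f" for h f by (simp add: U_def)
  then have "((\<lambda>h. (1 / h) *\<^sub>R (U (\<lambda>\<xi>. - m \<xi>) h (snd z) - snd z)) \<longlongrightarrow> snd y) (at_right 0)"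
    using tendsto_snd[OF lim] by (simp add: Sg_def)
  then have "snd z \<in> muldom (\<lambda>\<xi>. cpx (- m \<xi>))" by (rule U_muldom_converse[OF mm])
  then have "snd z \<in> muldom (cof m)" by (rule muldom_mono[of _ 1, rotated 2]) (use m in auto)
  with 1 show ?thesis by (simp add: Dm_def)
qed

lemma perturbed_group_Sg:
  assumes m: "m \<in> bfun" and B: "bounded_linear B" shows "perturbed_group (Sg m) (Dm m) (A0 m) B"
proof (rule perturbed_group.intro)
  show "bounded_linear (Sg m t)" for t by (rule Sg_bl[OF m])
  show "Sg m 0 z = z" for z by (rule Sg_0)
  show "Sg m (t + r) z = Sg m t (Sg m r z)" for t r z by (rule Sg_add[OF m])
  show "norm (Sg m t z) = norm z" for t z by (rule Sg_norm[OF m])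
  show "continuous_on UNIV (\<lambda>t. Sg m t z)" for z by (rule Sg_cont[OF m])
  show *: "((\<lambda>h. (1/h) *\<^sub>R (Sg m h z - z)) \<longlongrightarrow> A0 m z) (at_right 0)" if "z \<in> Dm m" for z
    by (rule tendsto_within_subset[OF Sg_quotient[OF m that]]) auto
  show "z \<in> Dm m \<longleftrightarrow> (\<exists>y. ((\<lambda>h. (1/h) *\<^sub>R (Sg m h z - z)) \<longlongrightarrow> y) (at_right 0))" for z
    using * Sg_Dm_converse[OF m] by blast
  show "bounded_linear B" by (rule B)
qed

lemma A0_skew:
  assumes m: "m \<in> bfun" and z: "z \<in> Dm m" shows "A0 m z \<bullet> z = 0"
proof -
  have *: "mulop (icof m) f \<bullet> f = 0" if f: "f \<in> muldom (cof m)" for f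
  proof -
    have fi: "f \<in> muldom (icof m)" using f m by (simp add: muldom_icof)
    have fi': "f \<in> muldom (\<lambda>\<xi>. - icof m \<xi>)" using fi by (simp add: muldom_def L2_iff)
    have "mulop (icof m) f \<bullet> f = f \<bullet> mulop (\<lambda>\<xi>. cnj (icof m \<xi>)) f" by (rule inner_mulop) (use fi fi' in auto)
    also have "\<dots> = - (f \<bullet> mulop (icof m) f)" using mulop_uminus_fun[OF fi] by simp
    finally show ?thesis by (simp add: inner_commute)
  qed
  then show ?thesis using z by (simp add: A0_def Dm_def inner_prod_def)
qed

lemma Dm_dense:
  assumes m: "m \<in> bfun" shows "closure (Dm m) = UNIV"
proof -
  have "z \<in> closure (Dm m)" for z :: "'a state"
  proof -
    obtain F G where F: "\<And>n. F n \<in> muldom (cof m)" "F \<longlonglongrightarrow> fst z" and G: "\<And>n. G n \<in> muldom (cof m)" "G \<longlonglongrightarrow> snd z"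
      using truncation_dense[OF m, of "fst z"] truncation_dense[OF m, of "snd z"] by blast
    have "(\<lambda>n. (F n, G n)) \<longlonglongrightarrow> (fst z, snd z)" by (intro tendsto_Pair F G)
    then show ?thesis unfolding closure_sequential by (intro exI[of _ "\<lambda>n. (F n, G n)"]) (auto simp: Dm_def F G)
  qed
  then show ?thesis by blast
qed

text \<open>In the diagonal coordinates \<open>(f, g)\<close> the velocity is \<open>vel (f, g)\<close>.\<close>

definition vel :: "'a::euclidean_space state \<Rightarrow> 'a l2" where
  "vel z = (1 / sqrt 2) *\<^sub>R (fst z + snd z)"

lemma vel_bl: "bounded_linear vel" unfolding vel_def[abs_def]
  by (rule bounded_linear_compose[OF bounded_linear_scaleR_right bounded_linear_add[OF bounded_linear_fst bounded_linear_snd]])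

lemma norm_vel_le: "norm (vel z) \<le> norm z"
proof -
  have "(norm (fst z + snd z))\<^sup>2 \<le> (norm (fst z) + norm (snd z))\<^sup>2" by (intro power_mono norm_triangle_ineq) auto
  also have "\<dots> \<le> 2 * ((norm (fst z))\<^sup>2 + (norm (snd z))\<^sup>2)"
    using sum_squares_bound[of "norm (fst z)" "norm (snd z)"] by (simp add: power2_sum)
  finally have "(norm (vel z))\<^sup>2 \<le> (norm z)\<^sup>2" by (simp add: vel_def norm_prod_def power_divide power_mult_distrib)
  then show ?thesis by (rule power2_le_imp_le) simp
qed

context damping
begin

text \<open>\<open>Q\<close> is the observation, sqrt \<gamma> times the inverse transform.
  \<open>G\<close> is \<open>Q\<close> followed by its adjoint, which gives the identity
  \<open>G f \<bullet> f = (norm (Q f))\<^sup>2\<close>, and \<open>B\<close> is the diagonal form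
  of the damping term, which acts on the velocity only.\<close>

definition Q :: "'a l2 \<Rightarrow> 'a l2" where "Q f = mulop (\<lambda>x. cpx (sqrt (\<gamma> x))) (Fi f)"
definition G :: "'a l2 \<Rightarrow> 'a l2" where "G f = Fo (mulop (cof \<gamma>) (Fi f))"
definition B :: "'a state \<Rightarrow> 'a state" where
  "B z = (- ((1 / sqrt 2) *\<^sub>R G (vel z)), - ((1 / sqrt 2) *\<^sub>R G (vel z)))"

lemma bmf_sqrt: "bmf (\<lambda>x. cpx (sqrt (\<gamma> x)))" by (rule bmfI[of _ "sqrt M"]) (use nonneg le_M in auto)

lemma bmf_\<gamma>: "bmf (cof \<gamma>)" by (rule bmfI[of _ M]) (use nonneg le_M in auto)

lemma Q_bl: "bounded_linear Q" unfolding Q_def[abs_def] by (rule bounded_linear_compose[OF bounded_linear_mulop[OF bmf_sqrt] bounded_linear_Fi])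

lemma G_bl: "bounded_linear G" unfolding G_def[abs_def]
  by (rule bounded_linear_compose[OF bounded_linear_Fo bounded_linear_compose[OF bounded_linear_mulop[OF bmf_\<gamma>] bounded_linear_Fi]])

lemma norm_sqrt_mulop: "norm (mulop (\<lambda>x. cpx (sqrt (\<gamma> x))) f) \<le> sqrt M * norm f"
  by (rule norm_mulop_le) (use bmf_sqrt nonneg le_M in auto)

lemma Q_norm: "norm (Q f) \<le> sqrt M * norm f" using norm_sqrt_mulop[of "Fi f"] by (simp add: Q_def)

lemma mulop_\<gamma>: "mulop (cof \<gamma>) f = mulop (\<lambda>x. cpx (sqrt (\<gamma> x))) (mulop (\<lambda>x. cpx (sqrt (\<gamma> x))) f)"
  using nonneg by (simp add: mulop_mulop_bmf[OF bmf_sqrt bmf_sqrt] flip: of_real_mult)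

lemma G_norm: "norm (G f) \<le> sqrt M * norm (Q f)" using norm_sqrt_mulop[of "Q f"] unfolding G_def mulop_\<gamma> Q_def by simp

lemma G_inner: "G f \<bullet> f = (norm (Q f))\<^sup>2"
proof -
  have "G f \<bullet> f = mulop (cof \<gamma>) (Fi f) \<bullet> Fi f" unfolding G_def by (rule inner_Fo_left)
  also have "\<dots> = mulop (\<lambda>x. cpx (sqrt (\<gamma> x))) (Fi f) \<bullet> mulop (\<lambda>x. cpx (sqrt (\<gamma> x))) (Fi f)"
    unfolding mulop_\<gamma> by (subst inner_mulop) (auto simp: bmf_sqrt)
  finally show ?thesis by (simp add: Q_def power2_norm_eq_inner)
qed

lemma B_bl: "bounded_linear B"
proof -
  have "bounded_linear (\<lambda>z. - ((1 / sqrt 2) *\<^sub>R G (vel z)))"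
    by (rule bounded_linear_minus[OF bounded_linear_compose[OF bounded_linear_scaleR_right bounded_linear_compose[OF G_bl vel_bl]]])
  from bounded_linear_Pair[OF this this] show ?thesis unfolding B_def[abs_def] .
qed

lemma B_inner: "B z \<bullet> z = - (norm (Q (vel z)))\<^sup>2"
proof -
  have "B z \<bullet> z = - (G (vel z) \<bullet> vel z)" by (simp add: B_def inner_prod_def vel_def inner_add_right add_divide_distrib)
  then show ?thesis by (simp add: G_inner)
qed

text \<open>A bound by the observation and not merely by |z|: when little energy is dissipated, the
  damping is also a small perturbation of the undamped flow.\<close>

lemma B_norm: "norm (B z) \<le> sqrt M * norm (Q (vel z))"
proof -
  have "(norm (B z))\<^sup>2 = (norm (G (vel z)))\<^sup>2" by (simp add: B_def norm_prod_def power_divide power_mult_distrib)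
  then have "norm (B z) = norm (G (vel z))" by (simp add: power2_eq_iff_nonneg)
  then show ?thesis using G_norm by simp
qed

lemma B_norm_le: "norm (B z) \<le> M * norm z"
proof -
  have "norm (B z) \<le> sqrt M * (sqrt M * norm (vel z))" by (rule order_trans[OF B_norm mult_left_mono[OF Q_norm]]) (simp add: M_nonneg)
  also have "\<dots> = M * norm (vel z)" using M_nonneg by (simp flip: mult.assoc)
  also have "\<dots> \<le> M * norm z" by (intro mult_left_mono norm_vel_le M_nonneg)
  finally show ?thesis .
qed

definition Aop :: "('a \<Rightarrow> real) \<Rightarrow> 'a state \<Rightarrow> 'a state" where "Aop m z = A0 m z + B z"

lemma Aop_inner: "m \<in> bfun \<Longrightarrow> z \<in> Dm m \<Longrightarrow> Aop m z \<bullet> z = - (norm (Q (vel z)))\<^sup>2"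
  by (simp add: Aop_def inner_add_left A0_skew B_inner)

lemma dissipative_semigroupI:
  assumes m: "m \<in> bfun" and T: "generates T (Dm m) (Aop m)" shows "dissipative_semigroup T (Dm m) (Aop m)"
  by unfold_locales (use T m in \<open>auto simp: Aop_inner Dm_dense\<close>)

end

section \<open>Transfer between states and diagonal coordinates\<close>

text \<open>Square root of the symbol of (I - \<Delta>)^(s/2), that is, the frequency of the
  undamped wave; the weight in the norm of H^r is the square of \<open>lam (2 * r)\<close>.\<close>

definition lam :: "real \<Rightarrow> 'a::euclidean_space \<Rightarrow> real" where
  "lam s \<xi> = (1 + (norm \<xi>)\<^sup>2) powr (s / 4)"

definition hat :: "('a::euclidean_space \<Rightarrow> complex) \<Rightarrow> 'a l2" where "hat u = Fo (cls u)"

lemma lam_measurable [measurable]: "lam s \<in> bfun" unfolding lam_def by measurable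

lemma lam_ge_1: "s \<ge> 0 \<Longrightarrow> lam s \<xi> \<ge> 1" unfolding lam_def by (rule ge_one_powr_ge_zero) auto

lemma lam_pos: "lam s \<xi> > 0" using add_pos_nonneg[OF zero_less_one zero_le_power2[of "norm \<xi>"]] by (simp add: lam_def)

lemma lam_sq: "(lam s \<xi>)\<^sup>2 = lam (2 * s) \<xi>" unfolding lam_def power2_eq_square by (simp flip: powr_add)

lemma lam_double: "lam s \<xi> * lam s \<xi> = lam (2 * s) \<xi>" using lam_sq[of s \<xi>] by (simp add: power2_eq_square)

lemma i_mult_i: "(\<i> * a) * (\<i> * b) = - (a * b)" by (simp add: complex_eq_iff algebra_simps)

lemma fourier_of_hat: "fourier_of u v \<Longrightarrow> hat u = cls v" by (simp add: hat_def fourier_of_iff_Fo)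

lemma fourier_of_rep_hat: "L2 u \<Longrightarrow> fourier_of u (rep (hat u))" by (simp add: hat_def fourier_of_iff_Fo)

lemma norm_hat: "L2 u \<Longrightarrow> norm (hat u) = l2norm u" by (simp add: hat_def norm_cls)

lemma hat_rep_Fi [simp]: "hat (rep (Fi f)) = f" by (simp add: hat_def)

lemma hat_add: "L2 u \<Longrightarrow> L2 v \<Longrightarrow> hat (\<lambda>x. u x + v x) = hat u + hat v" by (simp add: hat_def cls_add Fo_add)

lemma hat_cmul: "L2 u \<Longrightarrow> hat (\<lambda>x. c * u x) = mulop (\<lambda>_. c) (hat u)"
  by (simp add: hat_def Fo_cmul[symmetric] mulop_cls_bmf)

lemma hat_diff: "L2 u \<Longrightarrow> L2 v \<Longrightarrow> hat (\<lambda>x. u x - v x) = hat u - hat v"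
  unfolding hat_def by (simp add: cls_diff linear_simps(2)[OF bounded_linear_Fo])

lemma weight_sq: "msq (cof (lam (2 * r)) \<xi> * z) = (1 + (norm \<xi>)\<^sup>2) powr r * msq z"
  unfolding norm_mult power_mult_distrib norm_of_real power2_abs lam_sq by (simp add: lam_def)

lemma sobolev_iff: "u \<in> sobolev r \<longleftrightarrow> L2 u \<and> hat u \<in> muldom (cof (lam (2 * r)))"
proof -
  have *: "integrable lborel (\<lambda>\<xi>. (1 + (norm \<xi>)\<^sup>2) powr r * msq (v \<xi>)) \<longleftrightarrow> hat u \<in> muldom (cof (lam (2 * r)))"
    if uv: "fourier_of u v" for v
  proof -
    have sv: "L2 v" using uv by (simp add: fourier_of_iff)
    then have [measurable]: "v \<in> bfun" by auto
    have [measurable]: "cof (lam (2 * r)) \<in> bfun" by measurable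
    have "(\<lambda>\<xi>. cof (lam (2 * r)) \<xi> * v \<xi>) \<in> bfun" by measurable
    then show ?thesis unfolding fourier_of_hat[OF uv] by (subst muldom_cls[OF sv]) (simp_all add: L2_iff weight_sq[unfolded] del: of_real_mult)
  qed
  show ?thesis using * fourier_of_rep_hat unfolding sobolev_def by auto
qed

lemma sob_norm_eq:
  assumes u: "u \<in> sobolev r" shows "sob_norm r u = norm (mulop (cof (lam (2 * r))) (hat u))"
proof -
  have su: "L2 u" and d: "hat u \<in> muldom (cof (lam (2 * r)))" using u by (auto simp: sobolev_iff)
  define v where "v = (SOME v. fourier_of u v)"
  have uv: "fourier_of u v" unfolding v_def by (rule someI_ex[of "fourier_of u"]) (use fourier_of_rep_hat[OF su] in blast)
  have sv: "L2 v" using uv by (simp add: fourier_of_iff)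
  have h: "hat u = cls v" by (rule fourier_of_hat[OF uv])
  have s: "L2 (\<lambda>\<xi>. cof (lam (2 * r)) \<xi> * v \<xi>)" using d unfolding h by (subst (asm) muldom_cls[OF sv]) auto
  have "mulop (cof (lam (2 * r))) (hat u) = cls (\<lambda>\<xi>. cof (lam (2 * r)) \<xi> * v \<xi>)" unfolding h by (rule mulop_cls[OF sv _ s]) auto
  then show ?thesis unfolding sob_norm_def v_def[symmetric] by (simp only: norm_cls[OF s] l2norm_def weight_sq)
qed

lemma frac_power_hat:
  assumes u: "L2 u" and d: "hat u \<in> muldom (cof (lam (4 * r)))"
  shows "L2 (frac_power r u)" "hat (frac_power r u) = mulop (cof (lam (4 * r))) (hat u)"
proof -
  let ?m = "cof (lam (4 * r))"
  have meq: "cpx ((1 + (norm \<xi>)\<^sup>2) powr r) = ?m \<xi>" for \<xi> by (simp add: lam_def)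
  have "fourier_of (rep (Fi (mulop ?m (hat u)))) (\<lambda>\<xi>. ?m \<xi> * rep (hat u) \<xi>)"
    unfolding fourier_of_iff_Fo using d by (simp add: muldom_def mulop_def)
  then have "\<exists>f v. fourier_of u v \<and> fourier_of f (\<lambda>\<xi>. ?m \<xi> * v \<xi>)" using fourier_of_rep_hat[OF u] by blast
  from someI_ex[OF this] obtain v where v: "fourier_of u v" "fourier_of (frac_power r u) (\<lambda>\<xi>. ?m \<xi> * v \<xi>)"
    unfolding frac_power_def meq by blast
  show "L2 (frac_power r u)" using v(2) by (simp add: fourier_of_iff)
  have s: "L2 v" "L2 (\<lambda>\<xi>. ?m \<xi> * v \<xi>)" using v by (auto simp: fourier_of_iff)
  show "hat (frac_power r u) = mulop ?m (hat u)"
    unfolding fourier_of_hat[OF v(2)] fourier_of_hat[OF v(1)] by (rule mulop_cls[OF s(1) _ s(2), symmetric]) auto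
qed

text \<open>Half-wave variables (v + i \<lambda> u) / sqrt 2 and (v - i \<lambda> u) / sqrt 2 on the
  Fourier side. The factor makes \<open>J\<close> an isometry for the energy norm, and the undamped
  equation decouples into opposite phases.\<close>

definition J :: "real \<Rightarrow> 'a::euclidean_space st \<Rightarrow> 'a state" where
  "J s x = ((1 / sqrt 2) *\<^sub>R (hat (snd x) + mulop (icof (lam s)) (hat (fst x))),
            (1 / sqrt 2) *\<^sub>R (hat (snd x) - mulop (icof (lam s)) (hat (fst x))))"

text \<open>A section of \<open>J\<close> by chosen representatives: \<open>J s (Ji s z) = z\<close>
  holds exactly, whereas \<open>Ji s (J s x)\<close> and \<open>x\<close> agree only almost
  everywhere.\<close>

definition Ji :: "real \<Rightarrow> 'a::euclidean_space state \<Rightarrow> 'a st" where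
  "Ji s z = (rep (Fi (mulop (\<lambda>\<xi>. 1 / icof (lam s) \<xi>) ((1 / sqrt 2) *\<^sub>R (fst z - snd z)))), rep (Fi (vel z)))"

lemma Hsp_iff: "x \<in> Hsp s \<longleftrightarrow> L2 (fst x) \<and> L2 (snd x) \<and> hat (fst x) \<in> muldom (cof (lam s))"
  by (cases x) (auto simp: Hsp_def sobolev_iff)

lemma Hsp_icof: "x \<in> Hsp s \<Longrightarrow> hat (fst x) \<in> muldom (icof (lam s))" by (simp add: Hsp_iff muldom_icof)

lemma norm_mulop_icof: "f \<in> muldom (cof (m :: 'a::euclidean_space \<Rightarrow> real)) \<Longrightarrow> m \<in> bfun \<Longrightarrow> norm (mulop (icof m) f) = norm (mulop (cof m) f)"
  by (rule power2_eq_imp_eq) (simp_all add: norm_mulop_sq muldom_icof norm_mult)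

lemma norm_sum_diff_pair:
  fixes a b :: "'b::real_inner"
  shows "norm ((1 / sqrt 2) *\<^sub>R (a + b), (1 / sqrt 2) *\<^sub>R (a - b)) = sqrt ((norm b)\<^sup>2 + (norm a)\<^sup>2)"
proof -
  have "(norm (a + b))\<^sup>2 + (norm (a - b))\<^sup>2 = 2 * ((norm b)\<^sup>2 + (norm a)\<^sup>2)"
    by (simp add: power2_norm_eq_inner inner_add_left inner_add_right inner_diff_left inner_diff_right inner_commute)
  then show ?thesis by (simp add: norm_prod_def power_divide power_mult_distrib flip: add_divide_distrib)
qed

lemma norm_J: "x \<in> Hsp s \<Longrightarrow> norm (J s x) = Hnorm s x"
proof -
  assume x: "x \<in> Hsp s"
  then have "fst x \<in> sobolev (s / 2)" by (auto simp: Hsp_def)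
  then have "sob_norm (s / 2) (fst x) = norm (mulop (icof (lam s)) (hat (fst x)))" using x by (simp add: sob_norm_eq norm_mulop_icof Hsp_iff)
  then show ?thesis using x unfolding J_def norm_sum_diff_pair Hnorm_def by (simp add: norm_hat Hsp_iff)
qed

text \<open>States form a real inner product space; \<open>cm\<close> restores the complex scalars
  to which \<open>semigroup_generated_by\<close> refers.\<close>

definition cm :: "complex \<Rightarrow> 'a::euclidean_space state \<Rightarrow> 'a state" where
  "cm c z = (mulop (\<lambda>_. c) (fst z), mulop (\<lambda>_. c) (snd z))"

lemma cm_of_real: "cm (cpx c) z = c *\<^sub>R z" by (simp add: cm_def mulop_const_of_real prod_eq_iff)

lemma mulop_const_bl: "bounded_linear (mulop (\<lambda>_. c))" by (rule bounded_linear_mulop) simp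

lemma cm_bl: "bounded_linear (cm c)" unfolding cm_def[abs_def]
  by (rule bounded_linear_Pair[OF bounded_linear_compose[OF mulop_const_bl bounded_linear_fst] bounded_linear_compose[OF mulop_const_bl bounded_linear_snd]])

lemma st_add_Hsp:
  assumes x: "x \<in> Hsp s" and y: "y \<in> Hsp s" shows "st_add x y \<in> Hsp s" "J s (st_add x y) = J s x + J s y"
proof -
  note s = x[unfolded Hsp_iff] y[unfolded Hsp_iff]
  have m: "icof (lam s) \<in> bfun" "cof (lam s) \<in> bfun" by measurable
  show "st_add x y \<in> Hsp s" using s by (auto simp: Hsp_iff st_add_def hat_add muldom_add[OF m(2)])
  show "J s (st_add x y) = J s x + J s y"
    using s by (simp add: J_def st_add_def hat_add muldom_add[OF m(1) Hsp_icof[OF x] Hsp_icof[OF y]] algebra_simps)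
qed

lemma st_scale_Hsp:
  assumes x: "x \<in> Hsp s" shows "st_scale c x \<in> Hsp s" "J s (st_scale c x) = cm c (J s x)"
proof -
  note s = x[unfolded Hsp_iff]
  have m: "icof (lam s) \<in> bfun" "cof (lam s) \<in> bfun" by measurable
  show "st_scale c x \<in> Hsp s" using s by (auto simp: Hsp_iff st_scale_def hat_cmul muldom_cmult[OF m(2)] L2_cmult)
  show "J s (st_scale c x) = cm c (J s x)"
    using s by (simp add: J_def cm_def st_scale_def hat_cmul muldom_cmult[OF m(1) Hsp_icof[OF x]] linear_simps[OF mulop_const_bl])
qed

lemma st_diff_Hsp:
  assumes x: "x \<in> Hsp s" and y: "y \<in> Hsp s" shows "st_diff x y \<in> Hsp s" "J s (st_diff x y) = J s x - J s y"
proof -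
  have e: "st_diff x y = st_add x (st_scale (- 1) y)" by (simp add: st_diff_def st_add_def st_scale_def)
  have "cm (- 1) (J s y) = - J s y" using cm_of_real[of "-1" "J s y"] by simp
  then show "st_diff x y \<in> Hsp s" "J s (st_diff x y) = J s x - J s y"
    unfolding e using x st_scale_Hsp[OF y, of "-1"] st_add_Hsp[OF x, of "st_scale (-1) y"] by simp_all
qed

lemma Hnorm_diff_0: "x \<in> Hsp s \<Longrightarrow> y \<in> Hsp s \<Longrightarrow> Hnorm s (st_diff x y) = 0 \<longleftrightarrow> J s x = J s y"
  by (simp add: norm_J[symmetric] st_diff_Hsp)

lemma bmf_inv_lam:
  assumes "s > 0" shows "bmf (\<lambda>\<xi>. 1 / icof (lam s) \<xi>)"
proof (rule bmfI[of _ 1])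
  show "cmod (1 / icof (lam s) \<xi>) \<le> 1" for \<xi> using lam_ge_1[of s \<xi>] assms by (simp add: norm_divide norm_mult)
qed measurable

lemma Ji:
  assumes s: "s > 0" shows "Ji s z \<in> Hsp s" "J s (Ji s z) = z"
proof -
  let ?d = "(1 / sqrt 2) *\<^sub>R (fst z - snd z)"
  let ?i = "\<lambda>\<xi>. 1 / icof (lam s) \<xi>"
  have m: "icof (lam s) \<in> bfun" "cof (lam s) \<in> bfun" "?i \<in> bfun" by measurable
  have ne: "icof (lam s) \<xi> * ?i \<xi> = 1" for \<xi> using lam_pos[of s \<xi>] by simp
  have sq: "L2 (\<lambda>\<xi>. ?i \<xi> * rep ?d \<xi>)" by (intro L2_bmf bmf_inv_lam s) auto
  have "(\<lambda>\<xi>. icof (lam s) \<xi> * (?i \<xi> * rep ?d \<xi>)) = rep ?d" by (simp only: mult.assoc[symmetric] ne mult_1)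
  then have dom: "mulop ?i ?d \<in> muldom (icof (lam s))" unfolding mulop_def by (subst muldom_cls[OF sq m(1)]) simp
  then have dom': "mulop ?i ?d \<in> muldom (cof (lam s))" by (simp add: muldom_icof)
  have inv: "mulop (icof (lam s)) (mulop ?i ?d) = ?d" by (simp only: mulop_mulop(1)[OF m(1) m(3) muldom_bmf[OF bmf_inv_lam[OF s]] dom] ne mulop_one)
  show "Ji s z \<in> Hsp s" using dom' by (simp add: Hsp_iff Ji_def)
  have "(1 / sqrt 2) *\<^sub>R (vel z + ?d) = fst z" "(1 / sqrt 2) *\<^sub>R (vel z - ?d) = snd z"
    unfolding vel_def by (simp_all add: scaleR_right_distrib scaleR_right_diff_distrib flip: scaleR_2 scaleR_add_left)
  then show "J s (Ji s z) = z" unfolding J_def Ji_def by (simp add: inv prod_eq_iff)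
qed

lemma Ji_ex:
  assumes s: "s > 0" shows "(\<exists>y\<in>Hsp s. P (J s y)) \<longleftrightarrow> (\<exists>y. P y)"
proof
  assume "\<exists>y. P y"
  then obtain y where "P y" ..
  then have "P (J s (Ji s y))" by (simp only: Ji(2)[OF s])
  with Ji(1)[OF s] show "\<exists>y\<in>Hsp s. P (J s y)" by blast
qed blast

text \<open>Sum and difference of the half-waves recover the velocity and i \<lambda> u, and
  \<lambda> u lies in the domain of \<lambda> exactly when u is in H^s. By the last claim the domain
  norm enters as the norm of the undamped generator, the quantity that controls high-frequency
  tails.\<close>

lemma Dom_iff:
  assumes s: "s > 0" shows "x \<in> Dom s \<longleftrightarrow> x \<in> Hsp s \<and> J s x \<in> Dm (lam s)"
    and "x \<in> Dom s \<Longrightarrow> hat (fst x) \<in> muldom (cof (lam (2 * s)))"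
    and "x \<in> Dom s \<Longrightarrow> Dnorm s x = norm (A0 (lam s) (J s x))"
proof -
  have m: "icof (lam s) \<in> bfun" "cof (lam s) \<in> bfun" "cof (lam (2 * s)) \<in> bfun"
     "lam s \<in> bfun" "icof (lam (2 * s)) \<in> bfun" by measurable
  have le: "lam s \<xi> \<le> lam (2 * s) \<xi>" for \<xi> :: 'a
    using lam_ge_1[of s \<xi>] s lam_double[of s \<xi>] mult_left_mono[of 1 "lam s \<xi>" "lam s \<xi>"] by simp
  have low: "f \<in> muldom (cof (lam (2 * s))) \<Longrightarrow> f \<in> muldom (cof (lam s))" for f :: "'a l2"
    by (rule muldom_mono[OF m(2), of 1 "cof (lam (2 * s))"]) (simp_all add: abs_of_pos[OF lam_pos] le)
  have D1: "x \<in> Dom s \<longleftrightarrow> L2 (fst x) \<and> L2 (snd x) \<and> hat (fst x) \<in> muldom (cof (lam (2 * s))) \<and> hat (snd x) \<in> muldom (cof (lam s))"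
    by (cases x) (auto simp: Dom_def sobolev_iff)
  have iter: "mulop (icof (lam s)) f \<in> muldom (cof (lam s)) \<longleftrightarrow> f \<in> muldom (cof (lam (2 * s)))" if f: "f \<in> muldom (cof (lam s))" for f :: "'a l2"
  proof -
    have "f \<in> muldom (icof (lam s))" using f by (simp add: muldom_icof)
    then have sf: "L2 (\<lambda>\<xi>. icof (lam s) \<xi> * rep f \<xi>)" by (simp add: muldom_def)
    have "mulop (icof (lam s)) f \<in> muldom (cof (lam s)) \<longleftrightarrow> L2 (\<lambda>\<xi>. cof (lam s) \<xi> * (icof (lam s) \<xi> * rep f \<xi>))"
      unfolding mulop_def by (rule muldom_cls[OF sf m(2)])
    also have "(\<lambda>\<xi>. cof (lam s) \<xi> * (icof (lam s) \<xi> * rep f \<xi>)) = (\<lambda>\<xi>. icof (lam (2 * s)) \<xi> * rep f \<xi>)"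
      by (auto simp: lam_double[symmetric])
    also have "L2 \<dots> \<longleftrightarrow> f \<in> muldom (icof (lam (2 * s)))" by (simp add: muldom_def)
    finally show ?thesis by (simp add: muldom_icof)
  qed
  show main: "x \<in> Dom s \<longleftrightarrow> x \<in> Hsp s \<and> J s x \<in> Dm (lam s)"
  proof
    assume "x \<in> Dom s"
    then have a: "L2 (fst x)" "L2 (snd x)" "hat (fst x) \<in> muldom (cof (lam (2 * s)))" "hat (snd x) \<in> muldom (cof (lam s))" "hat (fst x) \<in> muldom (cof (lam s))"
      using D1 low by auto
    then have b: "mulop (icof (lam s)) (hat (fst x)) \<in> muldom (cof (lam s))" using iter by simp
    show "x \<in> Hsp s \<and> J s x \<in> Dm (lam s)"
      using a by (simp add: Hsp_iff J_def Dm_def muldom_scaleR[OF m(2)] muldom_add[OF m(2) a(4) b] muldom_diff[OF m(2) a(4) b])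
  next
    assume a: "x \<in> Hsp s \<and> J s x \<in> Dm (lam s)"
    then have h: "hat (fst x) \<in> muldom (cof (lam s))" by (simp add: Hsp_iff)
    define f g where "f = hat (snd x)" and "g = mulop (icof (lam s)) (hat (fst x))"
    have fg: "(1 / sqrt 2) *\<^sub>R (f + g) \<in> muldom (cof (lam s))" "(1 / sqrt 2) *\<^sub>R (f - g) \<in> muldom (cof (lam s))"
      using a by (auto simp: J_def Dm_def f_def g_def)
    have "(1 / sqrt 2) *\<^sub>R ((1 / sqrt 2) *\<^sub>R (f + g) + (1 / sqrt 2) *\<^sub>R (f - g)) = f"
      "(1 / sqrt 2) *\<^sub>R ((1 / sqrt 2) *\<^sub>R (f + g) - (1 / sqrt 2) *\<^sub>R (f - g)) = g"
      by (simp_all add: scaleR_right_distrib scaleR_right_diff_distrib flip: scaleR_2 scaleR_add_left)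
    then have "f \<in> muldom (cof (lam s))" "g \<in> muldom (cof (lam s))"
      using muldom_scaleR(1)[OF m(2) muldom_add(1)[OF m(2) fg], of "1 / sqrt 2"] muldom_scaleR(1)[OF m(2) muldom_diff(1)[OF m(2) fg], of "1 / sqrt 2"] by simp_all
    then show "x \<in> Dom s" using a iter[OF h] unfolding D1 f_def g_def by (simp add: Hsp_iff)
  qed
  show "x \<in> Dom s \<Longrightarrow> hat (fst x) \<in> muldom (cof (lam (2 * s)))" using D1 by blast
  assume x: "x \<in> Dom s"
  then have a: "L2 (fst x)" "L2 (snd x)" "hat (fst x) \<in> muldom (cof (lam (2 * s)))" "hat (snd x) \<in> muldom (cof (lam s))" "hat (fst x) \<in> muldom (cof (lam s))"
    using D1 low by auto
  define f g where "f = hat (snd x)" and "g = mulop (icof (lam s)) (hat (fst x))"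
  have fd: "f \<in> muldom (icof (lam s))" "g \<in> muldom (icof (lam s))" using a iter m(4) by (auto simp: f_def g_def muldom_icof)
  let ?F = "mulop (icof (lam s)) f" and ?G = "mulop (icof (lam s)) g"
  have "A0 (lam s) (J s x) = ((1 / sqrt 2) *\<^sub>R (?F + ?G), - ((1 / sqrt 2) *\<^sub>R (?F - ?G)))"
    by (simp add: A0_def J_def f_def[symmetric] g_def[symmetric] muldom_scaleR(2)[OF m(1)] muldom_add[OF m(1) fd] muldom_diff[OF m(1) fd])
  then have "norm (A0 (lam s) (J s x)) = norm ((1 / sqrt 2) *\<^sub>R (?F + ?G), (1 / sqrt 2) *\<^sub>R (?F - ?G))" by (simp add: norm_prod_def)
  also have "\<dots> = sqrt ((norm ?G)\<^sup>2 + (norm ?F)\<^sup>2)" by (rule norm_sum_diff_pair)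
  also have "norm ?F = sob_norm (s / 2) (snd x)" using a x m(4) by (auto simp: f_def norm_mulop_icof Dom_def sob_norm_eq)
  also have "norm ?G = norm (mulop (cof (lam (2 * s))) (hat (fst x)))"
  proof -
    have "?G = mulop (\<lambda>\<xi>. icof (lam s) \<xi> * icof (lam s) \<xi>) (hat (fst x))"
      unfolding g_def by (rule mulop_mulop(1)[OF m(1) m(1)]) (use a fd m(4) in \<open>auto simp: muldom_icof g_def\<close>)
    also have "(\<lambda>\<xi>. icof (lam s) \<xi> * icof (lam s) \<xi>) = (\<lambda>\<xi>. - cof (lam (2 * s)) \<xi>)"
      by (rule ext) (simp only: i_mult_i lam_double[symmetric] of_real_mult)
    finally show ?thesis using mulop_uminus_fun[OF a(3)] by simp
  qed
  also have "\<dots> = sob_norm s (fst x)" using x by (auto simp: Dom_def sob_norm_eq)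
  finally show "Dnorm s x = norm (A0 (lam s) (J s x))" by (simp add: Dnorm_def)
qed

context damping
begin

lemma Agen_J:
  assumes s: "s > 0" and x: "x \<in> Dom s" shows "Agen s \<gamma> x \<in> Hsp s" "J s (Agen s \<gamma> x) = Aop (lam s) (J s x)"
proof -
  have m: "icof (lam s) \<in> bfun" by measurable
  have xH: "x \<in> Hsp s" "J s x \<in> Dm (lam s)" using Dom_iff(1)[OF s, of x] x by blast+
  have h2: "hat (fst x) \<in> muldom (cof (lam (2 * s)))" by (rule Dom_iff(2)[OF s x])
  have sq: "L2 (fst x)" "L2 (snd x)" using xH by (auto simp: Hsp_iff)
  define f where "f = frac_power (s / 2) (fst x)"
  have f: "L2 f" "hat f = mulop (cof (lam (2 * s))) (hat (fst x))" unfolding f_def using frac_power_hat[OF sq(1), of "s / 2"] h2 by simp_all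
  have u2: "hat (snd x) \<in> muldom (cof (lam s))" using x by (auto simp: Dom_def sobolev_iff)
  have gs: "L2 (\<lambda>z. cpx (\<gamma> z) * snd x z)" by (rule L2_bmf[OF bmf_\<gamma> sq(2)])
  have gh: "hat (\<lambda>z. cpx (\<gamma> z) * snd x z) = G (hat (snd x))"
    unfolding hat_def G_def by (simp add: mulop_cls_bmf[OF bmf_\<gamma> sq(2)])
  have A2: "snd (Agen s \<gamma> x) = (\<lambda>z. (-1) * f z - cpx (\<gamma> z) * snd x z)" by (simp add: Agen_def f_def)
  have sA: "L2 (snd (Agen s \<gamma> x))" unfolding A2 using f gs by (intro L2_diff L2_cmult)
  have hA: "hat (snd (Agen s \<gamma> x)) = - hat f - G (hat (snd x))" unfolding A2 using mulop_const_of_real[of "-1" "hat f"]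
    by (simp only: hat_diff[OF L2_cmult[OF f(1)] gs] hat_cmul[OF f(1)] gh) simp
  show "Agen s \<gamma> x \<in> Hsp s" using sq sA u2 by (simp add: Hsp_iff Agen_def)
  let ?L = "mulop (icof (lam s))"
  have d1: "hat (fst x) \<in> muldom (icof (lam s))" "hat (snd x) \<in> muldom (icof (lam s))" using xH u2 by (auto simp: Hsp_iff muldom_icof)
  have d2: "?L (hat (fst x)) \<in> muldom (icof (lam s))"
  proof -
    have "hat (fst x) \<in> muldom (\<lambda>\<xi>. icof (lam s) \<xi> * icof (lam s) \<xi>)"
      by (rule muldom_mono[of _ 1, OF _ _ h2]) (auto simp: norm_mult lam_double[symmetric] abs_mult)
    then have "L2 (\<lambda>\<xi>. icof (lam s) \<xi> * (icof (lam s) \<xi> * rep (hat (fst x)) \<xi>))" by (simp add: muldom_def mult.assoc)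
    then show ?thesis unfolding mulop_def using d1 by (subst muldom_cls) (auto simp: muldom_def)
  qed
  have LL: "?L (?L (hat (fst x))) = - hat f"
  proof -
    have "?L (?L (hat (fst x))) = mulop (\<lambda>\<xi>. icof (lam s) \<xi> * icof (lam s) \<xi>) (hat (fst x))"
      by (rule mulop_mulop(1)[OF m m d1(1) d2])
    also have "(\<lambda>\<xi>. icof (lam s) \<xi> * icof (lam s) \<xi>) = (\<lambda>\<xi>. - cof (lam (2 * s)) \<xi>)"
      by (rule ext) (simp only: i_mult_i lam_double[symmetric] of_real_mult)
    finally show ?thesis using mulop_uminus_fun[OF h2] f by simp
  qed
  have v: "vel (J s x) = hat (snd x)"
    unfolding vel_def J_def by (simp add: scaleR_right_distrib scaleR_right_diff_distrib flip: scaleR_2 scaleR_add_left)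
  have "Aop (lam s) (J s x) = ((1 / sqrt 2) *\<^sub>R (?L (hat (snd x)) + ?L (?L (hat (fst x)))) - (1 / sqrt 2) *\<^sub>R G (hat (snd x)),
      - ((1 / sqrt 2) *\<^sub>R (?L (hat (snd x)) - ?L (?L (hat (fst x))))) - (1 / sqrt 2) *\<^sub>R G (hat (snd x)))"
    unfolding Aop_def A0_def B_def v by (simp add: J_def muldom_scaleR(2)[OF m] muldom_add[OF m d1(2) d2] muldom_diff[OF m d1(2) d2])
  also have "\<dots> = J s (Agen s \<gamma> x)" unfolding J_def hA LL by (simp add: Agen_def algebra_simps)
  finally show "J s (Agen s \<gamma> x) = Aop (lam s) (J s x)" ..
qed

lemma quotient_J:
  assumes "x \<in> Hsp s" "x' \<in> Hsp s" "y \<in> Hsp s"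
  shows "Hnorm s (st_diff (st_scale (cpx (1/h)) (st_diff x' x)) y) = norm ((1/h) *\<^sub>R (J s x' - J s x) - J s y)"
  using assms by (simp only: norm_J[symmetric] st_diff_Hsp st_scale_Hsp cm_of_real)

lemma tendsto_J:
  fixes T :: "real \<Rightarrow> 'a st \<Rightarrow> 'a st"
  assumes "x \<in> Hsp s" "\<And>t. 0 \<le> t \<Longrightarrow> T t x \<in> Hsp s" "y \<in> Hsp s"
  shows "((\<lambda>h. Hnorm s (st_diff (st_scale (cpx (1/h)) (st_diff (T h x) x)) y)) \<longlongrightarrow> 0) (at_right 0)
     \<longleftrightarrow> ((\<lambda>h. (1/h) *\<^sub>R (J s (T h x) - J s x)) \<longlongrightarrow> J s y) (at_right 0)"
proof -
  have "\<forall>\<^sub>F h in at_right 0. Hnorm s (st_diff (st_scale (cpx (1/h)) (st_diff (T h x) x)) y) = norm ((1/h) *\<^sub>R (J s (T h x) - J s x) - J s y)"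
    unfolding eventually_at_filter using assms by (intro always_eventually allI impI quotient_J) auto
  then have "((\<lambda>h. Hnorm s (st_diff (st_scale (cpx (1/h)) (st_diff (T h x) x)) y)) \<longlongrightarrow> 0) (at_right 0)
     \<longleftrightarrow> ((\<lambda>h. norm ((1/h) *\<^sub>R (J s (T h x) - J s x) - J s y)) \<longlongrightarrow> 0) (at_right 0)"
    by (rule tendsto_cong)
  also have "\<dots> \<longleftrightarrow> ((\<lambda>h. (1/h) *\<^sub>R (J s (T h x) - J s x) - J s y) \<longlongrightarrow> 0) (at_right 0)" by (rule tendsto_norm_zero_iff)
  also have "\<dots> \<longleftrightarrow> ((\<lambda>h. (1/h) *\<^sub>R (J s (T h x) - J s x)) \<longlongrightarrow> J s y) (at_right 0)" by (rule LIM_zero_iff)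
  finally show ?thesis .
qed

lemma semigroup_transfer:
  assumes s: "s > 0" and T: "semigroup_generated_by s \<gamma> T"
  defines "T' \<equiv> \<lambda>t z. J s (T t (Ji s z))" shows "generates T' (Dm (lam s)) (Aop (lam s))"
    and "\<And>t x. 0 \<le> t \<Longrightarrow> x \<in> Hsp s \<Longrightarrow> J s (T t x) = T' t (J s x)"
proof -
  have TH: "T t x \<in> Hsp s" if "0 \<le> t" "x \<in> Hsp s" for t x using T that unfolding semigroup_generated_by_def by blast
  have lin: "J s (T t (st_add (st_scale c x) y)) = cm c (J s (T t x)) + J s (T t y)" if "0 \<le> t" "x \<in> Hsp s" "y \<in> Hsp s" for t x y c
  proof -
    have "Hnorm s (st_diff (T t (st_add (st_scale c x) y)) (st_add (st_scale c (T t x)) (T t y))) = 0"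
      using T that unfolding semigroup_generated_by_def by blast
    then show ?thesis using that TH by (simp add: Hnorm_diff_0 st_add_Hsp st_scale_Hsp)
  qed
  have bd: "\<exists>K. \<forall>x\<in>Hsp s. Hnorm s (T t x) \<le> K * Hnorm s x" if "0 \<le> t" for t
    using T that unfolding semigroup_generated_by_def by blast
  \<comment> \<open>\<open>T t\<close> acts on representatives, and \<open>Ji s (J s x)\<close> is
    another representative of the class of \<open>x\<close>. Boundedness applied to the difference,
    a null element, shows that \<open>T t\<close> respects classes.\<close>
  have wd: "J s (T t x) = J s (T t y)" if t: "0 \<le> t" and x: "x \<in> Hsp s" and y: "y \<in> Hsp s" and e: "J s x = J s y" for t x y
  proof -
    let ?d = "st_add (st_scale (-1) y) x"
    have cm1: "cm (-1) z = - z" for z :: "'a state" using cm_of_real[of "-1" z] by simp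
    have dH: "?d \<in> Hsp s" "J s ?d = 0" using x y e by (simp_all add: st_add_Hsp st_scale_Hsp cm1)
    obtain K where K: "\<forall>x\<in>Hsp s. Hnorm s (T t x) \<le> K * Hnorm s x" using bd[OF t] by blast
    have "norm (J s (T t ?d)) \<le> K * norm (J s ?d)" by (simp only: norm_J[OF TH[OF t dH(1)]] norm_J[OF dH(1)]) (rule K[rule_format, OF dH(1)])
    then have "J s (T t ?d) = 0" using dH by simp
    then show ?thesis using lin[OF t y x, of "-1"] by (simp add: cm1)
  qed
  show comm: "J s (T t x) = T' t (J s x)" if "0 \<le> t" "x \<in> Hsp s" for t x
    unfolding T'_def by (rule wd[OF that Ji(1)[OF s]]) (simp add: Ji(2)[OF s])
  show "generates T' (Dm (lam s)) (Aop (lam s))" unfolding generates_def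
  proof (intro conjI allI impI ballI)
    fix t :: real assume t: "0 \<le> t"
    obtain K where K: "\<forall>x\<in>Hsp s. Hnorm s (T t x) \<le> K * Hnorm s x" using bd[OF t] by blast
    have lin': "T' t (cm c z + y) = cm c (T' t z) + T' t y" for c z y
    proof -
      have "T' t (cm c z + y) = T' t (J s (st_add (st_scale c (Ji s z)) (Ji s y)))" by (simp add: st_add_Hsp st_scale_Hsp Ji[OF s])
      also have "\<dots> = J s (T t (st_add (st_scale c (Ji s z)) (Ji s y)))" by (rule comm[OF t, symmetric]) (simp add: st_add_Hsp st_scale_Hsp Ji[OF s])
      also have "\<dots> = cm c (T' t z) + T' t y" unfolding T'_def by (rule lin[OF t Ji(1)[OF s] Ji(1)[OF s]])
      finally show ?thesis .
    qed
    have cm1: "cm 1 z = z" for z :: "'a state" using cm_of_real[of 1 z] by simp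
    have add: "T' t (z + y) = T' t z + T' t y" for z y using lin'[of 1 z y] by (simp add: cm1)
    have "T' t 0 = 0" using add[of 0 0] by simp
    then have scl: "T' t (c *\<^sub>R z) = c *\<^sub>R T' t z" for c z using lin'[of "cpx c" z 0] by (simp add: cm_of_real)
    show "bounded_linear (T' t)"
    proof (rule bounded_linear_intro[OF add scl])
      show "norm (T' t z) \<le> norm z * K" for z
        using K[rule_format, OF Ji(1)[OF s, of z]] unfolding T'_def by (simp add: norm_J[symmetric] TH[OF t] Ji[OF s] mult.commute)
    qed
  next
    have "Hnorm s (st_diff (T 0 x) x) = 0" if "x \<in> Hsp s" for x using T that unfolding semigroup_generated_by_def by blast
    from this[OF Ji(1)[OF s]] show "T' 0 z = z" for z
      unfolding T'_def Hnorm_diff_0[OF TH[OF order_refl Ji(1)[OF s]] Ji(1)[OF s]] by (simp only: Ji(2)[OF s])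
  next
    fix t r :: real and z assume t: "0 \<le> t" and r: "0 \<le> r"
    have "Hnorm s (st_diff (T (t + r) x) (T t (T r x))) = 0" if "x \<in> Hsp s" for x using T that t r unfolding semigroup_generated_by_def by blast
    from this[OF Ji(1)[OF s, of z]] have "J s (T (t + r) (Ji s z)) = J s (T t (T r (Ji s z)))"
      using t r by (subst (asm) Hnorm_diff_0[OF TH TH[OF _ TH]]) (simp_all add: Ji(1)[OF s])
    also have "\<dots> = T' t (J s (T r (Ji s z)))" by (rule comm[OF t TH[OF r Ji(1)[OF s]]])
    finally show "T' (t + r) z = T' t (T' r z)" unfolding T'_def .
  next
    fix z
    have l: "((\<lambda>t. Hnorm s (st_diff (T t (Ji s z)) (Ji s z))) \<longlongrightarrow> 0) (at_right 0)"
      using T Ji(1)[OF s, of z] unfolding semigroup_generated_by_def by blast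
    have "\<forall>\<^sub>F t in at_right 0. Hnorm s (st_diff (T t (Ji s z)) (Ji s z)) = norm (T' t z - z)"
      unfolding eventually_at_filter T'_def using TH Ji[OF s, of z] by (intro always_eventually allI impI) (simp add: norm_J[symmetric] st_diff_Hsp)
    from iffD1[OF tendsto_cong[OF this] l]
    show "((\<lambda>t. T' t z) \<longlongrightarrow> z) (at_right 0)" by (rule LIM_zero_cancel[OF tendsto_norm_zero_cancel])
  next
    fix z
    have "Ji s z \<in> Dom s \<longleftrightarrow> (\<exists>y\<in>Hsp s. ((\<lambda>h. Hnorm s (st_diff (st_scale (cpx (1/h)) (st_diff (T h (Ji s z)) (Ji s z))) y)) \<longlongrightarrow> 0) (at_right 0))"
      using T Ji(1)[OF s, of z] unfolding semigroup_generated_by_def by blast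
    also have "\<dots> \<longleftrightarrow> (\<exists>y\<in>Hsp s. ((\<lambda>h. (1/h) *\<^sub>R (T' h z - z)) \<longlongrightarrow> J s y) (at_right 0))"
      using tendsto_J[where T = T, OF Ji(1)[OF s, of z] TH[OF _ Ji(1)[OF s]]] by (simp add: T'_def Ji(2)[OF s])
    also have "\<dots> \<longleftrightarrow> (\<exists>y. ((\<lambda>h. (1/h) *\<^sub>R (T' h z - z)) \<longlongrightarrow> y) (at_right 0))"
      by (rule Ji_ex[OF s])
    finally show "z \<in> Dm (lam s) \<longleftrightarrow> (\<exists>y. ((\<lambda>h. (1/h) *\<^sub>R (T' h z - z)) \<longlongrightarrow> y) (at_right 0))"
      using Dom_iff(1)[OF s, of "Ji s z"] Ji[OF s, of z] by simp
  next
    fix z :: "'a state" assume z: "z \<in> Dm (lam s)"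
    then have d: "Ji s z \<in> Dom s" using Dom_iff(1)[OF s, of "Ji s z"] Ji[OF s, of z] by simp
    then have "((\<lambda>h. Hnorm s (st_diff (st_scale (cpx (1/h)) (st_diff (T h (Ji s z)) (Ji s z))) (Agen s \<gamma> (Ji s z)))) \<longlongrightarrow> 0) (at_right 0)"
      using T unfolding semigroup_generated_by_def by blast
    then show "((\<lambda>h. (1/h) *\<^sub>R (T' h z - z)) \<longlongrightarrow> Aop (lam s) z) (at_right 0)"
      using tendsto_J[where T = T, OF Ji(1)[OF s, of z] TH[OF _ Ji(1)[OF s]] Agen_J(1)[OF s d]] Agen_J(2)[OF s d] by (simp add: T'_def Ji(2)[OF s])
  qed
qed

lemma semigroup_exists:
  assumes s: "s > 0" shows "\<exists>T. semigroup_generated_by s \<gamma> T"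
proof -
  have m: "(lam s :: 'a \<Rightarrow> real) \<in> bfun" by measurable
  interpret P: perturbed_group "Sg (lam s)" "Dm (lam s)" "A0 (lam s)" B by (rule perturbed_group_Sg[OF m B_bl])
  have gen: "generates P.T (Dm (lam s)) (Aop (lam s))" using P.generates_T unfolding Aop_def[abs_def] .
  \<comment> \<open>Complex linearity is part of \<open>semigroup_generated_by\<close>, whereas the
    perturbation argument is real; it follows once complex scalars commute with the group and with
    the damping.\<close>
  have cmS: "cm c (Sg (lam s) t z) = Sg (lam s) t (cm c z)" for c t and z :: "'a state"
  proof -
    have "mulop (\<lambda>_. c) (U (lam s) t f) = U (lam s) t (mulop (\<lambda>_. c) f)" for t and f :: "'a l2"
      unfolding U_def by (simp only: mulop_mulop_bmf[OF bmf_const bmf_iexp[OF m]] mulop_mulop_bmf[OF bmf_iexp[OF m] bmf_const] mult.commute)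
    then show ?thesis by (simp add: cm_def Sg_def)
  qed
  have cmB: "cm c (B z) = B (cm c z)" for c z
  proof -
    have "G (mulop (\<lambda>_. c) f) = mulop (\<lambda>_. c) (G f)" for f
      by (simp add: G_def Fi_cmul Fo_cmul mulop_mulop_bmf bmf_\<gamma> mult.commute flip: Fo_cmul)
    moreover have "vel (cm c z) = mulop (\<lambda>_. c) (vel z)" by (simp add: vel_def cm_def linear_simps[OF mulop_const_bl])
    ultimately show ?thesis by (simp add: B_def cm_def linear_simps[OF mulop_const_bl])
  qed
  define T where "T t x = Ji s (P.T t (J s x))" for t x
  have JT: "T t x \<in> Hsp s" "J s (T t x) = P.T t (J s x)" for t x unfolding T_def by (rule Ji[OF s])+
  note g = gen[unfolded generates_def]
  have bl: "0 \<le> t \<Longrightarrow> bounded_linear (P.T t)" for t using g by blast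
  have T0: "P.T 0 z = z" for z using g by blast
  have "semigroup_generated_by s \<gamma> T" unfolding semigroup_generated_by_def
  proof (intro conjI allI impI ballI)
    show "T t x \<in> Hsp s" for t x by (rule JT)
    show "Hnorm s (st_diff (T t (st_add (st_scale c x) y)) (st_add (st_scale c (T t x)) (T t y))) = 0"
      if "0 \<le> t" "x \<in> Hsp s" "y \<in> Hsp s" for t x y c
      using that by (simp add: Hnorm_diff_0 JT st_add_Hsp st_scale_Hsp linear_simps[OF bl] P.T_commute[OF cm_bl cmS cmB])
    show "\<exists>K. \<forall>x\<in>Hsp s. Hnorm s (T t x) \<le> K * Hnorm s x" if t: "0 \<le> t" for t
    proof -
      obtain K where "\<And>z. norm (P.T t z) \<le> norm z * K" using bounded_linear.bounded[OF bl[OF t]] by blast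
      then show ?thesis by (intro exI[of _ K]) (simp add: norm_J[symmetric] JT mult.commute)
    qed
    show "Hnorm s (st_diff (T 0 x) x) = 0" if "x \<in> Hsp s" for x using that by (simp add: Hnorm_diff_0 JT T0)
    show "Hnorm s (st_diff (T (t + r) x) (T t (T r x))) = 0" if "0 \<le> t" "0 \<le> r" for t r x
      using that P.T_semigroup[of r t] by (simp add: Hnorm_diff_0 JT)
    show "((\<lambda>t. Hnorm s (st_diff (T t x) x)) \<longlongrightarrow> 0) (at_right 0)" if x: "x \<in> Hsp s" for x
    proof -
      have "((\<lambda>t. P.T t (J s x)) \<longlongrightarrow> J s x) (at_right 0)" using g by blast
      then have "((\<lambda>t. norm (P.T t (J s x) - J s x)) \<longlongrightarrow> 0) (at_right 0)" by (rule tendsto_norm_zero[OF LIM_zero])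
      then show ?thesis using x by (simp add: norm_J[symmetric] st_diff_Hsp JT)
    qed
    show "x \<in> Dom s \<longleftrightarrow> (\<exists>y\<in>Hsp s. ((\<lambda>h. Hnorm s (st_diff (st_scale (cpx (1/h)) (st_diff (T h x) x)) y)) \<longlongrightarrow> 0) (at_right 0))" if x: "x \<in> Hsp s" for x
    proof -
      have "x \<in> Dom s \<longleftrightarrow> J s x \<in> Dm (lam s)" using Dom_iff(1)[OF s, of x] x by simp
      also have "\<dots> \<longleftrightarrow> (\<exists>y. ((\<lambda>h. (1/h) *\<^sub>R (P.T h (J s x) - J s x)) \<longlongrightarrow> y) (at_right 0))" using g by blast
      also have "\<dots> \<longleftrightarrow> (\<exists>y\<in>Hsp s. ((\<lambda>h. (1/h) *\<^sub>R (P.T h (J s x) - J s x)) \<longlongrightarrow> J s y) (at_right 0))" by (rule Ji_ex[OF s, symmetric])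
      also have "\<dots> \<longleftrightarrow> (\<exists>y\<in>Hsp s. ((\<lambda>h. Hnorm s (st_diff (st_scale (cpx (1/h)) (st_diff (T h x) x)) y)) \<longlongrightarrow> 0) (at_right 0))"
        using tendsto_J[where T = T, OF x JT(1)] by (simp add: JT)
      finally show ?thesis .
    qed
    show "((\<lambda>h. Hnorm s (st_diff (st_scale (cpx (1/h)) (st_diff (T h x) x)) (Agen s \<gamma> x))) \<longlongrightarrow> 0) (at_right 0)" if x: "x \<in> Dom s" for x
    proof -
      have xx: "x \<in> Hsp s" "J s x \<in> Dm (lam s)" using Dom_iff(1)[OF s, of x] x by blast+
      have "((\<lambda>h. (1/h) *\<^sub>R (P.T h (J s x) - J s x)) \<longlongrightarrow> Aop (lam s) (J s x)) (at_right 0)" using g xx(2) by blast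
      then show ?thesis using tendsto_J[where T = T, OF xx(1) JT(1) Agen_J(1)[OF s x]] by (simp add: JT Agen_J(2)[OF s x])
    qed
  qed
  then show ?thesis by blast
qed

end

section \<open>Observability of the undamped flow\<close>

text \<open>The flow is replaced by one with frequencies in \<open>h \<int>\<close>. Multiplied by a Dirichlet kernel of length \<open>N\<close> it
  becomes a trigonometric polynomial whose coefficients live in spectral windows of width \<open>N h\<close>, so that Parseval's
  identity reduces observability to the uncertainty principle.\<close>

lemma norm_mulop_const: "norm (mulop (\<lambda>_. c) f) = cmod c * norm f"
proof -
  have "(norm (mulop (\<lambda>_. c) f))\<^sup>2 = (cmod c * norm f)\<^sup>2" by (simp add: norm_mulop_sq norm_l2_sq[of f] power_mult_distrib)
  then show ?thesis by (simp add: power2_eq_iff_nonneg)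
qed

lemma mulop_const_const: "mulop (\<lambda>_. c) (mulop (\<lambda>_. d) f) = mulop (\<lambda>_. c * d) f" by (simp add: mulop_mulop_bmf)

lemma mulop_const_commute: "bmf m \<Longrightarrow> mulop m (mulop (\<lambda>_. c) f) = mulop (\<lambda>_. c) (mulop m f)"
  by (simp add: mulop_mulop_bmf mult.commute)

lemma mulop_const_inner: "mulop (\<lambda>_. c) f \<bullet> g = f \<bullet> mulop (\<lambda>_. cnj c) g" by (rule inner_mulop) auto

lemma iexp_eq: "iexp a = cpx (cos a) + \<i> * cpx (sin a)" by (simp add: complex_eq_iff Re_exp Im_exp)

lemma mulop_iexp_const: "mulop (\<lambda>_. iexp a) f = cos a *\<^sub>R f + sin a *\<^sub>R mulop (\<lambda>_. \<i>) f"
proof -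
  have "(\<lambda>x. iexp a * rep f x) = (\<lambda>x. cpx (cos a) * rep f x + cpx (sin a) * (\<i> * rep f x))" by (simp add: iexp_eq algebra_simps)
  then show ?thesis unfolding mulop_def by (simp add: cls_add cls_scaleR L2_cmult)
qed

lemma mulop_sum_const:
  assumes m: "\<And>j. bmf (m j)"
  shows "mulop (\<lambda>\<xi>. \<Sum>j\<in>I. c j * m j \<xi>) f = (\<Sum>j\<in>I. mulop (\<lambda>_. c j) (mulop (m j) f))"
proof -
  have s: "L2 (\<lambda>\<xi>. c j * (m j \<xi> * rep f \<xi>))" for j by (intro L2_cmult L2_bmf m) auto
  have "mulop (\<lambda>\<xi>. \<Sum>j\<in>I. c j * m j \<xi>) f = cls (\<lambda>\<xi>. \<Sum>j\<in>I. c j * (m j \<xi> * rep f \<xi>))"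
    unfolding mulop_def by (simp add: sum_distrib_right mult.assoc)
  also have "\<dots> = (\<Sum>j\<in>I. cls (\<lambda>\<xi>. c j * (m j \<xi> * rep f \<xi>)))" using cls_sum[of I "\<lambda>j \<xi>. c j * (m j \<xi> * rep f \<xi>)"] s by simp
  also have "\<dots> = (\<Sum>j\<in>I. mulop (\<lambda>_. c j) (mulop (m j) f))"
    by (rule sum.cong[OF refl]) (simp add: mulop_def[of "m _"] mulop_cls_bmf L2_bmf m)
  finally show ?thesis .
qed

lemma trig_integrals:
  fixes n :: int and h :: real
  assumes h: "h > 0" shows "((\<lambda>t. cos (of_int n * h * t)) has_integral (if n = 0 then 2 * pi / h else 0)) {- pi / h..pi / h}"
    and "((\<lambda>t. sin (of_int n * h * t)) has_integral 0) {- pi / h..pi / h}"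
proof -
  have le: "- pi / h \<le> pi / h" using h by (simp add: divide_right_mono)
  have "((\<lambda>t. cos (of_int n * h * t)) has_integral (if n = 0 then 2 * pi / h else 0)) {- pi / h..pi / h}
     \<and> ((\<lambda>t. sin (of_int n * h * t)) has_integral 0) {- pi / h..pi / h}"
  proof (cases "n = 0")
    case True
    have "((\<lambda>t. 1::real) has_integral (pi / h - - pi / h)) {- pi / h..pi / h}"
      using has_integral_const_real[of "1::real" "- pi / h" "pi / h"] le by simp
    then show ?thesis using True by (simp add: has_integral_0)
  next
    case False
    let ?a = "of_int n * h"
    have a: "?a \<noteq> 0" using False h by simp
    have "((\<lambda>t. cos (?a * t)) has_integral (sin (?a * (pi / h)) / ?a - sin (?a * (- pi / h)) / ?a)) {- pi / h..pi / h}"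
      by (rule fundamental_theorem_of_calculus[OF le])
         (use a in \<open>auto intro!: derivative_eq_intros simp: has_real_derivative_iff_has_vector_derivative[symmetric]\<close>)
    moreover have "((\<lambda>t. sin (?a * t)) has_integral (- cos (?a * (pi / h)) / ?a - (- cos (?a * (- pi / h)) / ?a))) {- pi / h..pi / h}"
      by (rule fundamental_theorem_of_calculus[OF le])
         (use a in \<open>auto intro!: derivative_eq_intros simp: has_real_derivative_iff_has_vector_derivative[symmetric]\<close>)
    moreover have "?a * (pi / h) = of_int n * pi" "?a * (- pi / h) = - (of_int n * pi)" using h by simp_all
    ultimately show ?thesis using False by (simp add: sin_int_times_real mult.commute[of _ pi])
  qed
  then show "((\<lambda>t. cos (of_int n * h * t)) has_integral (if n = 0 then 2 * pi / h else 0)) {- pi / h..pi / h}"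
    "((\<lambda>t. sin (of_int n * h * t)) has_integral 0) {- pi / h..pi / h}" by blast+
qed

text \<open>Orthogonality over one period 2 pi / h with coefficients in the Hilbert space. As the
  inner product is real, a phase difference contributes a cosine term and a sine term paired with
  \<open>mulop (\<lambda>_. \<i>)\<close>; both integrate to 0 off the diagonal.\<close>

lemma trig_parseval:
  fixes Y :: "int \<Rightarrow> 'a::euclidean_space l2"
  assumes h: "h > 0" and I: "finite I"
  shows "((\<lambda>t. (norm (\<Sum>j\<in>I. mulop (\<lambda>_. iexp (of_int j * h * t)) (Y j)))\<^sup>2) has_integral (2 * pi / h * (\<Sum>j\<in>I. (norm (Y j))\<^sup>2)))
      {- pi / h..pi / h}"
proof -
  have pair: "mulop (\<lambda>_. iexp a) f \<bullet> mulop (\<lambda>_. iexp b) g = cos (a - b) * (f \<bullet> g) + sin (a - b) * (mulop (\<lambda>_. \<i>) f \<bullet> g)"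
    for a b and f g :: "'a l2"
  proof -
    have "cnj (iexp a) * iexp b = cnj (iexp (a - b))" by (simp add: exp_cnj exp_add[symmetric] algebra_simps)
    then have "mulop (\<lambda>_. iexp a) f \<bullet> mulop (\<lambda>_. iexp b) g = mulop (\<lambda>_. iexp (a - b)) f \<bullet> g"
      by (simp only: mulop_const_inner mulop_const_const)
    then show ?thesis unfolding mulop_iexp_const[of "a - b"] by (simp add: inner_add_left)
  qed
  have eq: "(norm (\<Sum>j\<in>I. mulop (\<lambda>_. iexp (of_int j * h * t)) (Y j)))\<^sup>2
    = (\<Sum>j\<in>I. \<Sum>l\<in>I. cos (of_int (j - l) * h * t) * (Y j \<bullet> Y l) + sin (of_int (j - l) * h * t) * (mulop (\<lambda>_. \<i>) (Y j) \<bullet> Y l))" for t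
    unfolding power2_norm_eq_inner inner_sum_left inner_sum_right pair by (subst sum.swap) (simp only: of_int_diff left_diff_distrib)
  have "((\<lambda>t. \<Sum>j\<in>I. \<Sum>l\<in>I. cos (of_int (j - l) * h * t) * (Y j \<bullet> Y l) + sin (of_int (j - l) * h * t) * (mulop (\<lambda>_. \<i>) (Y j) \<bullet> Y l))
     has_integral (\<Sum>j\<in>I. \<Sum>l\<in>I. (if j - l = 0 then 2 * pi / h else 0) * (Y j \<bullet> Y l) + 0 * (mulop (\<lambda>_. \<i>) (Y j) \<bullet> Y l))) {- pi / h..pi / h}"
    by (intro has_integral_sum I has_integral_add has_integral_mult_left trig_integrals h)
  moreover have "(\<Sum>l\<in>I. (if j - l = 0 then 2 * pi / h else 0) * (Y j \<bullet> Y l) + 0 * (mulop (\<lambda>_. \<i>) (Y j) \<bullet> Y l)) = 2 * pi / h * (norm (Y j))\<^sup>2" if "j \<in> I" for j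
  proof -
    have "(\<Sum>l\<in>I. (if j - l = 0 then 2 * pi / h else 0) * (Y j \<bullet> Y l) + 0 * (mulop (\<lambda>_. \<i>) (Y j) \<bullet> Y l)) = (\<Sum>l\<in>I. if j = l then 2 * pi / h * (Y j \<bullet> Y l) else 0)"
      by (rule sum.cong) auto
    then show ?thesis using that I by (simp add: power2_norm_eq_inner)
  qed
  ultimately show ?thesis unfolding eq by (simp add: sum_distrib_left cong: sum.cong)
qed

definition dirichlet :: "nat \<Rightarrow> real \<Rightarrow> real \<Rightarrow> complex" where
  "dirichlet N h t = (\<Sum>n<N. iexp (- (real n * h * t)))"

text \<open>The kernel spreads the frequency k over j = k - n with 0 <= n < N, which is the
  condition j <= k < j + N; the summation range contains all such j as soon as |k| <= n0.\<close>

lemma dirichlet_window: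
  fixes k n0 :: int
  assumes "\<bar>k\<bar> \<le> n0" shows "dirichlet N h t * iexp (t * (h * of_int k))
    = (\<Sum>j\<in>{- n0 - int N..n0}. iexp (of_int j * h * t) * (if j \<le> k \<and> k < j + int N then 1 else 0))"
proof -
  have "(\<Sum>j\<in>{- n0 - int N..n0}. iexp (of_int j * h * t) * (if j \<le> k \<and> k < j + int N then 1 else 0))
    = (\<Sum>j\<in>{j\<in>{- n0 - int N..n0}. j \<le> k \<and> k < j + int N}. iexp (of_int j * h * t))"
    by (subst sum.inter_filter) (auto intro!: sum.cong)
  also have "\<dots> = (\<Sum>n<N. iexp (of_int (k - int n) * h * t))"
    by (rule sum.reindex_bij_witness[of _ "\<lambda>n. k - int n" "\<lambda>j. nat (k - j)"]) (use assms in auto)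
  also have "\<dots> = dirichlet N h t * iexp (t * (h * of_int k))"
    unfolding dirichlet_def sum_distrib_right by (rule sum.cong) (simp_all add: exp_add[symmetric] algebra_simps)
  finally show ?thesis ..
qed

lemma norm_dirichlet_le: "cmod (dirichlet N h t) \<le> real N" unfolding dirichlet_def by (rule order_trans[OF norm_sum]) simp

lemma sin_ge_third:
  assumes "0 \<le> x" "x \<le> pi / 2" shows "x / 3 \<le> sin x"
proof -
  have "\<bar>Im (iexp x - (\<Sum>k\<le>2. (\<i> * cpx x) ^ k / fact k))\<bar> \<le> \<bar>x\<bar> ^ Suc 2 / fact (Suc 2)"
    by (rule order_trans[OF abs_Im_le_cmod iexp_approx1])
  then have "\<bar>sin x - x\<bar> \<le> x ^ 3 / 6" using assms by (simp add: numeral_eq_Suc Im_exp fact_numeral power2_eq_square)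
  moreover have "x ^ 3 / 6 \<le> 2 / 3 * x"
  proof -
    have "x \<le> 2" using assms pi_half_less_two by simp
    then have "x * x \<le> 2 * 2" using assms by (intro mult_mono) auto
    then have "x * (x * x) \<le> x * 4" using assms by (intro mult_left_mono) auto
    then show ?thesis by (simp add: power3_eq_cube)
  qed
  ultimately show ?thesis by linarith
qed

text \<open>Geometric sum: the numerator is at most 2 in modulus, and the denominator has modulus 2
  sin(|h t| / 2), at least h |t| / 3.\<close>

lemma norm_dirichlet_tail:
  assumes h: "h > 0" and t: "t \<noteq> 0" "\<bar>h * t\<bar> \<le> pi" shows "cmod (dirichlet N h t) \<le> 6 / (h * \<bar>t\<bar>)"
proof -
  let ?z = "iexp (- (h * t))"
  have "dirichlet N h t = (\<Sum>n<N. ?z ^ n)" unfolding dirichlet_def exp_of_nat_mult[symmetric] by (rule sum.cong) (simp_all add: algebra_simps)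
  then have "(1 - ?z) * dirichlet N h t = 1 - ?z ^ N" by (simp only: one_diff_power_eq)
  then have "cmod (1 - ?z) * cmod (dirichlet N h t) = cmod (1 - ?z ^ N)" by (simp only: norm_mult[symmetric])
  also have "\<dots> \<le> 1 + 1" by (rule order_trans[OF norm_triangle_ineq4]) (simp add: norm_power)
  finally have a: "cmod (1 - ?z) * cmod (dirichlet N h t) \<le> 2" by simp
  have "msq (1 - ?z) = (2 * sin (\<bar>h * t\<bar> / 2))\<^sup>2"
  proof -
    have "msq (1 - ?z) = (1 - cos (h * t))\<^sup>2 + (sin (h * t))\<^sup>2" unfolding cmod_power2 by (simp add: Re_exp Im_exp)
    also have "\<dots> = 2 - 2 * cos \<bar>h * t\<bar>" using sin_squared_eq[of "h * t"] by (simp add: power2_eq_square algebra_simps)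
    also have "\<dots> = (2 * sin (\<bar>h * t\<bar> / 2))\<^sup>2" using cos_double_sin[of "\<bar>h * t\<bar> / 2"] by (simp add: power_mult_distrib)
    finally show ?thesis .
  qed
  note sq = this
  have s: "\<bar>h * t\<bar> / 2 / 3 \<le> sin (\<bar>h * t\<bar> / 2)" by (rule sin_ge_third) (use t in auto)
  have "0 \<le> sin (\<bar>h * t\<bar> / 2)" using s by (rule order_trans[rotated]) simp
  then have "cmod (1 - ?z) = 2 * sin (\<bar>h * t\<bar> / 2)" by (intro power2_eq_imp_eq[OF sq]) auto
  then have "h * \<bar>t\<bar> / 3 \<le> cmod (1 - ?z)" using s h by (simp add: abs_mult)
  then have "h * \<bar>t\<bar> / 3 * cmod (dirichlet N h t) \<le> 2" using mult_right_mono[OF _ norm_ge_zero] a order_trans by blast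
  then show ?thesis using h t by (simp add: field_simps)
qed

section \<open>Discretised frequencies and spectral windows\<close>

definition cutoff :: "('a \<Rightarrow> real) \<Rightarrow> real \<Rightarrow> 'a \<Rightarrow> complex" where "cutoff m \<rho> \<xi> = (if m \<xi> \<le> \<rho> then 1 else 0)"

text \<open>Rounding down to the grid of mesh h makes the flow periodic in time with period 2 pi /
  h, at the cost of an error of norm at most h in the generator.\<close>

definition dsc :: "real \<Rightarrow> ('a \<Rightarrow> real) \<Rightarrow> 'a \<Rightarrow> real" where "dsc h m \<xi> = h * of_int \<lfloor>m \<xi> / h\<rfloor>"

lemma bmf_cutoff: "m \<in> bfun \<Longrightarrow> bmf (cutoff m \<rho>)" by (rule bmfI[of _ 1]) (auto simp: cutoff_def[abs_def])

lemma floor_quotient_measurable: "m \<in> bfun \<Longrightarrow> (\<lambda>\<xi>. \<lfloor>m \<xi> / h :: real\<rfloor>) \<in> measurable borel (count_space UNIV)"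
  by (rule measurable_compose[OF _ measurable_real_floor]) simp

lemma dsc_measurable [measurable]: "m \<in> bfun \<Longrightarrow> dsc h m \<in> bfun"
  unfolding dsc_def[abs_def] by (rule measurable_compose[OF floor_quotient_measurable]) simp_all

lemma dsc_le: "h > 0 \<Longrightarrow> \<bar>m \<xi> - dsc h m \<xi>\<bar> \<le> h"
proof -
  assume h: "h > 0"
  then have "m \<xi> - dsc h m \<xi> = h * (m \<xi> / h - of_int \<lfloor>m \<xi> / h\<rfloor>)" by (simp add: dsc_def right_diff_distrib)
  moreover have "\<bar>m \<xi> / h - of_int \<lfloor>m \<xi> / h\<rfloor>\<bar> \<le> 1" by linarith
  ultimately show ?thesis using h by (simp add: abs_mult)
qed

text \<open>\<sigma> = 1 and \<sigma> = -1 are the two half-waves, and the integer frequency is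
  \<sigma> times the grid index. With the spectral cutoff at \<rho> built in, finitely many windows
  suffice.\<close>

definition win :: "real \<Rightarrow> ('a \<Rightarrow> real) \<Rightarrow> real \<Rightarrow> nat \<Rightarrow> int \<Rightarrow> int \<Rightarrow> 'a \<Rightarrow> complex" where
  "win h m \<rho> N \<sigma> j \<xi> = (if j \<le> \<sigma> * \<lfloor>m \<xi> / h\<rfloor> \<and> \<sigma> * \<lfloor>m \<xi> / h\<rfloor> < j + int N then cutoff m \<rho> \<xi> else 0)"

lemma win_measurable:
  assumes m[measurable]: "m \<in> bfun" shows "win h m \<rho> N \<sigma> j \<in> bfun"
proof -
  have [measurable]: "Measurable.pred borel (\<lambda>\<xi>. j \<le> \<sigma> * \<lfloor>m \<xi> / h\<rfloor> \<and> \<sigma> * \<lfloor>m \<xi> / h\<rfloor> < j + int N)"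
    by (rule measurable_compose[OF floor_quotient_measurable[OF m]]) simp
  show ?thesis unfolding win_def[abs_def] cutoff_def by measurable
qed

lemma bmf_win: "m \<in> bfun \<Longrightarrow> bmf (win h m \<rho> N \<sigma> j)"
  by (rule bmfI[of _ 1]) (auto simp: win_def cutoff_def win_measurable)

lemma win_sum:
  fixes k :: int assumes "\<bar>k\<bar> \<le> n0"
  shows "(\<Sum>j\<in>{- n0 - int N..n0}. if j \<le> k \<and> k < j + int N then 1 else (0::real)) = real N"
proof -
  have "(\<Sum>j\<in>{- n0 - int N..n0}. if j \<le> k \<and> k < j + int N then 1 else (0::real)) = real (card {j\<in>{- n0 - int N..n0}. j \<le> k \<and> k < j + int N})"
    by (subst sum.inter_filter[symmetric]) auto
  also have "{j\<in>{- n0 - int N..n0}. j \<le> k \<and> k < j + int N} = {k - int N + 1..k}" using assms by auto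
  finally show ?thesis by simp
qed

lemma floor_bound:
  fixes a \<rho> h :: real
  assumes "h > 0" "1 \<le> a" "a \<le> \<rho>" shows "\<bar>\<lfloor>a / h\<rfloor>\<bar> \<le> \<lfloor>\<rho> / h\<rfloor>"
proof -
  have "0 \<le> \<lfloor>a / h\<rfloor>" using assms by simp
  moreover have "\<lfloor>a / h\<rfloor> \<le> \<lfloor>\<rho> / h\<rfloor>" using assms by (intro floor_mono divide_right_mono) auto
  ultimately show ?thesis by simp
qed

text \<open>Each grid frequency below the cutoff lies in exactly N windows.\<close>

lemma sum_norm_win:
  fixes f :: "'a::euclidean_space l2"
  assumes m[measurable]: "m \<in> bfun" and m1: "\<And>\<xi>. 1 \<le> m \<xi>" and h: "h > 0" and f: "mulop (cutoff m \<rho>) f = f" and \<sigma>: "\<bar>\<sigma>\<bar> = 1"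
    and n0: "n0 = \<lfloor>\<rho> / h\<rfloor>"
  shows "(\<Sum>j\<in>{- n0 - int N..n0}. (norm (mulop (win h m \<rho> N \<sigma> j) f))\<^sup>2) = real N * (norm f)\<^sup>2"
proof -
  note [measurable] = win_measurable[OF m]
  have I: "integrable lborel (\<lambda>\<xi>. msq (win h m \<rho> N \<sigma> j \<xi>) * msq (rep f \<xi>))" for j
    using L2_normD[OF L2_bmf[OF bmf_win[OF m, of h \<rho> N \<sigma> j] L2_rep[of f]]] by (simp add: norm_mult power_mult_distrib)
  have pt: "(\<Sum>j\<in>{- n0 - int N..n0}. msq (win h m \<rho> N \<sigma> j \<xi>)) = real N * msq (cutoff m \<rho> \<xi>)" for \<xi>
  proof (cases "m \<xi> \<le> \<rho>")
    case True
    have k: "\<bar>\<sigma> * \<lfloor>m \<xi> / h\<rfloor>\<bar> \<le> n0" using floor_bound[OF h m1 True] \<sigma> n0 by (simp add: abs_mult)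
    have "(\<Sum>j\<in>{- n0 - int N..n0}. msq (win h m \<rho> N \<sigma> j \<xi>)) = (\<Sum>j\<in>{- n0 - int N..n0}. if j \<le> \<sigma> * \<lfloor>m \<xi> / h\<rfloor> \<and> \<sigma> * \<lfloor>m \<xi> / h\<rfloor> < j + int N then 1 else 0)"
      using True by (intro sum.cong) (auto simp: win_def cutoff_def)
    then show ?thesis unfolding win_sum[OF k] using True by (simp add: cutoff_def)
  next
    case False
    then have "win h m \<rho> N \<sigma> j \<xi> = 0" for j by (simp add: win_def cutoff_def)
    then show ?thesis using False by (simp add: cutoff_def)
  qed
  have "(\<Sum>j\<in>{- n0 - int N..n0}. (norm (mulop (win h m \<rho> N \<sigma> j) f))\<^sup>2)
     = (LEB \<xi>. (\<Sum>j\<in>{- n0 - int N..n0}. msq (win h m \<rho> N \<sigma> j \<xi>) * msq (rep f \<xi>)))"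
    by (subst Bochner_Integration.integral_sum[OF I]) (simp add: norm_mulop_sq bmf_win)
  also have "\<dots> = (LEB \<xi>. real N * (msq (cutoff m \<rho> \<xi>) * msq (rep f \<xi>)))"
    by (simp only: sum_distrib_right[symmetric] pt mult.assoc)
  also have "\<dots> = real N * (norm (mulop (cutoff m \<rho>) f))\<^sup>2" by (simp add: norm_mulop_sq bmf_cutoff)
  finally show ?thesis unfolding f .
qed

lemma mulop_window:
  fixes f :: "'a::euclidean_space l2"
  assumes m[measurable]: "m \<in> bfun" and m1: "\<And>\<xi>. 1 \<le> m \<xi>" and h: "h > 0" and f: "mulop (cutoff m \<rho>) f = f" and \<sigma>: "\<bar>\<sigma>\<bar> = 1"
    and n0: "n0 = \<lfloor>\<rho> / h\<rfloor>"
  shows "mulop (\<lambda>_. dirichlet N h t) (mulop (\<lambda>\<xi>. iexp (of_int \<sigma> * t * dsc h m \<xi>)) f)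
    = (\<Sum>j\<in>{- n0 - int N..n0}. mulop (\<lambda>_. iexp (of_int j * h * t)) (mulop (win h m \<rho> N \<sigma> j) f))"
proof -
  have pt: "dirichlet N h t * (iexp (of_int \<sigma> * t * dsc h m \<xi>) * cutoff m \<rho> \<xi>) = (\<Sum>j\<in>{- n0 - int N..n0}. iexp (of_int j * h * t) * win h m \<rho> N \<sigma> j \<xi>)" for \<xi>
  proof (cases "m \<xi> \<le> \<rho>")
    case True
    have k: "\<bar>\<sigma> * \<lfloor>m \<xi> / h\<rfloor>\<bar> \<le> n0" using floor_bound[OF h m1 True] \<sigma> n0 by (simp add: abs_mult)
    have e: "of_int \<sigma> * t * dsc h m \<xi> = t * (h * of_int (\<sigma> * \<lfloor>m \<xi> / h\<rfloor>))" by (simp add: dsc_def)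
    show ?thesis unfolding e mult.assoc[symmetric] dirichlet_window[OF k, unfolded mult.assoc[symmetric]]
      using True by (auto intro!: sum.cong simp: win_def cutoff_def mult.assoc)
  next
    case False
    then have "win h m \<rho> N \<sigma> j \<xi> = 0" for j by (simp add: win_def cutoff_def)
    then show ?thesis using False by (simp add: cutoff_def)
  qed
  have "mulop (\<lambda>_. dirichlet N h t) (mulop (\<lambda>\<xi>. iexp (of_int \<sigma> * t * dsc h m \<xi>)) (mulop (cutoff m \<rho>) f))
     = mulop (\<lambda>\<xi>. dirichlet N h t * (iexp (of_int \<sigma> * t * dsc h m \<xi>) * cutoff m \<rho> \<xi>)) f"
  proof -
    have b: "bmf (\<lambda>\<xi>. iexp (of_int \<sigma> * t * dsc h m \<xi>))" by (rule bmf_iexp) measurable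
    show ?thesis by (simp only: mulop_mulop_bmf[OF b bmf_cutoff[OF m]] mulop_mulop_bmf[OF bmf_const bmf_mult[OF b bmf_cutoff[OF m]]])
  qed
  also have "\<dots> = (\<Sum>j\<in>{- n0 - int N..n0}. mulop (\<lambda>_. iexp (of_int j * h * t)) (mulop (win h m \<rho> N \<sigma> j) f))"
    unfolding pt by (rule mulop_sum_const[OF bmf_win[OF m]])
  finally show ?thesis unfolding f .
qed

lemma has_integral_le_split:
  fixes F G :: "real \<Rightarrow> real"
  assumes F: "continuous_on {-a..a} F" and G: "continuous_on {-a..a} G" and \<tau>: "0 < \<tau>" "\<tau> \<le> a"
    and inner: "\<And>t. \<bar>t\<bar> \<le> \<tau> \<Longrightarrow> F t \<le> A * G t" and outer: "\<And>t. \<tau> \<le> \<bar>t\<bar> \<Longrightarrow> \<bar>t\<bar> \<le> a \<Longrightarrow> F t \<le> b / t\<^sup>2" and b: "b \<ge> 0"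
  shows "integral {-a..a} F \<le> A * integral {-\<tau>..\<tau>} G + 2 * b / \<tau>"
proof -
  have cF: "F integrable_on {u..v}" if "-a \<le> u" "v \<le> a" for u v
    using that by (intro integrable_continuous_interval continuous_on_subset[OF F]) auto
  have cG: "G integrable_on {-\<tau>..\<tau>}" using \<tau> by (intro integrable_continuous_interval continuous_on_subset[OF G]) auto
  have D: "((\<lambda>t. b / t\<^sup>2) has_integral (- b / v - - b / u)) {u..v}" if uv: "u \<le> v" "0 < u \<or> v < 0" for u v
    by (rule fundamental_theorem_of_calculus[OF uv(1)])
       (use uv in \<open>auto intro!: derivative_eq_intros simp: has_real_derivative_iff_has_vector_derivative[symmetric] power2_eq_square\<close>)
  have 1: "integral {-a..-\<tau>} F \<le> b / \<tau>"
  proof -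
    have "integral {-a..-\<tau>} F \<le> - b / (-\<tau>) - - b / (-a)"
      by (rule has_integral_le[OF integrable_integral[OF cF] D]) (use \<tau> outer in auto)
    also have "\<dots> \<le> b / \<tau>" using \<tau> b by simp
    finally show ?thesis .
  qed
  have 2: "integral {\<tau>..a} F \<le> b / \<tau>"
  proof -
    have "integral {\<tau>..a} F \<le> - b / a - - b / \<tau>" by (rule has_integral_le[OF integrable_integral[OF cF] D]) (use \<tau> outer in auto)
    also have "\<dots> \<le> b / \<tau>" using \<tau> b by simp
    finally show ?thesis .
  qed
  have 3: "integral {-\<tau>..\<tau>} F \<le> A * integral {-\<tau>..\<tau>} G" unfolding integral_mult_right[symmetric]
    by (rule integral_le[OF cF]) (use \<tau> inner in \<open>auto intro!: integrable_continuous_interval continuous_intros continuous_on_subset[OF G]\<close>)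
  have "integral {-a..a} F = integral {-a..-\<tau>} F + (integral {-\<tau>..\<tau>} F + integral {\<tau>..a} F)"
    using \<tau> by (simp add: integral_combine cF Henstock_Kurzweil_Integration.integral_combine)
  then show ?thesis using 1 2 3 by simp
qed

context damping
begin

lemma Q_const: "Q (mulop (\<lambda>_. c) f) = mulop (\<lambda>_. c) (Q f)" unfolding Q_def by (simp add: Fi_cmul mulop_const_commute[OF bmf_sqrt])

text \<open>Separates the two inputs of the argument: \<open>observable\<close> depends on \<gamma>
  alone and \<open>narrow\<close> on the symbol alone, so that only the latter distinguishes the
  ranges of s.\<close>

definition observable :: "real \<Rightarrow> real \<Rightarrow> bool" where
  "observable \<delta> \<kappa> \<longleftrightarrow> 0 < \<delta> \<and> 0 < \<kappa> \<and> (\<forall>R\<ge>0. \<forall>g::'a l2. (AE \<xi> in lborel. rep g \<xi> \<noteq> 0 \<longrightarrow> R \<le> norm \<xi> \<and> norm \<xi> \<le> R + \<delta>) \<longrightarrow>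
     \<kappa> * (norm g)\<^sup>2 \<le> (norm (Q g))\<^sup>2)"

definition narrow :: "real \<Rightarrow> ('a \<Rightarrow> real) \<Rightarrow> real \<Rightarrow> real \<Rightarrow> bool" where
  "narrow \<delta> m \<epsilon> \<rho> \<longleftrightarrow> (\<forall>\<theta>. \<exists>R\<ge>0. \<forall>\<xi>. \<theta> \<le> m \<xi> \<and> m \<xi> < \<theta> + \<epsilon> \<and> m \<xi> \<le> \<rho> \<longrightarrow> R \<le> norm \<xi> \<and> norm \<xi> \<le> R + \<delta>)"

text \<open>For given j at most one half-wave is present: as m >= 1, the signed frequencies of the
  two half-waves are further apart than the window length N h <= 1. So there is no interference, and
  the factor 1/2 is just the square of 1 / sqrt 2.\<close>

lemma window_lower_bound:
  fixes f g :: "'a l2"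
  assumes obs: "observable \<delta> \<kappa>" and nar: "narrow \<delta> m \<epsilon> \<rho>" and m: "m \<in> bfun" and m1: "\<And>\<xi>. 1 \<le> m \<xi>"
    and h: "0 < h" "h \<le> 1 / 2" and N: "real N * h \<le> 1" "real N * h \<le> \<epsilon>"
  shows "\<kappa> / 2 * ((norm (mulop (win h m \<rho> N 1 j) f))\<^sup>2 + (norm (mulop (win h m \<rho> N (- 1) j) g))\<^sup>2)
    \<le> (norm (Q ((1 / sqrt 2) *\<^sub>R (mulop (win h m \<rho> N 1 j) f + mulop (win h m \<rho> N (- 1) j) g))))\<^sup>2"
proof -
  let ?W = "\<lambda>\<sigma>. win h m \<rho> N \<sigma> j"
  have one: "\<kappa> * (norm (mulop (?W \<sigma>) u))\<^sup>2 \<le> (norm (Q (mulop (?W \<sigma>) u)))\<^sup>2" if \<sigma>: "\<sigma> = 1 \<or> \<sigma> = -1" for \<sigma> and u :: "'a l2"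
  proof -
    \<comment> \<open>For \<sigma> = -1 the condition j <= -k < j + N reads 1 - j - N <= k <= -j,
      hence the lower endpoint.\<close>
    define \<theta> where "\<theta> = (if \<sigma> = 1 then of_int j * h else of_int (1 - j - int N) * h)"
    have win: "\<theta> \<le> m \<xi> \<and> m \<xi> < \<theta> + \<epsilon> \<and> m \<xi> \<le> \<rho>" if "?W \<sigma> \<xi> \<noteq> 0" for \<xi>
    proof -
      let ?k = "\<lfloor>m \<xi> / h\<rfloor>"
      have k: "j \<le> \<sigma> * ?k" "\<sigma> * ?k < j + int N" "m \<xi> \<le> \<rho>" using that by (auto simp: win_def cutoff_def split: if_splits)
      have a: "of_int ?k * h \<le> m \<xi>" "m \<xi> < of_int (?k + 1) * h"
        using of_int_floor_le[of "m \<xi> / h"] real_of_int_floor_add_one_gt[of "m \<xi> / h"]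
        unfolding pos_le_divide_eq[OF h(1)] by (simp_all only: pos_divide_less_eq[OF h(1)] of_int_add of_int_1)
      define k0 where "k0 = (if \<sigma> = 1 then j else 1 - j - int N)"
      have k0: "k0 \<le> ?k" "?k + 1 \<le> k0 + int N" using k \<sigma> by (auto simp: k0_def)
      have "of_int k0 * h \<le> of_int ?k * h" using k0 h by (intro mult_right_mono) auto
      moreover have "of_int (?k + 1) * h \<le> of_int (k0 + int N) * h" using k0(2) h by (intro mult_right_mono) (simp_all only: of_int_le_iff less_imp_le)
      moreover have "\<theta> = of_int k0 * h" by (simp add: \<theta>_def k0_def)
      moreover have "of_int (k0 + int N) * h = of_int k0 * h + real N * h" by (simp add: distrib_right)
      ultimately show ?thesis using a k(3) N(2) by linarith
    qed
    obtain R where R: "R \<ge> 0" "\<And>\<xi>. \<theta> \<le> m \<xi> \<and> m \<xi> < \<theta> + \<epsilon> \<and> m \<xi> \<le> \<rho> \<Longrightarrow> R \<le> norm \<xi> \<and> norm \<xi> \<le> R + \<delta>"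
      using nar unfolding narrow_def by blast
    have "AE \<xi> in lborel. rep (mulop (?W \<sigma>) u) \<xi> = ?W \<sigma> \<xi> * rep u \<xi>" by (intro rep_mulop muldom_bmf bmf_win m)
    then have "AE \<xi> in lborel. rep (mulop (?W \<sigma>) u) \<xi> \<noteq> 0 \<longrightarrow> R \<le> norm \<xi> \<and> norm \<xi> \<le> R + \<delta>"
    proof eventually_elim
      case (elim \<xi>)
      then show ?case using R(2)[OF win[of \<xi>]] by auto
    qed
    then show ?thesis using obs R(1) unfolding observable_def by blast
  qed
  have scale: "\<kappa> * (norm v)\<^sup>2 \<le> (norm (Q v))\<^sup>2 \<Longrightarrow> \<kappa> / 2 * (norm v)\<^sup>2 \<le> (norm (Q ((1 / sqrt 2) *\<^sub>R v)))\<^sup>2" for v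
    by (simp add: linear_simps[OF Q_bl] power_divide)
  have "(\<forall>\<xi>. ?W 1 \<xi> = 0) \<or> (\<forall>\<xi>. ?W (-1) \<xi> = 0)"
  proof (rule ccontr)
    assume "\<not> ?thesis"
    then obtain \<xi> \<xi>' where "?W 1 \<xi> \<noteq> 0" "?W (-1) \<xi>' \<noteq> 0" by blast
    then have "\<lfloor>m \<xi> / h\<rfloor> + \<lfloor>m \<xi>' / h\<rfloor> < int N" by (auto simp: win_def split: if_splits)
    then have "of_int (\<lfloor>m \<xi> / h\<rfloor> + \<lfloor>m \<xi>' / h\<rfloor> + 1) \<le> real N" by linarith
    moreover have "1 / h \<le> m \<xi> / h" "1 / h \<le> m \<xi>' / h" using h m1 by (auto intro: divide_right_mono)
    moreover have "real N \<le> 1 / h" "2 \<le> 1 / h" using N h by (auto simp: field_simps)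
    ultimately show False by linarith
  qed
  then show ?thesis
  proof
    assume "\<forall>\<xi>. ?W 1 \<xi> = 0"
    then have "?W 1 = (\<lambda>_. 0)" by auto
    then show ?thesis using scale[OF one[of "-1" g]] by simp
  next
    assume "\<forall>\<xi>. ?W (-1) \<xi> = 0"
    then have "?W (-1) = (\<lambda>_. 0)" by auto
    then show ?thesis using scale[OF one[of 1 f]] by simp
  qed
qed

text \<open>Multiplied by the Dirichlet kernel, the observed velocity is a trigonometric polynomial
  with coefficients \<open>Q (w j)\<close>, so Parseval's identity over |t| <= pi / h and the
  windowed lower bound apply. The kernel is at most N everywhere and at most 6 / (h |t|) away from
  0, which confines the observation to [-\<tau>, \<tau>] up to a tail absorbed by the condition on N
  h \<tau>.\<close>

lemma observability_centered:
  fixes y :: "'a state"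
  assumes obs: "observable \<delta> \<kappa>" and nar: "narrow \<delta> m \<epsilon> \<rho>" and m: "m \<in> bfun" and m1: "\<And>\<xi>. 1 \<le> m \<xi>"
    and h: "0 < h" "h \<le> 1 / 2" and N: "0 < N" "real N * h \<le> 1" "real N * h \<le> \<epsilon>" and \<tau>: "0 < \<tau>" "h * \<tau> \<le> 1" "48 * M / \<kappa> \<le> real N * h * \<tau>"
    and y: "mulop (cutoff m \<rho>) (fst y) = fst y" "mulop (cutoff m \<rho>) (snd y) = snd y"
  shows "\<kappa> / (real N * h) * (norm y)\<^sup>2 \<le> integral {-\<tau>..\<tau>} (\<lambda>t. (norm (Q (vel (Sg (dsc h m) t y))))\<^sup>2)"
proof -
  have \<kappa>: "0 < \<kappa>" using obs by (simp add: observable_def)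
  define n0 where "n0 = \<lfloor>\<rho> / h\<rfloor>"
  define I where "I = {- n0 - int N..n0}"
  define w where "w j = (1 / sqrt 2) *\<^sub>R (mulop (win h m \<rho> N 1 j) (fst y) + mulop (win h m \<rho> N (- 1) j) (snd y))" for j
  define V where "V t = Q (vel (Sg (dsc h m) t y))" for t
  have dm: "dsc h m \<in> bfun" by (rule dsc_measurable[OF m])
  have blc: "bounded_linear (mulop (\<lambda>_. c))" for c by (rule mulop_const_bl)
  have DV: "mulop (\<lambda>_. dirichlet N h t) (V t) = (\<Sum>j\<in>I. mulop (\<lambda>_. iexp (of_int j * h * t)) (Q (w j)))" for t
  proof -
    have "mulop (\<lambda>_. dirichlet N h t) (vel (Sg (dsc h m) t y))
      = (1 / sqrt 2) *\<^sub>R (mulop (\<lambda>_. dirichlet N h t) (mulop (\<lambda>\<xi>. iexp (of_int 1 * t * dsc h m \<xi>)) (fst y))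
          + mulop (\<lambda>_. dirichlet N h t) (mulop (\<lambda>\<xi>. iexp (of_int (-1) * t * dsc h m \<xi>)) (snd y)))"
      by (simp add: vel_def Sg_def U_def linear_simps[OF blc])
    also have "\<dots> = (\<Sum>j\<in>I. mulop (\<lambda>_. iexp (of_int j * h * t)) (w j))"
    proof -
      have "mulop (\<lambda>_. dirichlet N h t) (mulop (\<lambda>\<xi>. iexp (of_int 1 * t * dsc h m \<xi>)) (fst y)) = (\<Sum>j\<in>I. mulop (\<lambda>_. iexp (of_int j * h * t)) (mulop (win h m \<rho> N 1 j) (fst y)))"
        unfolding I_def by (rule mulop_window[OF m m1 h(1) y(1) _ n0_def]) simp
      moreover have "mulop (\<lambda>_. dirichlet N h t) (mulop (\<lambda>\<xi>. iexp (of_int (-1) * t * dsc h m \<xi>)) (snd y)) = (\<Sum>j\<in>I. mulop (\<lambda>_. iexp (of_int j * h * t)) (mulop (win h m \<rho> N (-1) j) (snd y)))"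
        unfolding I_def by (rule mulop_window[OF m m1 h(1) y(2) _ n0_def]) simp
      ultimately show ?thesis by (simp add: w_def linear_simps[OF blc] sum.distrib scaleR_sum_right scaleR_add_right)
    qed
    finally have "mulop (\<lambda>_. dirichlet N h t) (V t) = Q (\<Sum>j\<in>I. mulop (\<lambda>_. iexp (of_int j * h * t)) (w j))" by (simp only: V_def Q_const[symmetric])
    then show ?thesis by (simp only: linear_sum[OF bounded_linear.linear[OF Q_bl]] Q_const)
  qed
  have sumw: "real N * (norm y)\<^sup>2 = (\<Sum>j\<in>I. (norm (mulop (win h m \<rho> N 1 j) (fst y)))\<^sup>2 + (norm (mulop (win h m \<rho> N (- 1) j) (snd y)))\<^sup>2)"
  proof -
    have "(\<Sum>j\<in>I. (norm (mulop (win h m \<rho> N 1 j) (fst y)))\<^sup>2) = real N * (norm (fst y))\<^sup>2"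
      unfolding I_def by (rule sum_norm_win[OF m m1 h(1) y(1) _ n0_def]) simp
    moreover have "(\<Sum>j\<in>I. (norm (mulop (win h m \<rho> N (-1) j) (snd y)))\<^sup>2) = real N * (norm (snd y))\<^sup>2"
      unfolding I_def by (rule sum_norm_win[OF m m1 h(1) y(2) _ n0_def]) simp
    ultimately show ?thesis by (simp add: sum.distrib norm_prod_def distrib_left)
  qed
  have "\<kappa> / 2 * (real N * (norm y)\<^sup>2) \<le> (\<Sum>j\<in>I. (norm (Q (w j)))\<^sup>2)"
    unfolding sumw sum_distrib_left w_def by (intro sum_mono window_lower_bound[OF obs nar m m1 h N(2,3)])
  then have "2 * pi / h * (\<kappa> / 2 * (real N * (norm y)\<^sup>2)) \<le> 2 * pi / h * (\<Sum>j\<in>I. (norm (Q (w j)))\<^sup>2)"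
    using h by (intro mult_left_mono) auto
  also have "\<dots> = integral {- (pi / h)..pi / h} (\<lambda>t. (norm (mulop (\<lambda>_. dirichlet N h t) (V t)))\<^sup>2)"
    using trig_parseval[OF h(1), of I "\<lambda>j. Q (w j)"] unfolding DV by (simp add: I_def integral_unique)
  also have "\<dots> \<le> (real N)\<^sup>2 * integral {-\<tau>..\<tau>} (\<lambda>t. (norm (V t))\<^sup>2) + 2 * (36 * M * (norm y)\<^sup>2 / h\<^sup>2) / \<tau>"
  proof (rule has_integral_le_split)
    have cV: "continuous_on S V" for S unfolding V_def
      by (intro bounded_linear.continuous_on[OF Q_bl] bounded_linear.continuous_on[OF vel_bl] continuous_on_subset[OF Sg_cont[OF dm]]) simp
    show "continuous_on {- (pi / h)..pi / h} (\<lambda>t. (norm (V t))\<^sup>2)" by (intro continuous_intros cV)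
    have cD: "continuous_on S (dirichlet N h)" for S unfolding dirichlet_def[abs_def] by (intro continuous_intros)
    show "continuous_on {- (pi / h)..pi / h} (\<lambda>t. (norm (mulop (\<lambda>_. dirichlet N h t) (V t)))\<^sup>2)"
      unfolding norm_mulop_const by (intro continuous_intros cV cD)
    have "\<tau> \<le> 1 / h" using \<tau> h by (simp add: field_simps)
    also have "\<dots> \<le> pi / h" using h pi_gt3 by (intro divide_right_mono) auto
    finally show "\<tau> \<le> pi / h" .
    show "(norm (mulop (\<lambda>_. dirichlet N h t) (V t)))\<^sup>2 \<le> (real N)\<^sup>2 * (norm (V t))\<^sup>2" for t
      unfolding norm_mulop_const power_mult_distrib by (intro mult_right_mono power_mono norm_dirichlet_le) auto
    show "(norm (mulop (\<lambda>_. dirichlet N h t) (V t)))\<^sup>2 \<le> 36 * M * (norm y)\<^sup>2 / h\<^sup>2 / t\<^sup>2" if t: "\<tau> \<le> \<bar>t\<bar>" "\<bar>t\<bar> \<le> pi / h" for t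
    proof -
      have t0: "t \<noteq> 0" using t \<tau> by auto
      have "\<bar>h * t\<bar> \<le> pi" using t h by (simp add: abs_mult field_simps)
      then have a: "msq (dirichlet N h t) \<le> (6 / (h * \<bar>t\<bar>))\<^sup>2" by (intro power_mono norm_dirichlet_tail h t0) auto
      have "(norm (V t))\<^sup>2 \<le> (sqrt M * norm y)\<^sup>2" unfolding V_def using M_nonneg norm_vel_le[of "Sg (dsc h m) t y"]
        by (intro power_mono order_trans[OF Q_norm] mult_left_mono) (auto simp: Sg_norm[OF dm])
      then have b: "(norm (V t))\<^sup>2 \<le> M * (norm y)\<^sup>2" using M_nonneg by (simp add: power_mult_distrib)
      have "(norm (mulop (\<lambda>_. dirichlet N h t) (V t)))\<^sup>2 \<le> (6 / (h * \<bar>t\<bar>))\<^sup>2 * (M * (norm y)\<^sup>2)"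
        unfolding norm_mulop_const power_mult_distrib using a b by (intro mult_mono) auto
      also have "\<dots> = 36 * M * (norm y)\<^sup>2 / h\<^sup>2 / t\<^sup>2" by (simp add: power_divide power_mult_distrib)
      finally show ?thesis .
    qed
  qed (use \<tau> M_nonneg in auto)
  finally have main: "pi * \<kappa> * real N / h * (norm y)\<^sup>2 \<le> (real N)\<^sup>2 * integral {-\<tau>..\<tau>} (\<lambda>t. (norm (V t))\<^sup>2) + 72 * M * (norm y)\<^sup>2 / (h\<^sup>2 * \<tau>)"
    by (simp add: mult_ac)
  \<comment> \<open>The origin of 48 = 72 / (3/2): the tail takes 3/2 of the coefficient pi > 3, and
    at least 1 remains.\<close>
  have *: "72 * M / (h\<^sup>2 * \<tau>) \<le> 3 / 2 * \<kappa> * real N / h" using \<tau>(1,3) h \<kappa> by (simp add: field_simps power2_eq_square)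
  define Z where "Z = \<kappa> * real N / h * (norm y)\<^sup>2"
  have "72 * M * (norm y)\<^sup>2 / (h\<^sup>2 * \<tau>) = 72 * M / (h\<^sup>2 * \<tau>) * (norm y)\<^sup>2" by simp
  also have "\<dots> \<le> 3 / 2 * \<kappa> * real N / h * (norm y)\<^sup>2" by (rule mult_right_mono[OF *]) simp
  also have "\<dots> = 3 / 2 * Z" by (simp add: Z_def)
  finally have 1: "72 * M * (norm y)\<^sup>2 / (h\<^sup>2 * \<tau>) \<le> 3 / 2 * Z" .
  have Z0: "0 \<le> Z" using \<kappa> h by (simp add: Z_def)
  have 2: "pi * \<kappa> * real N / h * (norm y)\<^sup>2 = pi * Z" by (simp add: Z_def)
  have "3 * Z \<le> pi * Z" using Z0 pi_gt3 by (intro mult_right_mono) auto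
  then have "Z \<le> (real N)\<^sup>2 * integral {-\<tau>..\<tau>} (\<lambda>t. (norm (V t))\<^sup>2)" using main 1 Z0 unfolding 2 by linarith
  then have "\<kappa> * real N / h * (norm y)\<^sup>2 \<le> (real N)\<^sup>2 * integral {-\<tau>..\<tau>} (\<lambda>t. (norm (V t))\<^sup>2)" by (simp only: Z_def)
  then have "real N * (\<kappa> / h * (norm y)\<^sup>2) \<le> real N * (real N * integral {-\<tau>..\<tau>} (\<lambda>t. (norm (V t))\<^sup>2))"
    by (simp add: power2_eq_square mult_ac)
  then have "\<kappa> / h * (norm y)\<^sup>2 \<le> real N * integral {-\<tau>..\<tau>} (\<lambda>t. (norm (V t))\<^sup>2)" using N by (simp only: mult_le_cancel_left_pos of_nat_0_less_iff)
  then show ?thesis using N(1) h unfolding V_def by (simp add: field_simps)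
qed

end

section \<open>Comparison of the damped flow with the discretised undamped flow\<close>

lemma has_vector_derivative_quotient_iff:
  fixes f :: "real \<Rightarrow> 'b::real_normed_vector"
  shows "(f has_vector_derivative D) (at t within S) \<longleftrightarrow> ((\<lambda>r. (1 / (r - t)) *\<^sub>R (f r - f t)) \<longlongrightarrow> D) (at t within S)"
proof
  assume l: "((\<lambda>r. (1 / (r - t)) *\<^sub>R (f r - f t)) \<longlongrightarrow> D) (at t within S)"
  show "(f has_vector_derivative D) (at t within S)"
  proof (rule has_vector_derivative_quotientI)
    fix e :: real assume "e > 0"
    from tendstoD[OF l this] obtain d where d: "d > 0" "\<forall>x\<in>S. x \<noteq> t \<and> dist x t < d \<longrightarrow> dist ((1 / (x - t)) *\<^sub>R (f x - f t)) D < e"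
      by (auto simp: eventually_at)
    then show "\<exists>d>0. \<forall>r\<in>S. r \<noteq> t \<and> \<bar>r - t\<bar> < d \<longrightarrow> norm ((1 / (r - t)) *\<^sub>R (f r - f t) - D) \<le> e"
      by (intro exI[of _ d]) (auto simp: dist_norm less_imp_le)
  qed
next
  assume d: "(f has_vector_derivative D) (at t within S)"
  have e: "norm ((1 / (r - t)) *\<^sub>R (f r - f t) - D) = norm ((1 / norm (r - t)) *\<^sub>R (f r - (f t + (r - t) *\<^sub>R D)))" if "r \<noteq> t" for r
  proof -
    have "(1 / (r - t)) *\<^sub>R (f r - f t) - D = (1 / (r - t)) *\<^sub>R (f r - (f t + (r - t) *\<^sub>R D))"
    proof -
      have "(1 / (r - t)) *\<^sub>R (r - t) *\<^sub>R D = D" using that by simp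
      then show ?thesis by (simp only: scaleR_right_diff_distrib scaleR_add_right diff_diff_eq)
    qed
    then show ?thesis by simp
  qed
  have "((\<lambda>r. norm ((1 / norm (r - t)) *\<^sub>R (f r - (f t + (r - t) *\<^sub>R D)))) \<longlongrightarrow> 0) (at t within S)"
    using d unfolding has_vector_derivative_def has_derivative_within by (intro tendsto_norm_zero) simp
  then have "((\<lambda>r. norm ((1 / (r - t)) *\<^sub>R (f r - f t) - D)) \<longlongrightarrow> 0) (at t within S)"
    by (rule Lim_transform_eventually) (auto simp: eventually_at_filter e)
  then have "((\<lambda>r. (1 / (r - t)) *\<^sub>R (f r - f t) - D) \<longlongrightarrow> 0) (at t within S)" by (rule tendsto_norm_zero_cancel)
  then show "((\<lambda>r. (1 / (r - t)) *\<^sub>R (f r - f t)) \<longlongrightarrow> D) (at t within S)" by (rule LIM_zero_cancel)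
qed

text \<open>Product rule in the interaction picture. The group is differentiable only strongly and
  on its domain, so the quotient of X is kept inside \<open>Sg m (- r)\<close>, and the group itself
  is differentiated only at the fixed vector \<open>X t\<close> of the domain.\<close>

lemma Sg_backward_derivative:
  fixes X :: "real \<Rightarrow> 'a::euclidean_space state"
  assumes m: "m \<in> bfun" and X: "(X has_vector_derivative X') (at t within S)" and D: "X t \<in> Dm m"
  shows "((\<lambda>r. Sg m (- r) (X r)) has_vector_derivative Sg m (- t) (X' - A0 m (X t))) (at t within S)"
  unfolding has_vector_derivative_quotient_iff
proof -
  interpret S: perturbed_group "Sg m" "Dm m" "A0 m" "\<lambda>_. 0" by (rule perturbed_group_Sg[OF m bounded_linear_zero])
  have q: "((\<lambda>r. (1 / (r - t)) *\<^sub>R (X r - X t)) \<longlongrightarrow> X') (at t within S)" using X by (simp only: has_vector_derivative_quotient_iff)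
  have 1: "((\<lambda>r. Sg m (- r) ((1 / (r - t)) *\<^sub>R (X r - X t))) \<longlongrightarrow> Sg m (- t) X') (at t within S)"
    by (rule S.S_tendsto[OF _ q]) (intro tendsto_intros)
  have "filterlim (\<lambda>r. t - r) (at 0) (at t within S)" unfolding filterlim_at by (auto intro!: tendsto_eq_intros simp: eventually_at_filter)
  from filterlim_compose[OF Sg_quotient[OF m D] this]
  have 2: "((\<lambda>r. (1 / (t - r)) *\<^sub>R (Sg m (t - r) (X t) - X t)) \<longlongrightarrow> A0 m (X t)) (at t within S)" .
  have 3: "((\<lambda>r. Sg m (- t) ((1 / (t - r)) *\<^sub>R (Sg m (t - r) (X t) - X t))) \<longlongrightarrow> Sg m (- t) (A0 m (X t))) (at t within S)"
    by (rule bounded_linear.tendsto[OF Sg_bl[OF m] 2])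
  have e: "Sg m (- r) ((1 / (r - t)) *\<^sub>R (X r - X t)) - Sg m (- t) ((1 / (t - r)) *\<^sub>R (Sg m (t - r) (X t) - X t))
    = (1 / (r - t)) *\<^sub>R (Sg m (- r) (X r) - Sg m (- t) (X t))" for r
  proof -
    have "Sg m (- t) (Sg m (t - r) (X t)) = Sg m (- r) (X t)" using Sg_add[OF m, of "- t" "t - r" "X t"] by simp
    moreover have "1 / (t - r) = - (1 / (r - t))" by (metis minus_diff_eq minus_divide_right)
    ultimately show ?thesis by (simp add: linear_simps[OF Sg_bl[OF m]] algebra_simps)
  qed
  show "((\<lambda>r. (1 / (r - t)) *\<^sub>R (Sg m (- r) (X r) - Sg m (- t) (X t))) \<longlongrightarrow> Sg m (- t) (X' - A0 m (X t))) (at t within S)"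
    using tendsto_diff[OF 1 3] unfolding e by (simp only: linear_simps(2)[OF Sg_bl[OF m]])
qed

lemma Dm_dsc:
  assumes m: "m \<in> bfun" and m1: "\<And>\<xi>. 1 \<le> m \<xi>" and h: "0 < h" and z: "z \<in> Dm m"
  shows "z \<in> Dm (dsc h m)" "norm (A0 m z - A0 (dsc h m) z) \<le> h * norm z"
proof -
  note dm = dsc_measurable[OF m, of h]
  have pos: "0 \<le> dsc h m \<xi>" "dsc h m \<xi> \<le> m \<xi>" for \<xi>
  proof -
    have "0 \<le> m \<xi> / h" using m1[of \<xi>] h by simp
    then show "0 \<le> dsc h m \<xi>" using h by (simp add: dsc_def)
    have "h * of_int \<lfloor>m \<xi> / h\<rfloor> \<le> h * (m \<xi> / h)" using h by (intro mult_left_mono) auto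
    then show "dsc h m \<xi> \<le> m \<xi>" using h by (simp add: dsc_def)
  qed
  have dom: "f \<in> muldom (cof (dsc h m))" if "f \<in> muldom (cof m)" for f :: "'a l2"
  proof (rule muldom_mono[OF _ _ that, of _ 1])
    show "cmod (cof (dsc h m) \<xi>) \<le> 1 * cmod (cof m \<xi>)" for \<xi> using pos[of \<xi>] by simp
  qed (use dm in measurable)
  then show "z \<in> Dm (dsc h m)" using z by (simp add: Dm_def)
  have df: "norm (mulop (icof m) f - mulop (icof (dsc h m)) f) \<le> h * norm f" if f: "f \<in> muldom (cof m)" for f :: "'a l2"
  proof -
    have s: "L2 (\<lambda>\<xi>. icof m \<xi> * rep f \<xi>)" "L2 (\<lambda>\<xi>. icof (dsc h m) \<xi> * rep f \<xi>)"
      using f dom[OF f] m dm by (simp_all add: muldom_icof[symmetric]) (simp_all add: muldom_def)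
    have "mulop (icof m) f - mulop (icof (dsc h m)) f = mulop (\<lambda>\<xi>. \<i> * cpx (m \<xi> - dsc h m \<xi>)) f"
      unfolding mulop_def cls_diff[OF s, symmetric] by (simp add: algebra_simps)
    also have "norm \<dots> \<le> h * norm f"
    proof (rule norm_mulop_le)
      show "cmod (\<i> * cpx (m \<xi> - dsc h m \<xi>)) \<le> h" for \<xi> by (simp only: norm_mult norm_ii norm_of_real mult_1 dsc_le[OF h])
    qed (use m dm in measurable)
    finally show ?thesis .
  qed
  have z': "fst z \<in> muldom (cof m)" "snd z \<in> muldom (cof m)" using z by (auto simp: Dm_def)
  have "(norm (A0 m z - A0 (dsc h m) z))\<^sup>2 = (norm (mulop (icof m) (fst z) - mulop (icof (dsc h m)) (fst z)))\<^sup>2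
      + (norm (mulop (icof m) (snd z) - mulop (icof (dsc h m)) (snd z)))\<^sup>2" by (simp add: A0_def norm_prod_def norm_minus_commute)
  also have "\<dots> \<le> (h * norm (fst z))\<^sup>2 + (h * norm (snd z))\<^sup>2" by (intro add_mono power_mono df z') auto
  also have "\<dots> = (h * norm z)\<^sup>2" by (simp add: norm_prod_def power_mult_distrib distrib_left)
  finally show "norm (A0 m z - A0 (dsc h m) z) \<le> h * norm z" by (rule power2_le_imp_le) (use h in simp)
qed

definition Pc :: "('a::euclidean_space \<Rightarrow> real) \<Rightarrow> real \<Rightarrow> 'a state \<Rightarrow> 'a state" where
  "Pc m \<rho> z = (mulop (cutoff m \<rho>) (fst z), mulop (cutoff m \<rho>) (snd z))"

lemma cutoff_idem: "m \<in> bfun \<Longrightarrow> mulop (cutoff m \<rho>) (mulop (cutoff m \<rho>) f) = mulop (cutoff m \<rho>) f"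
proof -
  assume m: "m \<in> bfun"
  have "(\<lambda>\<xi>. cutoff m \<rho> \<xi> * cutoff m \<rho> \<xi>) = cutoff m \<rho>" by (auto simp: cutoff_def)
  then show ?thesis by (simp add: mulop_mulop_bmf bmf_cutoff m)
qed

lemma Sg_Pc:
  assumes m: "m \<in> bfun" and m': "m' \<in> bfun" shows "Pc m \<rho> (Sg m' t z) = Sg m' t (Pc m \<rho> z)" unfolding Pc_def Sg_def U_def
  by (simp only: fst_conv snd_conv mulop_mulop_bmf[OF bmf_cutoff[OF m] bmf_iexp[OF m']] mulop_mulop_bmf[OF bmf_iexp[OF m'] bmf_cutoff[OF m]] mult.commute[of "cutoff m \<rho> _"])

context damping
begin

text \<open>Half of the energy loss, so that the time derivative is exactly
  \<open>(norm (Q (vel (T t z))))\<^sup>2\<close>.\<close>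

definition dissipated :: "(real \<Rightarrow> 'a state \<Rightarrow> 'a state) \<Rightarrow> 'a state \<Rightarrow> real \<Rightarrow> real" where
  "dissipated T z t = ((norm z)\<^sup>2 - (norm (T t z))\<^sup>2) / 2"

context
  fixes m :: "'a \<Rightarrow> real" and T :: "real \<Rightarrow> 'a state \<Rightarrow> 'a state"
  assumes m: "m \<in> bfun" and m1: "\<And>\<xi>. 1 \<le> m \<xi>" and T: "generates T (Dm m) (Aop m)"
begin

interpretation T: dissipative_semigroup T "Dm m" "Aop m" by (rule dissipative_semigroupI[OF m T])

lemma dissipated_derivative:
  assumes z: "z \<in> Dm m" and t: "0 \<le> t" shows "(dissipated T z has_vector_derivative (norm (Q (vel (T t z))))\<^sup>2) (at t within {0..})"
proof -
  have "((\<lambda>t. (norm (T t z))\<^sup>2) has_vector_derivative 2 * (Aop m (T t z) \<bullet> T t z)) (at t within {0..})"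
    by (rule T.energy_deriv[OF z t])
  then have "((\<lambda>t. ((norm z)\<^sup>2 - (norm (T t z))\<^sup>2) / 2) has_vector_derivative (0 - 2 * (Aop m (T t z) \<bullet> T t z)) / 2) (at t within {0..})"
    by (intro has_vector_derivative_divide has_vector_derivative_diff has_vector_derivative_const)
  then show ?thesis unfolding dissipated_def[abs_def] Aop_inner[OF m T.D_invariant(1)[OF z t]] by simp
qed

lemma dissipated_0: "dissipated T z 0 = 0" by (simp add: dissipated_def T.T0)

lemma dissipated_nonneg: "0 \<le> t \<Longrightarrow> 0 \<le> dissipated T z t"
  using power_mono[OF T.contraction, of t z 2] by (simp add: dissipated_def)

lemma dissipated_mono:
  assumes "0 \<le> t" "t \<le> r" shows "dissipated T z t \<le> dissipated T z r"
proof -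
  have "norm (T r z) \<le> norm (T t z)" using T.contraction[of "r - t" "T t z"] T.Tadd[of "r - t" t z] assms by simp
  then show ?thesis by (simp add: dissipated_def power_mono)
qed

text \<open>The orbit transported back by the undamped flow moves with speed at most h |z| + sqrt M
  q, where q is the norm of the observed velocity. Young's inequality q <= a/2 + q^2/(2 a) turns the
  time integral of q into dissipated energy, with the parameter \<open>a\<close> left free.\<close>

lemma drift:
  assumes z: "z \<in> Dm m" and h: "0 < h" and t: "0 \<le> t" and a: "0 < a"
  shows "norm (Sg (dsc h m) (- t) (T t z) - z) \<le> h * norm z * t + sqrt M * (a * t / 2 + dissipated T z t / (2 * a))"
proof (cases "t = 0")
  case True then show ?thesis by (simp add: Sg_0 T.T0 dissipated_0)
next
  case False
  note dm = dsc_measurable[OF m, of h]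
  let ?X = "\<lambda>r. T r z" and ?q = "\<lambda>r. norm (Q (vel (T r z)))"
  let ?f = "\<lambda>r. Sg (dsc h m) (- r) (T r z)" and ?f' = "\<lambda>r. Sg (dsc h m) (- r) (Aop m (T r z) - A0 (dsc h m) (T r z))"
  let ?p = "\<lambda>r. h * norm z * r + sqrt M * (a * r / 2 + dissipated T z r / (2 * a))"
  let ?p' = "\<lambda>r. h * norm z + sqrt M * (a / 2 + (?q r)\<^sup>2 / (2 * a))"
  have D: "T r z \<in> Dm m" if "0 \<le> r" for r by (rule T.D_invariant(1)[OF z that])
  have df: "(?f has_vector_derivative ?f' r) (at r within {0..})" if r: "0 \<le> r" for r
    using Sg_backward_derivative[OF dm T.deriv[OF z r] Dm_dsc(1)[OF m m1 h D[OF r]]] by (simp only: T.D_invariant(2)[OF z r])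
  have dp: "(?p has_vector_derivative ?p' r) (at r within {0..})" if r: "0 \<le> r" for r
  proof -
    have "(?p has_vector_derivative (h * norm z * 1 + sqrt M * (a * 1 / 2 + (?q r)\<^sup>2 / (2 * a)))) (at r within {0..})"
      by (intro has_vector_derivative_add has_vector_derivative_mult_right has_vector_derivative_divide has_vector_derivative_id dissipated_derivative z r)
    then show ?thesis by simp
  qed
  have at: "at r within {0..} = at r" if "0 < r" for r :: real using that by (intro at_within_interior) simp
  have "norm (?f t - ?f 0) \<le> ?p t - ?p 0"
  proof (rule differentiable_bound_general[where f' = ?f' and \<phi>' = ?p'])
    show "0 < t" using t False by simp
    have "continuous_on {0..} ?f" using df unfolding continuous_on_eq_continuous_within by (blast intro: has_vector_derivative_continuous atLeast_iff[THEN iffD1])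
    then show "continuous_on {0..t} ?f" by (rule continuous_on_subset) auto
    have "continuous_on {0..} ?p" using dp unfolding continuous_on_eq_continuous_within by (blast intro: has_vector_derivative_continuous atLeast_iff[THEN iffD1])
    then show "continuous_on {0..t} ?p" by (rule continuous_on_subset) auto
    fix r assume r: "0 < r" "r < t"
    show "(?f has_vector_derivative ?f' r) (at r)" using df[of r] r at by simp
    show "(?p has_vector_derivative ?p' r) (at r)" using dp[of r] r at by simp
    have "norm (?f' r) = norm ((A0 m (T r z) - A0 (dsc h m) (T r z)) + B (T r z))" by (simp add: Sg_norm[OF dm] Aop_def algebra_simps)
    also have "\<dots> \<le> h * norm (T r z) + sqrt M * ?q r"
      using Dm_dsc(2)[OF m m1 h D[of r]] B_norm[of "T r z"] r by (intro norm_triangle_le add_mono) auto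
    also have "\<dots> \<le> ?p' r"
    proof (intro add_mono mult_left_mono)
      have "0 \<le> (a - ?q r)\<^sup>2 / (2 * a)" using a by simp
      then show "?q r \<le> a / 2 + (?q r)\<^sup>2 / (2 * a)" using a by (simp add: power2_diff field_simps power2_eq_square)
    qed (use h r M_nonneg T.contraction[of r z] in auto)
    finally show "norm (?f' r) \<le> ?p' r" .
  qed
  then show ?thesis by (simp add: Sg_0 T.T0 dissipated_0)
qed

text \<open>The undamped orbit of the truncated state is the damped orbit minus the drift minus the
  orbit of the high-frequency tail. The inequality (a + b + c)^2 <= 3 (a^2 + b^2 + c^2) over a time
  2 \<tau> explains the constants 3 and 6.\<close>

lemma damped_observability:
  assumes obs: "observable \<delta> \<kappa>" and nar: "narrow \<delta> m \<epsilon> \<rho>"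
    and h: "0 < h" "h \<le> 1 / 2" and N: "0 < N" "real N * h \<le> 1" "real N * h \<le> \<epsilon>" and \<tau>: "0 < \<tau>" "h * \<tau> \<le> 1" "48 * M / \<kappa> \<le> real N * h * \<tau>"
    and z: "z \<in> Dm m" and e: "\<And>t. 0 \<le> t \<Longrightarrow> t \<le> 2 * \<tau> \<Longrightarrow> norm (Sg (dsc h m) (- t) (T t z) - z) \<le> e1 * norm z"
  shows "\<kappa> / (real N * h) * (norm (Pc m \<rho> z))\<^sup>2 \<le> 3 * dissipated T z (2 * \<tau>) + 6 * \<tau> * M * e1\<^sup>2 * (norm z)\<^sup>2 + 6 * \<tau> * M * (norm (z - Pc m \<rho> z))\<^sup>2"
proof -
  note dm = dsc_measurable[OF m, of h]
  let ?S = "Sg (dsc h m)"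
  \<comment> \<open>Advancing by \<tau> turns the symmetric interval of
    \<open>observability_centered\<close> into [0, 2 \<tau>].\<close>
  define y where "y = ?S \<tau> (Pc m \<rho> z)"
  have y: "Pc m \<rho> y = y" "norm y = norm (Pc m \<rho> z)" unfolding y_def Sg_Pc[OF m dm] by (simp_all add: Pc_def cutoff_idem m Sg_norm[OF dm])
  have QS: "(norm (Q (vel (?S t x))))\<^sup>2 \<le> M * (norm x)\<^sup>2" for t x
  proof -
    have "norm (Q (vel (?S t x))) \<le> sqrt M * norm x"
      using Q_norm[of "vel (?S t x)"] norm_vel_le[of "?S t x"] M_nonneg mult_left_mono[of "norm (vel (?S t x))" "norm x" "sqrt M"]
      by (simp add: Sg_norm[OF dm])
    from power_mono[OF this, of 2] show ?thesis using M_nonneg by (simp add: power_mult_distrib)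
  qed
  have cQ: "continuous_on S (\<lambda>t. (norm (Q (vel (?S t x))))\<^sup>2)" for S x
    by (intro continuous_intros bounded_linear.continuous_on[OF Q_bl] bounded_linear.continuous_on[OF vel_bl] continuous_on_subset[OF Sg_cont[OF dm]]) simp
  have "\<kappa> / (real N * h) * (norm (Pc m \<rho> z))\<^sup>2 \<le> integral {-\<tau>..\<tau>} (\<lambda>t. (norm (Q (vel (?S t y))))\<^sup>2)"
    using observability_centered[OF obs nar m m1 h N \<tau>, of y] y by (simp add: Pc_def prod_eq_iff)
  also have "\<dots> = integral {-\<tau>..\<tau>} (\<lambda>t. (norm (Q (vel (?S (t + \<tau>) (Pc m \<rho> z)))))\<^sup>2)" by (simp add: y_def Sg_add[OF dm])
  also have "\<dots> = integral {0..2 * \<tau>} (\<lambda>t. (norm (Q (vel (?S t (Pc m \<rho> z)))))\<^sup>2)"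
    using integral_shift_real_ivl[of 0 \<tau> "2 * \<tau>" "\<lambda>t. (norm (Q (vel (?S t (Pc m \<rho> z)))))\<^sup>2"] by simp
  also have "\<dots> \<le> 3 * dissipated T z (2 * \<tau>) + (2 * \<tau> - 0) *\<^sub>R (3 * M * e1\<^sup>2 * (norm z)\<^sup>2 + 3 * M * (norm (z - Pc m \<rho> z))\<^sup>2)"
  proof (rule has_integral_le)
    show "((\<lambda>t. (norm (Q (vel (?S t (Pc m \<rho> z)))))\<^sup>2) has_integral integral {0..2 * \<tau>} (\<lambda>t. (norm (Q (vel (?S t (Pc m \<rho> z)))))\<^sup>2)) {0..2 * \<tau>}"
      by (rule integrable_integral[OF integrable_continuous_interval[OF cQ]])
    have "((\<lambda>t. (norm (Q (vel (T t z))))\<^sup>2) has_integral (dissipated T z (2 * \<tau>) - dissipated T z 0)) {0..2 * \<tau>}"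
      by (rule fundamental_theorem_of_calculus) (use \<tau> in \<open>auto intro!: has_vector_derivative_within_subset[OF dissipated_derivative[OF z]]\<close>)
    then have 1: "((\<lambda>t. 3 * (norm (Q (vel (T t z))))\<^sup>2) has_integral 3 * dissipated T z (2 * \<tau>)) {0..2 * \<tau>}"
      unfolding dissipated_0 diff_0_right by (rule has_integral_mult_right)
    show "((\<lambda>t. 3 * (norm (Q (vel (T t z))))\<^sup>2 + (3 * M * e1\<^sup>2 * (norm z)\<^sup>2 + 3 * M * (norm (z - Pc m \<rho> z))\<^sup>2)) has_integral
       3 * dissipated T z (2 * \<tau>) + (2 * \<tau> - 0) *\<^sub>R (3 * M * e1\<^sup>2 * (norm z)\<^sup>2 + 3 * M * (norm (z - Pc m \<rho> z))\<^sup>2)) {0..2 * \<tau>}"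
      using has_integral_add[OF 1 has_integral_const_real[of "3 * M * e1\<^sup>2 * (norm z)\<^sup>2 + 3 * M * (norm (z - Pc m \<rho> z))\<^sup>2" 0 "2 * \<tau>"]] \<tau> by simp
    fix t assume t: "t \<in> {0..2 * \<tau>}"
    define Y where "Y = ?S (- t) (T t z)"
    have SY: "?S t Y = T t z" using Sg_add[OF dm, of t "- t" "T t z"] by (simp add: Y_def Sg_0)
    have "?S t (Pc m \<rho> z) = T t z - ?S t (Y - z) - ?S t (z - Pc m \<rho> z)" by (simp add: linear_simps[OF Sg_bl[OF dm]] SY)
    then have "Q (vel (?S t (Pc m \<rho> z))) = Q (vel (T t z)) - Q (vel (?S t (Y - z))) - Q (vel (?S t (z - Pc m \<rho> z)))"
      by (simp add: linear_simps[OF Q_bl] linear_simps[OF vel_bl])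
    then have "norm (Q (vel (?S t (Pc m \<rho> z)))) \<le> norm (Q (vel (T t z))) + norm (Q (vel (?S t (Y - z)))) + norm (Q (vel (?S t (z - Pc m \<rho> z))))"
      by (metis (no_types, lifting) add_right_mono norm_triangle_ineq4 order_trans)
    then have "(norm (Q (vel (?S t (Pc m \<rho> z)))))\<^sup>2 \<le> (norm (Q (vel (T t z))) + norm (Q (vel (?S t (Y - z)))) + norm (Q (vel (?S t (z - Pc m \<rho> z)))))\<^sup>2"
      by (intro power_mono) auto
    also have "\<dots> \<le> 3 * (norm (Q (vel (T t z))))\<^sup>2 + 3 * (norm (Q (vel (?S t (Y - z)))))\<^sup>2 + 3 * (norm (Q (vel (?S t (z - Pc m \<rho> z)))))\<^sup>2"
    proof -
      have "(a + b + c)\<^sup>2 \<le> 3 * a\<^sup>2 + 3 * b\<^sup>2 + 3 * c\<^sup>2" for a b c :: real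
        using zero_le_power2[of "a - b"] zero_le_power2[of "a - c"] zero_le_power2[of "b - c"] by (simp add: power2_eq_square algebra_simps)
      then show ?thesis .
    qed
    also have "(norm (Q (vel (?S t (Y - z)))))\<^sup>2 \<le> M * (e1 * norm z)\<^sup>2"
      using e[of t] t M_nonneg by (intro order_trans[OF QS] mult_left_mono power_mono) (auto simp: Y_def)
    also have "(norm (Q (vel (?S t (z - Pc m \<rho> z)))))\<^sup>2 \<le> M * (norm (z - Pc m \<rho> z))\<^sup>2" by (rule QS)
    finally show "(norm (Q (vel (?S t (Pc m \<rho> z)))))\<^sup>2 \<le> 3 * (norm (Q (vel (T t z))))\<^sup>2 + (3 * M * e1\<^sup>2 * (norm z)\<^sup>2 + 3 * M * (norm (z - Pc m \<rho> z))\<^sup>2)"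
      by (simp add: power_mult_distrib)
  qed
  finally show ?thesis by (simp add: algebra_simps)
qed

end

text \<open>By contradiction: if little is dissipated on [0, 2 \<tau>], the damped orbit stays close
  to the undamped one by \<open>drift\<close>, and undamped observability then forces a dissipation
  of order \<tau>, more than assumed. All constants depend on M and \<kappa> only, not on the
  symbol, \<tau> or \<rho>; this uniformity permits \<tau> to vary along the evolution.\<close>

lemma dissipation_lower_bound:
  assumes obs: "observable \<delta> \<kappa>"
  shows "\<exists>\<tau>0\<ge>1. \<exists>c>0. \<exists>C\<ge>0. \<exists>K>0. \<forall>m T \<tau> \<rho> z. m \<in> bfun \<longrightarrow> (\<forall>\<xi>. 1 \<le> m \<xi>) \<longrightarrow> generates T (Dm m) (Aop m) \<longrightarrow>
     \<tau>0 \<le> \<tau> \<longrightarrow> narrow \<delta> m (K / \<tau>) \<rho> \<longrightarrow> z \<in> Dm m \<longrightarrow>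
     c / \<tau> * ((norm z)\<^sup>2 - C * (norm (z - Pc m \<rho> z))\<^sup>2) \<le> dissipated T z (2 * \<tau>)"
proof -
  have \<kappa>: "0 < \<kappa>" using obs by (simp add: observable_def)
  define C1 where "C1 = 48 * M / \<kappa> + 1"
  have C1: "1 \<le> C1" "48 * M / \<kappa> \<le> C1" using \<kappa> M_nonneg by (auto simp: C1_def)
  define c1 where "c1 = \<kappa> / (C1 + 1)"
  have c1: "c1 > 0" using \<kappa> C1 by (simp add: c1_def)
  \<comment> \<open>Admissible relative drift: its coefficient 6 \<tau> M e0^2 in the observability
    estimate is at most c1 \<tau> / 4.\<close>
  define e0 where "e0 = sqrt (c1 / (24 * (M + 1)))"
  have e0: "0 < e0" "6 * M * e0\<^sup>2 \<le> c1 / 4" using c1 M_nonneg by (auto simp: e0_def field_simps)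
  define \<sigma> where "\<sigma> = min 1 (e0 / 6)"
  have \<sigma>: "0 < \<sigma>" "\<sigma> \<le> 1" "2 * \<sigma> \<le> e0 / 3" using e0 by (auto simp: \<sigma>_def)
  define \<eta> where "\<eta> = e0 / (3 * (sqrt M + 1))"
  have sM: "0 \<le> sqrt M" "0 < sqrt M + 1" using M_nonneg by (auto intro: add_nonneg_pos)
  have \<eta>: "0 < \<eta>" "sqrt M * \<eta> \<le> e0 / 3" using e0 sM by (auto simp: \<eta>_def field_simps)
  \<comment> \<open>\<sigma>, \<eta> and c each account for one third of e0: through 2 h \<tau> = 2
    \<sigma>, through sqrt M \<eta>, and through sqrt M c / (2 \<eta>).\<close>
  define c where "c = min (c1 / 12) (2 * \<eta> * e0 / (3 * (sqrt M + 1)))"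
  have "sqrt M * c \<le> sqrt M * (2 * \<eta> * e0 / (3 * (sqrt M + 1)))" using sM by (intro mult_left_mono) (auto simp: c_def)
  also have "\<dots> \<le> 2 * \<eta> * (e0 / 3)" using sM e0 \<eta> by (simp add: field_simps)
  finally have c: "0 < c" "c \<le> c1 / 12" "sqrt M * (c / (2 * \<eta>)) \<le> e0 / 3" using c1 e0 \<eta> sM by (auto simp: c_def field_simps)
  \<comment> \<open>With h = \<sigma> / \<tau> this puts N h \<tau> = N \<sigma> between C1 and C1 +
    1, independently of \<tau>.\<close>
  define N where "N = nat \<lceil>C1 / \<sigma>\<rceil>"
  have N: "C1 / \<sigma> \<le> real N" "real N \<le> C1 / \<sigma> + 1" using C1 \<sigma> by (auto simp: N_def)
  have N0: "0 < N" using N(1) C1 \<sigma> by (metis divide_pos_pos less_le_trans not_gr_zero of_nat_0 not_less zero_less_one)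
  have N\<sigma>: "C1 \<le> real N * \<sigma>" "real N * \<sigma> \<le> C1 + 1" using N \<sigma> by (auto simp: field_simps intro: order_trans)
  let ?C = "4 * (6 * M + c1) / c1"
  have main: "c / \<tau> * ((norm z)\<^sup>2 - ?C * (norm (z - Pc m \<rho> z))\<^sup>2) \<le> dissipated T z (2 * \<tau>)"
    if m: "m \<in> bfun" and m1: "\<forall>\<xi>. 1 \<le> m \<xi>" and T: "generates T (Dm m) (Aop m)"
      and \<tau>: "C1 + 1 \<le> \<tau>" and nar: "narrow \<delta> m ((C1 + 1) / \<tau>) \<rho>" and z: "z \<in> Dm m" for m T \<tau> \<rho> z
  proof (rule ccontr)
    assume not: "\<not> ?thesis"
    let ?p = "(norm (z - Pc m \<rho> z))\<^sup>2" and ?D = "dissipated T z (2 * \<tau>)"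
    have \<tau>0: "2 \<le> \<tau>" "0 < \<tau>" using \<tau> C1 by auto
    have m1': "1 \<le> m \<xi>" for \<xi> using m1 by blast
    note DD = dissipated_nonneg[OF m m1' T] dissipated_mono[OF m m1' T]
    have C0: "0 \<le> ?C" using c1 M_nonneg by simp
    have pos: "0 < (norm z)\<^sup>2 - ?C * ?p"
    proof (rule ccontr)
      assume "\<not> ?thesis"
      then have "c / \<tau> * ((norm z)\<^sup>2 - ?C * ?p) \<le> 0" using c \<tau>0 by (intro mult_nonneg_nonpos) auto
      then show False using not DD(1)[of "2 * \<tau>" z] \<tau>0 by simp
    qed
    have CP: "0 \<le> ?C * ?p" by (rule mult_nonneg_nonneg[OF C0 zero_le_power2])
    then have "0 < (norm z)\<^sup>2" using pos by linarith
    then have z0: "0 < norm z" by simp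
    have "(norm z)\<^sup>2 - ?C * ?p \<le> (norm z)\<^sup>2" using CP by linarith
    then have "c / \<tau> * ((norm z)\<^sup>2 - ?C * ?p) \<le> c / \<tau> * (norm z)\<^sup>2" by (rule mult_left_mono) (use c \<tau>0 in simp)
    then have Dle: "?D \<le> c / \<tau> * (norm z)\<^sup>2" using not by simp
    define h where "h = \<sigma> / \<tau>"
    have h: "0 < h" "h \<le> 1 / 2" "h * \<tau> = \<sigma>" using \<sigma> \<tau>0 by (auto simp: h_def field_simps)
    have Nh: "real N * h \<le> (C1 + 1) / \<tau>" using N\<sigma> \<tau>0 by (simp add: h_def divide_right_mono)
    also have "\<dots> \<le> 1" using \<tau> \<tau>0 by simp
    finally have Nh1: "real N * h \<le> 1" .
    have drift': "norm (Sg (dsc h m) (- t) (T t z) - z) \<le> e0 * norm z" if t: "0 \<le> t" "t \<le> 2 * \<tau>" for t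
    proof -
      \<comment> \<open>The scale at which both terms of Young's inequality are proportional to |z|
        and independent of \<tau>, given a dissipation of at most c / \<tau> times |z|^2.\<close>
      define a where "a = \<eta> * norm z / \<tau>"
      have a: "0 < a" using \<eta> z0 \<tau>0 by (simp add: a_def)
      have "norm (Sg (dsc h m) (- t) (T t z) - z) \<le> h * norm z * t + sqrt M * (a * t / 2 + dissipated T z t / (2 * a))"
        by (rule drift[OF m m1' T z h(1) t(1) a])
      also have "\<dots> \<le> h * norm z * (2 * \<tau>) + sqrt M * (a * (2 * \<tau>) / 2 + (c / \<tau> * (norm z)\<^sup>2) / (2 * a))"
        using t a h sM Dle order_trans[OF DD(2)[OF t, of z] Dle] by (intro add_mono mult_left_mono divide_right_mono) auto
      also have "\<dots> = (2 * (h * \<tau>) + sqrt M * \<eta> + sqrt M * (c / (2 * \<eta>))) * norm z"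
        using z0 \<tau>0 \<eta> by (simp add: a_def field_simps power2_eq_square)
      also have "\<dots> \<le> (e0 / 3 + e0 / 3 + e0 / 3) * norm z" unfolding h(3) using \<sigma> \<eta> c by (intro mult_right_mono add_mono) auto
      finally show ?thesis by simp
    qed
    have "48 * M / \<kappa> \<le> real N * h * \<tau>" using C1(2) N\<sigma>(1) h(3) by (simp add: mult.assoc)
    from damped_observability[OF m m1' T obs nar h(1,2) N0 Nh1 Nh \<tau>0(2) _ this z drift']
    have ob: "\<kappa> / (real N * h) * (norm (Pc m \<rho> z))\<^sup>2 \<le> 3 * ?D + 6 * \<tau> * M * e0\<^sup>2 * (norm z)\<^sup>2 + 6 * \<tau> * M * ?p"
      using h \<sigma> by simp
    have Nh0: "0 < real N * h" using N0 h by simp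
    have "c1 * \<tau> \<le> \<kappa> / (real N * h)"
    proof -
      have "c1 * \<tau> * (real N * h) \<le> c1 * \<tau> * ((C1 + 1) / \<tau>)" using Nh c1 \<tau>0 by (intro mult_left_mono) auto
      also have "\<dots> = \<kappa>" using \<tau>0 C1 by (simp add: c1_def)
      finally show ?thesis using Nh0 by (simp add: pos_le_divide_eq)
    qed
    then have ob1: "c1 * \<tau> * (norm (Pc m \<rho> z))\<^sup>2 \<le> 3 * ?D + 6 * \<tau> * M * e0\<^sup>2 * (norm z)\<^sup>2 + 6 * \<tau> * M * ?p"
      using ob by (meson mult_right_mono order_trans zero_le_power2)
    have "(norm z)\<^sup>2 \<le> 2 * (norm (Pc m \<rho> z))\<^sup>2 + 2 * ?p"
    proof -
      have "norm z \<le> norm (Pc m \<rho> z) + norm (z - Pc m \<rho> z)" using norm_triangle_ineq[of "Pc m \<rho> z" "z - Pc m \<rho> z"] by simp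
      then have "(norm z)\<^sup>2 \<le> (norm (Pc m \<rho> z) + norm (z - Pc m \<rho> z))\<^sup>2" by (rule power_mono) simp
      then show ?thesis using sum_squares_bound[of "norm (Pc m \<rho> z)" "norm (z - Pc m \<rho> z)"] by (simp add: power2_sum)
    qed
    then have "c1 * \<tau> * ((norm z)\<^sup>2 / 2 - ?p) \<le> c1 * \<tau> * (norm (Pc m \<rho> z))\<^sup>2" using c1 \<tau>0 by (intro mult_left_mono) auto
    moreover have "\<tau> * (norm z)\<^sup>2 * (6 * M * e0\<^sup>2) \<le> \<tau> * (norm z)\<^sup>2 * (c1 / 4)" using e0(2) \<tau>0 by (intro mult_left_mono) auto
    ultimately have "c1 * \<tau> / 4 * (norm z)\<^sup>2 \<le> 3 * ?D + \<tau> * (6 * M + c1) * ?p" using ob1 by (simp add: algebra_simps)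
    then have "c1 * \<tau> / 12 * (norm z)\<^sup>2 - \<tau> * (2 * M + c1 / 3) * ?p \<le> ?D" by (simp add: algebra_simps)
    moreover have "\<tau> * (c1 / 12) * ((norm z)\<^sup>2 - C' * ?p) = c1 * \<tau> / 12 * (norm z)\<^sup>2 - \<tau> * (c1 / 12 * C') * ?p" for C'
      by (simp add: algebra_simps)
    moreover have "c1 / 12 * ?C = 2 * M + c1 / 3" using c1 by (simp add: field_simps)
    ultimately have "\<tau> * (c1 / 12) * ((norm z)\<^sup>2 - ?C * ?p) \<le> ?D" by (simp only:)
    moreover have "c / \<tau> * ((norm z)\<^sup>2 - ?C * ?p) \<le> \<tau> * (c1 / 12) * ((norm z)\<^sup>2 - ?C * ?p)"
    proof (rule mult_right_mono)
      have "c / \<tau> \<le> c" using c \<tau>0 by (simp add: divide_le_eq)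
      also have "\<dots> \<le> c1 / 12" by (rule c)
      also have "\<dots> \<le> \<tau> * (c1 / 12)" using c1 \<tau>0 by simp
      finally show "c / \<tau> \<le> \<tau> * (c1 / 12)" .
    qed (use pos in simp)
    ultimately show False using not by linarith
  qed
  have "0 \<le> ?C" using c1 M_nonneg by simp
  moreover have "1 \<le> C1 + 1" "0 < C1 + 1" using C1 by auto
  ultimately show ?thesis using c(1) main by (intro exI[of _ "C1 + 1"] exI[of _ c] exI[of _ ?C] conjI) blast+
qed

end

section \<open>Spectral windows and decay\<close>

text \<open>The difference is (r1 - r2)(r1 + r2) / S with S <= 2 + (r1 + r2), and x / (2 + x)
  increases in x = r1 + r2 >= \<delta>.\<close>

lemma japanese_gap:
  assumes \<delta>: "0 < \<delta>" and r: "0 \<le> r2" "r2 + \<delta> \<le> r1"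
  shows "\<delta>\<^sup>2 / (2 + \<delta>) \<le> sqrt (1 + r1\<^sup>2) - sqrt (1 + r2\<^sup>2)"
proof -
  define S where "S = sqrt (1 + r1\<^sup>2) + sqrt (1 + r2\<^sup>2)"
  have le: "sqrt (1 + x\<^sup>2) \<le> 1 + x" if "0 \<le> x" for x :: real by (rule real_le_lsqrt) (use that in \<open>auto simp: power2_sum\<close>)
  have S: "0 < S" "S \<le> 2 + (r1 + r2)" using le[of r1] le[of r2] r \<delta> by (auto simp: S_def intro!: add_pos_pos simp: add_pos_nonneg)
  have "(sqrt (1 + r1\<^sup>2) - sqrt (1 + r2\<^sup>2)) * S = r1\<^sup>2 - r2\<^sup>2"
    unfolding S_def by (simp add: algebra_simps flip: power2_eq_square)
  then have e: "sqrt (1 + r1\<^sup>2) - sqrt (1 + r2\<^sup>2) = (r1 - r2) * (r1 + r2) / S" using S(1) by (simp add: field_simps power2_eq_square)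
  have "\<delta>\<^sup>2 / (2 + \<delta>) = \<delta> * (\<delta> / (2 + \<delta>))" by (simp add: power2_eq_square)
  also have "\<dots> \<le> \<delta> * ((r1 + r2) / (2 + (r1 + r2)))"
    using \<delta> r by (intro mult_left_mono) (auto simp: frac_le_eq divide_le_0_iff field_simps)
  also have "\<dots> \<le> (r1 - r2) * ((r1 + r2) / S)" using \<delta> r S by (intro mult_mono divide_left_mono) auto
  finally show ?thesis unfolding e by simp
qed

text \<open>For p <= 1 this is the mean value theorem: the derivative is smallest at the right end,
  which is the point controlled by the spectral cutoff.\<close>

lemma powr_gap:
  fixes a1 a2 p :: real
  assumes a: "1 \<le> a2" "a2 \<le> a1" and p: "0 < p" shows "1 \<le> p \<Longrightarrow> a1 - a2 \<le> a1 powr p - a2 powr p"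
    and "p \<le> 1 \<Longrightarrow> p * a1 powr (p - 1) * (a1 - a2) \<le> a1 powr p - a2 powr p"
proof -
  have split: "x powr p = x * x powr (p - 1)" if "1 \<le> x" for x using that powr_add[of x 1 "p - 1"] by simp
  show "a1 - a2 \<le> a1 powr p - a2 powr p" if "1 \<le> p"
  proof -
    have g: "1 \<le> a2 powr (p - 1)" "a2 powr (p - 1) \<le> a1 powr (p - 1)" using a that by (auto intro: ge_one_powr_ge_zero powr_mono2)
    have "(a1 - a2) * 1 \<le> (a1 - a2) * a2 powr (p - 1)" using a g by (intro mult_left_mono) auto
    also have "\<dots> \<le> a1 * a1 powr (p - 1) - a2 * a2 powr (p - 1)" using a g by (simp add: left_diff_distrib mult_left_mono)
    finally show ?thesis using a by (simp add: split)
  qed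
  show "p * a1 powr (p - 1) * (a1 - a2) \<le> a1 powr p - a2 powr p" if "p \<le> 1"
  proof (cases "a1 = a2")
    case False
    have "\<exists>z>a2. z < a1 \<and> a1 powr p - a2 powr p = (a1 - a2) * (p * z powr (p - 1))"
      by (rule MVT2) (use False a in \<open>auto intro!: has_real_derivative_powr\<close>)
    then obtain c where c: "a2 < c" "c < a1" "a1 powr p - a2 powr p = (a1 - a2) * (p * c powr (p - 1))" by blast
    have "a1 powr (p - 1) \<le> c powr (p - 1)" using c a that by (intro powr_mono2') auto
    then show ?thesis unfolding c(3) using a p by (simp add: mult_left_mono mult.commute)
  qed simp
qed

lemma lam_eq: "lam s \<xi> = sqrt (1 + (norm \<xi>)\<^sup>2) powr (s / 2)"
  by (simp add: lam_def powr_half_sqrt[symmetric] powr_powr add_nonneg_nonneg)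

context damping
begin

text \<open>The shell starts at the infimum R of the norms in the window: a point beyond R +
  \<delta> would exceed some point of the window by \<delta> in norm, against the gap.\<close>

lemma narrowI:
  assumes gap: "\<And>\<xi>1 \<xi>2. norm \<xi>2 + \<delta> \<le> norm \<xi>1 \<Longrightarrow> m \<xi>1 \<le> \<rho> \<Longrightarrow> \<epsilon> \<le> m \<xi>1 - m \<xi>2"
  shows "narrow \<delta> m \<epsilon> \<rho>" unfolding narrow_def
proof
  fix \<theta>
  let ?S = "{\<xi>. \<theta> \<le> m \<xi> \<and> m \<xi> < \<theta> + \<epsilon> \<and> m \<xi> \<le> \<rho>}"
  show "\<exists>R\<ge>0. \<forall>\<xi>. \<theta> \<le> m \<xi> \<and> m \<xi> < \<theta> + \<epsilon> \<and> m \<xi> \<le> \<rho> \<longrightarrow> R \<le> norm \<xi> \<and> norm \<xi> \<le> R + \<delta>"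
  proof (cases "?S = {}")
    case False
    let ?R = "Inf (norm ` ?S)"
    have bd: "bdd_below (norm ` ?S)" by (rule bdd_belowI[of _ 0]) auto
    show ?thesis
    proof (intro exI[of _ ?R] conjI allI impI)
      show "0 \<le> ?R" using False by (intro cInf_greatest) auto
      fix \<xi> assume \<xi>: "\<theta> \<le> m \<xi> \<and> m \<xi> < \<theta> + \<epsilon> \<and> m \<xi> \<le> \<rho>"
      then show "?R \<le> norm \<xi>" using bd by (intro cInf_lower) auto
      show "norm \<xi> \<le> ?R + \<delta>"
      proof (rule ccontr)
        assume "\<not> norm \<xi> \<le> ?R + \<delta>"
        then have "?R < norm \<xi> - \<delta>" by simp
        then obtain \<xi>2 where "\<xi>2 \<in> ?S" "norm \<xi>2 < norm \<xi> - \<delta>" using cInf_less_iff[OF _ bd] False by auto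
        then show False using gap[of \<xi>2 \<xi>] \<xi> by auto
      qed
    qed
  qed auto
qed

text \<open>With a = sqrt(1 + |\<xi>|^2) one has \<lambda> = a^(s/2). Its slope in a is at least 1
  for s >= 2, whereas for s < 2 and \<lambda> <= \<rho> the available lower bound is (s/2)
  \<rho>^(-(2 - s)/s).\<close>

lemma narrow_lam:
  assumes \<delta>: "0 < \<delta>" and s: "0 < s"
  shows "2 \<le> s \<Longrightarrow> \<epsilon> \<le> \<delta>\<^sup>2 / (2 + \<delta>) \<Longrightarrow> narrow \<delta> (lam s) \<epsilon> \<rho>"
    and "s < 2 \<Longrightarrow> 0 < \<rho> \<Longrightarrow> \<epsilon> \<le> s / 2 * \<rho> powr (- ((2 - s) / s)) * (\<delta>\<^sup>2 / (2 + \<delta>)) \<Longrightarrow> narrow \<delta> (lam s) \<epsilon> \<rho>"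
proof -
  let ?a = "\<lambda>\<xi>::'a. sqrt (1 + (norm \<xi>)\<^sup>2)"
  have a: "\<delta>\<^sup>2 / (2 + \<delta>) \<le> ?a \<xi>1 - ?a \<xi>2" "1 \<le> ?a \<xi>2" "?a \<xi>2 \<le> ?a \<xi>1" if "norm \<xi>2 + \<delta> \<le> norm \<xi>1" for \<xi>1 \<xi>2 :: 'a
    using japanese_gap[OF \<delta> _ that] that \<delta> by (auto intro!: power_mono)
  show "narrow \<delta> (lam s) \<epsilon> \<rho>" if s2: "2 \<le> s" and e: "\<epsilon> \<le> \<delta>\<^sup>2 / (2 + \<delta>)"
  proof (rule narrowI)
    fix \<xi>1 \<xi>2 :: 'a assume n: "norm \<xi>2 + \<delta> \<le> norm \<xi>1"
    have "?a \<xi>1 - ?a \<xi>2 \<le> lam s \<xi>1 - lam s \<xi>2" unfolding lam_eq using s2 by (intro powr_gap(1) a(2,3)[OF n]) auto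
    then show "\<epsilon> \<le> lam s \<xi>1 - lam s \<xi>2" using a(1)[OF n] e by linarith
  qed
  show "narrow \<delta> (lam s) \<epsilon> \<rho>" if s2: "s < 2" and \<rho>: "0 < \<rho>" and e: "\<epsilon> \<le> s / 2 * \<rho> powr (- ((2 - s) / s)) * (\<delta>\<^sup>2 / (2 + \<delta>))"
  proof (rule narrowI)
    fix \<xi>1 \<xi>2 :: 'a assume n: "norm \<xi>2 + \<delta> \<le> norm \<xi>1" and le: "lam s \<xi>1 \<le> \<rho>"
    have pos: "0 < ?a \<xi>1" using a(2,3)[OF n] by linarith
    have "\<rho> powr (- ((2 - s) / s)) \<le> lam s \<xi>1 powr (- ((2 - s) / s))" using s s2 le lam_pos[of s \<xi>1] by (intro powr_mono2') auto
    also have "\<dots> = ?a \<xi>1 powr (s / 2 - 1)"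
    proof -
      have "s / 2 * - ((2 - s) / s) = s / 2 - 1" using s by (simp add: field_simps)
      then show ?thesis by (simp only: lam_eq powr_powr)
    qed
    finally have r: "\<rho> powr (- ((2 - s) / s)) \<le> ?a \<xi>1 powr (s / 2 - 1)" .
    have "s / 2 * \<rho> powr (- ((2 - s) / s)) * (\<delta>\<^sup>2 / (2 + \<delta>)) \<le> s / 2 * ?a \<xi>1 powr (s / 2 - 1) * (?a \<xi>1 - ?a \<xi>2)"
      using r a(1)[OF n] \<delta> s by (intro mult_mono) auto
    also have "\<dots> \<le> lam s \<xi>1 - lam s \<xi>2" unfolding lam_eq using s s2 by (intro powr_gap(2) a(2,3)[OF n]) auto
    finally show "\<epsilon> \<le> lam s \<xi>1 - lam s \<xi>2" using e by linarith
  qed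
qed

end

section \<open>From lower bounds on the dissipation to decay rates\<close>

lemma Pc_tendsto:
  assumes m: "m \<in> bfun" shows "(\<lambda>n. Pc m (real n) z) \<longlonglongrightarrow> z"
proof -
  have "(\<lambda>n. mulop (cutoff m (real n)) f) \<longlonglongrightarrow> mulop (\<lambda>_. 1) f" for f :: "'a l2"
  proof (rule tendsto_mulop_dominated[where b = "\<lambda>_. 1"])
    fix \<xi>
    obtain N where N: "m \<xi> \<le> real N" using real_arch_simple by blast
    then have "cutoff m (real n) \<xi> = 1" if "n \<ge> N" for n using that by (auto simp: cutoff_def)
    then show "(\<lambda>n. cutoff m (real n) \<xi>) \<longlonglongrightarrow> 1" by (intro tendsto_eventually) (auto simp: eventually_sequentially)
  qed (use bmf_cutoff[OF m] in \<open>auto simp: cutoff_def\<close>)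
  from tendsto_Pair[OF this[of "fst z"] this[of "snd z"]] show ?thesis by (simp add: Pc_def)
qed

text \<open>Chebyshev's inequality on the spectral side: above the threshold, m / \<rho> exceeds
  1.\<close>

lemma norm_tail_le:
  assumes m: "m \<in> bfun" and \<rho>: "0 < \<rho>" and z: "z \<in> Dm m" shows "norm (z - Pc m \<rho> z) \<le> norm (A0 m z) / \<rho>"
proof -
  have one: "norm (f - mulop (cutoff m \<rho>) f) \<le> norm (mulop (icof m) f) / \<rho>" if f: "f \<in> muldom (cof m)" for f :: "'a l2"
  proof -
    have sf: "L2 (\<lambda>\<xi>. icof m \<xi> * rep f \<xi>)" using f m by (simp add: muldom_icof[symmetric]) (simp add: muldom_def)
    have sc: "L2 (\<lambda>\<xi>. cutoff m \<rho> \<xi> * rep f \<xi>)" by (intro L2_bmf bmf_cutoff m) auto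
    have s1: "L2 (\<lambda>\<xi>. rep f \<xi> - cutoff m \<rho> \<xi> * rep f \<xi>)" by (intro L2_diff sc) auto
    have "norm (cls (\<lambda>\<xi>. rep f \<xi> - cutoff m \<rho> \<xi> * rep f \<xi>)) \<le> norm (cls (\<lambda>\<xi>. cpx (1 / \<rho>) * (icof m \<xi> * rep f \<xi>)))"
    proof (rule norm_cls_mono[OF s1 L2_cmult[OF sf]], intro AE_I2)
      fix \<xi>
      show "cmod (rep f \<xi> - cutoff m \<rho> \<xi> * rep f \<xi>) \<le> cmod (cpx (1 / \<rho>) * (icof m \<xi> * rep f \<xi>))"
      proof (cases "m \<xi> \<le> \<rho>")
        case False
        have "1 * cmod (rep f \<xi>) \<le> m \<xi> / \<rho> * cmod (rep f \<xi>)" using False \<rho> by (intro mult_right_mono) auto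
        then show ?thesis using False \<rho> by (simp add: cutoff_def norm_mult norm_divide)
      qed (simp add: cutoff_def)
    qed
    also have "\<dots> = norm (mulop (icof m) f) / \<rho>" using \<rho> by (simp add: cls_scaleR[OF sf] mulop_def del: of_real_divide)
    finally show ?thesis unfolding mulop_def[of "cutoff m \<rho>"] using cls_diff[OF L2_rep[of f] sc] by simp
  qed
  have z': "fst z \<in> muldom (cof m)" "snd z \<in> muldom (cof m)" using z by (auto simp: Dm_def)
  have "(norm (z - Pc m \<rho> z))\<^sup>2 = (norm (fst z - mulop (cutoff m \<rho>) (fst z)))\<^sup>2 + (norm (snd z - mulop (cutoff m \<rho>) (snd z)))\<^sup>2"
    by (simp add: Pc_def norm_prod_def)
  also have "\<dots> \<le> (norm (mulop (icof m) (fst z)) / \<rho>)\<^sup>2 + (norm (mulop (icof m) (snd z)) / \<rho>)\<^sup>2"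
    by (intro add_mono power_mono one z') auto
  also have "\<dots> = (norm (A0 m z) / \<rho>)\<^sup>2" by (simp add: A0_def norm_prod_def power_divide add_divide_distrib)
  finally show ?thesis by (rule power2_le_imp_le) (use \<rho> in simp)
qed

lemma norm_le_A0:
  assumes m: "m \<in> bfun" and m1: "\<And>\<xi>. 1 \<le> m \<xi>" and z: "z \<in> Dm m" shows "norm z \<le> norm (A0 m z)"
proof -
  have one: "norm f \<le> norm (mulop (icof m) f)" if f: "f \<in> muldom (cof m)" for f :: "'a l2"
  proof -
    have sf: "L2 (\<lambda>\<xi>. icof m \<xi> * rep f \<xi>)" using f m by (simp add: muldom_icof[symmetric]) (simp add: muldom_def)
    have "norm (cls (rep f)) \<le> norm (cls (\<lambda>\<xi>. icof m \<xi> * rep f \<xi>))"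
    proof (rule norm_cls_mono[OF _ sf], simp, intro AE_I2)
      show "cmod (rep f \<xi>) \<le> cmod (icof m \<xi> * rep f \<xi>)" for \<xi>
        using mult_right_mono[of 1 "\<bar>m \<xi>\<bar>" "cmod (rep f \<xi>)"] m1[of \<xi>] by (simp add: norm_mult)
    qed
    then show ?thesis by (simp add: mulop_def)
  qed
  have "fst z \<in> muldom (cof m)" "snd z \<in> muldom (cof m)" using z by (auto simp: Dm_def)
  then show ?thesis unfolding norm_prod_def A0_def by (intro real_sqrt_le_mono add_mono power_mono) (auto intro: one)
qed

lemma exp_bernoulli: "0 \<le> x \<Longrightarrow> x < 1 \<Longrightarrow> 0 < b \<Longrightarrow> 1 + b * x \<le> (1 - x) powr (- b)" for x b :: real
proof -
  assume x: "0 \<le> x" "x < 1" "0 < b"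
  have "1 + b * x \<le> exp (b * x)" by (rule exp_ge_add_one_self)
  also have "\<dots> = exp (- x) powr (- b)" by (simp add: powr_def)
  also have "\<dots> \<le> (1 - x) powr (- b)" using x exp_ge_add_one_self[of "- x"] by (intro powr_mono2') auto
  finally show ?thesis .
qed

text \<open>Along the times \<open>t' = t + 2 A \<surd>f\<close> the quantity \<open>f = (W / e)\<^bsup>1/\<alpha>\<^esup>\<close> grows at least linearly.\<close>

lemma polynomial_decay:
  fixes c \<tau>0 \<alpha> C3 :: real
  assumes pos: "0 < c" "1 \<le> \<tau>0" "0 < \<alpha>" "0 \<le> C3"
  shows "\<exists>K>0. \<forall>e W. (\<forall>t r. 0 \<le> t \<longrightarrow> t \<le> r \<longrightarrow> e r \<le> e t) \<longrightarrow> (\<forall>t\<ge>0. 0 \<le> e t) \<longrightarrow> e 0 \<le> W \<longrightarrow>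
     (\<forall>t\<ge>0. \<forall>\<tau>\<ge>\<tau>0. 2 * c / \<tau> * (e t - C3 * \<tau> powr (- 2 * \<alpha>) * W) \<le> e t - e (t + 2 * \<tau>)) \<longrightarrow> (\<forall>t\<ge>0. e t \<le> W * (K / (1 + t)) powr \<alpha>)"
proof -
  define b where "b = 1 / \<alpha>"
  have b: "0 < b" "b * \<alpha> = 1" using pos by (auto simp: b_def)
  \<comment> \<open>The three entries make the step parameter at least \<tau>0, the relative loss x
    less than 1, and the \<open>C3\<close> term at most half of the current energy.\<close>
  define A where "A = max (max \<tau>0 (2 * c)) ((2 * C3 + 1) powr (b / 2))"
  have A: "\<tau>0 \<le> A" "2 * c \<le> A" "1 \<le> A" and A': "(2 * C3 + 1) powr (b / 2) \<le> A" using pos by (auto simp: A_def)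
  have AC: "C3 * A powr (- 2 * \<alpha>) \<le> 1 / 2"
  proof -
    have "((2 * C3 + 1) powr (b / 2)) powr (2 * \<alpha>) \<le> A powr (2 * \<alpha>)" using pos A' by (intro powr_mono2) auto
    then have "2 * C3 + 1 \<le> A powr (2 * \<alpha>)" using b pos by (simp add: powr_powr)
    then have "C3 \<le> 1 / 2 * A powr (2 * \<alpha>)" by simp
    then show ?thesis using A by (simp add: powr_minus field_simps)
  qed
  \<comment> \<open>Chosen so that f b x = c' (2 A sqrt f) for x = c / (A sqrt f): in one step f
    gains at least c' times the length of the step.\<close>
  define c' where "c' = b * c / (2 * A\<^sup>2)"
  have c': "0 < c'" using b pos A by (simp add: c'_def)
  define K where "K = 1 / c' + 2 * A + 1"
  have K: "0 < K" using c' A by (simp add: K_def add_pos_pos)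
  have main: "e t \<le> W * (K / (1 + t)) powr \<alpha>"
    if mono: "\<And>t r. 0 \<le> t \<Longrightarrow> t \<le> r \<Longrightarrow> e r \<le> e t" and e0: "\<And>t. 0 \<le> t \<Longrightarrow> 0 \<le> e t" and W: "e 0 \<le> W"
      and step: "\<And>t \<tau>. 0 \<le> t \<Longrightarrow> \<tau>0 \<le> \<tau> \<Longrightarrow> 2 * c / \<tau> * (e t - C3 * \<tau> powr (- 2 * \<alpha>) * W) \<le> e t - e (t + 2 * \<tau>)"
      and t: "0 \<le> t" for e :: "real \<Rightarrow> real" and W t
  proof (cases "e t = 0")
    case True
    then show ?thesis using e0[of 0] W by simp
  next
    case False
    then have et: "0 < e t" using e0[OF t] by simp
    have ep: "0 < e r" if "0 \<le> r" "r \<le> t" for r using mono[OF that] et by simp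
    have W0: "0 < W" using ep[of 0] t W by simp
    define f where "f r = (W / e r) powr b" for r
    have f1: "1 \<le> f r" if "0 \<le> r" "r \<le> t" for r
      using mono[of 0 r] W ep[OF that] that b unfolding f_def by (intro ge_one_powr_ge_zero) auto
    have fmono: "f r \<le> f r'" if "0 \<le> r" "r \<le> r'" "r' \<le> t" for r r'
      using mono[OF that(1,2)] ep[of r] ep[of r'] that W0 b unfolding f_def by (intro powr_mono2 divide_left_mono) auto
    have inc: "f r + c' * (2 * A * sqrt (f r)) \<le> f (r + 2 * A * sqrt (f r))" if r: "0 \<le> r" "r + 2 * A * sqrt (f r) \<le> t" for r
    proof -
      let ?\<tau> = "A * sqrt (f r)"
      have q0: "0 \<le> 2 * A * sqrt (f r)" using A f_def by simp
      have r1: "r \<le> t" using r q0 by linarith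
      have sq: "1 \<le> sqrt (f r)" using f1[OF r(1) r1] by simp
      have \<tau>: "A \<le> ?\<tau>" using sq A by simp
      have er: "0 < e r" "0 < e (r + 2 * ?\<tau>)" using ep[OF r(1) r1] ep[of "r + 2 * A * sqrt (f r)"] r q0 by (auto simp: mult.assoc)
      \<comment> \<open>The choice \<tau> = A sqrt f is made for this: \<tau>^(-2 \<alpha>) W
        becomes a fixed multiple of the current energy.\<close>
      have "?\<tau> powr (- 2 * \<alpha>) = A powr (- 2 * \<alpha>) * (e r / W)"
      proof -
        have "sqrt (f r) powr (- 2 * \<alpha>) = f r powr (- \<alpha>)" using f1[OF r(1) r1] by (simp add: powr_half_sqrt[symmetric] powr_powr)
        also have "\<dots> = (W / e r) powr (- 1)" using b by (simp add: f_def powr_powr)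
        also have "\<dots> = e r / W" using W0 er by (simp add: powr_minus)
        finally show ?thesis using A sq by (simp add: powr_mult)
      qed
      then have "C3 * ?\<tau> powr (- 2 * \<alpha>) * W = C3 * A powr (- 2 * \<alpha>) * e r" using W0 by simp
      also have "\<dots> \<le> 1 / 2 * e r" using AC er by (intro mult_right_mono) auto
      finally have half: "1 / 2 * e r \<le> e r - C3 * ?\<tau> powr (- 2 * \<alpha>) * W" by simp
      define x where "x = c / ?\<tau>"
      have \<tau>0: "0 < ?\<tau>" using \<tau> A by linarith
      have "c < ?\<tau>" "\<tau>0 \<le> ?\<tau>" using pos \<tau> A by linarith+
      then have x: "0 < x" "x < 1" using pos \<tau>0 by (auto simp: x_def)
      have "x * e r = 2 * c / ?\<tau> * (1 / 2 * e r)" by (simp add: x_def)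
      also have "\<dots> \<le> 2 * c / ?\<tau> * (e r - C3 * ?\<tau> powr (- 2 * \<alpha>) * W)" using half pos \<tau>0 by (intro mult_left_mono) auto
      also have "\<dots> \<le> e r - e (r + 2 * ?\<tau>)" by (rule step[OF r(1) \<open>\<tau>0 \<le> ?\<tau>\<close>])
      finally have dec: "e (r + 2 * ?\<tau>) \<le> e r * (1 - x)" by (simp add: algebra_simps)
      have "f r * (1 + b * x) \<le> f r * (1 - x) powr (- b)" using exp_bernoulli[of x b] x b f1[OF r(1) r1] by (intro mult_left_mono) auto
      also have "\<dots> = (W / (e r * (1 - x))) powr b" using x er W0 by (simp add: f_def powr_mult powr_divide powr_minus divide_inverse inverse_powr)
      also have "\<dots> \<le> f (r + 2 * ?\<tau>)" unfolding f_def[of "r + 2 * ?\<tau>"] using dec er x W0 b by (intro powr_mono2 divide_left_mono mult_pos_pos) auto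
      finally have 1: "f r * (1 + b * x) \<le> f (r + 2 * ?\<tau>)" .
      have "f r * (b * x) = c' * (2 * ?\<tau>)" using A sq f1[OF r(1) r1] by (simp add: c'_def x_def field_simps power2_eq_square)
      then show ?thesis using 1 by (simp add: algebra_simps)
    qed
    define T where "T = rec_nat 0 (\<lambda>_ r. r + 2 * A * sqrt (f r))"
    have T: "T 0 = 0" "T (Suc n) = T n + 2 * A * sqrt (f (T n))" for n by (simp_all add: T_def)
    have Tn: "0 \<le> T n" for n by (induction n) (use A in \<open>auto simp: T f_def\<close>)
    have Tinc: "T n \<le> T (Suc n)" for n using A by (simp add: T f_def)
    have grow: "T n \<le> t \<Longrightarrow> c' * T n \<le> f (T n) \<and> real n \<le> T n" for n
    proof (induction n)
      case (Suc n)
      have le: "T n \<le> t" using Suc.prems Tinc[of n] by linarith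
      have "c' * T (Suc n) = c' * T n + c' * (2 * A * sqrt (f (T n)))" by (simp add: T distrib_left)
      also have "\<dots> \<le> f (T (Suc n))" using Suc.IH[OF le] inc[OF Tn[of n]] Suc.prems unfolding T(2) by linarith
      finally have 1: "c' * T (Suc n) \<le> f (T (Suc n))" .
      have "1 * 1 \<le> A * sqrt (f (T n))" using A f1[OF Tn le] by (intro mult_mono) auto
      then show ?case using 1 Suc.IH[OF le] by (simp add: T)
    qed (simp add: T f_def)
    have "\<exists>n. t < T (Suc n)"
    proof (rule ccontr)
      assume "\<not> ?thesis"
      then have "T (Suc n) \<le> t" for n by (meson not_less)
      moreover obtain n where "t < real n" using reals_Archimedean2 by blast
      ultimately show False using grow[of "Suc n"] by (smt (verit) of_nat_Suc)
    qed
    then have ex: "t < T (Suc (LEAST n. t < T (Suc n)))" by (rule LeastI_ex)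
    \<comment> \<open>\<open>T n\<close> is the last of these times not exceeding t. The remaining
      time is below one step, 2 A sqrt f <= 2 A f since f >= 1, which together with T n <= f / c'
      explains the constant K.\<close>
    define n where "n = (LEAST n. t < T (Suc n))"
    have n: "t < T (Suc n)" using ex by (simp add: n_def)
    have Tt: "T n \<le> t"
    proof (cases n)
      case (Suc k)
      then have "\<not> t < T (Suc k)" using not_less_Least[of k "\<lambda>n. t < T (Suc n)"] by (simp add: n_def)
      then show ?thesis using Suc by simp
    qed (use t T in simp)
    have fT: "1 \<le> f (T n)" "f (T n) \<le> f t" using f1[OF Tn Tt] fmono[OF Tn Tt] by auto
    have "sqrt (f (T n)) \<le> f (T n)" using fT(1) by (intro real_le_lsqrt) (auto simp: power2_eq_square)
    then have "t \<le> T n + 2 * A * f (T n)" using n A unfolding T(2) by (smt (verit) mult_left_mono)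
    moreover have "T n \<le> f (T n) / c'" using grow[OF Tt] c' by (simp add: pos_le_divide_eq mult.commute)
    moreover have "K * f (T n) = f (T n) / c' + 2 * A * f (T n) + f (T n)" by (simp add: K_def algebra_simps)
    ultimately have "1 + t \<le> K * f (T n)" using fT(1) by linarith
    also have "\<dots> \<le> K * f t" using fT K by (intro mult_left_mono) auto
    finally have "(1 + t) / K \<le> f t" using K by (simp add: field_simps)
    then have "((1 + t) / K) powr \<alpha> \<le> f t powr \<alpha>" using t K pos by (intro powr_mono2) auto
    also have "\<dots> = W / e t" using b et W0 by (simp add: f_def powr_powr)
    finally have "e t * ((1 + t) / K) powr \<alpha> \<le> W" using et by (simp add: field_simps)
    moreover have "((1 + t) / K) powr \<alpha> * (K / (1 + t)) powr \<alpha> = 1" using t K by (simp flip: powr_mult)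
    ultimately have "e t * 1 \<le> W * (K / (1 + t)) powr \<alpha>" by (metis mult.assoc mult_right_mono powr_ge_zero)
    then show ?thesis by simp
  qed
  show ?thesis using K main by (intro exI[of _ K]) auto
qed

context damping
begin

text \<open>For s >= 2 the windows are thin at every height, so \<tau> is fixed and letting the
  cutoff tend to infinity removes the tail. A time 2 \<tau> then shrinks the norm by a factor q, on
  the domain and by density everywhere.\<close>

lemma exponential_decay:
  assumes obs: "observable \<delta> \<kappa>" and s: "2 \<le> s"
  shows "\<exists>C>0. \<exists>\<omega>>0. \<forall>T. generates T (Dm (lam s)) (Aop (lam s)) \<longrightarrow> (\<forall>z. \<forall>t\<ge>0. norm (T t z) \<le> C * exp (- \<omega> * t) * norm z)"
proof -
  have \<delta>: "0 < \<delta>" using obs by (simp add: observable_def)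
  from dissipation_lower_bound[OF obs] obtain \<tau>0 c C K where k: "1 \<le> \<tau>0" "0 < c" "0 \<le> C" "0 < K" and
    lower: "\<forall>m T \<tau> \<rho> z. m \<in> bfun \<longrightarrow> (\<forall>\<xi>. 1 \<le> m \<xi>) \<longrightarrow> generates T (Dm m) (Aop m) \<longrightarrow>
     \<tau>0 \<le> \<tau> \<longrightarrow> narrow \<delta> m (K / \<tau>) \<rho> \<longrightarrow> z \<in> Dm m \<longrightarrow> c / \<tau> * ((norm z)\<^sup>2 - C * (norm (z - Pc m \<rho> z))\<^sup>2) \<le> dissipated T z (2 * \<tau>)"
    by (elim exE conjE) (rule that; assumption)
  define \<epsilon> where "\<epsilon> = \<delta>\<^sup>2 / (2 + \<delta>)"
  have \<epsilon>: "0 < \<epsilon>" using \<delta> by (simp add: \<epsilon>_def)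
  define \<tau> where "\<tau> = max \<tau>0 (K / \<epsilon>)"
  have \<tau>: "\<tau>0 \<le> \<tau>" "K / \<epsilon> \<le> \<tau>" "0 < \<tau>" using k by (auto simp: \<tau>_def)
  have "K / \<tau> \<le> \<epsilon>" using \<tau>(2,3) \<epsilon> by (simp add: field_simps)
  then have nar: "narrow \<delta> (lam s) (K / \<tau>) \<rho>" for \<rho> using s \<delta> unfolding \<epsilon>_def by (intro narrow_lam(1)) auto
  \<comment> \<open>The maximum with 1/2 keeps q positive, so that ln q is meaningful.\<close>
  define q where "q = sqrt (max (1 / 2) (1 - 2 * c / \<tau>))"
  have q: "0 < q" "q < 1" using k \<tau> by (auto simp: q_def)
  define \<omega> where "\<omega> = - ln q / (2 * \<tau>)"
  have \<omega>: "0 < \<omega>" using q \<tau> by (simp add: \<omega>_def divide_neg_pos)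
  have "norm (T t z) \<le> 1 / q * exp (- \<omega> * t) * norm z" if T: "generates T (Dm (lam s)) (Aop (lam s))" and t: "0 \<le> t" for T t and z :: "'a state"
  proof -
    have m1: "1 \<le> lam s \<xi>" for \<xi> :: 'a using s by (intro lam_ge_1) simp
    interpret T: dissipative_semigroup T "Dm (lam s)" "Aop (lam s)" by (rule dissipative_semigroupI[OF lam_measurable T])
    have "norm (T (2 * \<tau>) z) \<le> q * norm z" if z: "z \<in> Dm (lam s)" for z
    proof -
      have "(\<lambda>n. c / \<tau> * ((norm z)\<^sup>2 - C * (norm (z - Pc (lam s) (real n) z))\<^sup>2)) \<longlonglongrightarrow> c / \<tau> * ((norm z)\<^sup>2 - C * (norm (z - z))\<^sup>2)"
        by (intro tendsto_intros Pc_tendsto) measurable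
      then have "c / \<tau> * ((norm z)\<^sup>2 - C * (norm (z - z))\<^sup>2) \<le> dissipated T z (2 * \<tau>)"
        by (rule LIMSEQ_le_const2) (use lower[rule_format, OF lam_measurable m1 T \<tau>(1) nar z] in blast)
      then have "(norm (T (2 * \<tau>) z))\<^sup>2 \<le> (1 - 2 * c / \<tau>) * (norm z)\<^sup>2" by (simp add: dissipated_def algebra_simps)
      also have "\<dots> \<le> q\<^sup>2 * (norm z)\<^sup>2" by (intro mult_right_mono) (auto simp: q_def)
      finally have "(norm (T (2 * \<tau>) z))\<^sup>2 \<le> (q * norm z)\<^sup>2" by (simp add: power_mult_distrib)
      then show ?thesis by (rule power2_le_imp_le) (use q in simp)
    qed
    moreover have "closed {z. norm (T (2 * \<tau>) z) \<le> q * norm z}"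
      using \<tau> by (intro closed_Collect_le continuous_intros linear_continuous_on T.bl) simp
    ultimately have "closure (Dm (lam s)) \<subseteq> {z. norm (T (2 * \<tau>) z) \<le> q * norm z}" by (intro closure_minimal) auto
    then have one: "norm (T (2 * \<tau>) z) \<le> q * norm z" for z using T.dense by auto
    have it: "norm (T (real n * (2 * \<tau>)) z) \<le> q ^ n * norm z" for n
    proof (induction n)
      case (Suc n)
      have "T (real (Suc n) * (2 * \<tau>)) z = T (2 * \<tau>) (T (real n * (2 * \<tau>)) z)"
        using T.Tadd[of "2 * \<tau>" "real n * (2 * \<tau>)" z] \<tau> by (simp add: algebra_simps)
      then have "norm (T (real (Suc n) * (2 * \<tau>)) z) \<le> q * norm (T (real n * (2 * \<tau>)) z)" using one by simp
      also have "\<dots> \<le> q * (q ^ n * norm z)" using Suc.IH q by (intro mult_left_mono) auto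
      finally show ?case by simp
    qed (simp add: T.T0)
    define n where "n = nat \<lfloor>t / (2 * \<tau>)\<rfloor>"
    have "real n \<le> t / (2 * \<tau>)" "t / (2 * \<tau>) - 1 \<le> real n" using t \<tau> by (auto simp: n_def)
    then have n: "real n * (2 * \<tau>) \<le> t" "t / (2 * \<tau>) - 1 \<le> real n" using \<tau> by (auto simp: pos_le_divide_eq)
    have "norm (T t z) \<le> norm (T (real n * (2 * \<tau>)) z)"
      using T.contraction[of "t - real n * (2 * \<tau>)" "T (real n * (2 * \<tau>)) z"] T.Tadd[of "t - real n * (2 * \<tau>)" "real n * (2 * \<tau>)" z] n \<tau> by simp
    also have "\<dots> \<le> q ^ n * norm z" by (rule it)
    also have "q ^ n = q powr (real n)" using q by (simp add: powr_realpow)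
    also have "\<dots> \<le> q powr (t / (2 * \<tau>) - 1)" using q n by (intro powr_mono') auto
    also have "\<dots> = 1 / q * exp (- \<omega> * t)"
    proof -
      have "q powr (t / (2 * \<tau>)) = exp (- \<omega> * t)" using q by (simp add: powr_def \<omega>_def)
      then show ?thesis using q by (simp add: powr_diff)
    qed
    finally show ?thesis by (simp add: mult_right_mono)
  qed
  then show ?thesis using q \<omega> by (intro exI[of _ "1 / q"] exI[of _ \<omega>] conjI) auto
qed

text \<open>The generator commutes with the semigroup and differs from \<open>A0\<close> by a
  bounded operator, so the norm of \<open>A0 (lam s) (T t z)\<close> stays below one constant W for
  all times, and the tail above \<rho> is at most W / \<rho> uniformly in t.\<close>

lemma algebraic_decay:
  assumes obs: "observable \<delta> \<kappa>" and s: "0 < s" "s < 2"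
  shows "\<exists>C>0. \<forall>T. generates T (Dm (lam s)) (Aop (lam s)) \<longrightarrow>
    (\<forall>z\<in>Dm (lam s). \<forall>t\<ge>0. norm (T t z) \<le> C * (1 + t) powr (- (s / (4 - 2 * s))) * norm (A0 (lam s) z))"
proof -
  have \<delta>: "0 < \<delta>" using obs by (simp add: observable_def)
  from dissipation_lower_bound[OF obs] obtain \<tau>0 c C K where k: "1 \<le> \<tau>0" "0 < c" "0 \<le> C" "0 < K" and
    lower: "\<forall>m T \<tau> \<rho> z. m \<in> bfun \<longrightarrow> (\<forall>\<xi>. 1 \<le> m \<xi>) \<longrightarrow> generates T (Dm m) (Aop m) \<longrightarrow>
     \<tau>0 \<le> \<tau> \<longrightarrow> narrow \<delta> m (K / \<tau>) \<rho> \<longrightarrow> z \<in> Dm m \<longrightarrow> c / \<tau> * ((norm z)\<^sup>2 - C * (norm (z - Pc m \<rho> z))\<^sup>2) \<le> dissipated T z (2 * \<tau>)"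
    by (elim exE conjE) (rule that; assumption)
  define \<epsilon> where "\<epsilon> = \<delta>\<^sup>2 / (2 + \<delta>)"
  have \<epsilon>: "0 < \<epsilon>" using \<delta> by (simp add: \<epsilon>_def)
  define \<alpha> where "\<alpha> = s / (2 - s)"
  have \<alpha>: "0 < \<alpha>" "(2 - s) / s = 1 / \<alpha>" "s / (4 - 2 * s) = \<alpha> / 2" using s by (auto simp: \<alpha>_def field_simps)
  \<comment> \<open>Makes the window width available up to \<rho> = (c3 \<tau>)^\<alpha> equal to K
    / \<tau>.\<close>
  define c3 where "c3 = s / 2 * \<epsilon> / K"
  have c3: "0 < c3" using s \<epsilon> k by (simp add: c3_def)
  define C3 where "C3 = C * c3 powr (- 2 * \<alpha>)"
  have C3: "0 \<le> C3" using k by (simp add: C3_def)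
  from polynomial_decay[OF k(2,1) \<alpha>(1) C3] obtain K2 where K2: "0 < K2" and
    decay: "\<forall>e W. (\<forall>t r. 0 \<le> t \<longrightarrow> t \<le> r \<longrightarrow> e r \<le> e t) \<longrightarrow> (\<forall>t\<ge>0. 0 \<le> e t) \<longrightarrow> e 0 \<le> W \<longrightarrow>
     (\<forall>t\<ge>0. \<forall>\<tau>\<ge>\<tau>0. 2 * c / \<tau> * (e t - C3 * \<tau> powr (- 2 * \<alpha>) * W) \<le> e t - e (t + 2 * \<tau>)) \<longrightarrow> (\<forall>t\<ge>0. e t \<le> W * (K2 / (1 + t)) powr \<alpha>)"
    by (elim exE conjE) (rule that; assumption)
  have m1: "1 \<le> lam s \<xi>" for \<xi> :: 'a using s by (intro lam_ge_1) simp
  have "norm (T t z) \<le> (1 + 2 * M) * K2 powr (\<alpha> / 2) * (1 + t) powr (- (\<alpha> / 2)) * norm (A0 (lam s) z)"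
    if T: "generates T (Dm (lam s)) (Aop (lam s))" and z: "z \<in> Dm (lam s)" and t: "0 \<le> t" for T t and z :: "'a state"
  proof -
    interpret T: dissipative_semigroup T "Dm (lam s)" "Aop (lam s)" by (rule dissipative_semigroupI[OF lam_measurable T])
    define W where "W = (1 + 2 * M) * norm (A0 (lam s) z)"
    have zA: "norm z \<le> norm (A0 (lam s) z)" by (rule norm_le_A0[OF lam_measurable m1 z])
    have W: "norm z \<le> W" "0 \<le> W" using zA M_nonneg mult_right_mono[of 1 "1 + 2 * M" "norm (A0 (lam s) z)"] by (auto simp: W_def)
    have D: "T t z \<in> Dm (lam s)" if "0 \<le> t" for t by (rule T.D_invariant(1)[OF z that])
    have AX: "norm (A0 (lam s) (T t z)) \<le> W" if t: "0 \<le> t" for t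
    proof -
      have "A0 (lam s) (T t z) = T t (Aop (lam s) z) - B (T t z)" using T.D_invariant(2)[OF z t] by (simp add: Aop_def[of _ "T t z"] eq_diff_eq)
      then have "norm (A0 (lam s) (T t z)) \<le> norm (T t (Aop (lam s) z)) + norm (B (T t z))" by (simp only: norm_triangle_ineq4)
      also have "\<dots> \<le> norm (Aop (lam s) z) + M * norm z"
        using T.contraction[OF t] B_norm_le[of "T t z"] mult_left_mono[OF T.contraction[OF t, of z] M_nonneg] by (intro add_mono) (auto intro: order_trans)
      also have "norm (Aop (lam s) z) \<le> norm (A0 (lam s) z) + M * norm z" unfolding Aop_def using B_norm_le by (intro norm_triangle_le) simp
      also have "norm (A0 (lam s) z) + M * norm z + M * norm z \<le> W" using mult_left_mono[OF zA M_nonneg] by (simp add: W_def algebra_simps)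
      finally show ?thesis by simp
    qed
    have "(norm (T t z))\<^sup>2 \<le> W\<^sup>2 * (K2 / (1 + t)) powr \<alpha>"
    proof (rule decay[rule_format, of "\<lambda>t. (norm (T t z))\<^sup>2"])
      show "(norm (T r z))\<^sup>2 \<le> (norm (T t z))\<^sup>2" if "0 \<le> t" "t \<le> r" for t r
        using T.contraction[of "r - t" "T t z"] T.Tadd[of "r - t" t z] that by (intro power_mono) auto
      show "(norm (T 0 z))\<^sup>2 \<le> W\<^sup>2" using W by (simp add: T.T0 power_mono)
      fix t \<tau> :: real assume t: "0 \<le> t" and \<tau>: "\<tau>0 \<le> \<tau>"
      have \<tau>p: "0 < \<tau>" using \<tau> k by simp
      define \<rho> where "\<rho> = (c3 * \<tau>) powr \<alpha>"
      have \<rho>: "0 < \<rho>" using c3 \<tau>p by (simp add: \<rho>_def)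
      have nar: "narrow \<delta> (lam s) (K / \<tau>) \<rho>"
      proof (rule narrow_lam(2)[OF \<delta> s \<rho>])
        have "\<rho> powr (- ((2 - s) / s)) = (c3 * \<tau>) powr (- 1)" using \<alpha> by (simp add: \<rho>_def powr_powr)
        also have "\<dots> = 1 / (c3 * \<tau>)" using c3 \<tau>p by (simp add: powr_minus divide_inverse)
        finally have "s / 2 * \<rho> powr (- ((2 - s) / s)) * \<epsilon> = K / \<tau>" using s \<epsilon> k \<tau>p by (simp add: c3_def field_simps)
        then show "K / \<tau> \<le> s / 2 * \<rho> powr (- ((2 - s) / s)) * (\<delta>\<^sup>2 / (2 + \<delta>))" by (simp add: \<epsilon>_def)
      qed
      have "norm (T t z - Pc (lam s) \<rho> (T t z)) \<le> W / \<rho>"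
        using norm_tail_le[OF lam_measurable \<rho> D[OF t]] AX[OF t] \<rho> divide_right_mono[of _ W \<rho>] by (meson less_imp_le order_trans)
      then have "(norm (T t z - Pc (lam s) \<rho> (T t z)))\<^sup>2 \<le> (W / \<rho>)\<^sup>2" by (rule power_mono) simp
      also have "\<dots> = c3 powr (- 2 * \<alpha>) * \<tau> powr (- 2 * \<alpha>) * W\<^sup>2"
      proof -
        have "\<rho>\<^sup>2 = (c3 * \<tau>) powr (2 * \<alpha>)" unfolding \<rho>_def power2_eq_square by (simp flip: powr_add)
        then have "\<rho>\<^sup>2 * (c3 powr (- 2 * \<alpha>) * \<tau> powr (- 2 * \<alpha>)) = 1"
          using c3 \<tau>p by (simp add: powr_mult powr_minus field_simps)
        then show ?thesis using \<rho> by (simp add: power_divide field_simps)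
      qed
      finally have "C * (norm (T t z - Pc (lam s) \<rho> (T t z)))\<^sup>2 \<le> C3 * \<tau> powr (- 2 * \<alpha>) * W\<^sup>2"
        using mult_left_mono[OF _ k(3)] by (simp add: C3_def mult.assoc)
      then have "c / \<tau> * ((norm (T t z))\<^sup>2 - C3 * \<tau> powr (- 2 * \<alpha>) * W\<^sup>2) \<le> c / \<tau> * ((norm (T t z))\<^sup>2 - C * (norm (T t z - Pc (lam s) \<rho> (T t z)))\<^sup>2)"
        using k \<tau>p by (intro mult_left_mono) auto
      also have "\<dots> \<le> dissipated T (T t z) (2 * \<tau>)" by (rule lower[rule_format, OF lam_measurable m1 T \<tau> nar D[OF t]])
      also have "\<dots> = ((norm (T t z))\<^sup>2 - (norm (T (t + 2 * \<tau>) z))\<^sup>2) / 2"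
        using T.Tadd[of "2 * \<tau>" t z] t \<tau>p by (simp add: dissipated_def add.commute)
      finally show "2 * c / \<tau> * ((norm (T t z))\<^sup>2 - C3 * \<tau> powr (- 2 * \<alpha>) * W\<^sup>2) \<le> (norm (T t z))\<^sup>2 - (norm (T (t + 2 * \<tau>) z))\<^sup>2"
        by (simp add: mult_ac)
    qed (use t in auto)
    \<comment> \<open>The decay law was applied to the squared norm, so the exponent is halved here:
      \<alpha> / 2 = s / (4 - 2 s).\<close>
    also have "(K2 / (1 + t)) powr \<alpha> = (K2 powr (\<alpha> / 2) * (1 + t) powr (- (\<alpha> / 2)))\<^sup>2"
    proof -
      have "K2 powr (\<alpha> / 2) * (1 + t) powr (- (\<alpha> / 2)) = (K2 / (1 + t)) powr (\<alpha> / 2)" by (simp only: powr_divide powr_minus divide_inverse[of "K2 powr _"])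
      then show ?thesis by (simp only: power2_eq_square powr_add[symmetric] field_sum_of_halves)
    qed
    finally have "(norm (T t z))\<^sup>2 \<le> (W * (K2 powr (\<alpha> / 2) * (1 + t) powr (- (\<alpha> / 2))))\<^sup>2" by (simp only: power_mult_distrib)
    then have "norm (T t z) \<le> W * (K2 powr (\<alpha> / 2) * (1 + t) powr (- (\<alpha> / 2)))" by (rule power2_le_imp_le) (use W in simp)
    then show ?thesis by (simp add: W_def mult_ac)
  qed
  moreover have "0 < (1 + 2 * M) * K2 powr (\<alpha> / 2)" using M_nonneg K2 by simp
  ultimately show ?thesis unfolding \<alpha>(3) by (intro exI[of _ "(1 + 2 * M) * K2 powr (\<alpha> / 2)"]) auto
qed

end

section \<open>Wave packets along undamped segments\<close>

lemma ft_translate: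
  fixes w :: "'a::euclidean_space \<Rightarrow> complex"
  assumes w[measurable]: "w \<in> bfun" shows "ft (\<lambda>x. w (x - b)) \<xi> = exp (- \<i> * cpx (b \<bullet> \<xi>)) * ft w \<xi>"
proof -
  have "(LEB x. exp (- \<i> * cpx (x \<bullet> \<xi>)) * w (x - b)) = (LEB x. exp (- \<i> * cpx ((b + x) \<bullet> \<xi>)) * w (b + x - b))"
    by (rule lborel_integral_shift[symmetric]) measurable
  also have "\<dots> = (LEB x. exp (- \<i> * cpx (b \<bullet> \<xi>)) * (exp (- \<i> * cpx (x \<bullet> \<xi>)) * w x))"
    by (intro Bochner_Integration.integral_cong) (simp_all add: inner_add_left distrib_left exp_add exp_minus mult_ac exp_diff divide_inverse)
  also have "\<dots> = exp (- \<i> * cpx (b \<bullet> \<xi>)) * (LEB x. exp (- \<i> * cpx (x \<bullet> \<xi>)) * w x)"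
    by (rule integral_mult_right_zero)
  finally show ?thesis unfolding ft_def by (simp only: mult.left_commute)
qed

lemma ft_modulate: "ft (\<lambda>x. exp (- \<i> * cpx (x \<bullet> b)) * w x) \<xi> = ft w (\<xi> + b)"
proof -
  have "exp (- \<i> * cpx (x \<bullet> \<xi>)) * (exp (- \<i> * cpx (x \<bullet> b)) * w x) = exp (- \<i> * cpx (x \<bullet> (\<xi> + b))) * w x" for x
    unfolding mult.assoc[symmetric] exp_add[symmetric] by (simp add: inner_add_right algebra_simps)
  then show ?thesis unfolding ft_def by (simp only:)
qed

text \<open>Around the frequency -n e the symbol becomes affine with slope -e, so its flow is
  asymptotically a translation with velocity e up to a scalar phase, without dispersion. Multiplying
  by the sum of the two roots turns their difference into a quotient that is continuous in 1 /
  n.\<close>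

lemma phase_limit:
  fixes \<eta> e :: "'a::euclidean_space"
  assumes e: "norm e = 1"
  shows "(\<lambda>n. lam 2 (\<eta> - real n *\<^sub>R e) - (sqrt (1 + (real n)\<^sup>2) - \<eta> \<bullet> e)) \<longlonglongrightarrow> 0"
proof -
  define k p where "k = 1 + (norm \<eta>)\<^sup>2" and "p = \<eta> \<bullet> e"
  let ?D = "\<lambda>x. sqrt (k * x\<^sup>2 - 2 * p * x + 1) + sqrt (x\<^sup>2 + 1)"
  have lame: "lam 2 (\<eta> - r *\<^sub>R e) = sqrt (k - 2 * r * p + r\<^sup>2)" for r
  proof -
    have "(norm (\<eta> - r *\<^sub>R e))\<^sup>2 = (norm \<eta>)\<^sup>2 - 2 * r * p + r\<^sup>2"
      using e unfolding power2_norm_eq_inner by (simp add: inner_diff_left inner_diff_right inner_commute p_def norm_eq_sqrt_inner power2_eq_square)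
    then show ?thesis by (simp add: lam_eq k_def add_nonneg_nonneg powr_one algebra_simps)
  qed
  have eq: "lam 2 (\<eta> - r *\<^sub>R e) - (sqrt (1 + r\<^sup>2) - p) = ((k - 1) * inverse r - 2 * p) / ?D (inverse r) + p" if r: "0 < r" for r
  proof -
    let ?a = "sqrt (k - 2 * r * p + r\<^sup>2)" and ?b = "sqrt (1 + r\<^sup>2)"
    have nn: "0 \<le> k - 2 * r * p + r\<^sup>2"
    proof -
      have "0 \<le> (lam 2 (\<eta> - r *\<^sub>R e))" using less_imp_le[OF lam_pos] .
      then show ?thesis unfolding lame by simp
    qed
    have b: "0 < ?b" by (simp add: add_pos_nonneg)
    have a: "0 \<le> ?a" using nn by simp
    have "(?a - ?b) * (?a + ?b) = ?a\<^sup>2 - ?b\<^sup>2" by (simp add: algebra_simps power2_eq_square)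
    also have "\<dots> = (k - 1) - 2 * r * p" using nn by (simp add: add_nonneg_nonneg)
    finally have "(?a - ?b) * (?a + ?b) = (k - 1) - 2 * r * p" .
    moreover have "?a + ?b \<noteq> 0" using a b by linarith
    ultimately have 1: "?a - ?b = ((k - 1) - 2 * r * p) / (?a + ?b)" by (metis nonzero_eq_divide_eq)
    have da: "k * (inverse r)\<^sup>2 - 2 * p * inverse r + 1 = (k - 2 * r * p + r\<^sup>2) / r\<^sup>2" using r by (simp add: field_simps power2_eq_square)
    have db: "(inverse r)\<^sup>2 + 1 = (1 + r\<^sup>2) / r\<^sup>2" using r by (simp add: field_simps power2_eq_square)
    have 2: "?D (inverse r) = (?a + ?b) / r" unfolding da db real_sqrt_divide using r by (simp add: add_divide_distrib)
    have 3: "(k - 1) * inverse r - 2 * p = ((k - 1) - 2 * r * p) / r" using r by (simp add: field_simps)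
    have "((k - 1) * inverse r - 2 * p) / ?D (inverse r) = ?a - ?b" unfolding 1 2 3 using r by simp
    then show ?thesis unfolding lame by simp
  qed
  have i: "(\<lambda>n. inverse (real n)) \<longlonglongrightarrow> 0" by (rule lim_inverse_n)
  have "(\<lambda>n. ((k - 1) * inverse (real n) - 2 * p) / ?D (inverse (real n)) + p) \<longlonglongrightarrow> ((k - 1) * 0 - 2 * p) / ?D 0 + p"
    by (intro tendsto_intros i) simp
  then have "(\<lambda>n. ((k - 1) * inverse (real n) - 2 * p) / ?D (inverse (real n)) + p) \<longlonglongrightarrow> 0" by simp
  then have "(\<lambda>n. lam 2 (\<eta> - real n *\<^sub>R e) - (sqrt (1 + (real n)\<^sup>2) - p)) \<longlonglongrightarrow> 0"
    by (rule Lim_transform_eventually) (use eventually_gt_at_top[of 0] in eventually_elim, simp only: eq of_nat_0_less_iff)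
  then show ?thesis by (simp add: p_def)
qed

context damping
begin

lemma Q_inner: "G f \<bullet> g = Q f \<bullet> Q g"
proof -
  have "G f \<bullet> g = mulop (cof \<gamma>) (Fi f) \<bullet> Fi g" unfolding G_def by (rule inner_Fo_left)
  also have "\<dots> = Q f \<bullet> Q g" unfolding mulop_\<gamma> Q_def by (subst inner_mulop) (auto simp: bmf_sqrt)
  finally show ?thesis .
qed

lemma B_inner_pair: "B x \<bullet> y = - (Q (vel x) \<bullet> Q (vel y))"
proof -
  have "B x \<bullet> y = - (G (vel x) \<bullet> vel y)" by (simp add: B_def inner_prod_def vel_def inner_add_right add_divide_distrib)
  then show ?thesis by (simp add: Q_inner)
qed

text \<open>A wave whose undamped evolution hardly meets the damping keeps its energy: differentiate
  \<open>\<langle>S\<^bsub>-t\<^esub> T\<^bsub>t\<^esub> z, z\<rangle>\<close>.\<close>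

lemma weakly_damped_lower_bound:
  assumes m: "m \<in> bfun" and T: "generates T (Dm m) (Aop m)" and z: "z \<in> Dm m" and t: "0 \<le> t"
    and b: "\<And>r. 0 \<le> r \<Longrightarrow> r \<le> t \<Longrightarrow> norm (Q (vel (Sg m r z))) \<le> b"
  shows "norm z - sqrt M * b * t \<le> norm (T t z)"
proof (cases "z = 0")
  case True
  have "0 \<le> b" using b[of 0] t norm_ge_zero order_trans by blast
  then have "0 \<le> sqrt M * b * t" using t M_nonneg by simp
  then show ?thesis unfolding True norm_zero using norm_ge_zero[of "T t 0"] by linarith
next
  case False
  interpret T: dissipative_semigroup T "Dm m" "Aop m" by (rule dissipative_semigroupI[OF m T])
  let ?Y = "\<lambda>r. Sg m (- r) (T r z)" and ?f = "\<lambda>r. - (sqrt M * norm z * b * r) - Sg m (- r) (T r z) \<bullet> z"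
  have adj: "Sg m (- r) x \<bullet> z = x \<bullet> Sg m r z" for r x
  proof -
    have n: "norm (Sg m r y) = norm y" for r y by (rule Sg_norm[OF m])
    have "Sg m r (Sg m (- r) x) = x" using Sg_add[OF m, of r "- r" x] by (simp add: Sg_0)
    then have "x + Sg m r z = Sg m r (Sg m (- r) x + z)" by (simp add: linear_simps[OF Sg_bl[OF m]])
    then show ?thesis unfolding dot_norm by (simp add: n)
  qed
  have dY: "(?f has_vector_derivative (- (sqrt M * norm z * b) + Q (vel (T r z)) \<bullet> Q (vel (Sg m r z)))) (at r within {0..t})" if r: "r \<in> {0..t}" for r
  proof -
    have r0: "0 \<le> r" using r by simp
    have "(?Y has_vector_derivative Sg m (- r) (B (T r z))) (at r within {0..})"
      using Sg_backward_derivative[OF m T.deriv[OF z r0] T.D_invariant(1)[OF z r0]]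
      by (simp only: T.D_invariant(2)[OF z r0, symmetric]) (simp add: Aop_def)
    then have "(?Y has_vector_derivative Sg m (- r) (B (T r z))) (at r within {0..t})" by (rule has_vector_derivative_within_subset) auto
    then have "((\<lambda>r. ?Y r \<bullet> z) has_vector_derivative Sg m (- r) (B (T r z)) \<bullet> z) (at r within {0..t})"
      by (rule bounded_linear.has_vector_derivative[OF bounded_linear_inner_left])
    then have "(?f has_vector_derivative (- (sqrt M * norm z * b * 1) - Sg m (- r) (B (T r z)) \<bullet> z)) (at r within {0..t})"
      by (intro has_vector_derivative_diff has_vector_derivative_minus has_vector_derivative_mult_right has_vector_derivative_id)
    then show ?thesis by (simp add: adj B_inner_pair)
  qed
  have "?f t \<le> ?f 0"
  proof (rule has_vector_derivative_nonpos_antimono[OF dY _ t])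
    fix r assume r: "r \<in> {0..t}"
    have "norm (Q (vel (T r z))) \<le> sqrt M * norm z"
      using r by (intro order_trans[OF Q_norm] mult_left_mono order_trans[OF norm_vel_le] T.contraction) (auto simp: M_nonneg)
    then have "norm (Q (vel (T r z))) * norm (Q (vel (Sg m r z))) \<le> sqrt M * norm z * b" using b[of r] r M_nonneg by (intro mult_mono) auto
    then show "- (sqrt M * norm z * b) + Q (vel (T r z)) \<bullet> Q (vel (Sg m r z)) \<le> 0"
      using norm_cauchy_schwarz[of "Q (vel (T r z))" "Q (vel (Sg m r z))"] by linarith
  qed auto
  then have "norm z * norm z - sqrt M * norm z * b * t \<le> Sg m (- t) (T t z) \<bullet> z" by (simp add: Sg_0 T.T0 dot_square_norm power2_eq_square)
  also have "\<dots> \<le> norm (T t z) * norm z" using norm_cauchy_schwarz[of "Sg m (- t) (T t z)" z] by (simp add: Sg_norm[OF m])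
  finally have "(norm z - sqrt M * b * t) * norm z \<le> norm (T t z) * norm z" by (simp add: algebra_simps)
  then show ?thesis using False by simp
qed

text \<open>The packet is the indicator of a ball modulated to frequency -n e, and f is its
  transform. Replacing the symbol by its affine approximation costs at most \<eta> for suitable n,
  uniformly for t <= t0; the remaining flow translates the ball along the tube, where sqrt \<gamma>
  is at most sqrt \<epsilon>.\<close>

lemma wave_packet:
  fixes a e :: 'a
  assumes e: "norm e = 1" and r: "0 < r" and t0: "0 \<le> t0" and \<epsilon>: "0 \<le> \<epsilon>" and \<eta>: "0 < \<eta>"
    and tube: "\<And>t x. 0 \<le> t \<Longrightarrow> t \<le> t0 \<Longrightarrow> dist x (a + t *\<^sub>R e) < r \<Longrightarrow> \<gamma> x \<le> \<epsilon>"
  shows "\<exists>f::'a l2. f \<noteq> 0 \<and> (\<forall>t. 0 \<le> t \<longrightarrow> t \<le> t0 \<longrightarrow> norm (Q (mulop (\<lambda>\<xi>. iexp (t * lam 2 \<xi>)) f)) \<le> (sqrt \<epsilon> + \<eta>) * norm f)"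
proof -
  define u where "u x = (if dist x a < r then 1 else 0 :: complex)" for x
  have um[measurable]: "u \<in> bfun" unfolding u_def by measurable
  have ub: "cmod (u x) \<le> 1" for x by (simp add: u_def)
  have us: "u x = 0" if "norm a + r < norm x" for x using that norm_triangle_sub[of x a] by (auto simp: u_def dist_norm)
  have ui: "integrable lborel u" "L2 u" using bounded_support_integrable[OF um ub us] by auto
  have sq_u: "msq (u x) = indicat_real (ball a r) x" for x by (simp add: u_def indicator_def dist_commute)
  have "(norm (cls u))\<^sup>2 = measure lborel (ball a r)" by (simp add: norm_cls_sq[OF ui(2)] sq_u)
  then have N: "0 < norm (cls u)" using content_ball_pos[OF r, of a] by (metis norm_zero zero_less_norm_iff power_zero_numeral less_irrefl)
  define v where "v = ft u"
  have v: "v \<in> bfun" "L2 v" unfolding v_def using ft_contraction(1)[OF ui] by auto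
  note [measurable] = v(1)
  define \<mu> where "\<mu> n = sqrt (1 + (real n)\<^sup>2)" for n :: nat
  \<comment> \<open>A majorant, free of t, of the phase error at the shifted frequency; the bound 2
    provides domination and \<open>phase_limit\<close> the limit 0.\<close>
  define k where "k n x = min 2 (t0 * \<bar>lam 2 (x - real n *\<^sub>R e) - (\<mu> n - x \<bullet> e)\<bar>)" for n and x :: 'a
  have k: "0 \<le> k n x" "k n x \<le> 2" for n x using t0 by (auto simp: k_def)
  have km[measurable]: "k n \<in> bfun" for n unfolding k_def by measurable
  have klim: "(\<lambda>n. k n x) \<longlonglongrightarrow> 0" for x
  proof -
    have "(\<lambda>n. min 2 (t0 * \<bar>lam 2 (x - real n *\<^sub>R e) - (\<mu> n - x \<bullet> e)\<bar>)) \<longlonglongrightarrow> min 2 (t0 * \<bar>0\<bar>)"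
      unfolding \<mu>_def by (intro tendsto_intros phase_limit e)
    then show ?thesis by (simp add: k_def)
  qed
  have gs: "L2 (\<lambda>x. cpx (k n x) * v x)" for n by (rule L2_bmf[OF bmfI[of _ 2] v(2)]) (use k in auto)
  have "(\<lambda>n. cls (\<lambda>x. cpx (k n x) * v x)) \<longlonglongrightarrow> cls (\<lambda>x. cpx 0 * v x)"
  proof (rule tendsto_cls_dominated(3)[where g = "\<lambda>x. 4 * msq (v x)"])
    show "integrable lborel (\<lambda>x. 4 * msq (v x))" using v(2) by (simp add: L2_iff)
    show "AE x in lborel. (\<lambda>n. cpx (k n x) * v x) \<longlonglongrightarrow> cpx 0 * v x" by (intro AE_I2 tendsto_intros klim)
    have "msq (cpx (k n x) * v x) \<le> 4 * msq (v x)" for n x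
      using power_mono[OF k(2,1), of n x 2] by (simp add: norm_mult power_mult_distrib mult_right_mono)
    then show "AE x in lborel. msq (cpx (k n x) * v x) \<le> 4 * msq (v x)" for n by simp
  qed measurable
  then have "(\<lambda>n. sqrt M * norm (cls (\<lambda>x. cpx (k n x) * v x))) \<longlonglongrightarrow> sqrt M * norm (cls (\<lambda>x. cpx 0 * v x))"
    by (intro tendsto_intros)
  then have "(\<lambda>n. sqrt M * norm (cls (\<lambda>x. cpx (k n x) * v x))) \<longlonglongrightarrow> 0" by (simp add: cls_zero)
  moreover have "0 < \<eta> * norm (cls u)" using \<eta> N by simp
  ultimately obtain n where n: "sqrt M * norm (cls (\<lambda>x. cpx (k n x) * v x)) \<le> \<eta> * norm (cls u)"
    using order_tendstoD(2) eventually_happens'[OF sequentially_bot] by (metis (no_types, lifting) less_imp_le)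
  define w where "w x = exp (- \<i> * cpx (x \<bullet> (real n *\<^sub>R e))) * u x" for x
  have cw: "cmod (w x) = cmod (u x)" for x by (simp add: w_def norm_mult)
  have wm[measurable]: "w \<in> bfun" unfolding w_def by measurable
  have ws: "integrable lborel (\<lambda>x. w (x - b))" "L2 (\<lambda>x. w (x - b))" for b
  proof -
    have "w (x - b) = 0" if "norm a + r + norm b < norm x" for x using us[of "x - b"] that norm_triangle_ineq2[of x b] by (simp add: w_def)
    then show "integrable lborel (\<lambda>x. w (x - b))" "L2 (\<lambda>x. w (x - b))"
      by (intro bounded_support_integrable[of "\<lambda>x. w (x - b)" 1 "norm a + r + norm b"]; simp add: cw ub)+
  qed
  have w0: "integrable lborel w" "L2 w" using ws[of 0] by simp_all
  define f where "f = Fo (cls w)"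
  have fv: "f = cls (\<lambda>\<xi>. v (\<xi> + real n *\<^sub>R e))" unfolding f_def Fo_cls[OF w0] v_def ft_modulate[symmetric] w_def ..
  have nf: "norm f = norm (cls u)" unfolding f_def norm_Fo by (rule power2_eq_imp_eq) (simp_all add: norm_cls_sq w0 ui cw)
  have vs: "L2 (\<lambda>\<xi>. v (\<xi> + real n *\<^sub>R e))" using ft_contraction(1)[OF w0] unfolding v_def ft_modulate[symmetric] w_def .
  have main: "norm (Q (mulop (\<lambda>\<xi>. iexp (t * lam 2 \<xi>)) f)) \<le> (sqrt \<epsilon> + \<eta>) * norm f" if t: "0 \<le> t" "t \<le> t0" for t
  proof -
    \<comment> \<open>The affine phase: a unimodular constant times the symbol of translation by t
      e.\<close>
    define P where "P \<xi> = iexp (t * (\<mu> n - real n - \<xi> \<bullet> e))" for \<xi> :: 'a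
    have bm: "bmf (\<lambda>\<xi>::'a. iexp (t * lam 2 \<xi>))" "bmf P" unfolding P_def[abs_def] by (rule bmf_iexp; measurable)+
    let ?c = "iexp (t * (\<mu> n - real n))" and ?E = "\<lambda>\<xi>. exp (- \<i> * cpx ((t *\<^sub>R e) \<bullet> \<xi>))"
    have bE: "bmf ?E" by (rule bmfI[of _ 1]) auto
    have "P = (\<lambda>\<xi>. ?c * ?E \<xi>)"
    proof
      show "P \<xi> = ?c * ?E \<xi>" for \<xi>
        unfolding P_def exp_add[symmetric] inner_scaleR_left inner_commute[of e \<xi>] by (simp add: algebra_simps)
    qed
    then have "mulop P f = mulop (\<lambda>_. ?c) (mulop ?E f)" by (simp only: mulop_mulop_bmf[OF bmf_const bE])
    moreover have Ef: "mulop ?E f = Fo (cls (\<lambda>x. w (x - t *\<^sub>R e)))"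
      unfolding f_def Fo_cls[OF w0] Fo_cls[OF ws] mulop_cls_bmf[OF bE ft_contraction(1)[OF w0]] ft_translate[OF wm] ..
    ultimately have "norm (Q (mulop P f)) = norm (Q (Fo (cls (\<lambda>x. w (x - t *\<^sub>R e)))))" by (simp add: Q_const norm_mulop_const)
    also have "\<dots> = norm (cls (\<lambda>x. cpx (sqrt (\<gamma> x)) * w (x - t *\<^sub>R e)))"
      by (simp add: Q_def mulop_cls_bmf[OF bmf_sqrt ws(2)])
    also have "\<dots> \<le> norm (cls (\<lambda>x. cpx (sqrt \<epsilon>) * w (x - t *\<^sub>R e)))"
    proof (rule norm_cls_mono[OF L2_bmf[OF bmf_sqrt ws(2)] L2_cmult[OF ws(2)]], intro AE_I2)
      fix x
      show "cmod (cpx (sqrt (\<gamma> x)) * w (x - t *\<^sub>R e)) \<le> cmod (cpx (sqrt \<epsilon>) * w (x - t *\<^sub>R e))"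
      proof (cases "u (x - t *\<^sub>R e) = 0")
        case False
        then have "dist x (a + t *\<^sub>R e) < r" by (auto simp: u_def dist_norm algebra_simps split: if_splits)
        then have "\<gamma> x \<le> \<epsilon>" using tube t by blast
        then show ?thesis using nonneg[of x] \<epsilon> by (simp add: norm_mult mult_right_mono)
      qed (simp add: w_def)
    qed
    also have "\<dots> = sqrt \<epsilon> * norm (cls (\<lambda>x. w (x - t *\<^sub>R e)))" using \<epsilon> by (simp add: cls_scaleR[OF ws(2)])
    also have "norm (cls (\<lambda>x. w (x - t *\<^sub>R e))) = norm f"
    proof -
      have "norm (mulop ?E f) = norm f" by (rule norm_mulop_unimodular) auto
      then show ?thesis unfolding Ef norm_Fo .
    qed
    finally have 1: "norm (Q (mulop P f)) \<le> sqrt \<epsilon> * norm f" .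
    have 2: "norm (mulop (\<lambda>\<xi>. iexp (t * lam 2 \<xi>)) f - mulop P f) \<le> norm (cls (\<lambda>x. cpx (k n x) * v x))"
    proof -
      let ?g = "\<lambda>x. cpx (k n x) * v x"
      have s: "L2 (\<lambda>\<xi>. iexp (t * lam 2 \<xi>) * v (\<xi> + real n *\<^sub>R e))" "L2 (\<lambda>\<xi>. P \<xi> * v (\<xi> + real n *\<^sub>R e))"
        by (rule L2_bmf[OF bm(1) vs], rule L2_bmf[OF bm(2) vs])
      have sg: "L2 (\<lambda>\<xi>. ?g (real n *\<^sub>R e + \<xi>))"
        using gs[of n] lborel_integrable_shift[of "\<lambda>x. msq (?g x)" "real n *\<^sub>R e"] unfolding L2_iff by (auto simp: norm_mult)
      have "norm (mulop (\<lambda>\<xi>. iexp (t * lam 2 \<xi>)) f - mulop P f) = norm (cls (\<lambda>\<xi>. iexp (t * lam 2 \<xi>) * v (\<xi> + real n *\<^sub>R e) - P \<xi> * v (\<xi> + real n *\<^sub>R e)))"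
        unfolding fv mulop_cls_bmf[OF bm(1) vs] mulop_cls_bmf[OF bm(2) vs] cls_diff[OF s] ..
      also have "\<dots> \<le> norm (cls (\<lambda>\<xi>. ?g (real n *\<^sub>R e + \<xi>)))"
      proof (rule norm_cls_mono[OF L2_diff[OF s] sg], intro AE_I2)
        fix \<xi>
        let ?x = "real n *\<^sub>R e + \<xi>"
        have ne: "\<mu> n - real n - \<xi> \<bullet> e = \<mu> n - ?x \<bullet> e" using e by (simp add: inner_add_left dot_square_norm)
        have "cmod (iexp (t * lam 2 \<xi>) - P \<xi>) \<le> \<bar>t * lam 2 \<xi> - t * (\<mu> n - ?x \<bullet> e)\<bar>"
          unfolding P_def ne by (rule norm_exp_diff_le)
        also have "\<dots> = t * \<bar>lam 2 (?x - real n *\<^sub>R e) - (\<mu> n - ?x \<bullet> e)\<bar>"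
          using t by (simp add: abs_mult flip: right_diff_distrib)
        also have "\<dots> \<le> t0 * \<bar>lam 2 (?x - real n *\<^sub>R e) - (\<mu> n - ?x \<bullet> e)\<bar>" using t by (intro mult_right_mono) auto
        finally have "cmod (iexp (t * lam 2 \<xi>) - P \<xi>) \<le> t0 * \<bar>lam 2 (?x - real n *\<^sub>R e) - (\<mu> n - ?x \<bullet> e)\<bar>" .
        moreover have "cmod (iexp (t * lam 2 \<xi>) - P \<xi>) \<le> 2" by (rule order_trans[OF norm_triangle_ineq4]) (simp add: P_def)
        ultimately have "cmod (iexp (t * lam 2 \<xi>) - P \<xi>) \<le> k n ?x" by (simp add: k_def)
        then have "cmod (iexp (t * lam 2 \<xi>) - P \<xi>) * cmod (v ?x) \<le> k n ?x * cmod (v ?x)" by (rule mult_right_mono) simp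
        then show "cmod (iexp (t * lam 2 \<xi>) * v (\<xi> + real n *\<^sub>R e) - P \<xi> * v (\<xi> + real n *\<^sub>R e)) \<le> cmod (?g ?x)"
          using k(1) by (simp add: norm_mult add.commute flip: left_diff_distrib)
      qed
      also have "\<dots> = norm (cls ?g)"
      proof (rule power2_eq_imp_eq)
        show "(norm (cls (\<lambda>\<xi>. ?g (real n *\<^sub>R e + \<xi>))))\<^sup>2 = (norm (cls ?g))\<^sup>2"
          unfolding norm_cls_sq[OF sg] norm_cls_sq[OF gs] by (rule lborel_integral_shift) measurable
      qed auto
      finally show ?thesis .
    qed
    have "Q (mulop (\<lambda>\<xi>. iexp (t * lam 2 \<xi>)) f) = Q (mulop P f) + Q (mulop (\<lambda>\<xi>. iexp (t * lam 2 \<xi>)) f - mulop P f)"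
      by (simp add: linear_simps[OF Q_bl])
    then have "norm (Q (mulop (\<lambda>\<xi>. iexp (t * lam 2 \<xi>)) f)) \<le> norm (Q (mulop P f)) + norm (Q (mulop (\<lambda>\<xi>. iexp (t * lam 2 \<xi>)) f - mulop P f))"
      by (simp only: norm_triangle_ineq)
    moreover have "norm (Q (mulop (\<lambda>\<xi>. iexp (t * lam 2 \<xi>)) f - mulop P f)) \<le> \<eta> * norm f"
      using order_trans[OF Q_norm mult_left_mono[OF 2, of "sqrt M"]] n M_nonneg unfolding nf by simp
    ultimately have "norm (Q (mulop (\<lambda>\<xi>. iexp (t * lam 2 \<xi>)) f)) \<le> sqrt \<epsilon> * norm f + \<eta> * norm f" using 1 by linarith
    then show ?thesis by (simp add: distrib_right)
  qed
  moreover have "f \<noteq> 0" using nf N by auto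
  ultimately show ?thesis by blast
qed

text \<open>A value above \<epsilon> in the tube gives more than 2 \<epsilon> / 3 at the nearby axis
  point, hence at least \<epsilon> / 3 on an axis interval of length l, and so an integral of at
  least \<epsilon> l / 3.\<close>

lemma thin_tube:
  assumes t0: "0 < t0" and \<epsilon>: "0 < \<epsilon>"
  shows "\<exists>r>0. \<exists>c>0. \<forall>a e::'a. norm e = 1 \<longrightarrow> integral {0..t0} (\<lambda>\<tau>. \<gamma> (a + \<tau> *\<^sub>R e)) < c \<longrightarrow>
     (\<forall>t x. 0 \<le> t \<longrightarrow> t \<le> t0 \<longrightarrow> dist x (a + t *\<^sub>R e) < r \<longrightarrow> \<gamma> x \<le> \<epsilon>)"
proof -
  obtain r where r: "0 < r" "\<And>x y. dist x y < r \<Longrightarrow> \<bar>\<gamma> x - \<gamma> y\<bar> < \<epsilon> / 3" using uc_dist[of "\<epsilon> / 3"] \<epsilon> by auto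
  define l where "l = min (r / 2) (t0 / 2)"
  have l: "0 < l" "l < r" "l \<le> t0 / 2" using r t0 by (auto simp: l_def)
  have "\<gamma> x \<le> \<epsilon>" if e: "norm e = 1" and i: "integral {0..t0} (\<lambda>\<tau>. \<gamma> (a + \<tau> *\<^sub>R e)) < \<epsilon> / 3 * l" and t: "0 \<le> t" "t \<le> t0"
    and x: "dist x (a + t *\<^sub>R e) < r" for a e x :: 'a and t
  proof (rule ccontr)
    assume "\<not> \<gamma> x \<le> \<epsilon>"
    then have big: "2 * \<epsilon> / 3 < \<gamma> (a + t *\<^sub>R e)" using r(2)[OF x] by linarith
    \<comment> \<open>The interval is put after t in the first half of [0, t0] and before t in the
      second, so it stays inside.\<close>
    define p where "p = (if t \<le> t0 / 2 then t else t - l)"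
    have p: "0 \<le> p" "p + l \<le> t0" "p \<le> t" "t \<le> p + l" using t l by (auto simp: p_def)
    have c: "continuous_on S (\<lambda>\<tau>. \<gamma> (a + \<tau> *\<^sub>R e))" for S
      by (rule continuous_on_compose2[OF cont]) (auto intro!: continuous_intros)
    have "\<epsilon> / 3 * l = integral {p..p + l} (\<lambda>_. \<epsilon> / 3)" using l by simp
    also have "\<dots> \<le> integral {p..p + l} (\<lambda>\<tau>. \<gamma> (a + \<tau> *\<^sub>R e))"
    proof (rule integral_le[OF _ integrable_continuous_interval[OF c]])
      fix \<tau> assume \<tau>: "\<tau> \<in> {p..p + l}"
      have "dist (a + \<tau> *\<^sub>R e) (a + t *\<^sub>R e) = \<bar>\<tau> - t\<bar>" using e by (simp add: dist_norm flip: scaleR_left_diff_distrib)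
      also have "\<dots> < r" using \<tau> p l by auto
      finally show "\<epsilon> / 3 \<le> \<gamma> (a + \<tau> *\<^sub>R e)" using r(2)[of "a + \<tau> *\<^sub>R e" "a + t *\<^sub>R e"] big by linarith
    qed auto
    also have "\<dots> \<le> integral {0..t0} (\<lambda>\<tau>. \<gamma> (a + \<tau> *\<^sub>R e))"
      by (rule integral_subset_le) (use p l nonneg in \<open>auto intro!: integrable_continuous_interval c\<close>)
    finally show False using i by simp
  qed
  moreover have "0 < \<epsilon> / 3 * l" using \<epsilon> l by simp
  ultimately show ?thesis using r(1) by (intro exI[of _ r] exI[of _ "\<epsilon> / 3 * l"] conjI) blast+
qed

text \<open>After the time t0 every state has lost at least three quarters of its norm, so t0 serves
  as the length L: along a segment with too small an integral a packet would keep more. The packet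
  need not lie in the domain of the generator, hence its approximation by \<open>z\<close>.\<close>

lemma decay_imp_gcc:
  assumes T: "generates T (Dm (lam 2)) (Aop (lam 2))" and \<omega>: "0 < \<omega>" and C: "0 < C"
    and dec: "\<And>z t. 0 < t \<Longrightarrow> norm (T t z) \<le> C * exp (- \<omega> * t) * norm z"
  shows "\<exists>L>0. \<exists>c>0. \<forall>a e::'a. norm e = 1 \<longrightarrow> c \<le> integral {0..L} (\<lambda>\<tau>. \<gamma> (a + \<tau> *\<^sub>R e))"
proof -
  define t0 where "t0 = ln (4 * C + 1) / \<omega> + 1"
  have lnC: "0 < ln (4 * C + 1)" using C by simp
  have t0: "0 < t0" using lnC \<omega> by (simp add: t0_def add_pos_pos)
  have "exp (- \<omega> * t0) \<le> exp (- ln (4 * C + 1))" using \<omega> by (simp add: t0_def algebra_simps)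
  also have "\<dots> = 1 / (4 * C + 1)" using C by (simp add: exp_minus divide_inverse)
  finally have "C * exp (- \<omega> * t0) \<le> C * (1 / (4 * C + 1))" using C by (intro mult_left_mono) auto
  also have "\<dots> \<le> 1 / 4" using C by (simp add: field_simps)
  finally have quarter: "C * exp (- \<omega> * t0) \<le> 1 / 4" .
  \<comment> \<open>An upper bound for sqrt M (3 + M) t0, where 3 + M = 2 + (M + 1) adds the damping
    met by the packet and the approximation error. With D \<eta> <= 1/4 the estimate (3/4) |z| <=
    (1/4) |f| contradicts |z| >= (3/4) |f|.\<close>
  define D where "D = (M + 1) * (3 + M) * (t0 + 1)"
  define \<eta> where "\<eta> = min (1 / 4) (1 / (4 * D))"
  have sM: "0 \<le> sqrt M" using M_nonneg by simp
  have sM': "sqrt M \<le> M + 1" by (rule real_le_lsqrt) (use M_nonneg in \<open>auto simp: power2_sum\<close>)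
  have D: "0 < D" using M_nonneg t0 by (simp add: D_def)
  have \<eta>: "0 < \<eta>" "\<eta> \<le> 1 / 4" "D * \<eta> \<le> 1 / 4" using D mult_left_mono[of \<eta> "1 / (4 * D)" D] by (auto simp: \<eta>_def)
  have "0 < \<eta>\<^sup>2" using \<eta>(1) by simp
  from thin_tube[OF t0 this] obtain r c where rc: "0 < r" "0 < c" and thin: "\<forall>a e::'a. norm e = 1 \<longrightarrow> integral {0..t0} (\<lambda>\<tau>. \<gamma> (a + \<tau> *\<^sub>R e)) < c \<longrightarrow>
     (\<forall>t x. 0 \<le> t \<longrightarrow> t \<le> t0 \<longrightarrow> dist x (a + t *\<^sub>R e) < r \<longrightarrow> \<gamma> x \<le> \<eta>\<^sup>2)"
    by (elim exE conjE) (rule that; assumption)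
  have "c \<le> integral {0..t0} (\<lambda>\<tau>. \<gamma> (a + \<tau> *\<^sub>R e))" if e: "norm e = 1" for a e :: 'a
  proof (rule ccontr)
    assume "\<not> ?thesis"
    then have tube: "\<gamma> x \<le> \<eta>\<^sup>2" if "0 \<le> t" "t \<le> t0" "dist x (a + t *\<^sub>R e) < r" for t x using thin e that by (simp add: not_le)
    have "\<exists>f::'a l2. f \<noteq> 0 \<and> (\<forall>t. 0 \<le> t \<longrightarrow> t \<le> t0 \<longrightarrow> norm (Q (mulop (\<lambda>\<xi>. iexp (t * lam 2 \<xi>)) f)) \<le> (sqrt (\<eta>\<^sup>2) + \<eta>) * norm f)"
      by (rule wave_packet[OF e rc(1) less_imp_le[OF t0] zero_le_power2 \<eta>(1)]) (rule tube)
    then obtain f :: "'a l2" where f: "f \<noteq> 0" "\<And>t. 0 \<le> t \<Longrightarrow> t \<le> t0 \<Longrightarrow> norm (Q (mulop (\<lambda>\<xi>. iexp (t * lam 2 \<xi>)) f)) \<le> (sqrt (\<eta>\<^sup>2) + \<eta>) * norm f" by blast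
    have N: "0 < norm f" using f by simp
    obtain z :: "'a state" where z: "z \<in> Dm (lam 2)" "dist z (f, 0) < \<eta> * norm f"
      using closure_approachable[of "(f, 0)" "Dm (lam 2)"] Dm_dense[OF lam_measurable] \<eta>(1) N by (metis UNIV_I mult_pos_pos)
    have nz: "norm f * (3 / 4) \<le> norm z"
    proof -
      have "norm (f, 0::'a l2) \<le> norm z + norm (z - (f, 0))" using norm_triangle_sub[of "(f, 0)" z] by (simp add: norm_minus_commute)
      moreover have "\<eta> * norm f \<le> 1 / 4 * norm f" using \<eta>(2) by (intro mult_right_mono) auto
      ultimately show ?thesis using z(2) by (simp add: dist_norm)
    qed
    have b: "norm (Q (vel (Sg (lam 2) t z))) \<le> (3 + M) * \<eta> * norm f" if t: "0 \<le> t" "t \<le> t0" for t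
    proof -
      have "vel (Sg (lam 2) t (f, 0)) = (1 / sqrt 2) *\<^sub>R mulop (\<lambda>\<xi>. iexp (t * lam 2 \<xi>)) f"
        using linear_simps(3)[OF U_bl[OF lam_measurable[of 2], of "- t"]] by (simp add: vel_def Sg_def U_def)
      then have "norm (Q (vel (Sg (lam 2) t (f, 0)))) = 1 / sqrt 2 * norm (Q (mulop (\<lambda>\<xi>. iexp (t * lam 2 \<xi>)) f))"
        by (simp add: linear_simps[OF Q_bl])
      also have "\<dots> \<le> 1 * ((sqrt (\<eta>\<^sup>2) + \<eta>) * norm f)" using f(2)[OF t] by (intro mult_mono) auto
      finally have 1: "norm (Q (vel (Sg (lam 2) t (f, 0)))) \<le> 2 * \<eta> * norm f" using \<eta>(1) by simp
      have "norm (Q (vel (Sg (lam 2) t (z - (f, 0))))) \<le> sqrt M * norm (z - (f, 0))"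
        by (intro order_trans[OF Q_norm] mult_left_mono order_trans[OF norm_vel_le]) (auto simp: Sg_norm M_nonneg)
      also have "\<dots> \<le> (M + 1) * (\<eta> * norm f)" using z(2) sM sM' M_nonneg by (intro mult_mono) (auto simp: dist_norm)
      finally have 2: "norm (Q (vel (Sg (lam 2) t (z - (f, 0))))) \<le> (M + 1) * (\<eta> * norm f)" .
      have "Sg (lam 2) t z = Sg (lam 2) t (f, 0) + Sg (lam 2) t (z - (f, 0))"
        using linear_simps(1)[OF Sg_bl[OF lam_measurable[of 2], of t], of "(f, 0)" "z - (f, 0)"] by simp
      then have "norm (Q (vel (Sg (lam 2) t z))) \<le> norm (Q (vel (Sg (lam 2) t (f, 0)))) + norm (Q (vel (Sg (lam 2) t (z - (f, 0)))))"
        by (simp only: linear_simps(1)[OF Q_bl] linear_simps(1)[OF vel_bl] norm_triangle_ineq)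
      then show ?thesis using 1 2 by (simp add: algebra_simps)
    qed
    have "norm z - sqrt M * ((3 + M) * \<eta> * norm f) * t0 \<le> norm (T t0 z)"
      by (rule weakly_damped_lower_bound[OF lam_measurable T z(1) less_imp_le[OF t0] b])
    also have "\<dots> \<le> 1 / 4 * norm z" using dec[OF t0, of z] quarter by (meson mult_right_mono norm_ge_zero order_trans)
    finally have "3 / 4 * norm z \<le> sqrt M * (3 + M) * t0 * \<eta> * norm f" by (simp add: algebra_simps)
    moreover have "sqrt M * (3 + M) * t0 * \<eta> * norm f \<le> D * \<eta> * norm f"
      unfolding D_def using sM sM' M_nonneg t0 \<eta> by (intro mult_right_mono mult_mono) auto
    moreover have "D * \<eta> * norm f \<le> 1 / 4 * norm f" using \<eta>(3) by (intro mult_right_mono) auto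
    ultimately show False using nz N by linarith
  qed
  then show ?thesis using t0 rc by blast
qed

end

section \<open>The equivalence\<close>

context damping
begin

lemma energy_transfer:
  assumes s: "s > 0" and T: "semigroup_generated_by s \<gamma> T"
  obtains T' where "generates T' (Dm (lam s)) (Aop (lam s))"
    and "\<And>t x. 0 \<le> t \<Longrightarrow> x \<in> Hsp s \<Longrightarrow> energy s T x t = norm (T' t (J s x))"
proof
  let ?T = "\<lambda>t z. J s (T t (Ji s z))"
  show "generates ?T (Dm (lam s)) (Aop (lam s))" by (rule semigroup_transfer(1)[OF s T])
  fix t :: real and x :: "'a st" assume t: "0 \<le> t" and x: "x \<in> Hsp s"
  have "T t x \<in> Hsp s" using T t x unfolding semigroup_generated_by_def by blast
  then show "energy s T x t = norm (?T t (J s x))"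
    unfolding energy_def norm_J[OF \<open>T t x \<in> Hsp s\<close>, symmetric] by (simp only: semigroup_transfer(2)[OF s T t x])
qed

lemma gcc_imp_decay:
  assumes obs: "observable \<delta> \<kappa>" and s: "s > 0"
  shows "\<exists>C>0. \<exists>\<omega>>0. \<forall>T. semigroup_generated_by s \<gamma> T \<longrightarrow>
      (s < 2 \<longrightarrow> (\<forall>x\<in>Dom s. \<forall>t>0. energy s T x t \<le> C * (1 + t) powr (- (s / (4 - 2 * s))) * Dnorm s x)) \<and>
      (s \<ge> 2 \<longrightarrow> (\<forall>x\<in>Hsp s. \<forall>t>0. energy s T x t \<le> C * exp (- \<omega> * t) * energy s T x 0))"
proof (cases "s < 2")
  case True
  from algebraic_decay[OF obs s True] obtain C where C: "0 < C" and dec: "\<forall>T. generates T (Dm (lam s)) (Aop (lam s)) \<longrightarrow>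
      (\<forall>z\<in>Dm (lam s). \<forall>t\<ge>0. norm (T t z) \<le> C * (1 + t) powr (- (s / (4 - 2 * s))) * norm (A0 (lam s) z))"
    by (elim exE conjE) (rule that; assumption)
  have "energy s T x t \<le> C * (1 + t) powr (- (s / (4 - 2 * s))) * Dnorm s x"
    if T: "semigroup_generated_by s \<gamma> T" and x: "x \<in> Dom s" and t: "0 < t" for T x t
  proof -
    obtain T' where T': "generates T' (Dm (lam s)) (Aop (lam s))"
      and e: "\<And>t x. 0 \<le> t \<Longrightarrow> x \<in> Hsp s \<Longrightarrow> energy s T x t = norm (T' t (J s x))" using energy_transfer[OF s T] by metis
    have "x \<in> Hsp s" "J s x \<in> Dm (lam s)" using Dom_iff(1)[OF s] x by blast+
    then show ?thesis using dec T' t unfolding Dom_iff(3)[OF s x] by (simp add: e)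
  qed
  \<comment> \<open>Any positive value serves as \<omega> for s < 2.\<close>
  then show ?thesis using C True by (intro exI[of _ C] exI[of _ 1]) auto
next
  case False
  then have s2: "2 \<le> s" by simp
  from exponential_decay[OF obs s2] obtain C \<omega> where C: "0 < C" "0 < \<omega>"
    and dec: "\<forall>T. generates T (Dm (lam s)) (Aop (lam s)) \<longrightarrow> (\<forall>z. \<forall>t\<ge>0. norm (T t z) \<le> C * exp (- \<omega> * t) * norm z)"
    by (elim exE conjE) (rule that; assumption)
  have "energy s T x t \<le> C * exp (- \<omega> * t) * energy s T x 0"
    if T: "semigroup_generated_by s \<gamma> T" and x: "x \<in> Hsp s" and t: "0 < t" for T x t
  proof -
    obtain T' where T': "generates T' (Dm (lam s)) (Aop (lam s))"
      and e: "\<And>t x. 0 \<le> t \<Longrightarrow> x \<in> Hsp s \<Longrightarrow> energy s T x t = norm (T' t (J s x))" using energy_transfer[OF s T] by metis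
    have "T' 0 (J s x) = J s x" using T' unfolding generates_def by blast
    moreover have "norm (T' t (J s x)) \<le> C * exp (- \<omega> * t) * norm (J s x)" using dec T' less_imp_le[OF t] by blast
    ultimately show ?thesis using t x by (simp add: e)
  qed
  then show ?thesis using C False by (intro exI[of _ C] exI[of _ \<omega>]) auto
qed

end

lemma (in gcc_damping) ex_observable: "\<exists>\<delta> \<kappa>. observable \<delta> \<kappa>"
  using uncertainty unfolding observable_def Q_def by blast

theorem theorem1p3:
  fixes \<gamma> :: "'a::euclidean_space \<Rightarrow> real"
  assumes "\<forall>x. \<gamma> x \<ge> 0"
    and "bounded (range \<gamma>)"
    and "uniformly_continuous_on UNIV \<gamma>"
  shows "(\<exists>L>0. \<exists>c>0. \<forall>a e. norm e = 1 \<longrightarrow>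
            integral {0..L} (\<lambda>\<tau>. \<gamma> (a + \<tau> *\<^sub>R e)) \<ge> c)
     \<longleftrightarrow>
         (\<forall>s>0. \<exists>C>0. \<exists>\<omega>>0. \<forall>T. semigroup_generated_by s \<gamma> T \<longrightarrow>
            (s < 2 \<longrightarrow> (\<forall>x\<in>Dom s. \<forall>t>0.
                energy s T x t \<le> C * (1 + t) powr (- (s / (4 - 2 * s))) * Dnorm s x)) \<and>
            (s \<ge> 2 \<longrightarrow> (\<forall>x\<in>Hsp s. \<forall>t>0.
                energy s T x t \<le> C * exp (- \<omega> * t) * energy s T x 0)))"
    (is "?gcc \<longleftrightarrow> ?decay")
proof -
  obtain M where M: "\<And>x. norm (\<gamma> x) \<le> M" using assms(2) by (auto simp: bounded_iff)
  interpret damping \<gamma> M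
    by unfold_locales (use assms M abs_le_D1 in \<open>auto simp: real_norm_def\<close>)
  show ?thesis
  proof
    assume ?gcc
    then obtain L c where L: "0 < L" "0 < c" "\<And>a e. norm e = 1 \<Longrightarrow> c \<le> integral {0..L} (\<lambda>\<tau>. \<gamma> (a + \<tau> *\<^sub>R e))" by blast
    interpret gcc_damping \<gamma> M L c by unfold_locales (use L in auto)
    obtain \<delta> \<kappa> where "observable \<delta> \<kappa>" using ex_observable by blast
    then show ?decay using gcc_imp_decay by blast
  next
    assume d: ?decay
    have two: "(2::real) > 0" by simp
    from d[rule_format, OF two] obtain C \<omega> where C: "0 < C" "0 < \<omega>"
      and dec: "\<And>T x t. semigroup_generated_by 2 \<gamma> T \<Longrightarrow> x \<in> Hsp 2 \<Longrightarrow> 0 < t \<Longrightarrow> energy 2 T x t \<le> C * exp (- \<omega> * t) * energy 2 T x 0"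
      by auto
    \<comment> \<open>The decay hypothesis, instantiated at s = 2, yields information only through
      an actual semigroup.\<close>
    obtain T where T: "semigroup_generated_by 2 \<gamma> T" using semigroup_exists[OF two] by blast
    obtain T' where T': "generates T' (Dm (lam 2)) (Aop (lam 2))"
      and e: "\<And>t x. 0 \<le> t \<Longrightarrow> x \<in> Hsp 2 \<Longrightarrow> energy 2 T x t = norm (T' t (J 2 x))" using energy_transfer[OF two T] by metis
    have "norm (T' t z) \<le> C * exp (- \<omega> * t) * norm z" if t: "0 < t" for t and z :: "'a state"
    proof -
      have "T' 0 z = z" using T' unfolding generates_def by blast
      then show ?thesis using dec[OF T Ji(1)[OF two, of z] t] t by (simp add: e Ji[OF two])
    qed
    then show ?gcc using decay_imp_gcc[OF T' C(2,1)] by blast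
  qed
qed

end
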